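(* (a) For any $W\in Gr(\mathbb H)$ and $t_0\in\mathbb R$, $$L_{W(t_0)}=e^{-it_0}L_We^{it_0}.$$ (b) The group $\Gamma_0$ acts trivially on $\mathcal M_{\mathrm{KP}}$, while the space $\mathcal M_{\mathrm{QKP}}/\Gamma_0$ of $\Gamma_0$-orbits in $\mathcal M_{\mathrm{QKP}}$ is the quotient of $\mathcal M_{\mathrm{QKP}}$ by a free action of $S^1$. (c) Let $W\in Gr(\mathbb H)$ and let $\Lambda\subset\mathbb C$ be a lattice. Then $L_W(z+\lambda)=\mu(\lambda)^{-1}L_W(z)\mu(\lambda)$ (for all $z\in\mathbb C$, $\lambda\in\Lambda$) for some $\mu\in\mathrm{Hom}(\Lambda,S^1)$ if and only if the map $$\mathbb C\to\mathcal M/\Gamma_0,\qquad z\mapsto[L_{W(z)}]$$ is $\Lambda$-periodic, where $[L_W]$ denotes the $\Gamma_0$-orbit of $L_W\in\mathcal M$.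
   Context: Grassmannian. $\mathbb H$ denotes the quaternions with units $i,j,k$, and $\mathbb C=\mathrm{span}_{\mathbb R}(1,i)\subset\mathbb H$. Let $H=L^2(S^1,\mathbb H)$; each $f\in H$ is written as a left Fourier series $f(\zeta)=\sum_{m\in\mathbb Z}q_m\zeta^m$, $q_m\in\mathbb H$. $H$ is a left $\mathbb H$-module and is a complex Hilbert space via left multiplication by $i$ and $\langle f,g\rangle=\int_{S^1}(f\bar g)_{\mathbb C}$, where $(a+bj)_{\mathbb C}=a$ for $a,b\in\mathbb C$. $H_+$ (resp. $H_-$) is the subspace of functions with only non-negative (resp. only negative) powers of $\zeta$; $\mathrm{pr}_\pm$ are the projections. $Gr(\mathbb C^2)$ is the Hilbert manifold of closed subspaces $W\subset H$ with $iW=W$, $\mathrm{pr}_+:W\to H_+$ Fredholm of index zero and $\mathrm{pr}_-:W\to H_-$ Hilbert–Schmidt; $Gr(\mathbb H)=\{W\in Gr(\mathbb C^2): jW=W\}$. The big cell is the set of $W$ with $\mathrm{pr}_+:W\to H_+$ invertible. $Gr(\mathbb C)$ is the analogous (Segal–Wilson, index zero) Grassmannian of $L^2(S^1,\mathbb C)$. $Gr_{\mathrm{KP}}\subset Gr(\mathbb H)$ is the set of $W=V+jV$ with $V\in Gr(\mathbb C)$, and $Gr_{\mathrm{QKP}}=Gr(\mathbb H)\setminus Gr_{\mathrm{KP}}$. Group. $\Gamma$ is the group of real analytic maps $S^1\to\mathbb C^\times$ of winding number zero; it acts on $Gr(\mathbb H)$ by $\gamma\circ W=W\gamma$. $\Gamma_+$: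 elements extending holomorphically (without zeros) to $|\zeta|<1$, unimodular at $\zeta=0$; $\Gamma_-$: elements extending holomorphically (without zeros) to $|\zeta|>1$ including $\infty$, real positive at $\infty$. Elements of $\Gamma_+$ are written $\gamma(\mathbf t)=\exp[it_0+\sum_{k\ge1}(s_k+it_k)\zeta^k]$, with $x=s_1,y=t_1,z=x+iy$. $\Gamma_0=\{e^{it_0}:t_0\in\mathbb R\}\subset\Gamma_+$. For $W\in Gr(\mathbb H)$, $W(t_0,z)=We^{it_0+z\zeta}$; an omitted variable is zero, so $W(t_0)=We^{it_0}$ and $W(z)=We^{z\zeta}$. Baker function and $L_W$. For $\mathbf t$ outside a proper real analytic subvariety, $\psi_W(\mathbf t)$ is the unique element of $W$ of the form $(1+\sum_{k\ge1}a_k(\mathbf t)\zeta^{-k})\gamma(\mathbf t)$, $a_k$ $\mathbb H$-valued. $L_W=K_W\,i\partial_y\,K_W^{-1}$ with $K_W=1+\sum_{k>0}a_k(\mathbf t)(i\partial_y^{-1})^k$; it is a formal pseudo-differential operator with $\mathbb H$-valued coefficients depending on $\mathbf t$; $L_W(z)$ denotes it as a function of $z$ (all parameters other than $x,y$ set to zero). $\mathcal M=Gr(\mathbb H)/\Gamma_-$ is a manifold, identified with $\{L_W: W\in Gr(\mathbb H)\}$ by the bijection $\Gamma_-\circ W\mapsto L_W$. $\mathcal M_{\mathrm{KP}}=Gr_{\mathrm{KP}}/\Gamma_-$ and $\mathcal M_{\mathrm{QKP}}=Gr_{\mathrm{QKP}}/\Gamma_-$, so $\mathcal M=\mathcal M_{\mathrm{KP}}\cup\mathcal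 M_{\mathrm{QKP}}$ (disjoint). Since $\Gamma$ is abelian, $\Gamma_+$ (hence $\Gamma_0$) acts on $\mathcal M$ by $\gamma\circ L_W=L_{W\gamma}$. *)

theory Defs
  imports "HOL-Analysis.Analysis"
begin

section \<open>Quaternions\<close>

text \<open>\<open>Quat a b\<close> is the quaternion $a + bj$ with $a, b \in \mathrm{span}(1,i)$, so that
  $jc = \bar c j$ for complex \<open>c\<close>, and \<open>cpart\<close> is the map $(a+bj)_{\mathbb C} = a$.\<close>

datatype quat = Quat (cpart: complex) (jpart: complex)

instantiation quat :: real_inner
begin
definition "0 = Quat 0 0"
definition "p + q = Quat (cpart p + cpart q) (jpart p + jpart q)"
definition "p - q = Quat (cpart p - cpart q) (jpart p - jpart q)"
definition "- q = Quat (- cpart q) (- jpart q)"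
definition "scaleR r q = Quat (scaleR r (cpart q)) (scaleR r (jpart q))"
definition "inner p q = inner (cpart p) (cpart q) + inner (jpart p) (jpart q)"
definition "norm (q::quat) = sqrt (inner q q)"
definition "sgn (q::quat) = scaleR (inverse (norm q)) q"
definition "dist (p::quat) q = norm (p - q)"
definition "uniformity = (INF e\<in>{0<..}. principal {(x::quat, y). dist x y < e})"
definition "open (S::quat set) \<longleftrightarrow>
  (\<forall>x\<in>S. \<forall>\<^sub>F (x', y) in uniformity. x' = x \<longrightarrow> y \<in> S)"
instance
proof
  fix x :: quat
  show "inner x x = 0 \<longleftrightarrow> x = 0"
    by (cases x) (simp add: zero_quat_def inner_quat_def add_nonneg_eq_0_iff)
qed (auto simp: zero_quat_def plus_quat_def minus_quat_def uminus_quat_def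
      scaleR_quat_def inner_quat_def norm_quat_def sgn_quat_def dist_quat_def
      uniformity_quat_def open_quat_def algebra_simps inner_commute
      inner_add_left inner_scaleR_left)
end

lemma cpart_simps [simp]:
  "cpart 0 = 0" "cpart (p + q) = cpart p + cpart q" "cpart (p - q) = cpart p - cpart q"
  "cpart (- q) = - cpart q" "cpart (scaleR r q) = scaleR r (cpart q)"
  by (simp_all add: zero_quat_def plus_quat_def minus_quat_def uminus_quat_def scaleR_quat_def)

lemma jpart_simps [simp]:
  "jpart 0 = 0" "jpart (p + q) = jpart p + jpart q" "jpart (p - q) = jpart p - jpart q"
  "jpart (- q) = - jpart q" "jpart (scaleR r q) = scaleR r (jpart q)"
  by (simp_all add: zero_quat_def plus_quat_def minus_quat_def uminus_quat_def scaleR_quat_def)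

lemma quat_eq_iff: "p = q \<longleftrightarrow> cpart p = cpart q \<and> jpart p = jpart q"
  by (cases p; cases q) auto

instantiation quat :: euclidean_space
begin
definition "Basis = {Quat 1 0, Quat \<i> 0, Quat 0 1, Quat 0 \<i>}"
instance
proof
  fix x :: quat
  show "(\<forall>u\<in>Basis. inner x u = 0) \<longleftrightarrow> x = 0"
    by (cases x)
      (auto simp: Basis_quat_def inner_quat_def zero_quat_def inner_complex_def complex_eq_iff)
qed (auto simp: Basis_quat_def inner_quat_def inner_complex_def complex_eq_iff)
end

instantiation quat :: division_ring
begin
definition "1 = Quat 1 0"
definition "p * q = Quat (cpart p * cpart q - jpart p * cnj (jpart q))
                         (cpart p * jpart q + jpart p * cnj (cpart q))"
definition "inverse q = scaleR (inverse ((norm q)\<^sup>2)) (Quat (cnj (cpart q)) (- jpart q))"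
definition "p div (q::quat) = p * inverse q"
instance
proof
  fix q :: quat
  have n: "(norm q)\<^sup>2 = (cmod (cpart q))\<^sup>2 + (cmod (jpart q))\<^sup>2" for q :: quat
    by (simp add: norm_quat_def inner_quat_def dot_square_norm)
  have nz: "cpart q * cnj (cpart q) + jpart q * cnj (jpart q) = of_real ((norm q)\<^sup>2)" for q :: quat
    by (simp only: n complex_norm_square of_real_add)
  assume "q \<noteq> 0"
  then have 0: "complex_of_real ((norm q)\<^sup>2) \<noteq> 0"
    by simp
  note [simp del] = norm_eq_zero of_real_power
  show "inverse q * q = 1"
    using 0 nz[of q]
    by (simp add: inverse_quat_def times_quat_def one_quat_def quat_eq_iff
        scaleR_conv_of_real field_simps)
  show "q * inverse q = 1"
    using 0 nz[of q]
    by (simp add: inverse_quat_def times_quat_def one_quat_def quat_eq_iff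
        scaleR_conv_of_real field_simps)
qed (auto simp: times_quat_def one_quat_def divide_quat_def inverse_quat_def quat_eq_iff
      algebra_simps)
end

instance quat :: real_normed_div_algebra
proof
  fix p q :: quat and r :: real
  show "scaleR r p * q = scaleR r (p * q)" "p * scaleR r q = scaleR r (p * q)"
    by (auto simp: quat_eq_iff times_quat_def scaleR_conv_of_real algebra_simps)
  have n: "complex_of_real ((norm q)\<^sup>2) = cpart q * cnj (cpart q) + jpart q * cnj (jpart q)"
    for q :: quat
    by (simp add: norm_quat_def inner_quat_def dot_square_norm complex_norm_square
        del: of_real_power)
  have "complex_of_real ((norm (p * q))\<^sup>2) = of_real ((norm p)\<^sup>2 * (norm q)\<^sup>2)"
    unfolding of_real_mult n by (simp add: times_quat_def algebra_simps)
  then have "(norm (p * q))\<^sup>2 = (norm p * norm q)\<^sup>2"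
    by (simp only: of_real_eq_iff power_mult_distrib)
  then show "norm (p * q) = norm p * norm q"
    by (simp add: power2_eq_iff_nonneg)
qed

definition quat_of_complex :: "complex \<Rightarrow> quat" where
  "quat_of_complex a = Quat a 0"

definition quat_cnj :: "quat \<Rightarrow> quat" where
  "quat_cnj q = Quat (cnj (cpart q)) (- jpart q)"

definition quat_i :: quat where "quat_i = Quat \<i> 0"
definition quat_j :: quat where "quat_j = Quat 0 1"

lemma norm_quat_of_complex [simp]: "norm (quat_of_complex a) = cmod a"
  by (simp add: quat_of_complex_def norm_quat_def inner_quat_def norm_eq_sqrt_inner)

lemma norm_quat_cnj [simp]: "norm (quat_cnj q) = norm q"
  by (simp add: quat_cnj_def norm_quat_def inner_quat_def dot_square_norm)

section \<open>The Hilbert space of square integrable quaternion valued functions on the circle\<close>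

text \<open>Normalised arc length on the unit circle.\<close>

definition circle_measure :: "complex measure" where
  "circle_measure =
     distr (uniform_measure lborel {0..2*pi}) (restrict_space borel (sphere 0 1)) cis"

lemma space_circle [simp]: "space circle_measure = sphere 0 1"
  by (simp add: circle_measure_def)

lemma sets_circle [measurable_cong]:
  "sets circle_measure = sets (restrict_space borel (sphere 0 1))"
  by (simp add: circle_measure_def)

definition square_integrable :: "(complex \<Rightarrow> quat) \<Rightarrow> bool" where
  "square_integrable f \<longleftrightarrow> f \<in> borel_measurable circle_measure \<and>
     integrable circle_measure (\<lambda>x. (norm (f x))\<^sup>2)"

lemma square_integrable_zero: "square_integrable (\<lambda>_. 0)"
  by (simp add: square_integrable_def)

lemma square_integrable_add:
  assumes "square_integrable f" "square_integrable g"
  shows "square_integrable (\<lambda>x. f x + g x)"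
proof -
  have [measurable]: "f \<in> borel_measurable circle_measure" "g \<in> borel_measurable circle_measure"
    using assms by (auto simp: square_integrable_def)
  have "integrable circle_measure (\<lambda>x. 2 * (norm (f x))\<^sup>2 + 2 * (norm (g x))\<^sup>2)"
    using assms by (auto simp: square_integrable_def)
  then have "integrable circle_measure (\<lambda>x. (norm (f x + g x))\<^sup>2)"
  proof (rule Bochner_Integration.integrable_bound, goal_cases)
    case 2
    have "(norm (f x + g x))\<^sup>2 \<le> 2 * (norm (f x))\<^sup>2 + 2 * (norm (g x))\<^sup>2" for x
    proof -
      have "(norm (f x + g x))\<^sup>2 \<le> (norm (f x) + norm (g x))\<^sup>2"
        by (intro power_mono norm_triangle_ineq) auto
      also have "\<dots> \<le> 2 * (norm (f x))\<^sup>2 + 2 * (norm (g x))\<^sup>2"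
        using sum_squares_bound[of "norm (f x)" "norm (g x)"]
        by (simp add: power2_sum)
      finally show ?thesis .
    qed
    then show ?case by auto
  qed simp
  then show ?thesis by (simp add: square_integrable_def)
qed

lemma square_integrable_bounded_image:
  assumes "square_integrable f" "g \<in> borel_measurable circle_measure"
    "\<And>x. x \<in> sphere 0 1 \<Longrightarrow> norm (g x) \<le> C * norm (f x)"
  shows "square_integrable g"
proof -
  note [measurable] = assms(2)
  have "integrable circle_measure (\<lambda>x. C\<^sup>2 * (norm (f x))\<^sup>2)"
    using assms(1) by (auto simp: square_integrable_def)
  then have "integrable circle_measure (\<lambda>x. (norm (g x))\<^sup>2)"
  proof (rule Bochner_Integration.integrable_bound, goal_cases)
    case 2
    show ?case
    proof (rule AE_I2)
      fix x assume "x \<in> space circle_measure"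
      then have "(norm (g x))\<^sup>2 \<le> (C * norm (f x))\<^sup>2"
        using assms(3) by (intro power_mono) auto
      then show "norm ((norm (g x))\<^sup>2) \<le> norm (C\<^sup>2 * (norm (f x))\<^sup>2)"
        by (simp add: power_mult_distrib)
    qed
  qed simp
  then show ?thesis using assms(2) by (simp add: square_integrable_def)
qed

lemma square_integrable_uminus:
  "square_integrable f \<Longrightarrow> square_integrable (\<lambda>x. - f x)"
  by (auto simp: square_integrable_def)

lemma square_integrable_scaleR:
  assumes "square_integrable f" shows "square_integrable (\<lambda>x. scaleR r (f x))"
  by (rule square_integrable_bounded_image[of f _ "\<bar>r\<bar>"])
    (use assms in \<open>auto simp: square_integrable_def\<close>)

lemma square_integrable_mult_left:
  assumes "square_integrable f" shows "square_integrable (\<lambda>x. q * f x)"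
  by (rule square_integrable_bounded_image[of f _ "norm q"])
    (use assms in \<open>auto simp: square_integrable_def norm_mult\<close>)

lemma continuous_on_quat_of_complex [continuous_intros]:
  "continuous_on S f \<Longrightarrow> continuous_on S (\<lambda>x. quat_of_complex (f x))"
proof -
  have "bounded_linear quat_of_complex"
    by (rule bounded_linear_intro[where K = 1])
      (auto simp: quat_of_complex_def plus_quat_def scaleR_quat_def norm_quat_def
        inner_quat_def norm_eq_sqrt_inner)
  then show "continuous_on S f \<Longrightarrow> continuous_on S (\<lambda>x. quat_of_complex (f x))"
    by (rule bounded_linear.continuous_on)
qed

lemma square_integrable_mult_right:
  assumes "square_integrable f" "continuous_on (sphere 0 1) g"
  shows "square_integrable (\<lambda>x. f x * quat_of_complex (g x))"
proof -
  have "compact (g ` sphere 0 1)"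
    using assms(2) by (intro compact_continuous_image) auto
  then obtain C where C: "\<And>x. x \<in> sphere 0 1 \<Longrightarrow> norm (g x) \<le> C"
    by (metis bounded_iff compact_imp_bounded imageI)
  have "continuous_on (sphere 0 1) (\<lambda>x. quat_of_complex (g x))"
    using assms(2) by (intro continuous_intros)
  then have [measurable]: "(\<lambda>x. quat_of_complex (g x)) \<in> borel_measurable circle_measure"
    by (subst measurable_cong_sets[OF sets_circle refl])
      (rule borel_measurable_continuous_on_restrict)
  have [measurable]: "f \<in> borel_measurable circle_measure"
    using assms by (auto simp: square_integrable_def)
  show ?thesis
    by (rule square_integrable_bounded_image[OF assms(1), of _ C])
      (auto simp: norm_mult mult.commute[of C] intro!: mult_left_mono C)
qed

lemma integrable_inner:
  assumes "square_integrable f" "square_integrable g"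
  shows "integrable circle_measure (\<lambda>x. inner (f x) (g x))"
proof -
  have [measurable]: "f \<in> borel_measurable circle_measure" "g \<in> borel_measurable circle_measure"
    using assms by (auto simp: square_integrable_def)
  have "integrable circle_measure (\<lambda>x. (norm (f x))\<^sup>2 + (norm (g x))\<^sup>2)"
    using assms by (auto simp: square_integrable_def)
  then show ?thesis
  proof (rule Bochner_Integration.integrable_bound, goal_cases)
    case 2
    have "\<bar>inner (f x) (g x)\<bar> \<le> (norm (f x))\<^sup>2 + (norm (g x))\<^sup>2" for x
    proof -
      have "\<bar>inner (f x) (g x)\<bar> \<le> norm (f x) * norm (g x)"
        by (rule Cauchy_Schwarz_ineq2)
      also have "\<dots> \<le> 2 * norm (f x) * norm (g x)" by simp
      also have "\<dots> \<le> (norm (f x))\<^sup>2 + (norm (g x))\<^sup>2" by (rule sum_squares_bound)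
      finally show ?thesis .
    qed
    then show ?case by auto
  qed simp
qed

definition l2_eq :: "(complex \<Rightarrow> quat) \<Rightarrow> (complex \<Rightarrow> quat) \<Rightarrow> bool" where
  "l2_eq f g \<longleftrightarrow> square_integrable f \<and> square_integrable g \<and>
     (AE x in circle_measure. f x = g x)"

quotient_type L2H = "complex \<Rightarrow> quat" / partial: l2_eq
proof (rule part_equivpI)
  show "\<exists>f. l2_eq f f"
    using square_integrable_zero by (auto simp: l2_eq_def)
  show "symp l2_eq"
    unfolding symp_def l2_eq_def by (simp add: eq_commute)
  show "transp l2_eq"
    unfolding transp_def l2_eq_def
  proof (intro allI impI, elim conjE, intro conjI, goal_cases)
    case (3 f g h)
    show ?case using \<open>AE x in circle_measure. f x = g x\<close> \<open>AE x in circle_measure. g x = h x\<close> by eventually_elim simp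
  qed auto
qed

instantiation L2H :: real_inner
begin
lift_definition zero_L2H :: L2H is "\<lambda>_. 0"
  by (simp add: l2_eq_def square_integrable_zero)
lift_definition plus_L2H :: "L2H \<Rightarrow> L2H \<Rightarrow> L2H" is "\<lambda>f g x. f x + g x"
  unfolding l2_eq_def
proof (elim conjE, intro conjI, goal_cases)
  case (3 f f' g g')
  from \<open>AE x in circle_measure. f x = f' x\<close> \<open>AE x in circle_measure. g x = g' x\<close>
  show ?case by eventually_elim simp
qed (auto intro: square_integrable_add)
lift_definition uminus_L2H :: "L2H \<Rightarrow> L2H" is "\<lambda>f x. - f x"
  unfolding l2_eq_def using square_integrable_uminus by (auto elim!: eventually_mono)
definition "f - g = f + - (g :: L2H)"
lift_definition scaleR_L2H :: "real \<Rightarrow> L2H \<Rightarrow> L2H" is "\<lambda>r f x. scaleR r (f x)"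
  unfolding l2_eq_def using square_integrable_scaleR by (auto elim!: eventually_mono)
lift_definition inner_L2H :: "L2H \<Rightarrow> L2H \<Rightarrow> real"
  is "\<lambda>f g. \<integral>x. inner (f x) (g x) \<partial>circle_measure"
  unfolding l2_eq_def
proof (elim conjE, goal_cases)
  case (1 f f' g g')
  have "AE x in circle_measure. inner (f x) (g x) = inner (f' x) (g' x)"
    using \<open>AE x in circle_measure. f x = f' x\<close> \<open>AE x in circle_measure. g x = g' x\<close> by eventually_elim simp
  with 1 show ?case
    by (intro integral_cong_AE) (auto simp: square_integrable_def)
qed
definition "norm (f::L2H) = sqrt (inner f f)"
definition "sgn (f::L2H) = scaleR (inverse (norm f)) f"
definition "dist (f::L2H) g = norm (f - g)"
definition "uniformity = (INF e\<in>{0<..}. principal {(x::L2H, y). dist x y < e})"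
definition "open (S::L2H set) \<longleftrightarrow>
  (\<forall>x\<in>S. \<forall>\<^sub>F (x', y) in uniformity. x' = x \<longrightarrow> y \<in> S)"
instance
proof
  fix f g h :: L2H and r s :: real
  have si: "l2_eq f f \<Longrightarrow> square_integrable f" for f by (simp add: l2_eq_def)
  have refl: "l2_eq f f \<longleftrightarrow> square_integrable f" for f by (simp add: l2_eq_def)
  show "f + g + h = f + (g + h)"
    by transfer (auto simp: l2_eq_def add.assoc intro!: square_integrable_add)
  show "f + g = g + f"
    by transfer (auto simp: l2_eq_def add.commute intro!: square_integrable_add)
  show "0 + f = f"
    by transfer (auto simp: l2_eq_def)
  show "- f + f = 0"
    by transfer (auto simp: l2_eq_def square_integrable_zero)
  show "f - g = f + - g" by (simp add: minus_L2H_def)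
  show "scaleR r (f + g) = scaleR r f + scaleR r g"
    by transfer (auto simp: l2_eq_def scaleR_right_distrib
        intro!: square_integrable_add square_integrable_scaleR)
  show "scaleR (r + s) f = scaleR r f + scaleR s f"
    by transfer (auto simp: l2_eq_def scaleR_left_distrib
        intro!: square_integrable_add square_integrable_scaleR)
  show "scaleR r (scaleR s f) = scaleR (r * s) f"
    by transfer (auto simp: l2_eq_def intro!: square_integrable_scaleR)
  show "scaleR 1 f = f"
    by transfer (auto simp: l2_eq_def)
  show "inner f g = inner g f"
    by transfer (simp add: inner_commute)
  show "inner (f + g) h = inner f h + inner g h"
    by transfer (simp add: refl inner_add_left integrable_inner)
  show "inner (scaleR r f) g = r * inner f g"
    by transfer (simp add: refl)
  show "0 \<le> inner f f"
    by transfer simp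
  show "inner f f = 0 \<longleftrightarrow> f = 0"
  proof (transfer, unfold refl)
    fix f assume f: "square_integrable f"
    have "(\<integral>x. inner (f x) (f x) \<partial>circle_measure) = 0 \<longleftrightarrow>
        (AE x in circle_measure. inner (f x) (f x) = 0)"
      using f by (intro integral_nonneg_eq_0_iff_AE integrable_inner) auto
    then show "(\<integral>x. inner (f x) (f x) \<partial>circle_measure) = 0 \<longleftrightarrow> l2_eq f (\<lambda>_. 0)"
      using f by (simp add: l2_eq_def square_integrable_zero)
  qed
qed (auto simp: norm_L2H_def sgn_L2H_def dist_L2H_def uniformity_L2H_def open_L2H_def)
end

lift_definition lmult :: "quat \<Rightarrow> L2H \<Rightarrow> L2H" is "\<lambda>q f x. q * f x"
  unfolding l2_eq_def using square_integrable_mult_left by (auto elim!: eventually_mono)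

text \<open>Right multiplication by a continuous complex function on the circle
  (set to zero for other multipliers, which do not occur).\<close>

lift_definition rmult :: "L2H \<Rightarrow> (complex \<Rightarrow> complex) \<Rightarrow> L2H"
  is "\<lambda>f g x. if continuous_on (sphere 0 1) g then f x * quat_of_complex (g x) else 0"
  unfolding l2_eq_def
proof (elim conjE, goal_cases)
  case (1 f f' g)
  have "AE x in circle_measure. f x * quat_of_complex (g x) = f' x * quat_of_complex (g x)"
    using \<open>AE x in circle_measure. f x = f' x\<close> by eventually_elim simp
  with 1 show ?case
    by (cases "continuous_on (sphere 0 1) g")
      (simp_all add: square_integrable_mult_right square_integrable_zero)
qed

lift_definition cinner :: "L2H \<Rightarrow> L2H \<Rightarrow> complex"
  is "\<lambda>f g. \<integral>x. cpart (f x * quat_cnj (g x)) \<partial>circle_measure"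
  unfolding l2_eq_def
proof (elim conjE, goal_cases)
  case (1 f f' g g')
  have [measurable]: "cpart \<in> borel_measurable borel"
    by (intro borel_measurable_continuous_onI linear_continuous_on)
      (auto intro!: bounded_linear_intro[where K = 1]
        simp: norm_quat_def inner_quat_def dot_square_norm intro: real_le_rsqrt)
  have [measurable]: "quat_cnj \<in> borel_measurable borel"
    by (intro borel_measurable_continuous_onI linear_continuous_on)
      (auto intro!: bounded_linear_intro[where K = 1]
        simp: quat_eq_iff quat_cnj_def norm_quat_def inner_quat_def dot_square_norm)
  have "AE x in circle_measure. cpart (f x * quat_cnj (g x)) = cpart (f' x * quat_cnj (g' x))"
    using \<open>AE x in circle_measure. f x = f' x\<close> \<open>AE x in circle_measure. g x = g' x\<close> by eventually_elim simp
  with 1 show ?case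
    by (intro integral_cong_AE) (auto simp: square_integrable_def)
qed

text \<open>The coefficients of the left Fourier series \<open>f = \<Sum>m. q\<^sub>m \<zeta>\<^sup>m\<close>.\<close>

lift_definition fourier :: "L2H \<Rightarrow> int \<Rightarrow> quat"
  is "\<lambda>f m. \<integral>x. f x * quat_of_complex (x powi (- m)) \<partial>circle_measure"
  unfolding l2_eq_def
proof (elim conjE, rule ext, goal_cases)
  case (1 f g m)
  have "continuous_on (sphere 0 1) (\<lambda>x::complex. x powi (- m))"
    by (intro continuous_intros) auto
  note * = square_integrable_mult_right[OF _ this]
  have "AE x in circle_measure.
      f x * quat_of_complex (x powi (- m)) = g x * quat_of_complex (x powi (- m))"
    using \<open>AE x in circle_measure. f x = g x\<close> by eventually_elim simp
  moreover have "(\<lambda>x. f x * quat_of_complex (x powi (- m))) \<in> borel_measurable circle_measure"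
    "(\<lambda>x. g x * quat_of_complex (x powi (- m))) \<in> borel_measurable circle_measure"
    using *[of f] *[of g] 1 by (simp_all only: square_integrable_def)
  ultimately show ?case
    by (intro integral_cong_AE)
qed

lift_definition complex_valued :: "L2H \<Rightarrow> bool"
  is "\<lambda>f. AE x in circle_measure. f x \<in> range quat_of_complex"
  unfolding l2_eq_def
proof (elim conjE, intro iffI, goal_cases)
  case (1 f g)
  from \<open>AE x in circle_measure. f x = g x\<close> \<open>AE x in circle_measure. f x \<in> _\<close>
  show ?case by eventually_elim simp
next
  case (2 f g)
  from \<open>AE x in circle_measure. f x = g x\<close> \<open>AE x in circle_measure. g x \<in> _\<close>
  show ?case by eventually_elim simp
qed

text \<open>\<open>H\<close> as a complex vector space, via left multiplication.\<close>

global_interpretation cvs: vector_space "\<lambda>c. lmult (quat_of_complex c)"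
  defines cspan = cvs.span and cdim = cvs.dim
proof
  fix a b :: complex and f g :: L2H
  have refl: "l2_eq f f \<longleftrightarrow> square_integrable f" for f by (simp add: l2_eq_def)
  show "lmult (quat_of_complex a) (f + g) =
      lmult (quat_of_complex a) f + lmult (quat_of_complex a) g"
    by transfer (auto simp: l2_eq_def distrib_left
        intro!: square_integrable_add square_integrable_mult_left)
  have "quat_of_complex (a + b) = quat_of_complex a + quat_of_complex b"
    by (simp add: quat_of_complex_def plus_quat_def)
  then show "lmult (quat_of_complex (a + b)) f =
      lmult (quat_of_complex a) f + lmult (quat_of_complex b) f"
    by transfer (auto simp: l2_eq_def distrib_right
        intro!: square_integrable_add square_integrable_mult_left)
  have "quat_of_complex (a * b) = quat_of_complex a * quat_of_complex b"
    by (simp add: quat_of_complex_def times_quat_def)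
  then show "lmult (quat_of_complex a) (lmult (quat_of_complex b) f) =
      lmult (quat_of_complex (a * b)) f"
    by transfer (auto simp: l2_eq_def mult.assoc
        intro!: square_integrable_add square_integrable_mult_left)
  have "quat_of_complex 1 = 1"
    by (simp add: quat_of_complex_def one_quat_def)
  then show "lmult (quat_of_complex 1) f = f"
    by transfer (auto simp: l2_eq_def)
qed

section \<open>Grassmannians\<close>

definition H_plus :: "L2H set" where
  "H_plus = {f. \<forall>m<0. fourier f m = 0}"

definition H_minus :: "L2H set" where
  "H_minus = {f. \<forall>m\<ge>0. fourier f m = 0}"

definition pr_plus :: "L2H \<Rightarrow> L2H" where
  "pr_plus f = (THE g. g \<in> H_plus \<and> f - g \<in> H_minus)"

definition pr_minus :: "L2H \<Rightarrow> L2H" where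
  "pr_minus f = (THE g. g \<in> H_minus \<and> f - g \<in> H_plus)"

definition finite_cdim :: "L2H set \<Rightarrow> bool" where
  "finite_cdim S \<longleftrightarrow> (\<exists>B. finite B \<and> cspan B = S)"

text \<open>\<open>T : X \<rightarrow> Y\<close> is Fredholm of index zero; \<open>C\<close> is an algebraic complement of the range
  in \<open>Y\<close>, so that its dimension is that of the cokernel.\<close>

definition fredholm_index_zero :: "(L2H \<Rightarrow> L2H) \<Rightarrow> L2H set \<Rightarrow> L2H set \<Rightarrow> bool" where
  "fredholm_index_zero T X Y \<longleftrightarrow>
     T ` X \<subseteq> Y \<and> closed (T ` X) \<and> finite_cdim {f \<in> X. T f = 0} \<and>
     (\<exists>C. finite_cdim C \<and> T ` X \<inter> C = {0} \<and> {f + g | f g. f \<in> T ` X \<and> g \<in> C} = Y \<and>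
          cdim C = cdim {f \<in> X. T f = 0})"

definition orthonormal_basis :: "L2H set \<Rightarrow> L2H set \<Rightarrow> bool" where
  "orthonormal_basis E X \<longleftrightarrow>
     (\<forall>e\<in>E. \<forall>e'\<in>E. cinner e e' = (if e = e' then 1 else 0)) \<and> closure (cspan E) = X"

definition hilbert_schmidt :: "(L2H \<Rightarrow> L2H) \<Rightarrow> L2H set \<Rightarrow> bool" where
  "hilbert_schmidt T X \<longleftrightarrow>
     (\<exists>E. orthonormal_basis E X \<and> (\<lambda>e. (norm (T e))\<^sup>2) summable_on E)"

definition Gr_C2 :: "L2H set set" where
  "Gr_C2 = {W. subspace W \<and> closed W \<and> lmult quat_i ` W = W \<and>
     fredholm_index_zero pr_plus W H_plus \<and> hilbert_schmidt pr_minus W}"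

definition Gr_H :: "L2H set set" where
  "Gr_H = {W \<in> Gr_C2. lmult quat_j ` W = W}"

text \<open>The Grassmannian of \<open>L\<^sup>2(S\<^sup>1, \<complex>)\<close>, the latter being regarded as the subspace of
  complex valued elements of \<open>H\<close>.\<close>

definition Gr_C :: "L2H set set" where
  "Gr_C = {V. V \<subseteq> Collect complex_valued \<and> subspace V \<and> closed V \<and> lmult quat_i ` V = V \<and>
     fredholm_index_zero pr_plus V (H_plus \<inter> Collect complex_valued) \<and>
     hilbert_schmidt pr_minus V}"

definition Gr_KP :: "L2H set set" where
  "Gr_KP = {W \<in> Gr_H. \<exists>V\<in>Gr_C. W = {v + lmult quat_j v' | v v'. v \<in> V \<and> v' \<in> V}}"

definition Gr_QKP :: "L2H set set" where
  "Gr_QKP = Gr_H - Gr_KP"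

section \<open>The group action and the Baker function\<close>

definition gr_act :: "(complex \<Rightarrow> complex) \<Rightarrow> L2H set \<Rightarrow> L2H set" where
  "gr_act \<gamma> W = (\<lambda>f. rmult f \<gamma>) ` W"

definition W_t0 :: "L2H set \<Rightarrow> real \<Rightarrow> L2H set" where
  "W_t0 W t0 = gr_act (\<lambda>\<zeta>. exp (\<i> * of_real t0)) W"

definition W_z :: "L2H set \<Rightarrow> complex \<Rightarrow> L2H set" where
  "W_z W z = gr_act (\<lambda>\<zeta>. exp (z * \<zeta>)) W"

text \<open>The parameters \<open>\<^bold>t = (t\<^sub>0, s\<^sub>1, t\<^sub>1, s\<^sub>2, t\<^sub>2, \<dots>)\<close> are encoded as the complex sequence
  \<open>c\<close> with \<open>c 0 = \<i> t\<^sub>0\<close> and \<open>c k = s\<^sub>k + \<i> t\<^sub>k\<close> for \<open>k \<ge> 1\<close>. A radius of convergence greater than one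
  means that \<open>gam c\<close> is real analytic on the circle.\<close>

type_synonym times = "nat \<Rightarrow> complex"

definition valid_times :: "times set" where
  "valid_times = {c. Re (c 0) = 0 \<and> conv_radius c > 1}"

definition gam :: "times \<Rightarrow> complex \<Rightarrow> complex" where
  "gam c \<zeta> = exp (\<Sum>k. c k * \<zeta> ^ k)"

text \<open>\<open>baker_pre W c f\<close> says that \<open>f = 1 + \<Sum>k\<ge>1. a\<^sub>k \<zeta>\<^sup>-\<^sup>k\<close> and \<open>f \<cdot> gam c \<in> W\<close>, so that
  \<open>f \<cdot> gam c\<close> is the Baker function \<open>\<psi>\<^sub>W\<close> at \<open>c\<close> whenever \<open>f\<close> is unique.\<close>

definition baker_pre :: "L2H set \<Rightarrow> times \<Rightarrow> L2H \<Rightarrow> bool" where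
  "baker_pre W c f \<longleftrightarrow>
     fourier f 0 = 1 \<and> (\<forall>m>0. fourier f m = 0) \<and> rmult f (gam c) \<in> W"

text \<open>The parameters at which the Baker function of \<open>W\<close> is defined.\<close>

definition baker_dom :: "L2H set \<Rightarrow> times set" where
  "baker_dom W = {c \<in> valid_times. \<exists>!f. baker_pre W c f}"

definition baker_coeff :: "L2H set \<Rightarrow> nat \<Rightarrow> times \<Rightarrow> quat" where
  "baker_coeff W k c = fourier (THE f. baker_pre W c f) (- int k)"

section \<open>Formal pseudo-differential operators\<close>

text \<open>\<open>A :: psdo\<close> stands for \<open>\<Sum>n. A n \<partial>\<^sub>y\<^sup>n\<close>, with coefficients on the left. The coefficients are
  functions on a set \<open>U\<close> of parameters, extended by zero.\<close>

type_synonym psdo = "int \<Rightarrow> times \<Rightarrow> quat"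

definition psdos :: "times set \<Rightarrow> psdo set" where
  "psdos U = {A. (\<exists>N. \<forall>n>N. A n = (\<lambda>_. 0)) \<and> (\<forall>n. \<forall>c. c \<notin> U \<longrightarrow> A n c = 0)}"

text \<open>Recall \<open>y = t\<^sub>1\<close>, the imaginary part of \<open>c 1\<close>.\<close>

definition pd_y :: "times set \<Rightarrow> (times \<Rightarrow> quat) \<Rightarrow> times \<Rightarrow> quat" where
  "pd_y U f c =
     (if c \<in> U then vector_derivative (\<lambda>h. f (c(1 := c 1 + \<i> * of_real h))) (at 0) else 0)"

text \<open>The generalised Leibniz rule
  \<open>(a \<partial>\<^sub>y\<^sup>m) (b \<partial>\<^sub>y\<^sup>p) = \<Sum>l\<ge>0. (m choose l) a (\<partial>\<^sub>y\<^bsup>l\<^esup> b) \<partial>\<^sub>y\<^bsup>m+p-l\<^esup>\<close>; for operators of finite order the index set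
  below is finite.\<close>

definition psdo_mult :: "times set \<Rightarrow> psdo \<Rightarrow> psdo \<Rightarrow> psdo" where
  "psdo_mult U A B n c =
     (\<Sum>(m, p) \<in> {(m, p). A m \<noteq> (\<lambda>_. 0) \<and> B p \<noteq> (\<lambda>_. 0) \<and> n \<le> m + p}.
        (real_of_int m gchoose nat (m + p - n)) *\<^sub>R
          (A m c * (pd_y U ^^ nat (m + p - n)) (B p) c))"

definition psdo_one :: "times set \<Rightarrow> psdo" where
  "psdo_one U n c = (if n = 0 \<and> c \<in> U then 1 else 0)"

definition psdo_inverse :: "times set \<Rightarrow> psdo \<Rightarrow> psdo" where
  "psdo_inverse U A = (THE B. B \<in> psdos U \<and>
     psdo_mult U A B = psdo_one U \<and> psdo_mult U B A = psdo_one U)"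

definition i_pd_y :: "times set \<Rightarrow> psdo" where
  "i_pd_y U n c = (if n = 1 \<and> c \<in> U then quat_i else 0)"

text \<open>Since \<open>\<i>\<close> is constant, \<open>(\<i> \<partial>\<^sub>y\<^sup>-\<^sup>1)\<^sup>k = \<i>\<^sup>k \<partial>\<^sub>y\<^sup>-\<^sup>k\<close>.\<close>

definition K_op :: "L2H set \<Rightarrow> psdo" where
  "K_op W n c =
     (if c \<notin> baker_dom W \<or> n > 0 then 0
      else if n = 0 then 1
      else baker_coeff W (nat (- n)) c * quat_i ^ nat (- n))"

text \<open>The coefficient of \<open>\<partial>\<^sub>y\<close> in \<open>L_op W\<close> is \<open>\<i>\<close> on \<open>baker_dom W\<close> and zero elsewhere. Hence equality
  of two such operators means that they are defined for the same parameters and agree there.\<close>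

definition L_op :: "L2H set \<Rightarrow> psdo" where
  "L_op W = (let U = baker_dom W in
     psdo_mult U (psdo_mult U (K_op W) (i_pd_y U)) (psdo_inverse U (K_op W)))"

text \<open>\<open>u\<^sup>-\<^sup>1 L u\<close> for a complex constant \<open>u\<close>, which commutes with \<open>\<partial>\<^sub>y\<close>.\<close>

definition conj_by :: "complex \<Rightarrow> (int \<Rightarrow> 'a \<Rightarrow> quat) \<Rightarrow> int \<Rightarrow> 'a \<Rightarrow> quat" where
  "conj_by u L n c = inverse (quat_of_complex u) * L n c * quat_of_complex u"

text \<open>\<open>L\<^sub>W(z)\<close>, all parameters other than \<open>z = s\<^sub>1 + \<i> t\<^sub>1\<close> being zero.\<close>

definition L_z :: "L2H set \<Rightarrow> int \<Rightarrow> complex \<Rightarrow> quat" where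
  "L_z W n z = L_op W n ((\<lambda>_. 0)(1 := z))"

section \<open>The moduli space and its circle action\<close>

text \<open>\<open>\<M> = Gr(\<H>)/\<Gamma>\<^sub>-\<close> is realised as the set of operators \<open>L\<^sub>W\<close>, by the identification
  \<open>\<Gamma>\<^sub>- \<circ> W \<mapsto> L\<^sub>W\<close>; the action \<open>M_act\<close> is \<open>\<gamma> \<circ> L\<^sub>W = L\<^bsub>W\<gamma>\<^esub>\<close>. As \<open>W\<close> is closed under negation,
  \<open>\<gamma> = -1\<close> acts trivially, so that the circle which can act freely is \<open>\<Gamma>\<^sub>0/{\<plusminus>1}\<close>,
  identified with \<open>S\<^sup>1\<close> by squaring.\<close>

definition M_space :: "psdo set" where "M_space = L_op ` Gr_H"
definition M_KP :: "psdo set" where "M_KP = L_op ` Gr_KP"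
definition M_QKP :: "psdo set" where "M_QKP = L_op ` Gr_QKP"

definition M_act :: "(complex \<Rightarrow> complex) \<Rightarrow> psdo \<Rightarrow> psdo" where
  "M_act \<gamma> L = (THE L'. \<exists>W\<in>Gr_H. L = L_op W \<and> L' = L_op (gr_act \<gamma> W))"

definition Gamma0 :: "(complex \<Rightarrow> complex) set" where
  "Gamma0 = range (\<lambda>t0::real. \<lambda>\<zeta>. exp (\<i> * of_real t0))"

definition Gamma0_orbit :: "psdo \<Rightarrow> psdo set" where
  "Gamma0_orbit L = (\<lambda>\<gamma>. M_act \<gamma> L) ` Gamma0"

definition free_circle_action :: "(complex \<Rightarrow> 'a \<Rightarrow> 'a) \<Rightarrow> 'a set \<Rightarrow> bool" where
  "free_circle_action \<rho> X \<longleftrightarrow>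
     (\<forall>u\<in>sphere 0 1. \<forall>x\<in>X. \<rho> u x \<in> X) \<and>
     (\<forall>x\<in>X. \<rho> 1 x = x) \<and>
     (\<forall>u\<in>sphere 0 1. \<forall>v\<in>sphere 0 1. \<forall>x\<in>X. \<rho> (u * v) x = \<rho> u (\<rho> v x)) \<and>
     (\<forall>u\<in>sphere 0 1. \<forall>x\<in>X. \<rho> u x = x \<longrightarrow> u = 1)"

section \<open>Lattices\<close>

definition is_lattice :: "complex set \<Rightarrow> bool" where
  "is_lattice \<Lambda> \<longleftrightarrow> (\<exists>\<omega>1 \<omega>2. \<omega>1 \<noteq> \<omega>2 \<and> independent {\<omega>1, \<omega>2} \<and>
     \<Lambda> = {of_int m * \<omega>1 + of_int n * \<omega>2 | m n. True})"

definition circle_characters :: "complex set \<Rightarrow> (complex \<Rightarrow> complex) set" where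
  "circle_characters \<Lambda> = {\<mu>. (\<forall>l\<in>\<Lambda>. \<mu> l \<in> sphere 0 1) \<and>
     (\<forall>l\<in>\<Lambda>. \<forall>l'\<in>\<Lambda>. \<mu> (l + l') = \<mu> l * \<mu> l')}"

end

theory Submission
  imports Defs "HOL-Complex_Analysis.Complex_Analysis"
begin

text \<open>
  Let \<open>w\<^sub>k(\<^bold>t)\<close> be the element of \<open>W \<gamma>(\<^bold>t)\<^sup>-\<^sup>1\<close> with non-negative part \<open>\<zeta>\<^sup>k\<close>, so that \<open>w\<^sub>0 \<gamma>\<close> is the Baker function.
  The \<open>w\<^sub>k\<close> satisfy a closed system of first order equations in \<open>x\<close> and \<open>y\<close>; in particular their coefficients
  are smooth and \<open>L K = K i \<partial>\<^sub>y\<close> determines \<open>L\<close>. A constant \<open>u\<close> conjugates every \<open>w\<^sub>k\<close>, hence also \<open>L\<close>. If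
  \<open>L\<close> commutes with a non-real \<open>u\<close>, then \<open>L\<close> is complex, the recursion contained in \<open>L K = K i \<partial>\<^sub>y\<close> makes
  \<open>K\<close> complex, and therefore all \<open>w\<^sub>k\<close> and \<open>W\<close> itself come from \<open>Gr(\<complex>)\<close>. This is the freeness in (b).

  For (c), the point is that \<open>L\<^sub>W\<close> is determined by \<open>L\<^sub>W(z)\<close>. If \<open>L\<^sub>W(z) = L\<^sub>W\<^sub>'(z)\<close>, then \<open>K\<^sup>-\<^sup>1 K'\<close> commutes
  with \<open>i \<partial>\<^sub>y\<close>, so on the plane \<open>\<psi>' = \<psi> C\<close> with \<open>C = 1 + \<Sum> c\<^sub>s \<zeta>\<^sup>-\<^sup>s\<close> and complex \<open>c\<^sub>s\<close> independent of \<open>y\<close>; the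
  Dirac equation \<open>(\<partial>\<^sub>x + i \<partial>\<^sub>y) a\<^sub>k + a\<^bsub>k+1\<^esub> + i a\<^bsub>k+1\<^esub> i = b a\<^sub>k\<close> shows that they are constant, since the set of
  \<open>z\<close> at which \<open>\<psi>\<close> exists has discrete complement. The \<open>c\<^sub>s\<close> grow more slowly than any \<open>r\<^sup>s\<close> with \<open>r > 1\<close>, which is
  enough to transport \<open>\<psi>' = \<psi> C\<close> to all parameters \<open>\<^bold>t\<close>.
\<close>

text \<open>Three obstacles shape the development. First, the operator of \<open>W gamma\<close>
  makes sense only once \<open>W gamma\<close> is known to lie in \<open>Gr_H\<close>. Invariance of
  the Fredholm index is proved by cutting \<open>H\<close> off at a very negative exponent
  \<open>K\<close>: there the projection of \<open>W\<close> is injective with closed range, and the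
  index becomes a comparison of finite dimensions. Secondly, there is no tau function from which to
  read off that the Baker function exists for most \<open>z\<close>. Existence near each point comes
  instead from rescaling \<open>zeta\<close>, and smoothness from estimating difference quotients of
  the \<open>w_k\<close> directly. Discreteness of the exceptional \<open>z\<close> keeps the plane
  connected, so that factors which are locally constant are constant. Thirdly, in (c) the multiplier
  speaks of the operator on the plane only, whereas points of \<open>M_space\<close> are operators
  in all parameters. Agreement on the plane gives a priori just a formal series \<open>C\<close>,
  not an element of \<open>Gamma_-\<close>, and analysis is needed to carry it to the other
  parameters.\<close>

abbreviation (input) cm :: "complex measure" where "cm \<equiv> circle_measure"

section \<open>Quaternion arithmetic in complex coordinates\<close>

abbreviation qc :: "complex \<Rightarrow> quat" where "qc \<equiv> quat_of_complex"

lemma qc_mult: "qc (a * b) = qc a * qc b" by (simp add: quat_of_complex_def times_quat_def)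
lemma qc_add: "qc (a + b) = qc a + qc b" by (simp add: quat_of_complex_def plus_quat_def)
lemma qc_minus: "qc (- a) = - qc a" by (simp add: quat_of_complex_def uminus_quat_def)
lemma qc_1 [simp]: "qc 1 = 1" by (simp add: quat_of_complex_def one_quat_def)
lemma qc_0 [simp]: "qc 0 = 0" by (simp add: quat_of_complex_def zero_quat_def)
lemma qc_power: "qc (a ^ n) = qc a ^ n" by (induction n) (simp_all add: qc_mult)
lemma qc_scaleR: "qc (of_real r * a) = r *\<^sub>R qc a"
  by (simp add: quat_of_complex_def scaleR_quat_def scaleR_conv_of_real)
lemma qc_i: "qc \<i> = quat_i" by (simp add: quat_of_complex_def quat_i_def)
lemma qc_inject [simp]: "qc a = qc b \<longleftrightarrow> a = b" by (simp add: quat_of_complex_def)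
lemma cpart_qc [simp]: "cpart (qc a) = a" and jpart_qc [simp]: "jpart (qc a) = 0"
  by (simp_all add: quat_of_complex_def)
lemma qc_inverse: "qc (inverse a) = inverse (qc a)"
proof (cases "a = 0")
  case False
  then have "qc a * qc (inverse a) = 1" by (simp flip: qc_mult)
  then show ?thesis by (metis inverse_unique)
qed simp
lemma cpart_times [simp]: "cpart (p * q) = cpart p * cpart q - jpart p * cnj (jpart q)"
  and jpart_times [simp]: "jpart (p * q) = cpart p * jpart q + jpart p * cnj (cpart q)"
  by (simp_all add: times_quat_def)
lemma cpart_1 [simp]: "cpart 1 = 1" and jpart_1 [simp]: "jpart 1 = 0" by (simp_all add: one_quat_def)
lemma cpart_i [simp]: "cpart quat_i = \<i>" and jpart_i [simp]: "jpart quat_i = 0" by (simp_all add: quat_i_def)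
lemma cpart_j [simp]: "cpart quat_j = 0" and jpart_j [simp]: "jpart quat_j = 1" by (simp_all add: quat_j_def)

lemma range_qc_iff: "q \<in> range qc \<longleftrightarrow> jpart q = 0"
proof
  assume "jpart q = 0"
  then have "q = qc (cpart q)" by (simp add: quat_eq_iff)
  then show "q \<in> range qc" by (rule range_eqI)
qed auto

lemma norm_quat_sq: "(norm q)\<^sup>2 = (cmod (cpart q))\<^sup>2 + (cmod (jpart q))\<^sup>2"
  by (simp add: norm_quat_def inner_quat_def dot_square_norm)

lemma bounded_linear_qc: "bounded_linear qc" by (rule bounded_linear_intro[where K = 1])
     (auto simp: quat_of_complex_def plus_quat_def scaleR_quat_def norm_quat_def
        inner_quat_def norm_eq_sqrt_inner)

lemma norm_cpart_le: "cmod (cpart q) \<le> norm q" and norm_jpart_le: "cmod (jpart q) \<le> norm q"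
  by (rule power2_le_imp_le, simp_all add: norm_quat_sq)+

lemma bounded_linear_cpart: "bounded_linear cpart"
  by (rule bounded_linear_intro[where K = 1]) (auto simp: norm_cpart_le)
lemma bounded_linear_jpart: "bounded_linear jpart"
  by (rule bounded_linear_intro[where K = 1]) (auto simp: norm_jpart_le)

lemma inner_quat_mult_right: "inner (p * qc a) q = inner p (q * qc (cnj a))"
  by (simp add: inner_quat_def inner_complex_def algebra_simps)
lemma inner_quat_mult_left: "inner (r * p) q = inner p (quat_cnj r * q)"
  by (simp add: inner_quat_def inner_complex_def quat_cnj_def algebra_simps)

section \<open>Fourier analysis in \<open>L2H\<close>: completeness, multipliers and
  synthesis\<close>

section \<open>The circle\<close>

lemma cis_measurable_circle:
  "cis \<in> measurable (uniform_measure lborel {0..2*pi}) (restrict_space borel (sphere 0 1))"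
proof (rule measurable_restrict_space2)
  have "cis \<in> borel_measurable borel" by (intro borel_measurable_continuous_onI continuous_intros)
  then show "cis \<in> borel_measurable (uniform_measure lborel {0..2*pi})"
    by (simp add: measurable_cong_sets[OF sets_uniform_measure refl])
qed auto

lemma uniform_measure_density:
  "uniform_measure lborel {0..2*pi} = density lborel (\<lambda>t. ennreal (indicator {0..2*pi} t / (2*pi)))"
  unfolding uniform_measure_def
proof (rule density_cong)
  have "indicator {0..2*pi} t / emeasure lborel {0..2*pi} = ennreal (indicator {0..2*pi} t / (2*pi))" for t :: real
    using divide_ennreal[of 1 "2*pi"] by (cases "t \<in> {0..2*pi}") simp_all
  then show "AE t in lborel. indicator {0..2*pi} t / emeasure lborel {0..2*pi} = ennreal (indicator {0..2*pi} t / (2*pi))"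
    by simp
qed auto

lemma emeasure_circle: "emeasure cm (space cm) = 1"
proof -
  have "emeasure cm (space cm) =
     emeasure (uniform_measure lborel {0..2*pi}) (cis -` sphere 0 1 \<inter> UNIV)"
    unfolding space_circle unfolding circle_measure_def
    by (subst emeasure_distr[OF cis_measurable_circle]) (auto simp: sets_restrict_space)
  also have "cis -` sphere 0 1 \<inter> UNIV = UNIV" by auto
  finally show ?thesis using divide_ennreal[of "2*pi" "2*pi"] by simp
qed

interpretation circ: finite_measure cm by standard (metis emeasure_circle ennreal_one_neq_top infinity_ennreal_def)

lemma measure_circle: "measure cm (sphere 0 1) = 1" using emeasure_circle by (simp add: measure_def)

lemma borel_measurable_circle_continuous:
  assumes "continuous_on (sphere 0 1) (g :: complex \<Rightarrow> 'a::topological_space)"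
  shows "g \<in> borel_measurable cm" using assms by (subst measurable_cong_sets[OF sets_circle refl])
      (rule borel_measurable_continuous_on_restrict)

lemma continuous_on_powi [continuous_intros]: "continuous_on (sphere 0 1) (\<lambda>x::complex. x powi m)"
  by (intro continuous_intros) auto

lemma integral_circle_powi: "(\<integral>x. x powi m \<partial>cm) = (if m = 0 then 1 else 0)"
proof -
  have "(\<integral>x. x powi m \<partial>cm) = (\<integral>t. cis t powi m \<partial>uniform_measure lborel {0..2*pi})"
    unfolding circle_measure_def by (rule integral_distr[OF cis_measurable_circle])
       (rule borel_measurable_continuous_on_restrict, rule continuous_on_powi)
  also have "\<dots> = (\<integral>t. cis (of_int m * t) \<partial>uniform_measure lborel {0..2*pi})"
    by (simp add: cis_power_int)
  also have "\<dots> = (if m = 0 then 1 else 0)"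
  proof (cases "m = 0")
    case True
    have "measure (uniform_measure lborel {0..2*pi}) UNIV = 1"
      using divide_ennreal[of "2*pi" "2*pi"] by (simp add: measure_def)
    then show ?thesis using True by simp
  next
    case False
    have "(\<integral>t. cis (of_int m * t) \<partial>uniform_measure lborel {0..2*pi}) =
        (\<integral>t. (indicator {0..2*pi} t / (2*pi)) *\<^sub>R cis (of_int m * t) \<partial>lborel)"
      unfolding uniform_measure_density
      by (rule integral_density) (auto intro!: borel_measurable_continuous_onI continuous_intros)
    also have "\<dots> = (1/(2*pi)) *\<^sub>R (\<integral>t. indicator {0..2*pi} t *\<^sub>R cis (of_int m * t) \<partial>lborel)"
      by (subst integral_scaleR_right[symmetric]) simp
    also have "(\<integral>t. indicator {0..2*pi} t *\<^sub>R cis (of_int m * t) \<partial>lborel) =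
        (cis (of_int m * (2*pi)) / (\<i> * of_int m)) - (cis (of_int m * 0) / (\<i> * of_int m))"
    proof (rule integral_FTC_Icc)
      show "((\<lambda>t. cis (of_int m * t) / (\<i> * of_int m)) has_vector_derivative cis (of_int m * x)) (at x within {0..2*pi})" for x
        unfolding cis_conv_exp
        using False by (auto intro!: derivative_eq_intros has_vector_derivative_real_field simp: field_simps)
    qed (auto intro!: continuous_intros)
    also have "\<dots> = 0" using cis_multiple_2pi[of "of_int m"] by (simp add: mult.commute mult.left_commute)
    finally show ?thesis using False by simp
  qed
  finally show ?thesis .
qed

lemma square_integrable_continuous:
  assumes "continuous_on (sphere 0 1) g"
  shows "square_integrable (\<lambda>x. qc (g x))"
proof -
  have "square_integrable (\<lambda>_. 1)" by (simp add: square_integrable_def)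
  from square_integrable_mult_right[OF this assms] show ?thesis by simp
qed

lemma square_integrable_imp_integrable:
  assumes "square_integrable f" shows "integrable cm f"
proof -
  have "integrable cm (\<lambda>x. 1 + (norm (f x))\<^sup>2)" using assms by (auto simp: square_integrable_def)
  then show ?thesis
  proof (rule Bochner_Integration.integrable_bound)
    show "AE x in cm. norm (f x) \<le> norm (1 + (norm (f x))\<^sup>2)"
      using sum_squares_bound[of "norm (f _)" 1] by (intro AE_I2) (smt (verit) norm_ge_zero power2_sum real_norm_def zero_le_power2 power_one)
  qed (use assms in \<open>simp add: square_integrable_def\<close>)
qed

lemma integrable_fourier:
  assumes "square_integrable f"
  shows "integrable cm (\<lambda>x. f x * qc (x powi m))"
  by (rule square_integrable_imp_integrable) (rule square_integrable_mult_right[OF assms continuous_on_powi])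

lemma l2_eq_refl_iff: "l2_eq f f \<longleftrightarrow> square_integrable f" by (simp add: l2_eq_def)

lemma fourier_add [simp]: "fourier (f + g) m = fourier f m + fourier g m"
  by (transfer fixing: m) (simp add: l2_eq_refl_iff distrib_right integrable_fourier)

lemma fourier_lmult [simp]: "fourier (lmult q f) m = q * fourier f m"
  by (transfer fixing: m q) (simp add: l2_eq_refl_iff mult.assoc integrable_fourier)

lemma fourier_scaleR [simp]: "fourier (r *\<^sub>R f) m = r *\<^sub>R fourier f m"
  by (transfer fixing: m r) (simp add: l2_eq_refl_iff integrable_fourier)

lemma fourier_0 [simp]: "fourier 0 m = 0" using fourier_scaleR[of 0 0 m] by simp

lemma fourier_minus [simp]: "fourier (- f) m = - fourier f m" using fourier_scaleR[of "-1" f m] by simp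

lemma fourier_diff [simp]: "fourier (f - g) m = fourier f m - fourier g m" using fourier_add[of f "- g" m] by simp

lemma fourier_sum [simp]: "fourier (\<Sum>i\<in>A. f i) m = (\<Sum>i\<in>A. fourier (f i) m)"
  by (induction A rule: infinite_finite_induct) simp_all

lift_definition zpow :: "int \<Rightarrow> L2H" is "\<lambda>m x. qc (x powi m)"
  by (simp add: l2_eq_refl_iff square_integrable_continuous continuous_on_powi)

lemma fourier_zpow [simp]: "fourier (zpow m) n = (if n = m then 1 else 0)"
proof (transfer fixing: m n)
  have "(\<integral>x. qc (x powi m) * qc (x powi - n) \<partial>cm) = (\<integral>x. qc (x powi (m - n)) \<partial>cm)"
  proof (rule Bochner_Integration.integral_cong)
    fix x assume "x \<in> space cm"
    then have "x \<noteq> 0" by auto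
    then show "qc (x powi m) * qc (x powi - n) = qc (x powi (m - n))"
      by (simp add: power_int_diff power_int_minus divide_inverse flip: qc_mult)
  qed simp
  also have "\<dots> = qc (\<integral>x. x powi (m - n) \<partial>cm)"
    by (rule integral_bounded_linear[OF bounded_linear_qc])
       (rule circ.integrable_const_bound[where B = 1],
        auto simp: norm_power_int intro!: borel_measurable_circle_continuous continuous_on_powi)
  finally show "(\<integral>x. qc (x powi m) * qc (x powi - n) \<partial>cm) = (if n = m then 1 else 0)"
    by (simp add: integral_circle_powi)
qed

text \<open>The only contact between coefficients and the inner product: the contraction bound,
  Bessel and Parseval all come from here. On the circle \<open>cnj (x powi - m) = x powi m\<close>,
  which moves the monomial to the other side.\<close>

lemma inner_lmult_zpow: "inner f (lmult q (zpow m)) = inner (fourier f m) q"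
proof (transfer fixing: q m)
  fix f assume "l2_eq f f"
  then have f: "square_integrable f" by (simp add: l2_eq_refl_iff)
  have "(\<integral>x. inner (f x) (q * qc (x powi m)) \<partial>cm) = (\<integral>x. inner (f x * qc (x powi - m)) q \<partial>cm)"
  proof (rule Bochner_Integration.integral_cong)
    fix x assume "x \<in> space cm"
    then have x: "cmod x = 1" by simp
    then have "cnj (x powi - m) = x powi m"
    proof -
      have "x * cnj x = 1" using x complex_norm_square[of x] by simp
      then have "cnj x = inverse x" by (metis inverse_unique)
      then show ?thesis by (simp add: power_int_minus power_int_inverse)
    qed
    then show "inner (f x) (q * qc (x powi m)) = inner (f x * qc (x powi - m)) q" by (simp add: inner_quat_mult_right)
  qed simp
  also have "\<dots> = inner (\<integral>x. f x * qc (x powi - m) \<partial>cm) q"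
    using integrable_fourier[OF f, of "- m"] by simp
  finally show "(\<integral>x. inner (f x) (q * qc (x powi m)) \<partial>cm) = inner (\<integral>x. f x * qc (x powi - m) \<partial>cm) q" .
qed

lemma norm_L2H_sq: "(norm (f::L2H))\<^sup>2 = inner f f" by (simp add: power2_norm_eq_inner)

lemma norm_lmult [simp]: "norm (lmult q f) = norm q * norm f"
proof -
  have "(norm (lmult q f))\<^sup>2 = (norm q)\<^sup>2 * (norm f)\<^sup>2" unfolding norm_L2H_sq
    by transfer (simp add: l2_eq_refl_iff norm_mult power_mult_distrib flip: power2_norm_eq_inner)
  then show ?thesis
    by (metis abs_norm_cancel norm_mult power2_eq_iff_nonneg norm_ge_zero mult_nonneg_nonneg power_mult_distrib)
qed

lemma norm_zpow [simp]: "norm (zpow m) = 1"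
proof -
  have "lmult 1 f = f" for f by transfer (simp add: l2_eq_refl_iff)
  then have "(norm (zpow m))\<^sup>2 = 1"
    using inner_lmult_zpow[of "zpow m" 1 m] by (simp add: norm_L2H_sq) (simp add: norm_quat_sq flip: power2_norm_eq_inner)
  then show ?thesis by (metis norm_ge_zero power2_eq_iff_nonneg zero_le_one power_one)
qed

lemma norm_fourier_le: "norm (fourier f m) \<le> norm f"
proof -
  have "(norm (fourier f m))\<^sup>2 = inner f (lmult (fourier f m) (zpow m))"
    by (simp add: inner_lmult_zpow power2_norm_eq_inner)
  also have "\<dots> \<le> norm f * norm (fourier f m)"
    using norm_cauchy_schwarz[of f "lmult (fourier f m) (zpow m)"] by simp
  finally show ?thesis by (cases "norm (fourier f m) = 0") (auto simp: power2_eq_square)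
qed

lemma bounded_linear_fourier: "bounded_linear (\<lambda>f. fourier f m)"
  by (rule bounded_linear_intro[where K = 1]) (auto simp: norm_fourier_le)

section \<open>Completeness\<close>

lemma L2H_cases: obtains f where "square_integrable f" "x = abs_L2H f"
  using Quotient3_L2H by (metis Quotient3_abs_rep Quotient3_rep_reflp l2_eq_refl_iff)

lemma norm_abs_diff_sq:
  assumes "square_integrable f" "square_integrable g"
  shows "(norm (abs_L2H f - abs_L2H g))\<^sup>2 = (\<integral>x. (norm (f x - g x))\<^sup>2 \<partial>cm)"
proof -
  have "l2_eq f f" "l2_eq g g" using assms by (simp_all add: l2_eq_refl_iff)
  have h: "square_integrable (\<lambda>x. f x + - g x)"
    by (intro square_integrable_add square_integrable_uminus assms)
  have "abs_L2H f - abs_L2H g = abs_L2H (\<lambda>x. f x + - g x)" unfolding minus_L2H_def using assms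
    by (simp add: plus_L2H.abs_eq uminus_L2H.abs_eq l2_eq_refl_iff square_integrable_uminus)
  also have "inner \<dots> \<dots> = (\<integral>x. inner (f x + - g x) (f x + - g x) \<partial>cm)"
    using h by (simp add: inner_L2H.abs_eq l2_eq_refl_iff)
  finally show ?thesis by (simp add: norm_L2H_sq power2_norm_eq_inner)
qed

text \<open>The total mass is one, so the \<open>L^1\<close> norm is at most the \<open>L^2\<close>
  norm. The inequality \<open>2 e |h| <= |h|^2 + e^2\<close> stands in for Cauchy-Schwarz.\<close>

lemma integral_norm_le:
  assumes "square_integrable h" "(\<integral>x. (norm (h x))\<^sup>2 \<partial>cm) \<le> e\<^sup>2" "e > 0"
  shows "(\<integral>x. norm (h x) \<partial>cm) \<le> e"
proof -
  have "(\<integral>x. norm (h x) \<partial>cm) \<le> (\<integral>x. (e + (norm (h x))\<^sup>2 / e) / 2 \<partial>cm)"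
  proof (rule integral_mono)
    show "integrable cm (\<lambda>x. norm (h x))" using assms(1) square_integrable_imp_integrable by blast
    show "integrable cm (\<lambda>x. (e + (norm (h x))\<^sup>2 / e) / 2)"
      using assms(1) by (auto simp: square_integrable_def)
    fix x
    have "2 * norm (h x) * e \<le> (norm (h x))\<^sup>2 + e\<^sup>2" by (rule sum_squares_bound)
    then show "norm (h x) \<le> (e + (norm (h x))\<^sup>2 / e) / 2"
      using assms(3) by (simp add: field_simps power2_eq_square)
  qed
  also have "\<dots> = (e + (\<integral>x. (norm (h x))\<^sup>2 \<partial>cm) / e) / 2"
    using assms(1) by (auto simp: square_integrable_def measure_circle)
  also have "\<dots> \<le> (e + e\<^sup>2 / e) / 2" using assms by (intro divide_right_mono add_left_mono) auto
  finally show ?thesis using assms(3) by (simp add: power2_eq_square)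
qed

text \<open>The sum of the norms of the increments has integral at most a geometric series, hence is
  finite almost everywhere; the telescoping series then converges absolutely.\<close>

lemma AE_convergent_fast:
  fixes F :: "nat \<Rightarrow> complex \<Rightarrow> quat"
  assumes "\<And>k. square_integrable (F k)"
    and le: "\<And>k. (\<integral>x. norm (F (Suc k) x - F k x) \<partial>cm) \<le> (1/2)^k"
  shows "AE x in cm. convergent (\<lambda>k. F k x)"
proof -
  have [measurable]: "F k \<in> borel_measurable cm" for k using assms(1) by (simp add: square_integrable_def)
  have int: "integrable cm (\<lambda>x. F (Suc k) x - F k x)" for k
    using assms(1) square_integrable_imp_integrable by (intro Bochner_Integration.integrable_diff) auto
  have "(\<integral>\<^sup>+x. (\<Sum>k. ennreal (norm (F (Suc k) x - F k x))) \<partial>cm) =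
      (\<Sum>k. \<integral>\<^sup>+x. ennreal (norm (F (Suc k) x - F k x)) \<partial>cm)"
    by (rule nn_integral_suminf) measurable
  also have "\<dots> = (\<Sum>k. ennreal (\<integral>x. norm (F (Suc k) x - F k x) \<partial>cm))"
    using int by (intro suminf_cong nn_integral_eq_integral) auto
  also have "\<dots> \<le> (\<Sum>k. ennreal ((1/2)^k))" by (intro suminf_le summableI ennreal_leI le)
  also have "\<dots> = ennreal (\<Sum>k. (1/2)^k)" by (intro suminf_ennreal2) auto
  also have "\<dots> < \<infinity>" by simp
  finally have "AE x in cm. (\<Sum>k. ennreal (norm (F (Suc k) x - F k x))) \<noteq> \<infinity>"
    by (intro nn_integral_PInf_AE) auto
  then show ?thesis
  proof eventually_elim
    case (elim x)
    then have "summable (\<lambda>k. norm (F (Suc k) x - F k x))" by (intro summable_suminf_not_top) auto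
    then have "summable (\<lambda>k. F (Suc k) x - F k x)" by (rule summable_norm_cancel)
    then have "convergent (\<lambda>n. \<Sum>k<n. F (Suc k) x - F k x)" by (simp add: summable_iff_convergent)
    then have "convergent (\<lambda>n. F n x - F 0 x)" by (subst (asm) sum_lessThan_telescope[of "\<lambda>k. F k x"])
    then show ?case using convergent_diff_const_right_iff by blast
  qed
qed

lemma L2H_fast_limit:
  fixes X :: "nat \<Rightarrow> L2H"
  assumes "\<And>k m. k \<le> m \<Longrightarrow> norm (X m - X k) < (1/2)^k"
  shows "\<exists>l. X \<longlonglongrightarrow> l"
proof -
  have "\<exists>f. square_integrable f \<and> X k = abs_L2H f" for k by (rule L2H_cases[of "X k"]) blast
  then obtain F where F: "\<And>k. square_integrable (F k)" "\<And>k. X k = abs_L2H (F k)" by metis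
  have [measurable]: "F k \<in> borel_measurable cm" for k using F by (simp add: square_integrable_def)
  have sqd: "square_integrable (\<lambda>x. F m x - F k x)" for m k
    using square_integrable_add[OF F(1)[of m] square_integrable_uminus[OF F(1)[of k]]] by simp
  have le: "(\<integral>x. (norm (F m x - F k x))\<^sup>2 \<partial>cm) \<le> ((1/2)^k)\<^sup>2" if "k \<le> m" for k m
    using assms[OF that] unfolding F(2) norm_abs_diff_sq[OF F(1) F(1), symmetric] by (intro power_mono) auto
  define g where "g = (\<lambda>x. lim (\<lambda>k. F k x))"
  have [measurable]: "g \<in> borel_measurable cm" unfolding g_def by (rule borel_measurable_lim_metric) simp
  have conv: "AE x in cm. (\<lambda>k. F k x) \<longlonglongrightarrow> g x"
  proof -
    have "AE x in cm. convergent (\<lambda>k. F k x)"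
      by (rule AE_convergent_fast[OF F(1)]) (rule integral_norm_le[OF sqd], auto intro: le)
    then show ?thesis by eventually_elim (simp add: g_def convergent_LIMSEQ_iff)
  qed
  \<comment> \<open>Fatou's lemma along \<open>k\<close>. The bound shows both that
    \<open>g - F n\<close> is square integrable and that \<open>X n\<close> is close to the class of
    \<open>g\<close>.\<close>
  have nn: "(\<integral>\<^sup>+x. ennreal ((norm (g x - F n x))\<^sup>2) \<partial>cm) \<le> ennreal (((1/2)^n)\<^sup>2)" for n
  proof -
    have "(\<integral>\<^sup>+x. ennreal ((norm (g x - F n x))\<^sup>2) \<partial>cm) =
       (\<integral>\<^sup>+x. liminf (\<lambda>k. ennreal ((norm (F k x - F n x))\<^sup>2)) \<partial>cm)" using conv
    proof (intro nn_integral_cong_AE, eventually_elim)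
      case (elim x)
      have "(\<lambda>k. ennreal ((norm (F k x - F n x))\<^sup>2)) \<longlonglongrightarrow> ennreal ((norm (g x - F n x))\<^sup>2)"
        by (intro tendsto_intros elim)
      then show ?case by (rule lim_imp_Liminf[OF trivial_limit_sequentially, symmetric])
    qed
    also have "\<dots> \<le> liminf (\<lambda>k. \<integral>\<^sup>+x. ennreal ((norm (F k x - F n x))\<^sup>2) \<partial>cm)"
      by (rule nn_integral_liminf) measurable
    also have "\<dots> \<le> ennreal (((1/2)^n)\<^sup>2)"
    proof (rule Liminf_le)
      show "\<forall>\<^sub>F k in sequentially. (\<integral>\<^sup>+x. ennreal ((norm (F k x - F n x))\<^sup>2) \<partial>cm) \<le> ennreal (((1/2)^n)\<^sup>2)"
        using eventually_ge_at_top[of n]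
      proof eventually_elim
        case (elim k)
        have "(\<integral>\<^sup>+x. ennreal ((norm (F k x - F n x))\<^sup>2) \<partial>cm) = ennreal (\<integral>x. (norm (F k x - F n x))\<^sup>2 \<partial>cm)"
          using sqd[of k n] by (intro nn_integral_eq_integral) (auto simp: square_integrable_def)
        then show ?case using le[OF elim] by (simp add: ennreal_leI)
      qed
    qed simp
    finally show ?thesis .
  qed
  have gF: "square_integrable (\<lambda>x. g x - F n x)" for n unfolding square_integrable_def
  proof
    show "integrable cm (\<lambda>x. (norm (g x - F n x))\<^sup>2)"
      using nn[of n] by (intro integrableI_nonneg) (auto intro: le_less_trans simp: ennreal_less_top)
  qed simp
  have g: "square_integrable g" using square_integrable_add[OF gF[of 0] F(1)[of 0]] by simp
  have "norm (X n - abs_L2H g) \<le> (1/2)^n" for n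
  proof (rule power2_le_imp_le)
    have "(\<integral>x. (norm (g x - F n x))\<^sup>2 \<partial>cm) \<le> ((1/2)^n)\<^sup>2"
      using nn[of n] gF[of n] by (subst (asm) nn_integral_eq_integral) (auto simp: square_integrable_def ennreal_le_iff)
    then show "(norm (X n - abs_L2H g))\<^sup>2 \<le> ((1/2)^n)\<^sup>2"
      unfolding F(2) norm_abs_diff_sq[OF F(1) g] by (simp add: norm_minus_commute)
  qed simp
  then have "X \<longlonglongrightarrow> abs_L2H g"
    by (intro LIMSEQ_I) (smt (verit, best) LIMSEQ_D[OF LIMSEQ_realpow_zero[of "1/2"]] norm_power real_norm_def half_gt_zero_iff abs_of_nonneg diff_zero divide_nonneg_nonneg field_sum_of_halves zero_le_power power_mono)
  then show ?thesis by blast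
qed

instance L2H :: banach
proof
  fix X :: "nat \<Rightarrow> L2H" assume X: "Cauchy X"
  have "\<exists>N. \<forall>m\<ge>N. \<forall>n\<ge>N. norm (X m - X n) < (1/2)^k" for k :: nat
    using CauchyD[OF X, of "(1/2)^k"] by auto
  then obtain N where N: "\<And>k m n. m \<ge> N k \<Longrightarrow> n \<ge> N k \<Longrightarrow> norm (X m - X n) < (1/2)^k"
    by metis
  \<comment> \<open>Adding up the \<open>Suc (N i)\<close> makes \<open>r\<close> strictly
    increasing and at least \<open>N\<close>.\<close>
  define r where "r = (\<lambda>k. (\<Sum>i\<le>k. Suc (N i)))"
  have "strict_mono r" unfolding r_def strict_mono_Suc_iff by simp
  have rN: "r k \<ge> N k" for k unfolding r_def by (induction k) auto
  have "\<exists>l. (X \<circ> r) \<longlonglongrightarrow> l"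
  proof (rule L2H_fast_limit)
    fix k m :: nat assume "k \<le> m"
    then have "r k \<le> r m" using \<open>strict_mono r\<close> by (simp add: strict_mono_less_eq)
    then show "norm ((X \<circ> r) m - (X \<circ> r) k) < (1/2)^k" using N[of k "r m" "r k"] rN[of k] by simp
  qed
  then show "convergent X"
    using Cauchy_converges_subseq[OF X \<open>strict_mono r\<close>] by (auto simp: convergent_def)
qed

section \<open>Completeness of the Fourier system\<close>

definition fourier_null :: "(complex \<Rightarrow> quat) set" where
  "fourier_null = {f. square_integrable f \<and> (\<forall>m. (\<integral>x. f x * qc (x powi m) \<partial>cm) = 0)}"

text \<open>Completeness of the monomials is proved dually: instead of approximating
  \<open>f\<close>, one collects the real multipliers that preserve vanishing of all coefficients.
  They form an algebra containing \<open>Re\<close> and \<open>Im\<close>, so Stone-Weierstrass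
  applies. Asking for preservation, and not only for a vanishing integral, is what makes the class
  closed under products.\<close>

definition null_mult :: "(complex \<Rightarrow> real) \<Rightarrow> bool" where
  "null_mult g \<longleftrightarrow> continuous_on (sphere 0 1) g \<and>
     (\<forall>f\<in>fourier_null. (\<lambda>x. f x * qc (of_real (g x))) \<in> fourier_null)"

lemma circle_integral_cong:
  assumes "\<And>x. cmod x = 1 \<Longrightarrow> f x = (g x :: 'a::{banach,second_countable_topology})"
  shows "(\<integral>x. f x \<partial>cm) = (\<integral>x. g x \<partial>cm)"
  using assms by (intro Bochner_Integration.integral_cong) auto

lemma null_multI:
  assumes "continuous_on (sphere 0 1) g"
    "\<And>f m. f \<in> fourier_null \<Longrightarrow> (\<integral>x. (f x * qc (of_real (g x))) * qc (x powi m) \<partial>cm) = 0"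
  shows "null_mult g" unfolding null_mult_def fourier_null_def
proof safe
  fix f assume f: "square_integrable f" "\<forall>m. (\<integral>x. f x * qc (x powi m) \<partial>cm) = 0"
  show "square_integrable (\<lambda>x. f x * qc (of_real (g x)))"
    by (rule square_integrable_mult_right[OF f(1)]) (intro continuous_intros assms(1))
  fix m show "(\<integral>x. f x * qc (of_real (g x)) * qc (x powi m) \<partial>cm) = 0"
    using assms(2)[of f m] f by (simp add: fourier_null_def)
qed (rule assms(1))

lemma fourier_null_shift:
  assumes "f \<in> fourier_null"
  shows "(\<integral>x. f x * qc (c * x powi k) * qc (x powi m) \<partial>cm) = 0"
    "integrable cm (\<lambda>x. f x * qc (c * x powi k) * qc (x powi m))"
proof -
  have f: "square_integrable f" using assms by (simp add: fourier_null_def)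
  have eq: "f x * qc (c * x powi k) * qc (x powi m) = f x * qc (x powi (k + m)) * qc c" if "cmod x = 1" for x
  proof -
    have "x \<noteq> 0" using that by auto
    then show ?thesis by (simp add: mult.assoc power_int_add mult.left_commute mult.commute flip: qc_mult)
  qed
  have "(\<integral>x. f x * qc (c * x powi k) * qc (x powi m) \<partial>cm) = (\<integral>x. f x * qc (x powi (k + m)) * qc c \<partial>cm)"
    by (rule circle_integral_cong) (rule eq)
  also have "\<dots> = (\<integral>x. f x * qc (x powi (k + m)) \<partial>cm) * qc c"
    using integrable_fourier[OF f] by simp
  finally show "(\<integral>x. f x * qc (c * x powi k) * qc (x powi m) \<partial>cm) = 0"
    using assms by (simp add: fourier_null_def)
  have "square_integrable (\<lambda>x. f x * qc (c * x powi k) * qc (x powi m))"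
    by (intro square_integrable_mult_right f continuous_intros continuous_on_powi)
  then show "integrable cm (\<lambda>x. f x * qc (c * x powi k) * qc (x powi m))"
    by (rule square_integrable_imp_integrable)
qed

lemma null_mult_two_terms:
  assumes "continuous_on (sphere 0 1) g"
    and eq: "\<And>x. cmod x = 1 \<Longrightarrow> complex_of_real (g x) = a * x powi 1 + b * x powi (-1)"
  shows "null_mult g"
proof (rule null_multI[OF assms(1)])
  fix f m assume f: "f \<in> fourier_null"
  have "(\<integral>x. (f x * qc (of_real (g x))) * qc (x powi m) \<partial>cm) =
     (\<integral>x. f x * qc (a * x powi 1) * qc (x powi m) + f x * qc (b * x powi (-1)) * qc (x powi m) \<partial>cm)"
    by (rule circle_integral_cong) (simp only: eq qc_add distrib_left distrib_right)
  also have "\<dots> = 0"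
    by (subst Bochner_Integration.integral_add; (rule fourier_null_shift[OF f])?) (simp only: fourier_null_shift[OF f] add_0)
  finally show "(\<integral>x. (f x * qc (of_real (g x))) * qc (x powi m) \<partial>cm) = 0" .
qed

lemma null_mult_continuous_approx:
  assumes "continuous_on (sphere 0 1) g" "e > 0"
  shows "\<exists>h. null_mult h \<and> (\<forall>x\<in>sphere 0 1. \<bar>g x - h x\<bar> < e)"
proof (rule Stone_Weierstrass_HOL[where P = null_mult and S = "sphere 0 1"])
  show "null_mult (\<lambda>x. c)" for c
  proof (rule null_multI)
    fix f m assume "f \<in> fourier_null"
    from fourier_null_shift(1)[OF this, of "of_real c" 0 m]
    show "(\<integral>x. f x * qc (of_real c) * qc (x powi m) \<partial>cm) = 0" by simp
  qed simp
  show "null_mult f \<Longrightarrow> continuous_on (sphere 0 1) f" for f by (simp add: null_mult_def)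
  show "null_mult (\<lambda>x. f x + g x)" if "null_mult f \<and> null_mult g" for f g
  proof (rule null_multI)
    show "continuous_on (sphere 0 1) (\<lambda>x. f x + g x)"
      using that by (auto simp: null_mult_def intro!: continuous_intros)
    fix h m assume "h \<in> fourier_null"
    then have 1: "(\<lambda>x. h x * qc (of_real (f x))) \<in> fourier_null" "(\<lambda>x. h x * qc (of_real (g x))) \<in> fourier_null"
      using that by (auto simp: null_mult_def)
    then show "(\<integral>x. (h x * qc (of_real (f x + g x))) * qc (x powi m) \<partial>cm) = 0"
      by (simp add: qc_add distrib_left distrib_right fourier_null_def integrable_fourier)
  qed
  show "null_mult (\<lambda>x. f x * g x)" if "null_mult f \<and> null_mult g" for f g
  proof (rule null_multI)
    show "continuous_on (sphere 0 1) (\<lambda>x. f x * g x)"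
      using that by (auto simp: null_mult_def intro!: continuous_intros)
    fix h m assume "h \<in> fourier_null"
    then have "(\<lambda>x. h x * qc (of_real (f x)) * qc (of_real (g x))) \<in> fourier_null"
      using that by (auto simp: null_mult_def)
    then show "(\<integral>x. (h x * qc (of_real (f x * g x))) * qc (x powi m) \<partial>cm) = 0"
      by (simp add: qc_mult mult.assoc fourier_null_def)
  qed
  have inv: "inverse x = cnj x" if "cmod x = 1" for x
    using that complex_norm_square[of x] by (metis inverse_unique of_real_1 power_one)
  have Re: "null_mult Re" by (rule null_mult_two_terms[where a = "1/2" and b = "1/2"])
      (auto intro!: continuous_intros simp: power_int_minus inv complex_eq_iff)
  have Im: "null_mult Im" by (rule null_mult_two_terms[where a = "-\<i>/2" and b = "\<i>/2"])
      (auto intro!: continuous_intros simp: power_int_minus inv complex_eq_iff)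
  show "\<exists>f. null_mult f \<and> f x \<noteq> f y" if "x \<in> sphere 0 1 \<and> y \<in> sphere 0 1 \<and> x \<noteq> y" for x y
    using that Re Im by (metis complex_eq_iff)
qed (use assms in auto)

lemma fourier_null_integral_continuous:
  assumes f: "f \<in> fourier_null" and g: "continuous_on (sphere 0 1) g"
  shows "(\<integral>x. g x *\<^sub>R f x \<partial>cm) = 0"
proof -
  have sf: "square_integrable f" using f by (simp add: fourier_null_def)
  have fi: "integrable cm f" using sf by (rule square_integrable_imp_integrable)
  have eqs: "f x * qc (of_real r) = r *\<^sub>R f x" for x r using qc_scaleR[of r 1] by simp
  have int: "integrable cm (\<lambda>x. h x *\<^sub>R f x)" if "continuous_on (sphere 0 1) h" for h
    using square_integrable_mult_right[OF sf, of "\<lambda>x. of_real (h x)"] that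
    by (simp add: eqs square_integrable_imp_integrable continuous_intros)
  \<comment> \<open>The summand 1 keeps the factor positive whatever the integral of the norm is, so
    that it can be divided out before letting \<open>e\<close> tend to 0.\<close>
  have "norm (\<integral>x. g x *\<^sub>R f x \<partial>cm) \<le> e * (1 + (\<integral>x. norm (f x) \<partial>cm))" if "e > 0" for e
  proof -
    obtain h where h: "null_mult h" "\<And>x. x \<in> sphere 0 1 \<Longrightarrow> \<bar>g x - h x\<bar> < e"
      using null_mult_continuous_approx[OF g \<open>e > 0\<close>] by blast
    have hc: "continuous_on (sphere 0 1) h" using h by (simp add: null_mult_def)
    have "(\<integral>x. f x * qc (of_real (h x)) * qc (x powi 0) \<partial>cm) = 0"
      using h(1) f by (auto simp: null_mult_def fourier_null_def simp del: power_int_0_right)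
    then have "(\<integral>x. h x *\<^sub>R f x \<partial>cm) = 0" by (simp add: eqs)
    then have "(\<integral>x. g x *\<^sub>R f x \<partial>cm) = (\<integral>x. (g x - h x) *\<^sub>R f x \<partial>cm)"
      by (simp add: scaleR_diff_left int g hc)
    also have "norm \<dots> \<le> (\<integral>x. norm ((g x - h x) *\<^sub>R f x) \<partial>cm)"
      by (rule integral_norm_bound)
    also have "\<dots> \<le> (\<integral>x. e * norm (f x) \<partial>cm)"
    proof (rule integral_mono_AE)
      show "integrable cm (\<lambda>x. norm ((g x - h x) *\<^sub>R f x))"
        using int[of "\<lambda>x. g x - h x"] g hc by (intro integrable_norm) (auto intro: continuous_intros)
      show "AE x in cm. norm ((g x - h x) *\<^sub>R f x) \<le> e * norm (f x)"
        using h(2) by (intro AE_I2) (auto intro!: mult_right_mono simp: less_imp_le)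
    qed (use fi in auto)
    also have "\<dots> = e * (\<integral>x. norm (f x) \<partial>cm)" by simp
    also have "\<dots> \<le> e * (1 + (\<integral>x. norm (f x) \<partial>cm))" using \<open>e > 0\<close> by simp
    finally show ?thesis .
  qed
  then have le: "norm (\<integral>x. g x *\<^sub>R f x \<partial>cm) / (1 + (\<integral>x. norm (f x) \<partial>cm)) \<le> e" if "e > 0" for e
    using that by (subst pos_divide_le_eq) (auto intro!: add_pos_nonneg)
  then have "norm (\<integral>x. g x *\<^sub>R f x \<partial>cm) / (1 + (\<integral>x. norm (f x) \<partial>cm)) \<le> 0"
    by (rule dense_ge)
  moreover have "1 + (\<integral>x. norm (f x) \<partial>cm) > 0" by (intro add_pos_nonneg) auto
  ultimately show ?thesis by (simp add: divide_le_0_iff)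
qed

lemma fourier_null_integral_closed:
  assumes f: "f \<in> fourier_null" and A: "closed (A :: complex set)"
  shows "(\<integral>x. indicator A x *\<^sub>R f x \<partial>cm) = 0"
proof (cases "A = {}")
  case False
  have sf: "square_integrable f" using f by (simp add: fourier_null_def)
  have fi: "integrable cm f" using sf by (rule square_integrable_imp_integrable)
  have [measurable]: "f \<in> borel_measurable cm" using fi by auto
  \<comment> \<open>Continuous functions decreasing to the indicator of \<open>A\<close>, because
    \<open>A\<close> is closed.\<close>
  define g where "g = (\<lambda>n x. max 0 (1 - real n * infdist x A))"
  have gc: "continuous_on S (g n)" for n S unfolding g_def by (intro continuous_intros)
  have [measurable]: "g n \<in> borel_measurable cm" for n by (rule borel_measurable_circle_continuous[OF gc])
  have [measurable]: "A \<inter> sphere 0 1 \<in> sets cm" using A by (auto simp: sets_circle sets_restrict_space)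
  have lim: "(\<lambda>n. g n x) \<longlonglongrightarrow> indicator A x" for x
  proof (cases "x \<in> A")
    case False
    then have pos: "infdist x A > 0" using A \<open>A \<noteq> {}\<close> by (simp add: infdist_pos_not_in_closed)
    obtain N where N: "real N * infdist x A > 1" using reals_Archimedean3[OF pos] by auto
    have "g n x = 0" if "n \<ge> N" for n
    proof -
      have "real N * infdist x A \<le> real n * infdist x A" using that pos by (intro mult_right_mono) auto
      then show ?thesis using N by (simp add: g_def)
    qed
    then have "\<forall>\<^sub>F n in sequentially. g n x = 0" by (auto simp: eventually_sequentially)
    then show ?thesis using False by (simp add: tendsto_eventually)
  qed (simp add: g_def)
  have ind: "(\<lambda>x. indicator A x *\<^sub>R f x) \<in> borel_measurable cm"
  proof -
    have "(\<lambda>x. indicator (A \<inter> sphere 0 1) x *\<^sub>R f x) \<in> borel_measurable cm" by measurable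
    then show ?thesis by (rule measurable_cong[THEN iffD1, rotated]) (auto simp: indicator_def)
  qed
  have "(\<lambda>n. \<integral>x. g n x *\<^sub>R f x \<partial>cm) \<longlonglongrightarrow> (\<integral>x. indicator A x *\<^sub>R f x \<partial>cm)"
  proof (rule integral_dominated_convergence[where w = "\<lambda>x. norm (f x)"])
    show "AE x in cm. (\<lambda>n. g n x *\<^sub>R f x) \<longlonglongrightarrow> indicator A x *\<^sub>R f x"
      by (intro AE_I2 tendsto_scaleR lim tendsto_const)
    show "AE x in cm. norm (g n x *\<^sub>R f x) \<le> norm (f x)" for n
      by (intro AE_I2) (auto simp: g_def infdist_nonneg intro!: mult_left_le_one_le)
  qed (use fi ind in auto)
  moreover have "(\<integral>x. g n x *\<^sub>R f x \<partial>cm) = 0" for n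
    by (rule fourier_null_integral_continuous[OF f gc])
  ultimately show ?thesis by (simp add: LIMSEQ_const_iff)
qed simp

text \<open>Closed sets are stable under intersection and generate the Borel sets, so a Dynkin
  argument extends the vanishing of the integral from closed sets to all measurable ones.\<close>

lemma fourier_null_AE:
  assumes f: "f \<in> fourier_null"
  shows "AE x in cm. f x = 0"
proof (rule circ.density_zero)
  have sf: "square_integrable f" using f by (simp add: fourier_null_def)
  show fi: "integrable cm f" using sf by (rule square_integrable_imp_integrable)
  have [measurable]: "f \<in> borel_measurable cm" using fi by auto
  have *: "B \<in> sets borel \<Longrightarrow> (\<integral>x. indicator (B \<inter> sphere 0 1) x *\<^sub>R f x \<partial>cm) = 0" for B
  proof -
    assume "B \<in> sets borel"
    then have mem: "B \<in> sigma_sets UNIV (Collect closed)" by (simp add: borel_eq_closed)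
    have st: "Int_stable (Collect closed :: complex set set)" by (auto simp: Int_stable_def)
    have sub: "Collect closed \<subseteq> Pow (UNIV :: complex set)" by simp
    have sb: "sigma_sets UNIV (Collect closed) = sets (borel :: complex measure)" by (simp add: borel_eq_closed)
    have cm: "C \<inter> sphere 0 1 \<in> sets cm" if "C \<in> sigma_sets UNIV (Collect closed)" for C
      using that sb by (auto simp: sets_circle sets_restrict_space)
    have ii: "integrable cm (\<lambda>x. indicator (C \<inter> sphere 0 1) x *\<^sub>R f x)" if "C \<in> sigma_sets UNIV (Collect closed)" for C
      using integrable_mult_indicator[OF cm[OF that] fi] .
    have all0: "(\<integral>x. f x \<partial>cm) = 0" using f by (auto simp: fourier_null_def dest!: spec[of _ 0])
    show ?thesis using st sub mem
    proof (induction rule: sigma_sets_induct_disjoint)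
      case (basic A)
      then have "closed (A \<inter> sphere 0 1)" by (intro closed_Int) auto
      then show ?case by (rule fourier_null_integral_closed[OF f])
    next
      case (compl A)
      have "(\<integral>x. indicator ((UNIV - A) \<inter> sphere 0 1) x *\<^sub>R f x \<partial>cm) =
        (\<integral>x. f x - indicator (A \<inter> sphere 0 1) x *\<^sub>R f x \<partial>cm)"
        by (rule circle_integral_cong) (auto simp: indicator_def)
      then show ?case using compl fi ii[OF compl(1)] all0 by simp
    next
      case (union A)
      have "(\<integral>x\<in>(\<Union>i. A i \<inter> sphere 0 1). f x \<partial>cm) = (\<Sum>i. (\<integral>x\<in>(A i \<inter> sphere 0 1). f x \<partial>cm))"
      proof (rule lebesgue_integral_countable_add)
        show "A i \<inter> sphere 0 1 \<in> sets cm" for i using union cm by auto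
        show "(A i \<inter> sphere 0 1) \<inter> (A j \<inter> sphere 0 1) = {}" if "i \<noteq> j" for i j
          using union(1) that by (auto simp: disjoint_family_on_def)
        show "set_integrable cm (\<Union>i. A i \<inter> sphere 0 1) f" unfolding set_integrable_def
        proof (rule integrable_mult_indicator[OF _ fi])
          have "A i \<inter> sphere 0 1 \<in> sets cm" for i using union cm by auto
          then show "(\<Union>i. A i \<inter> sphere 0 1) \<in> sets cm" by (intro sets.countable_UN) auto
        qed
      qed
      then show ?case using union(3) by (simp add: set_lebesgue_integral_def Int_UN_distrib2)
    qed simp
  qed
  fix A assume "A \<in> sets cm"
  then obtain B where "B \<in> sets borel" "A = sphere 0 1 \<inter> B" by (auto simp: sets_circle sets_restrict_space)
  then show "set_lebesgue_integral cm A f = 0" using *[of B] by (simp add: set_lebesgue_integral_def Int_commute)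
qed

lemma fourier_eq_0_imp:
  assumes "\<And>m. fourier f m = 0" shows "f = 0"
proof -
  have "(\<forall>m. fourier f m = 0) \<longrightarrow> f = 0"
  proof (transfer, intro impI)
    fix f assume "l2_eq f f" and m: "\<forall>m. (\<integral>x. f x * qc (x powi - m) \<partial>cm) = 0"
    then have sf: "square_integrable f" by (simp add: l2_eq_refl_iff)
    have "(\<integral>x. f x * qc (x powi m) \<partial>cm) = 0" for m using m[rule_format, of "- m"] by simp
    with sf have "f \<in> fourier_null" by (simp add: fourier_null_def)
    then show "l2_eq f (\<lambda>_. 0)" using fourier_null_AE sf by (simp add: l2_eq_def square_integrable_zero)
  qed
  with assms show ?thesis by blast
qed

lemma L2H_eqI:
  assumes "\<And>m. fourier f m = fourier g m" shows "f = g" using fourier_eq_0_imp[of "f - g"] assms by simp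

section \<open>Right multiplication\<close>

lemma rmult_add: "rmult (f + g) h = rmult f h + rmult g h"
  by (cases "continuous_on (sphere 0 1) h"; transfer fixing: h)
     (auto simp: l2_eq_refl_iff distrib_right intro!: square_integrable_add square_integrable_mult_right square_integrable_zero)

lemma rmult_lmult: "rmult (lmult q f) h = lmult q (rmult f h)"
  by (cases "continuous_on (sphere 0 1) h"; transfer fixing: h q)
     (auto simp: l2_eq_refl_iff mult.assoc intro!: square_integrable_mult_left square_integrable_mult_right square_integrable_zero)

lemma rmult_scaleR: "rmult (r *\<^sub>R f) h = r *\<^sub>R rmult f h"
  by (cases "continuous_on (sphere 0 1) h"; transfer fixing: h r)
     (auto simp: l2_eq_refl_iff intro!: square_integrable_scaleR square_integrable_mult_right square_integrable_zero)

lemma rmult_0 [simp]: "rmult 0 h = 0" using rmult_scaleR[of 0 0 h] by simp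
lemma rmult_minus: "rmult (- f) h = - rmult f h" using rmult_scaleR[of "-1" f h] by simp
lemma rmult_diff: "rmult (f - g) h = rmult f h - rmult g h" using rmult_add[of f "- g" h] by (simp add: rmult_minus)

lemma l2_eqI:
  assumes "square_integrable f" "square_integrable g" "\<And>x. cmod x = 1 \<Longrightarrow> f x = g x"
  shows "l2_eq f g" using assms by (auto simp: l2_eq_def intro!: AE_I2)

lemma rmult_cong:
  assumes "continuous_on (sphere 0 1) g" "\<And>x. cmod x = 1 \<Longrightarrow> g x = h x"
  shows "rmult f g = rmult f h"
proof -
  have h: "continuous_on (sphere 0 1) h" using assms by (subst continuous_on_cong[where g = g]) auto
  show ?thesis using assms h
    by (transfer fixing: g h) (auto simp: l2_eq_refl_iff intro!: l2_eqI square_integrable_mult_right)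
qed

lemma rmult_rmult:
  assumes "continuous_on (sphere 0 1) g" "continuous_on (sphere 0 1) h"
  shows "rmult (rmult f g) h = rmult f (\<lambda>x. g x * h x)"
proof -
  note c = continuous_on_mult[OF assms]
  show ?thesis
  proof (transfer fixing: g h)
    fix f assume "l2_eq f f"
    then have f: "square_integrable f" by (simp add: l2_eq_refl_iff)
    have "l2_eq (\<lambda>x. f x * qc (g x) * qc (h x)) (\<lambda>x. f x * qc (g x * h x))"
      by (intro l2_eqI square_integrable_mult_right f assms c) (simp add: qc_mult mult.assoc)
    then show "l2_eq (\<lambda>x. if continuous_on (sphere 0 1) h then (if continuous_on (sphere 0 1) g then f x * qc (g x) else 0) * qc (h x) else 0)
          (\<lambda>x. if continuous_on (sphere 0 1) (\<lambda>x. g x * h x) then f x * qc (g x * h x) else 0)"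
      using assms c by simp
  qed
qed

lemma rmult_add_right:
  assumes "continuous_on (sphere 0 1) g" "continuous_on (sphere 0 1) h"
  shows "rmult f (\<lambda>x. g x + h x) = rmult f g + rmult f h"
proof -
  note c = continuous_on_add[OF assms]
  show ?thesis
  proof (transfer fixing: g h)
    fix f assume "l2_eq f f"
    then have f: "square_integrable f" by (simp add: l2_eq_refl_iff)
    have "l2_eq (\<lambda>x. f x * qc (g x + h x)) (\<lambda>x. f x * qc (g x) + f x * qc (h x))"
      by (intro l2_eqI square_integrable_mult_right square_integrable_add f assms c) (simp add: qc_add distrib_left)
    then show "l2_eq (\<lambda>x. if continuous_on (sphere 0 1) (\<lambda>x. g x + h x) then f x * qc (g x + h x) else 0)
          (\<lambda>x. (if continuous_on (sphere 0 1) g then f x * qc (g x) else 0) + (if continuous_on (sphere 0 1) h then f x * qc (h x) else 0))"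
      using assms c by simp
  qed
qed

lemma rmult_one [simp]: "rmult f (\<lambda>x. 1) = f" by transfer (auto simp: l2_eq_refl_iff)

lemma norm_rmult_le:
  assumes "continuous_on (sphere 0 1) g" "\<And>x. cmod x = 1 \<Longrightarrow> cmod (g x) \<le> C"
  shows "norm (rmult f g) \<le> C * norm f"
proof (rule power2_le_imp_le)
  have C: "C \<ge> 0" using assms(2)[of 1] norm_ge_zero[of "g 1"] by (simp del: norm_ge_zero)
  show "0 \<le> C * norm f" using C by simp
  have "inner (rmult f g) (rmult f g) \<le> C\<^sup>2 * inner f f"
  proof (transfer fixing: g C)
    fix f assume "l2_eq f f"
    then have f: "square_integrable f" by (simp add: l2_eq_refl_iff)
    have fg: "square_integrable (\<lambda>x. f x * qc (g x))" by (rule square_integrable_mult_right[OF f assms(1)])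
    have "(\<integral>x. inner (f x * qc (g x)) (f x * qc (g x)) \<partial>cm) \<le> (\<integral>x. C\<^sup>2 * inner (f x) (f x) \<partial>cm)"
    proof (rule integral_mono)
      fix x assume "x \<in> space cm"
      then have "cmod (g x) \<le> C" using assms(2) by simp
      then have "(norm (f x) * cmod (g x))\<^sup>2 \<le> (norm (f x) * C)\<^sup>2"
        by (intro power_mono mult_left_mono) auto
      then show "inner (f x * qc (g x)) (f x * qc (g x)) \<le> C\<^sup>2 * inner (f x) (f x)"
        by (simp add: norm_mult power_mult_distrib mult.commute flip: power2_norm_eq_inner)
    qed (use f fg in \<open>auto intro!: integrable_inner\<close>)
    then show "(\<integral>x. inner (if continuous_on (sphere 0 1) g then f x * qc (g x) else 0)
          (if continuous_on (sphere 0 1) g then f x * qc (g x) else 0) \<partial>cm)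
          \<le> C\<^sup>2 * (\<integral>x. inner (f x) (f x) \<partial>cm)" using assms(1) by simp
  qed
  then show "(norm (rmult f g))\<^sup>2 \<le> (C * norm f)\<^sup>2" by (simp add: norm_L2H_sq power_mult_distrib)
qed

lemma fourier_rmult_powi: "fourier (rmult f (\<lambda>x. a * x powi k)) m = fourier f (m - k) * qc a"
proof -
  have c: "continuous_on (sphere 0 1) (\<lambda>x. a * x powi k)" by (intro continuous_intros continuous_on_powi)
  show ?thesis
  proof (transfer fixing: a k m)
    fix f assume "l2_eq f f"
    then have f: "square_integrable f" by (simp add: l2_eq_refl_iff)
    have "(\<integral>x. f x * qc (a * x powi k) * qc (x powi - m) \<partial>cm) = (\<integral>x. f x * qc (x powi - (m - k)) * qc a \<partial>cm)"
    proof (rule circle_integral_cong)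
      fix x :: complex assume "cmod x = 1"
      then have "x \<noteq> 0" by auto
      then have "a * x powi k * x powi - m = x powi - (m - k) * a"
        by (simp add: power_int_diff power_int_minus divide_inverse)
      then show "f x * qc (a * x powi k) * qc (x powi - m) = f x * qc (x powi - (m - k)) * qc a"
        by (simp only: mult.assoc flip: qc_mult)
    qed
    also have "\<dots> = (\<integral>x. f x * qc (x powi - (m - k)) \<partial>cm) * qc a"
      using integrable_fourier[OF f] by simp
    finally show "(\<integral>x. (if continuous_on (sphere 0 1) (\<lambda>x. a * x powi k) then f x * qc (a * x powi k) else 0) *
           qc (x powi - m) \<partial>cm) = (\<integral>x. f x * qc (x powi - (m - k)) \<partial>cm) * qc a"
      using c by simp
  qed
qed

lemma fourier_rmult_const [simp]: "fourier (rmult f (\<lambda>x. a)) m = fourier f m * qc a"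
  using fourier_rmult_powi[of f a 0 m] by simp

text \<open>Absolute summability makes multiplication by \<open>g\<close> a norm limit of
  multiplication by polynomials in \<open>zeta\<close>. Only non-negative powers occur, so such
  multipliers never lower exponents.\<close>

definition pser :: "(complex \<Rightarrow> complex) \<Rightarrow> (nat \<Rightarrow> complex) \<Rightarrow> bool" where
  "pser g a \<longleftrightarrow> continuous_on (sphere 0 1) g \<and> summable (\<lambda>n. cmod (a n)) \<and>
     (\<forall>x. cmod x = 1 \<longrightarrow> (\<lambda>n. a n * x ^ n) sums g x)"

text \<open>Truncating the series gives finite convolutions, and the error is at most the norm of
  \<open>f\<close> times the tail \<open>T N\<close> of the sum of the
  \<open>cmod (a n)\<close>.\<close>

lemma fourier_rmult_pser:
  assumes "pser g a"
  shows "(\<lambda>n. fourier f (m - int n) * qc (a n)) sums fourier (rmult f g) m"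
proof -
  have c: "continuous_on (sphere 0 1) g" and sa: "summable (\<lambda>n. cmod (a n))"
    and g: "\<And>x. cmod x = 1 \<Longrightarrow> (\<lambda>n. a n * x ^ n) sums g x"
    using assms by (auto simp: pser_def)
  define p where "p = (\<lambda>N x. \<Sum>n<N. a n * x ^ n)"
  have pc: "continuous_on (sphere 0 1) (p N)" for N unfolding p_def by (intro continuous_intros)
  have fp: "fourier (rmult f (p N)) m = (\<Sum>n<N. fourier f (m - int n) * qc (a n))" for N
  proof (induction N)
    case 0
    have "p 0 = (\<lambda>x. 0)" by (simp add: p_def)
    then show ?case by simp
  next
    case (Suc N)
    have "p (Suc N) = (\<lambda>x. p N x + a N * x powi int N)" by (simp add: p_def fun_eq_iff)
    moreover have "rmult f (\<lambda>x. p N x + a N * x powi int N) = rmult f (p N) + rmult f (\<lambda>x. a N * x powi int N)"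
      by (intro rmult_add_right pc continuous_intros continuous_on_powi)
    ultimately show ?case using Suc by (simp add: fourier_rmult_powi del: power_int_of_nat)
  qed
  define T where "T = (\<lambda>N. \<Sum>n. cmod (a (n + N)))"
  have T0: "T \<longlonglongrightarrow> 0" unfolding T_def by (rule suminf_exist_split2[OF sa])
  have "norm (fourier (rmult f (p N)) m - fourier (rmult f g) m) \<le> T N * norm f" for N
  proof -
    have "rmult f (p N) = rmult f (\<lambda>x. g x + (p N x - g x))" by simp
    also have "\<dots> = rmult f g + rmult f (\<lambda>x. p N x - g x)"
      by (intro rmult_add_right c continuous_intros pc)
    finally have "fourier (rmult f (p N)) m - fourier (rmult f g) m = fourier (rmult f (\<lambda>x. p N x - g x)) m"
      by simp
    also have "norm \<dots> \<le> norm (rmult f (\<lambda>x. p N x - g x))" by (rule norm_fourier_le)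
    also have "\<dots> \<le> T N * norm f"
    proof (rule norm_rmult_le)
      show "continuous_on (sphere 0 1) (\<lambda>x. p N x - g x)" by (intro continuous_intros pc c)
      fix x :: complex assume x: "cmod x = 1"
      have s: "summable (\<lambda>n. cmod (a (n + N) * x ^ (n + N)))"
        using sa x summable_ignore_initial_segment[OF sa, of N] by (simp add: norm_mult norm_power)
      have "g x - p N x = (\<Sum>n. a (n + N) * x ^ (n + N))"
        using suminf_minus_initial_segment[OF sums_summable[OF g[OF x]], of N] sums_unique[OF g[OF x]]
        by (simp add: p_def)
      also have "cmod \<dots> \<le> (\<Sum>n. cmod (a (n + N) * x ^ (n + N)))" by (rule summable_norm[OF s])
      also have "\<dots> = T N" using x by (simp add: T_def norm_mult norm_power)
      finally show "cmod (p N x - g x) \<le> T N" by (simp add: norm_minus_commute)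
    qed
    finally show ?thesis .
  qed
  note le = this
  have "(\<lambda>N. T N * norm f) \<longlonglongrightarrow> 0" using tendsto_mult_right[OF T0, of "norm f"] by simp
  then have "(\<lambda>N. fourier (rmult f (p N)) m - fourier (rmult f g) m) \<longlonglongrightarrow> 0"
    by (rule Lim_null_comparison[OF always_eventually, rotated]) (use le in blast)
  then have "(\<lambda>N. fourier (rmult f (p N)) m) \<longlonglongrightarrow> fourier (rmult f g) m"
    by (rule LIM_zero_cancel)
  then show ?thesis by (simp add: sums_def fp)
qed

section \<open>Parseval and synthesis\<close>

lemma norm_sum_zpow: "finite F \<Longrightarrow> (norm (\<Sum>m\<in>F. lmult (a m) (zpow m)))\<^sup>2 = (\<Sum>m\<in>F. (norm (a m))\<^sup>2)"
  by (simp add: norm_L2H_sq inner_sum_right inner_lmult_zpow power2_norm_eq_inner if_distrib cong: if_cong)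

lemma summable_on_zpow:
  assumes "(\<lambda>m. (norm (a m))\<^sup>2) summable_on UNIV"
  shows "(\<lambda>m. lmult (a m) (zpow m)) summable_on UNIV"
proof -
  have "\<exists>F. finite F \<and> (\<forall>G. finite G \<and> F \<inter> G = {} \<longrightarrow> norm (\<Sum>m\<in>G. lmult (a m) (zpow m)) \<le> e)" if e: "e > 0" for e
  proof -
    obtain F where F: "finite F" "dist (\<Sum>m\<in>F. (norm (a m))\<^sup>2) (\<Sum>\<^sub>\<infinity>m. (norm (a m))\<^sup>2) \<le> e\<^sup>2"
      using has_sum_finite_approximation[OF has_sum_infsum[OF assms], of "e\<^sup>2"] e by auto
    have "norm (\<Sum>m\<in>G. lmult (a m) (zpow m)) \<le> e" if "finite G" "F \<inter> G = {}" for G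
    proof (rule power2_le_imp_le)
      have "(\<Sum>m\<in>F. (norm (a m))\<^sup>2) + (\<Sum>m\<in>G. (norm (a m))\<^sup>2) = (\<Sum>m\<in>F \<union> G. (norm (a m))\<^sup>2)"
        using F that by (simp add: sum.union_disjoint)
      also have "\<dots> \<le> (\<Sum>\<^sub>\<infinity>m. (norm (a m))\<^sup>2)"
        using F that by (intro finite_sum_le_infsum assms) auto
      also have "\<dots> \<le> (\<Sum>m\<in>F. (norm (a m))\<^sup>2) + e\<^sup>2" using F(2) by (simp add: dist_real_def abs_le_iff)
      finally show "(norm (\<Sum>m\<in>G. lmult (a m) (zpow m)))\<^sup>2 \<le> e\<^sup>2"
        using that by (simp add: norm_sum_zpow)
    qed (use e in auto)
    with F show ?thesis by blast
  qed
  note ex = this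
  define A where "A = (\<lambda>k. SOME F. finite F \<and> (\<forall>G. finite G \<and> F \<inter> G = {} \<longrightarrow> norm (\<Sum>m\<in>G. lmult (a m) (zpow m)) \<le> (1/2)^k))"
  have A: "finite (A k)" "\<And>G. finite G \<Longrightarrow> A k \<inter> G = {} \<Longrightarrow> norm (\<Sum>m\<in>G. lmult (a m) (zpow m)) \<le> (1/2)^k" for k
    using someI_ex[OF ex[of "(1/2)^k"]] unfolding A_def by auto
  \<comment> \<open>Unions of the finite exceptional sets increase with \<open>k\<close>, so that
    the partial sums over them are Cauchy; their limit is then shown to be the unordered
    sum.\<close>
  define B where "B = (\<lambda>k. \<Union>i\<le>k. A i)"
  have B: "finite (B k)" "A k \<subseteq> B k" for k using A by (auto simp: B_def)
  have Bmono: "B i \<subseteq> B k" if "i \<le> k" for i k using that by (fastforce simp: B_def)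
  let ?s = "\<lambda>F. \<Sum>m\<in>F. lmult (a m) (zpow m)"
  have near: "norm (?s G - ?s (B k)) \<le> (1/2)^k" if "finite G" "B k \<subseteq> G" for G k
  proof -
    have "?s G - ?s (B k) = ?s (G - B k)" using that B by (simp add: sum_diff)
    then show ?thesis using A(2)[of "G - B k" k] that B(2)[of k] by (auto simp: Diff_triv)
  qed
  have "Cauchy (\<lambda>k. ?s (B k))"
  proof (rule CauchyI)
    fix e :: real assume "e > 0"
    then obtain K where K: "(1/2)^K < e/2" using real_arch_pow_inv[of "e/2" "1/2"] by auto
    have "norm (?s (B m) - ?s (B n)) < e" if "m \<ge> K" "n \<ge> K" for m n
    proof -
      have "norm (?s (B m) - ?s (B n)) \<le> norm (?s (B m) - ?s (B K)) + norm (?s (B n) - ?s (B K))"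
        using norm_triangle_ineq4[of "?s (B m) - ?s (B K)" "?s (B n) - ?s (B K)"] by simp
      then show ?thesis using near[OF B(1) Bmono[OF that(1)]] near[OF B(1) Bmono[OF that(2)]] K by linarith
    qed
    then show "\<exists>M. \<forall>m\<ge>M. \<forall>n\<ge>M. norm (?s (B m) - ?s (B n)) < e" by blast
  qed
  then obtain l where l: "(\<lambda>k. ?s (B k)) \<longlonglongrightarrow> l" by (metis Cauchy_convergent convergent_def)
  have "((\<lambda>m. lmult (a m) (zpow m)) has_sum l) UNIV"
    unfolding has_sum_def tendsto_iff eventually_finite_subsets_at_top
  proof (intro allI impI)
    fix e :: real assume "e > 0"
    then obtain K where K: "(1/2)^K < e/2" using real_arch_pow_inv[of "e/2" "1/2"] by auto
    obtain M where M: "\<And>k. k \<ge> M \<Longrightarrow> norm (?s (B k) - l) < e/2" using LIMSEQ_D[OF l, of "e/2"] \<open>e > 0\<close> by auto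
    let ?k = "max K M"
    have "dist (?s Y) l < e" if "finite Y" "B ?k \<subseteq> Y" for Y
    proof -
      have "norm (?s Y - ?s (B ?k)) \<le> (1/2)^?k" by (rule near) (use that in auto)
      also have "\<dots> \<le> (1/2)^K" by (rule power_decreasing) auto
      finally have "norm (?s Y - ?s (B ?k)) < e/2" using K by simp
      moreover have "norm (?s (B ?k) - l) < e/2" by (rule M) simp
      ultimately show ?thesis using norm_triangle_ineq[of "?s Y - ?s (B ?k)" "?s (B ?k) - l"] by (simp add: dist_norm)
    qed
    then show "\<exists>X. finite X \<and> X \<subseteq> UNIV \<and> (\<forall>Y. finite Y \<and> X \<subseteq> Y \<and> Y \<subseteq> UNIV \<longrightarrow> dist (?s Y) l < e)"
      using B(1) by blast
  qed
  then show ?thesis by (auto simp: summable_on_def)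
qed

definition synth :: "(int \<Rightarrow> quat) \<Rightarrow> L2H" where
  "synth a = (\<Sum>\<^sub>\<infinity>m. lmult (a m) (zpow m))"

lemma fourier_synth:
  assumes "(\<lambda>m. (norm (a m))\<^sup>2) summable_on UNIV"
  shows "fourier (synth a) m = a m"
proof -
  have "((\<lambda>n. lmult (a n) (zpow n)) has_sum synth a) UNIV"
    unfolding synth_def by (rule has_sum_infsum[OF summable_on_zpow[OF assms]])
  from has_sum_bounded_linear[OF bounded_linear_fourier[of m] this]
  have "((\<lambda>n. if n = m then a m else 0) has_sum fourier (synth a) m) UNIV"
    by (rule has_sum_cong[THEN iffD1, rotated]) auto
  moreover have "((\<lambda>n. if n = m then a m else 0) has_sum a m) UNIV"
    using has_sum_finite_neutralI[of "{m}" UNIV "\<lambda>n. if n = m then a m else 0"] by auto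
  ultimately show ?thesis by (rule has_sum_unique)
qed

lemma bessel_finite: "finite F \<Longrightarrow> (\<Sum>m\<in>F. (norm (fourier f m))\<^sup>2) \<le> (norm f)\<^sup>2"
proof -
  assume F: "finite F"
  let ?s = "\<Sum>m\<in>F. lmult (fourier f m) (zpow m)"
  have "0 \<le> (norm (f - ?s))\<^sup>2" by simp
  also have "\<dots> = (norm f)\<^sup>2 - 2 * inner f ?s + (norm ?s)\<^sup>2"
    by (simp add: norm_L2H_sq inner_diff_left inner_diff_right inner_commute)
  also have "inner f ?s = (\<Sum>m\<in>F. (norm (fourier f m))\<^sup>2)"
    by (simp add: inner_sum_right inner_lmult_zpow power2_norm_eq_inner)
  finally show ?thesis using norm_sum_zpow[OF F] by simp
qed

lemma fourier_square_summable: "(\<lambda>m. (norm (fourier f m))\<^sup>2) summable_on UNIV"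
  by (rule nonneg_bdd_above_summable_on) (auto intro!: bdd_aboveI2[where M = "(norm f)\<^sup>2"] bessel_finite)

lemma synth_fourier [simp]: "synth (fourier f) = f"
  by (rule L2H_eqI) (simp add: fourier_synth fourier_square_summable)

lemma has_sum_fourier: "((\<lambda>m. lmult (fourier f m) (zpow m)) has_sum f) UNIV"
  using has_sum_infsum[OF summable_on_zpow[OF fourier_square_summable[of f]]] by (simp flip: synth_def)

lemma parseval: "((\<lambda>m. (norm (fourier f m))\<^sup>2) has_sum (norm f)\<^sup>2) UNIV"
  using has_sum_bounded_linear[OF bounded_linear_inner_right[of f] has_sum_fourier[of f]]
  by (simp add: inner_lmult_zpow norm_L2H_sq power2_norm_eq_inner)

section \<open>Module structure and Fourier projections\<close>

lemma lmult_add: "lmult q (f + g) = lmult q f + lmult q g" by (rule L2H_eqI) (simp add: distrib_left)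
lemma lmult_diff: "lmult q (f - g) = lmult q f - lmult q g" by (rule L2H_eqI) (simp add: right_diff_distrib)
lemma lmult_add_left: "lmult (p + q) f = lmult p f + lmult q f" by (rule L2H_eqI) (simp add: distrib_right)
lemma lmult_lmult [simp]: "lmult p (lmult q f) = lmult (p * q) f" by (rule L2H_eqI) (simp add: mult.assoc)
lemma lmult_1 [simp]: "lmult 1 f = f" by (rule L2H_eqI) simp
lemma lmult_0 [simp]: "lmult 0 f = 0" by (rule L2H_eqI) simp
lemma lmult_0_right [simp]: "lmult q 0 = 0" by (rule L2H_eqI) simp
lemma lmult_minus: "lmult (- q) f = - lmult q f" by (rule L2H_eqI) simp
lemma lmult_scaleR: "lmult q (r *\<^sub>R f) = r *\<^sub>R lmult q f" by (rule L2H_eqI) simp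
lemma lmult_scaleR_left: "lmult (r *\<^sub>R q) f = r *\<^sub>R lmult q f" by (rule L2H_eqI) simp
lemma lmult_of_real: "lmult (qc (of_real r)) f = r *\<^sub>R f"
  using qc_scaleR[of r 1] by (simp add: lmult_scaleR_left)

lemma bounded_linear_lmult: "bounded_linear (lmult q)"
  by (rule bounded_linear_intro[where K = "norm q"]) (auto simp: lmult_add lmult_scaleR mult.commute)

lemma bounded_linear_rmult:
  assumes "continuous_on (sphere 0 1) g" shows "bounded_linear (\<lambda>f. rmult f g)"
proof -
  have "compact (g ` sphere 0 1)" using assms by (intro compact_continuous_image) auto
  then obtain C where "\<And>x. x \<in> sphere 0 1 \<Longrightarrow> norm (g x) \<le> C"
    by (metis bounded_iff compact_imp_bounded imageI)
  then have "norm (rmult f g) \<le> C * norm f" for f by (intro norm_rmult_le assms) auto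
  then show ?thesis by (intro bounded_linear_intro[where K = C]) (auto simp: rmult_add rmult_scaleR mult.commute)
qed

definition proj :: "int set \<Rightarrow> L2H \<Rightarrow> L2H" where
  "proj S f = synth (\<lambda>m. if m \<in> S then fourier f m else 0)"

lemma square_summable_le:
  assumes "\<And>m. norm (a m) \<le> norm (b m)" "(\<lambda>m. (norm (b m))\<^sup>2) summable_on A"
  shows "(\<lambda>m. (norm (a m))\<^sup>2) summable_on A"
  by (rule summable_on_comparison_test[OF assms(2)]) (auto intro!: power_mono assms(1))

lemma fourier_proj [simp]: "fourier (proj S f) m = (if m \<in> S then fourier f m else 0)" unfolding proj_def
  by (rule fourier_synth, rule square_summable_le[OF _ fourier_square_summable[of f]]) auto

lemma proj_add: "proj S (f + g) = proj S f + proj S g" by (rule L2H_eqI) simp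
lemma proj_diff: "proj S (f - g) = proj S f - proj S g" by (rule L2H_eqI) simp
lemma proj_scaleR: "proj S (r *\<^sub>R f) = r *\<^sub>R proj S f" by (rule L2H_eqI) simp
lemma proj_lmult: "proj S (lmult q f) = lmult q (proj S f)" by (rule L2H_eqI) simp
lemma proj_0 [simp]: "proj S 0 = 0" by (rule L2H_eqI) simp
lemma proj_proj [simp]: "proj S (proj T f) = proj (S \<inter> T) f" by (rule L2H_eqI) simp
lemma proj_compl: "proj S f + proj (- S) f = f" by (rule L2H_eqI) simp
lemma proj_id_iff: "proj S f = f \<longleftrightarrow> (\<forall>m. m \<notin> S \<longrightarrow> fourier f m = 0)"
  by (metis (no_types, lifting) L2H_eqI fourier_proj)
lemma norm_le_fourier:
  assumes "\<And>m. norm (fourier f m) \<le> norm (fourier g m)" shows "norm f \<le> norm g"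
proof (rule power2_le_imp_le)
  show "(norm f)\<^sup>2 \<le> (norm g)\<^sup>2"
    by (rule has_sum_mono[OF parseval parseval]) (intro power_mono assms norm_ge_zero)
qed simp

lemma norm_proj_le: "norm (proj S f) \<le> norm f" by (rule norm_le_fourier) simp

lemma bounded_linear_proj: "bounded_linear (proj S)"
  by (rule bounded_linear_intro[where K = 1]) (auto simp: proj_add proj_scaleR norm_proj_le)

lemma inner_has_sum: "((\<lambda>m. inner (fourier f m) (fourier g m)) has_sum inner f g) UNIV"
  using has_sum_bounded_linear[OF bounded_linear_inner_right[of f] has_sum_fourier[of g]]
  by (simp add: inner_lmult_zpow)

lemma inner_eq_0_fourier:
  assumes "\<And>m. inner (fourier f m) (fourier g m) = 0" shows "inner f g = 0"
  using has_sum_unique[OF inner_has_sum[of f g]] assms by (simp add: has_sum_0)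

lemma inner_proj: "inner (proj S f) g = inner f (proj S g)"
proof -
  have "((\<lambda>m. inner (fourier (proj S f) m) (fourier g m)) has_sum inner f (proj S g)) UNIV"
    by (rule has_sum_cong[THEN iffD1, OF _ inner_has_sum]) auto
  then show ?thesis using has_sum_unique[OF inner_has_sum] by blast
qed

lemma norm_proj_sq: "(norm f)\<^sup>2 = (norm (proj S f))\<^sup>2 + (norm (proj (- S) f))\<^sup>2"
proof -
  have "inner (proj S f) (proj (- S) f) = 0" by (rule inner_eq_0_fourier) simp
  then show ?thesis
    by (subst proj_compl[of S f, symmetric]) (simp only: norm_L2H_sq inner_add_left inner_add_right inner_commute)
qed

lemma H_plus_iff: "f \<in> H_plus \<longleftrightarrow> proj {0..} f = f" by (auto simp: H_plus_def proj_id_iff)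
lemma H_minus_iff: "f \<in> H_minus \<longleftrightarrow> proj {..<0} f = f" by (auto simp: H_minus_def proj_id_iff)

lemma pr_plus_eq: "pr_plus f = proj {0..} f" unfolding pr_plus_def
proof (rule the_equality)
  fix g assume g: "g \<in> H_plus \<and> f - g \<in> H_minus"
  show "g = proj {0..} f"
  proof (rule L2H_eqI)
    fix m show "fourier g m = fourier (proj {0..} f) m" using g by (cases "m < 0") (auto simp: H_plus_def H_minus_def)
  qed
qed (simp add: H_plus_def H_minus_def)

lemma pr_minus_eq: "pr_minus f = proj {..<0} f" unfolding pr_minus_def
proof (rule the_equality)
  fix g assume g: "g \<in> H_minus \<and> f - g \<in> H_plus"
  show "g = proj {..<0} f"
  proof (rule L2H_eqI)
    fix m show "fourier g m = fourier (proj {..<0} f) m"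
      using g by (cases "m < 0") (auto simp: H_plus_def H_minus_def)
  qed
qed (simp add: H_plus_def H_minus_def)

lemma proj_fixed_closed: "closed {f. proj S f = f}"
  by (intro closed_Collect_eq linear_continuous_on bounded_linear_proj continuous_on_id)

lemma complex_valued_iff: "complex_valued f \<longleftrightarrow> (\<forall>m. jpart (fourier f m) = 0)"
proof
  show "complex_valued f \<Longrightarrow> \<forall>m. jpart (fourier f m) = 0"
  proof (transfer, intro allI)
    fix f m assume f: "l2_eq f f" and A: "AE x in cm. f x \<in> range qc"
    then have int: "integrable cm (\<lambda>x. f x * qc (x powi - m))"
      by (intro integrable_fourier) (simp add: l2_eq_refl_iff)
    have "jpart (\<integral>x. f x * qc (x powi - m) \<partial>cm) = (\<integral>x. jpart (f x * qc (x powi - m)) \<partial>cm)"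
      by (rule integral_bounded_linear[OF bounded_linear_jpart int, symmetric])
    also have "\<dots> = (\<integral>x. 0 \<partial>cm)"
    proof (rule integral_cong_AE)
      show "(\<lambda>x. jpart (f x * qc (x powi - m))) \<in> borel_measurable cm"
        using integrable_bounded_linear[OF bounded_linear_jpart int] by auto
      show "AE x in cm. jpart (f x * qc (x powi - m)) = 0" using A by eventually_elim (auto simp: range_qc_iff)
    qed simp
    finally show "jpart (\<integral>x. f x * qc (x powi - m) \<partial>cm) = 0" by simp
  qed
  assume "\<forall>m. jpart (fourier f m) = 0"
  \<comment> \<open>Commuting with \<open>i\<close> characterises complex values, for coefficients
    as well as pointwise; this carries the information from the former to the latter.\<close>
  then have "rmult f (\<lambda>_. \<i>) = lmult quat_i f" by (intro L2H_eqI) (simp add: quat_eq_iff qc_i mult.commute)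
  then show "complex_valued f"
  proof (transfer)
    fix f assume "l2_eq (\<lambda>x. if continuous_on (sphere 0 1) (\<lambda>_::complex. \<i>) then f x * qc \<i> else 0) (\<lambda>x. quat_i * f x)"
    then have "AE x in cm. f x * qc \<i> = quat_i * f x" by (simp add: l2_eq_def)
    then show "AE x in cm. f x \<in> range qc" by eventually_elim (auto simp: range_qc_iff quat_eq_iff)
  qed
qed

text \<open>Reduces complex orthogonality to real orthogonality against a vector and its multiple by
  \<open>i\<close>, so that the geometry can be done in the real inner product.\<close>

lemma cinner_eq: "cinner f g = of_real (inner f g) - \<i> * of_real (inner (lmult quat_i f) g)"
proof (transfer)
  fix f g assume "l2_eq f f" "l2_eq g g"
  then have fg: "square_integrable f" "square_integrable g" "square_integrable (\<lambda>x. quat_i * f x)"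
    by (simp_all add: l2_eq_refl_iff square_integrable_mult_left)
  have "(\<integral>x. cpart (f x * quat_cnj (g x)) \<partial>cm) =
    (\<integral>x. complex_of_real (inner (f x) (g x)) - \<i> * complex_of_real (inner (quat_i * f x) (g x)) \<partial>cm)"
    by (rule circle_integral_cong) (simp add: complex_eq_iff quat_cnj_def inner_quat_def inner_complex_def algebra_simps)
  also have "\<dots> = of_real (\<integral>x. inner (f x) (g x) \<partial>cm) - \<i> * of_real (\<integral>x. inner (quat_i * f x) (g x) \<partial>cm)"
    using fg by (simp add: integrable_inner)
  finally show "(\<integral>x. cpart (f x * quat_cnj (g x)) \<partial>cm) = \<dots>" .
qed

lemma lmult_qc: "lmult (qc a) f = Re a *\<^sub>R f + Im a *\<^sub>R lmult quat_i f"
  by (rule L2H_eqI) (simp add: quat_eq_iff complex_eq_iff)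

lemma inner_lmult: "inner (lmult q f) g = inner f (lmult (quat_cnj q) g)"
proof -
  have "((\<lambda>m. inner (fourier (lmult q f) m) (fourier g m)) has_sum inner f (lmult (quat_cnj q) g)) UNIV"
    by (rule has_sum_cong[THEN iffD1, OF _ inner_has_sum]) (auto simp: inner_quat_mult_left)
  then show ?thesis using has_sum_unique[OF inner_has_sum] by blast
qed

lemma inner_lmult_qc: "inner (lmult (qc a) f) (lmult (qc b) g) = Re (a * cnj b * cinner f g)"
proof -
  have "inner (lmult quat_i f) (lmult quat_i g) = inner f g"
    by (simp add: inner_lmult, rule arg_cong[where f = "inner f"], rule L2H_eqI) (simp add: quat_eq_iff quat_cnj_def algebra_simps)
  moreover have "inner f (lmult quat_i g) = - inner (lmult quat_i f) g"
    unfolding inner_lmult inner_minus_right[symmetric]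
    by (rule arg_cong[where f = "inner f"], rule L2H_eqI) (simp add: quat_eq_iff quat_cnj_def)
  ultimately show ?thesis by (simp add: lmult_qc inner_add_left inner_add_right cinner_eq algebra_simps)
qed

section \<open>Hilbert space geometry, the Hilbert-Schmidt condition, complements in complex linear
  algebra\<close>

section \<open>Hilbert space geometry\<close>

lemma norm_diff_scaleR_sq:
  fixes a v :: "'a::real_inner"
  shows "(norm (a - t *\<^sub>R v))\<^sup>2 = (norm a)\<^sup>2 - 2 * t * inner a v + t\<^sup>2 * (norm v)\<^sup>2"
  unfolding power2_norm_eq_inner
  by (simp add: inner_diff_left inner_diff_right inner_commute power2_eq_square algebra_simps)

lemma exists_orthogonal_projection:
  fixes Y :: "'a::{real_inner,complete_space} set"
  assumes Y: "subspace Y" "closed Y"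
  shows "\<exists>y\<in>Y. \<forall>v\<in>Y. inner (x - y) v = 0"
proof -
  define d where "d = (INF y\<in>Y. (norm (x - y))\<^sup>2)"
  have bdd: "bdd_below ((\<lambda>y. (norm (x - y))\<^sup>2) ` Y)" by (rule bdd_belowI2[where m = 0]) simp
  have Y0: "Y \<noteq> {}" using subspace_0[OF Y(1)] by auto
  have dle: "d \<le> (norm (x - y))\<^sup>2" if "y \<in> Y" for y unfolding d_def by (rule cINF_lower[OF bdd that])
  have "\<exists>y\<in>Y. (norm (x - y))\<^sup>2 < d + e" if "e > 0" for e
  proof (rule ccontr)
    assume "\<not> ?thesis"
    then have "d + e \<le> d" unfolding d_def using Y0 by (intro cINF_greatest) (auto simp: not_less d_def)
    then show False using that by simp
  qed
  then have "\<forall>n. \<exists>y\<in>Y. (norm (x - y))\<^sup>2 < d + 1 / real (Suc n)" by simp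
  then obtain u where u: "\<And>n. u n \<in> Y" "\<And>n. (norm (x - u n))\<^sup>2 < d + 1 / real (Suc n)" by metis
  \<comment> \<open>Parallelogram law; the midpoint of \<open>y\<close> and \<open>z\<close> lies in
    \<open>Y\<close> and so has squared distance at least \<open>d\<close> from
    \<open>x\<close>.\<close>
  have par: "(norm (y - z))\<^sup>2 \<le> 2 * (norm (x - y))\<^sup>2 + 2 * (norm (x - z))\<^sup>2 - 4 * d" if "y \<in> Y" "z \<in> Y" for y z
  proof -
    have "(1/2) *\<^sub>R (y + z) \<in> Y" using that Y by (intro subspace_scale subspace_add)
    from dle[OF this] have "4 * d \<le> (norm (2 *\<^sub>R (x - (1/2) *\<^sub>R (y + z))))\<^sup>2" by (simp add: power_mult_distrib)
    also have "2 *\<^sub>R (x - (1/2) *\<^sub>R (y + z)) = (x - y) + (x - z)" by (simp add: algebra_simps scaleR_2)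
    finally have "4 * d \<le> (norm ((x - y) + (x - z)))\<^sup>2" .
    moreover have "(norm ((x - y) + (x - z)))\<^sup>2 + (norm ((x - z) - (x - y)))\<^sup>2 = 2 * (norm (x - y))\<^sup>2 + 2 * (norm (x - z))\<^sup>2"
      by (simp add: power2_norm_eq_inner inner_diff_left inner_diff_right inner_add_left inner_add_right inner_commute)
    ultimately show ?thesis by simp
  qed
  have "Cauchy u"
  proof (rule CauchyI)
    fix e :: real assume e: "e > 0"
    then obtain N where N: "4 / e\<^sup>2 < real N" using reals_Archimedean2 by blast
    have "norm (u m - u n) < e" if "m \<ge> N" "n \<ge> N" for m n
    proof (rule power2_less_imp_less)
      have b: "1 / real (Suc k) < e\<^sup>2 / 4" if "k \<ge> N" for k
      proof -
        have "4 / e\<^sup>2 < real (Suc k)" using N that by simp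
        then show ?thesis using e by (simp add: field_simps)
      qed
      show "(norm (u m - u n))\<^sup>2 < e\<^sup>2"
        using par[OF u(1) u(1), of m n] u(2)[of m] u(2)[of n] b[OF that(1)] b[OF that(2)] by linarith
    qed (use e in simp)
    then show "\<exists>M. \<forall>m\<ge>M. \<forall>n\<ge>M. norm (u m - u n) < e" by blast
  qed
  then obtain y where y: "u \<longlonglongrightarrow> y" by (metis Cauchy_convergent convergent_def)
  then have yY: "y \<in> Y" using Y(2) u(1) by (metis closed_sequentially)
  have "(\<lambda>n. (norm (x - u n))\<^sup>2) \<longlonglongrightarrow> (norm (x - y))\<^sup>2" by (intro tendsto_intros y)
  moreover have "(\<lambda>n. d + 1 / real (Suc n)) \<longlonglongrightarrow> d + 0"
    by (intro tendsto_intros LIMSEQ_Suc[OF lim_1_over_n])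
  ultimately have dy: "(norm (x - y))\<^sup>2 \<le> d + 0" by (rule LIMSEQ_le) (use u(2) less_imp_le in blast)
  have "inner (x - y) v = 0" if v: "v \<in> Y" for v
  proof (cases "v = 0")
    case False
    define t where "t = inner (x - y) v / (norm v)\<^sup>2"
    have "y + t *\<^sub>R v \<in> Y" using yY v Y by (intro subspace_scale subspace_add)
    from dle[OF this] dy have "(norm (x - y))\<^sup>2 \<le> (norm (x - (y + t *\<^sub>R v)))\<^sup>2" by linarith
    also have "\<dots> = (norm ((x - y) - t *\<^sub>R v))\<^sup>2" by (simp add: diff_diff_add)
    also have "\<dots> = (norm (x - y))\<^sup>2 - 2 * t * inner (x - y) v + t\<^sup>2 * (norm v)\<^sup>2" by (rule norm_diff_scaleR_sq)
    also have "\<dots> = (norm (x - y))\<^sup>2 - (inner (x - y) v)\<^sup>2 / (norm v)\<^sup>2"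
      using False by (simp add: t_def power2_eq_square field_simps)
    finally have "(inner (x - y) v)\<^sup>2 / (norm v)\<^sup>2 \<le> 0" by simp
    then show ?thesis using False by (simp add: divide_le_0_iff)
  qed simp
  then show ?thesis using yY by blast
qed

lemma lmult_i_closed_qc:
  assumes "subspace Y" "\<And>f. f \<in> Y \<Longrightarrow> lmult quat_i f \<in> Y" "f \<in> Y"
  shows "lmult (qc a) f \<in> Y" unfolding lmult_qc using assms by (intro subspace_add subspace_scale) auto

lemma cspan_minimal:
  assumes "E \<subseteq> X" "subspace X" "\<And>f. f \<in> X \<Longrightarrow> lmult quat_i f \<in> X"
  shows "cspan E \<subseteq> X"
proof (rule cvs.span_minimal[OF assms(1)])
  show "cvs.subspace X" using assms by (auto simp: cvs.subspace_def subspace_0 subspace_add intro: lmult_i_closed_qc)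
qed

lemma csubspace_imp_subspace: "cvs.subspace X \<Longrightarrow> subspace X"
  unfolding subspace_def cvs.subspace_def by (metis lmult_of_real)

lemma subspace_cspan: "subspace (cspan E)" by (rule csubspace_imp_subspace) simp

lemma lmult_cspan: "f \<in> cspan E \<Longrightarrow> lmult quat_i f \<in> cspan E"
  using cvs.span_scale[of f E \<i>] by (simp add: qc_i)

lemma subspace_closure:
  fixes Y :: "'a::real_normed_vector set"
  assumes "subspace Y" shows "subspace (closure Y)" unfolding subspace_def
proof (intro conjI ballI allI)
  show "0 \<in> closure Y" using subspace_0[OF assms] closure_subset by blast
  fix x y r assume xy: "x \<in> closure Y"
  obtain u where u: "\<And>n::nat. u n \<in> Y" "u \<longlonglongrightarrow> x" using xy unfolding closure_sequential by blast
  have "(\<lambda>n. r *\<^sub>R u n) \<longlonglongrightarrow> r *\<^sub>R x" by (intro tendsto_intros u)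
  then show "r *\<^sub>R x \<in> closure Y"
    unfolding closure_sequential using u(1) subspace_scale[OF assms] by (intro exI[of _ "\<lambda>n. r *\<^sub>R u n"]) blast
  assume "y \<in> closure Y"
  then obtain v where v: "\<And>n::nat. v n \<in> Y" "v \<longlonglongrightarrow> y" unfolding closure_sequential by blast
  have "(\<lambda>n. u n + v n) \<longlonglongrightarrow> x + y" by (intro tendsto_intros u v)
  then show "x + y \<in> closure Y"
    unfolding closure_sequential using u(1) v(1) subspace_add[OF assms] by (intro exI[of _ "\<lambda>n. u n + v n"]) blast
qed

lemma has_sum_sum_finite:
  fixes f :: "'i \<Rightarrow> 'a \<Rightarrow> 'b::topological_comm_monoid_add"
  assumes "finite F" "\<And>i. i \<in> F \<Longrightarrow> (f i has_sum s i) A"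
  shows "((\<lambda>x. \<Sum>i\<in>F. f i x) has_sum (\<Sum>i\<in>F. s i)) A"
  using assms by (induction F) (auto intro!: has_sum_add)

lemma closure_lmult_closed:
  assumes "\<And>f. f \<in> Y \<Longrightarrow> lmult q f \<in> Y" "f \<in> closure Y"
  shows "lmult q f \<in> closure Y"
proof -
  obtain u where u: "\<And>n::nat. u n \<in> Y" "u \<longlonglongrightarrow> f" using assms(2) unfolding closure_sequential by blast
  then have "(\<lambda>n. lmult q (u n)) \<longlonglongrightarrow> lmult q f"
    using bounded_linear.tendsto[OF bounded_linear_lmult] by blast
  then show ?thesis
    unfolding closure_sequential using u(1) assms(1) by (intro exI[of _ "\<lambda>n. lmult q (u n)"]) blast
qed

definition orthonormal :: "L2H set \<Rightarrow> bool" where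
  "orthonormal E \<longleftrightarrow> (\<forall>e\<in>E. \<forall>e'\<in>E. cinner e e' = (if e = e' then 1 else 0))"

text \<open>A maximal orthonormal set spans densely: otherwise the normalised residue of a real
  orthogonal projection could be added. That residue is orthogonal in the complex sense because the
  closed span is stable under \<open>i\<close>.\<close>

lemma orthonormal_basis_exists:
  assumes X: "subspace X" "closed X" "\<And>f. f \<in> X \<Longrightarrow> lmult quat_i f \<in> X"
  shows "\<exists>E. orthonormal_basis E X"
proof -
  let ?A = "{E. E \<subseteq> X \<and> orthonormal E}"
  have "\<exists>M\<in>?A. \<forall>E\<in>?A. M \<subseteq> E \<longrightarrow> E = M"
  proof (rule subset_Zorn')
    fix C assume C: "subset.chain ?A C"
    show "\<Union>C \<in> ?A" unfolding orthonormal_def mem_Collect_eq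
    proof (intro conjI ballI)
      show "\<Union>C \<subseteq> X" using C by (auto simp: subset_chain_def)
      fix e e' assume "e \<in> \<Union>C" "e' \<in> \<Union>C"
      then obtain A B where AB: "A \<in> C" "B \<in> C" "e \<in> A" "e' \<in> B" by blast
      then have "A \<subseteq> B \<or> B \<subseteq> A" using C by (auto simp: subset_chain_def)
      then obtain D where "D \<in> C" "e \<in> D" "e' \<in> D" using AB by blast
      then show "cinner e e' = (if e = e' then 1 else 0)" using C by (auto simp: subset_chain_def orthonormal_def)
    qed
  qed
  then obtain E where E: "E \<subseteq> X" "orthonormal E" and max: "\<And>F. F \<subseteq> X \<Longrightarrow> orthonormal F \<Longrightarrow> E \<subseteq> F \<Longrightarrow> F = E"
    by auto
  let ?Y = "closure (cspan E)"
  have Ys: "subspace ?Y" by (intro subspace_closure subspace_cspan)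
  have YX: "?Y \<subseteq> X" using cspan_minimal[OF E(1) X(1) X(3)] X(2) by (simp add: closure_minimal)
  have Yi: "lmult quat_i f \<in> ?Y" if "f \<in> ?Y" for f using closure_lmult_closed[OF lmult_cspan that] .
  have EY: "E \<subseteq> ?Y" using cvs.span_superset[of E] closure_subset by blast
  have "X \<subseteq> ?Y"
  proof (rule ccontr)
    assume "\<not> X \<subseteq> ?Y"
    then obtain x where x: "x \<in> X" "x \<notin> ?Y" by blast
    obtain y where y: "y \<in> ?Y" "\<And>v. v \<in> ?Y \<Longrightarrow> inner (x - y) v = 0"
      using exists_orthogonal_projection[OF Ys closed_closure, of x] by blast
    define n where "n = x - y"
    have n0: "norm n > 0" using x y by (auto simp: n_def)
    have nX: "n \<in> X" unfolding n_def using x y YX X(1) by (intro subspace_diff) auto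
    define e where "e = (1 / norm n) *\<^sub>R n"
    have eX: "e \<in> X" unfolding e_def using nX X(1) by (intro subspace_scale)
    have i0: "inner e v = 0" if "v \<in> ?Y" for v using y(2)[OF that] by (simp add: e_def n_def)
    have i1: "inner (lmult quat_i e) v = 0" if "v \<in> ?Y" for v
    proof -
      have "lmult (- quat_i) v \<in> ?Y" using Yi[OF that] Ys by (simp add: lmult_minus subspace_neg)
      moreover have "quat_cnj quat_i = - quat_i" by (simp add: quat_eq_iff quat_cnj_def)
      ultimately show ?thesis using i0 by (simp add: inner_lmult)
    qed
    have ce: "cinner e v = 0" if "v \<in> ?Y" for v using i0[OF that] i1[OF that] by (simp add: cinner_eq)
    have skew: "inner (lmult quat_i f) g = - inner f (lmult quat_i g)" for f g
    proof -
      have "quat_cnj quat_i = - quat_i" by (simp add: quat_eq_iff quat_cnj_def)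
      then show ?thesis by (simp add: inner_lmult lmult_minus)
    qed
    have cv: "cinner v e = 0" if "v \<in> ?Y" for v
      using i0[OF that] i1[OF that] skew[of v e] by (simp add: cinner_eq inner_commute)
    have "inner e e = 1" using n0 by (simp add: e_def power2_eq_square flip: power2_norm_eq_inner)
    moreover have "inner (lmult quat_i e) e = 0" using skew[of e e] by (simp add: inner_commute)
    ultimately have "cinner e e = 1" by (simp add: cinner_eq)
    then have "orthonormal (insert e E)" using E(2) ce cv EY by (auto simp: orthonormal_def subset_iff)
    then have "insert e E = E" using max[of "insert e E"] E(1) eX by auto
    then have "e \<in> ?Y" using EY by blast
    then show False using i0[of e] \<open>inner e e = 1\<close> by simp
  qed
  then have "orthonormal_basis E X" unfolding orthonormal_basis_def using E(2) YX by (auto simp: orthonormal_def)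
  then show ?thesis by blast
qed

text \<open>If \<open>b\<close> lies outside \<open>Y\<close>, its distance to \<open>Y\<close>
  bounds the coefficient \<open>t\<close> by the norm of \<open>y + t b\<close>; convergence of the
  sums then forces convergence of the coefficients.\<close>

lemma closed_add_line:
  fixes Y :: "'a::banach set"
  assumes Y: "subspace Y" "closed Y"
  shows "closed {y + t *\<^sub>R b | y t. y \<in> Y}" "b \<notin> Y \<Longrightarrow> \<exists>d>0. \<forall>y\<in>Y. \<forall>t. d * \<bar>t\<bar> \<le> norm (y + t *\<^sub>R b)"
proof -
  have ex: "\<exists>d>0. \<forall>y\<in>Y. \<forall>t. d * \<bar>t\<bar> \<le> norm (y + t *\<^sub>R b)" if b: "b \<notin> Y"
  proof (intro exI conjI ballI allI)
    have Y0: "Y \<noteq> {}" using subspace_0[OF Y(1)] by auto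
    show "infdist b Y > 0" using b Y(2) Y0 by (simp add: infdist_pos_not_in_closed)
    fix y t assume y: "y \<in> Y"
    show "infdist b Y * \<bar>t\<bar> \<le> norm (y + t *\<^sub>R b)"
    proof (cases "t = 0")
      case False
      have "(- 1 / t) *\<^sub>R y \<in> Y" using y Y(1) by (rule subspace_scale[rotated])
      then have "infdist b Y \<le> dist b ((- 1 / t) *\<^sub>R y)" by (rule infdist_le)
      then have "infdist b Y * \<bar>t\<bar> \<le> \<bar>t\<bar> * norm (b - (- 1 / t) *\<^sub>R y)"
        by (simp add: dist_norm mult.commute mult_left_mono)
      also have "\<dots> = norm (t *\<^sub>R (b - (- 1 / t) *\<^sub>R y))" by simp
      also have "t *\<^sub>R (b - (- 1 / t) *\<^sub>R y) = y + t *\<^sub>R b" using False by (simp add: algebra_simps)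
      finally show ?thesis .
    qed simp
  qed
  then show "b \<notin> Y \<Longrightarrow> \<exists>d>0. \<forall>y\<in>Y. \<forall>t. d * \<bar>t\<bar> \<le> norm (y + t *\<^sub>R b)" .
  show "closed {y + t *\<^sub>R b | y t. y \<in> Y}"
  proof (cases "b \<in> Y")
    case True
    have "{y + t *\<^sub>R b | y t. y \<in> Y} = Y"
    proof safe
      fix y t assume "y \<in> Y" then show "y + t *\<^sub>R b \<in> Y" using True Y(1) by (intro subspace_add subspace_scale)
    next
      fix y assume "y \<in> Y" then show "\<exists>y' t. y = y' + t *\<^sub>R b \<and> y' \<in> Y" by (intro exI[of _ y] exI[of _ 0]) simp
    qed
    then show ?thesis using Y by simp
  next
    case False
    then obtain d where d: "d > 0" "\<And>y t. y \<in> Y \<Longrightarrow> d * \<bar>t\<bar> \<le> norm (y + t *\<^sub>R b)" using ex by blast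
    show ?thesis unfolding closed_sequential_limits
    proof (intro allI impI, elim conjE)
      fix z l assume z: "\<forall>n. z n \<in> {y + t *\<^sub>R b | y t. y \<in> Y}" and l: "z \<longlonglongrightarrow> l"
      then have "\<forall>n. \<exists>y t. z n = y + t *\<^sub>R b \<and> y \<in> Y" by auto
      then obtain y t where yt: "\<And>n. z n = y n + t n *\<^sub>R b" "\<And>n. y n \<in> Y" by metis
      have "Cauchy t"
      proof (rule CauchyI)
        fix e :: real assume e: "e > 0"
        obtain M where M: "\<And>m n. m \<ge> M \<Longrightarrow> n \<ge> M \<Longrightarrow> norm (z m - z n) < d * e"
          using CauchyD[OF LIMSEQ_imp_Cauchy[OF l], of "d * e"] d(1) e by auto
        have "norm (t m - t n) < e" if "m \<ge> M" "n \<ge> M" for m n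
        proof -
          have "y m - y n \<in> Y" using yt Y(1) by (intro subspace_diff)
          from d(2)[OF this, of "t m - t n"] have "d * \<bar>t m - t n\<bar> \<le> norm (z m - z n)"
            by (simp add: yt(1) algebra_simps)
          then show ?thesis using M[OF that] d(1) by (metis le_less_trans mult_less_cancel_left_pos real_norm_def)
        qed
        then show "\<exists>M. \<forall>m\<ge>M. \<forall>n\<ge>M. norm (t m - t n) < e" by blast
      qed
      then obtain s where s: "t \<longlonglongrightarrow> s" by (metis Cauchy_convergent convergent_def)
      have "(\<lambda>n. z n - t n *\<^sub>R b) \<longlonglongrightarrow> l - s *\<^sub>R b" by (intro tendsto_intros l s)
      then have "y \<longlonglongrightarrow> l - s *\<^sub>R b" by (simp add: yt(1))
      then have "l - s *\<^sub>R b \<in> Y" using Y(2) yt(2) by (metis closed_sequentially)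
      then show "l \<in> {y + t *\<^sub>R b | y t. y \<in> Y}" by (intro CollectI exI[of _ "l - s *\<^sub>R b"] exI[of _ s]) simp
    qed
  qed
qed

lemma subspace_add_image_span:
  assumes "subspace X" "linear \<phi>"
  shows "subspace {x + \<phi> e | x e. x \<in> X \<and> e \<in> span B}"
proof -
  have "{x + \<phi> e | x e. x \<in> X \<and> e \<in> span B} = {x + y | x y. x \<in> X \<and> y \<in> \<phi> ` span B}" by blast
  then show ?thesis using subspace_sums[OF assms(1) linear_subspace_image[OF assms(2) subspace_span]] by simp
qed

lemma closed_add_image_span:
  fixes X :: "'b::banach set" and \<phi> :: "'a::real_vector \<Rightarrow> 'b"
  assumes X: "subspace X" "closed X" and "linear \<phi>" "finite B"
  shows "closed {x + \<phi> e | x e. x \<in> X \<and> e \<in> span B}" using \<open>finite B\<close>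
proof (induction B)
  case empty
  then show ?case using X linear_0[OF \<open>linear \<phi>\<close>] by simp
next
  case (insert b B)
  interpret linear \<phi> by fact
  let ?Y = "{x + \<phi> e | x e. x \<in> X \<and> e \<in> span B}"
  have "{x + \<phi> e | x e. x \<in> X \<and> e \<in> span (insert b B)} = {y + t *\<^sub>R \<phi> b | y t. y \<in> ?Y}"
  proof (intro equalityI subsetI)
    fix z assume "z \<in> {x + \<phi> e | x e. x \<in> X \<and> e \<in> span (insert b B)}"
    then obtain x e where z: "z = x + \<phi> e" "x \<in> X" "e \<in> span (insert b B)" by blast
    then obtain k where k: "e - k *\<^sub>R b \<in> span B" by (auto simp: span_breakdown_eq)
    have "z = (x + \<phi> (e - k *\<^sub>R b)) + k *\<^sub>R \<phi> b" by (simp add: z diff scale)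
    then show "z \<in> {y + t *\<^sub>R \<phi> b | y t. y \<in> ?Y}" using z k by blast
  next
    fix z assume "z \<in> {y + t *\<^sub>R \<phi> b | y t. y \<in> ?Y}"
    then obtain x e t where z: "z = x + \<phi> e + t *\<^sub>R \<phi> b" "x \<in> X" "e \<in> span B" by blast
    have "e + t *\<^sub>R b \<in> span (insert b B)" using z by (auto simp: span_breakdown_eq intro!: exI[of _ t])
    moreover have "z = x + \<phi> (e + t *\<^sub>R b)" by (simp add: z add scale)
    ultimately show "z \<in> {x + \<phi> e | x e. x \<in> X \<and> e \<in> span (insert b B)}" using z by blast
  qed
  then show ?case
    using closed_add_line(1)[OF subspace_add_image_span[OF X(1) \<open>linear \<phi>\<close>] insert.IH] by simp
qed

text \<open>A quantitative form of injectivity modulo \<open>X\<close>, built one generator at a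
  time. It yields the bounded inverse of \<open>pr_plus\<close> on the big cell and the lower bound
  for the finite window in the rescaling argument.\<close>

lemma finite_span_bounded_below:
  fixes X :: "'b::banach set" and \<phi> :: "'a::real_normed_vector \<Rightarrow> 'b"
  assumes X: "subspace X" "closed X" and "linear \<phi>" "finite B"
    and "\<And>e. e \<in> span B \<Longrightarrow> \<phi> e \<in> X \<Longrightarrow> e = 0"
  shows "\<exists>\<delta>>0. \<forall>x\<in>X. \<forall>e\<in>span B. \<delta> * norm e \<le> norm (x + \<phi> e)"
  using assms(4,5)
proof (induction B)
  case empty
  then show ?case by (intro exI[of _ 1]) auto
next
  case (insert b B)
  interpret linear \<phi> by fact
  have sB: "span B \<subseteq> span (insert b B)" by (intro span_mono) auto
  then obtain \<delta> where \<delta>: "\<delta> > 0" "\<And>x e. x \<in> X \<Longrightarrow> e \<in> span B \<Longrightarrow> \<delta> * norm e \<le> norm (x + \<phi> e)"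
    using insert by (metis subsetD)
  let ?Y = "{x + \<phi> e | x e. x \<in> X \<and> e \<in> span B}"
  show ?case
  proof (cases "b \<in> span B")
    case True
    then show ?thesis using \<delta> by (metis span_redundant)
  next
    case False
    have nY: "\<phi> b \<notin> ?Y"
    proof
      assume "\<phi> b \<in> ?Y"
      then obtain x e where "\<phi> b = x + \<phi> e" "x \<in> X" "e \<in> span B" by blast
      then have "\<phi> (b - e) \<in> X" "b - e \<in> span (insert b B)"
        using sB by (auto simp: diff span_base intro!: span_diff)
      then have "b = e" using insert.prems by force
      then show False using False \<open>e \<in> span B\<close> by simp
    qed
    have "\<exists>d>0. \<forall>y\<in>?Y. \<forall>t. d * \<bar>t\<bar> \<le> norm (y + t *\<^sub>R \<phi> b)"
      by (rule closed_add_line(2)[OF subspace_add_image_span[OF X(1) \<open>linear \<phi>\<close>] closed_add_image_span[OF X \<open>linear \<phi>\<close> insert.hyps(1)] nY])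
    then obtain d where d: "d > 0" and d2: "\<forall>y\<in>?Y. \<forall>t. d * \<bar>t\<bar> \<le> norm (y + t *\<^sub>R \<phi> b)"
      by (elim exE conjE)
    \<comment> \<open>With \<open>r\<close> the norm of \<open>x + \<phi> e\<close> and
      \<open>e = e' + t b\<close> one has \<open>|t| <= r / d\<close>, hence
      \<open>\<delta> * norm e' <= r * (1 + norm (\<phi> b) / d)\<close>. \<open>M\<close> adds the
      resulting bounds for \<open>e'\<close> and \<open>t b\<close>.\<close>
    define M where "M = (1 + norm (\<phi> b) / d) / \<delta> + norm b / d"
    have M: "M > 0" unfolding M_def using d \<delta> by (intro add_pos_nonneg divide_pos_pos) auto
    have "(1 / M) * norm e \<le> norm (x + \<phi> e)" if xe: "x \<in> X" "e \<in> span (insert b B)" for x e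
    proof -
      obtain t where t: "e - t *\<^sub>R b \<in> span B" using xe by (auto simp: span_breakdown_eq)
      define e' where "e' = e - t *\<^sub>R b"
      have e: "e = e' + t *\<^sub>R b" by (simp add: e'_def)
      define r where "r = norm (x + \<phi> e)"
      have re: "r = norm ((x + \<phi> e') + t *\<^sub>R \<phi> b)" by (simp add: r_def e add scale algebra_simps)
      have "x + \<phi> e' \<in> ?Y" using xe t unfolding e'_def by blast
      then have "d * \<bar>t\<bar> \<le> r" unfolding re using d2 by blast
      then have t': "\<bar>t\<bar> \<le> r / d" using d by (simp add: field_simps)
      have "\<delta> * norm e' \<le> norm (x + \<phi> e')" using \<delta>(2) xe t by (simp add: e'_def)
      also have "\<dots> \<le> r + \<bar>t\<bar> * norm (\<phi> b)"
        using norm_triangle_ineq4[of "(x + \<phi> e') + t *\<^sub>R \<phi> b" "t *\<^sub>R \<phi> b"] by (simp add: re)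
      also have "\<dots> \<le> r + r / d * norm (\<phi> b)" using t' by (intro add_left_mono mult_right_mono) auto
      finally have "norm e' \<le> r * ((1 + norm (\<phi> b) / d) / \<delta>)" using \<delta>(1) by (simp add: field_simps)
      moreover have "norm (t *\<^sub>R b) \<le> r * (norm b / d)" using mult_right_mono[OF t', of "norm b"] by simp
      ultimately have "norm e \<le> r * M"
        using norm_triangle_ineq[of e' "t *\<^sub>R b"] unfolding e M_def distrib_left by linarith
      then show ?thesis using M by (simp add: r_def field_simps)
    qed
    then show ?thesis using M by (intro exI[of _ "1 / M"]) auto
  qed
qed

section \<open>Hilbert--Schmidt condition in coordinates\<close>

text \<open>The Hilbert-Schmidt condition without a basis: \<open>\<nu> m\<close> bounds the
  coefficient functional of index \<open>m\<close> on \<open>X\<close>. In this form it passes to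
  subspaces and through multiplication, where an orthonormal basis is not carried to one.\<close>

definition HSdom :: "L2H set \<Rightarrow> bool" where
  "HSdom X \<longleftrightarrow> (\<exists>\<nu>. (\<forall>m. 0 \<le> \<nu> m) \<and> (\<lambda>m. (\<nu> m)\<^sup>2) summable_on {..<0::int} \<and>
     (\<forall>w\<in>X. \<forall>m<0. norm (fourier w m) \<le> \<nu> m * norm w))"

lemma norm_orthonormal_sum:
  assumes "orthonormal E" "finite F" "F \<subseteq> E"
  shows "(norm (\<Sum>e\<in>F. lmult (qc (x e)) e))\<^sup>2 = (\<Sum>e\<in>F. (cmod (x e))\<^sup>2)"
proof -
  have "(norm (\<Sum>e\<in>F. lmult (qc (x e)) e))\<^sup>2 = (\<Sum>e\<in>F. \<Sum>e'\<in>F. Re (x e * cnj (x e') * cinner e e'))"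
    by (simp only: norm_L2H_sq inner_sum_left) (simp only: inner_sum_right inner_lmult_qc)
  also have "\<dots> = (\<Sum>e\<in>F. \<Sum>e'\<in>F. if e = e' then (cmod (x e))\<^sup>2 else 0)"
    using assms by (intro sum.cong refl) (auto simp: orthonormal_def subset_iff cmod_power2 simp flip: power2_eq_square)
  also have "\<dots> = (\<Sum>e\<in>F. (cmod (x e))\<^sup>2)" using assms(2) by simp
  finally show ?thesis .
qed

lemma hilbert_schmidt_imp_HSdom:
  assumes "hilbert_schmidt pr_minus X"
  shows "HSdom X"
proof -
  obtain E where E: "orthonormal_basis E X" and s: "(\<lambda>e. (norm (pr_minus e))\<^sup>2) summable_on E"
    using assms by (auto simp: hilbert_schmidt_def)
  have on: "orthonormal E" and cl: "closure (cspan E) = X" using E by (auto simp: orthonormal_basis_def orthonormal_def)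
  have sm: "(\<lambda>e. (norm (fourier e m))\<^sup>2) summable_on E" if "m < 0" for m
  proof (rule summable_on_comparison_test[OF s])
    fix e
    have "norm (fourier e m) = norm (fourier (pr_minus e) m)" using that by (simp add: pr_minus_eq)
    then show "(norm (fourier e m))\<^sup>2 \<le> (norm (pr_minus e))\<^sup>2" using norm_fourier_le[of "pr_minus e" m] by (simp add: power_mono)
  qed simp
  \<comment> \<open>The \<open>l^2\<close> norm of row \<open>m\<close> of the matrix of
    \<open>pr_minus\<close> in the basis \<open>E\<close>. Cauchy-Schwarz on the dense span turns it
    into a bound for the coefficient functional.\<close>
  define \<nu> where "\<nu> = (\<lambda>m. sqrt (\<Sum>\<^sub>\<infinity>e\<in>E. (norm (fourier e m))\<^sup>2))"
  have nn: "0 \<le> (\<Sum>\<^sub>\<infinity>e\<in>E. (norm (fourier e m))\<^sup>2)" for m by (rule infsum_nonneg) simp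
  have \<nu>0: "0 \<le> \<nu> m" for m using nn by (simp add: \<nu>_def)
  have \<nu>2: "(\<nu> m)\<^sup>2 = (\<Sum>\<^sub>\<infinity>e\<in>E. (norm (fourier e m))\<^sup>2)" for m using nn by (simp add: \<nu>_def)
  have "(\<lambda>m. (\<nu> m)\<^sup>2) summable_on {..<0}"
  proof (rule nonneg_bdd_above_summable_on)
    show "bdd_above (sum (\<lambda>m. (\<nu> m)\<^sup>2) ` {F. F \<subseteq> {..<0} \<and> finite F})"
    proof (rule bdd_aboveI2[where M = "\<Sum>\<^sub>\<infinity>e\<in>E. (norm (pr_minus e))\<^sup>2"])
      fix M :: "int set" assume M: "M \<in> {F. F \<subseteq> {..<0} \<and> finite F}"
      have "((\<lambda>e. \<Sum>m\<in>M. (norm (fourier e m))\<^sup>2) has_sum (\<Sum>m\<in>M. (\<nu> m)\<^sup>2)) E"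
        unfolding \<nu>2 using M sm by (intro has_sum_sum_finite has_sum_infsum) auto
      moreover have "((\<lambda>e. (norm (pr_minus e))\<^sup>2) has_sum (\<Sum>\<^sub>\<infinity>e\<in>E. (norm (pr_minus e))\<^sup>2)) E"
        by (rule has_sum_infsum[OF s])
      ultimately show "(\<Sum>m\<in>M. (\<nu> m)\<^sup>2) \<le> (\<Sum>\<^sub>\<infinity>e\<in>E. (norm (pr_minus e))\<^sup>2)"
      proof (rule has_sum_mono)
        fix e
        have "(\<Sum>m\<in>M. (norm (fourier e m))\<^sup>2) = (\<Sum>m\<in>M. (norm (fourier (pr_minus e) m))\<^sup>2)"
          using M by (intro sum.cong) (auto simp: pr_minus_eq)
        then show "(\<Sum>m\<in>M. (norm (fourier e m))\<^sup>2) \<le> (norm (pr_minus e))\<^sup>2"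
          using bessel_finite[of M "pr_minus e"] M by simp
      qed
    qed
  qed simp
  moreover have "norm (fourier w m) \<le> \<nu> m * norm w" if "w \<in> X" "m < 0" for w m
  proof -
    have "closed {w. norm (fourier w m) \<le> \<nu> m * norm w}"
      by (intro closed_Collect_le continuous_intros linear_continuous_on bounded_linear_fourier)
    moreover have "cspan E \<subseteq> {w. norm (fourier w m) \<le> \<nu> m * norm w}"
    proof
      fix w assume "w \<in> cspan E"
      then obtain F x where F: "finite F" "F \<subseteq> E" and w: "w = (\<Sum>e\<in>F. lmult (qc (x e)) e)"
        by (auto simp: cvs.span_explicit)
      have "(norm (fourier w m))\<^sup>2 \<le> (\<Sum>e\<in>F. cmod (x e) * norm (fourier e m))\<^sup>2"
        unfolding w by (intro power_mono) (auto simp: norm_mult intro!: sum_norm_le)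
      also have "\<dots> \<le> (\<Sum>e\<in>F. (cmod (x e))\<^sup>2) * (\<Sum>e\<in>F. (norm (fourier e m))\<^sup>2)"
        by (rule Cauchy_Schwarz_ineq_sum)
      also have "\<dots> \<le> (\<Sum>e\<in>F. (cmod (x e))\<^sup>2) * (\<nu> m)\<^sup>2"
        unfolding \<nu>2 using F sm[OF \<open>m < 0\<close>] by (intro mult_left_mono finite_sum_le_infsum) (auto intro: sum_nonneg)
      also have "\<dots> = (\<nu> m * norm w)\<^sup>2"
        unfolding w power_mult_distrib norm_orthonormal_sum[OF on F] by (simp add: mult.commute)
      finally show "w \<in> {w. norm (fourier w m) \<le> \<nu> m * norm w}"
        using \<nu>0 by (auto intro: power2_le_imp_le)
    qed
    ultimately show ?thesis using closure_minimal cl that by blast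
  qed
  ultimately show ?thesis using \<nu>0 by (auto simp: HSdom_def)
qed

lemma HSdom_imp_hilbert_schmidt:
  assumes X: "subspace X" "closed X" "\<And>f. f \<in> X \<Longrightarrow> lmult quat_i f \<in> X" and "HSdom X"
  shows "hilbert_schmidt pr_minus X"
proof -
  obtain E where E: "orthonormal_basis E X" using orthonormal_basis_exists[OF X] by blast
  have on: "orthonormal E" and cl: "closure (cspan E) = X" using E by (auto simp: orthonormal_basis_def orthonormal_def)
  have EX: "E \<subseteq> X" using cvs.span_superset[of E] closure_subset cl by blast
  obtain \<nu> where \<nu>: "\<And>m. 0 \<le> \<nu> m" "(\<lambda>m. (\<nu> m)\<^sup>2) summable_on {..<0::int}"
    "\<And>w m. w \<in> X \<Longrightarrow> m < 0 \<Longrightarrow> norm (fourier w m) \<le> \<nu> m * norm w"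
    using assms(4) by (auto simp: HSdom_def)
  have comp: "(\<Sum>e\<in>F. (cmod (c (fourier e m)))\<^sup>2) \<le> (\<nu> m)\<^sup>2"
    if F: "finite F" "F \<subseteq> E" and "m < 0" and c: "\<And>a q. c (qc a * q) = a * c q" "\<And>p q. c (p + q) = c p + c q" "c 0 = 0" "\<And>q. cmod (c q) \<le> norm q"
    for F m c
  proof -
    \<comment> \<open>\<open>w\<close> represents the complex coordinate \<open>c\<close> of the
      coefficient \<open>m\<close> on the span of \<open>F\<close>: that coordinate of
      \<open>w\<close> equals \<open>s\<close>, while the norm of \<open>w\<close> is
      \<open>sqrt s\<close>. The hypothesis applied to \<open>w\<close> therefore gives
      \<open>sqrt s <= \<nu> m\<close>.\<close>
    define w where "w = (\<Sum>e\<in>F. lmult (qc (cnj (c (fourier e m)))) e)"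
    define s where "s = (\<Sum>e\<in>F. (cmod (c (fourier e m)))\<^sup>2)"
    have s0: "s \<ge> 0" unfolding s_def by (intro sum_nonneg) auto
    have "w \<in> X" unfolding w_def using X F EX by (intro subspace_sum lmult_i_closed_qc) auto
    have csum: "c (\<Sum>e\<in>F. g e) = (\<Sum>e\<in>F. c (g e))" for g :: "L2H \<Rightarrow> quat"
      by (induction F rule: infinite_finite_induct) (simp_all add: c)
    have "c (fourier w m) = of_real s"
      by (simp add: w_def s_def csum c complex_norm_square mult.commute del: of_real_power)
    then have "s \<le> norm (fourier w m)" using c(4)[of "fourier w m"] s0 by simp
    also have "\<dots> \<le> \<nu> m * norm w" by (rule \<nu>(3)) fact+
    also have "norm w = sqrt s" using norm_orthonormal_sum[OF on F, of "\<lambda>e. cnj (c (fourier e m))"]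
      by (simp add: s_def w_def real_sqrt_unique)
    finally have le: "sqrt s * sqrt s \<le> \<nu> m * sqrt s" using s0 by simp
    have "sqrt s \<le> \<nu> m"
    proof (cases "s = 0")
      case False
      then show ?thesis using mult_right_le_imp_le[OF le] s0 by simp
    qed (use \<nu>(1)[of m] in simp)
    then have "(sqrt s)\<^sup>2 \<le> (\<nu> m)\<^sup>2" using s0 by (intro power_mono) auto
    then show ?thesis using s0 by (simp add: s_def)
  qed
  have "(\<lambda>e. (norm (pr_minus e))\<^sup>2) summable_on E"
  proof (rule nonneg_bdd_above_summable_on)
    show "bdd_above (sum (\<lambda>e. (norm (pr_minus e))\<^sup>2) ` {F. F \<subseteq> E \<and> finite F})"
    \<comment> \<open>A quaternionic coefficient has two complex coordinates, each contributing at
      most the square of \<open>\<nu> m\<close>.\<close>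
    proof (rule bdd_aboveI2[where M = "\<Sum>\<^sub>\<infinity>m\<in>{..<0}. 2 * (\<nu> m)\<^sup>2"])
      fix F assume F: "F \<in> {F. F \<subseteq> E \<and> finite F}"
      have hs: "((\<lambda>m. (norm (fourier e m))\<^sup>2) has_sum (norm (pr_minus e))\<^sup>2) {..<0}" for e
        by (rule has_sum_cong_neutral[THEN iffD1, OF _ _ _ parseval[of "pr_minus e"]]) (auto simp: pr_minus_eq)
      have "((\<lambda>m. \<Sum>e\<in>F. (norm (fourier e m))\<^sup>2) has_sum (\<Sum>e\<in>F. (norm (pr_minus e))\<^sup>2)) {..<0}"
        using F by (intro has_sum_sum_finite hs) auto
      moreover have "((\<lambda>m. 2 * (\<nu> m)\<^sup>2) has_sum (\<Sum>\<^sub>\<infinity>m\<in>{..<0}. 2 * (\<nu> m)\<^sup>2)) {..<0}"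
        using \<nu>(2) by (intro has_sum_infsum summable_on_cmult_right)
      ultimately show "(\<Sum>e\<in>F. (norm (pr_minus e))\<^sup>2) \<le> (\<Sum>\<^sub>\<infinity>m\<in>{..<0}. 2 * (\<nu> m)\<^sup>2)"
      proof (rule has_sum_mono)
        fix m :: int assume m: "m \<in> {..<0}"
        have "(\<Sum>e\<in>F. (norm (fourier e m))\<^sup>2) = (\<Sum>e\<in>F. (cmod (cpart (fourier e m)))\<^sup>2) + (\<Sum>e\<in>F. (cmod (jpart (fourier e m)))\<^sup>2)"
          by (simp add: norm_quat_sq sum.distrib)
        also have "\<dots> \<le> (\<nu> m)\<^sup>2 + (\<nu> m)\<^sup>2"
          using F m by (intro add_mono comp) (auto simp: norm_cpart_le norm_jpart_le)
        finally show "(\<Sum>e\<in>F. (norm (fourier e m))\<^sup>2) \<le> 2 * (\<nu> m)\<^sup>2" by simp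
      qed
    qed
  qed simp
  then show ?thesis using E by (auto simp: hilbert_schmidt_def)
qed

section \<open>Finite-dimensional complex linear algebra\<close>

interpretation cvp: vector_space_pair "\<lambda>c. lmult (qc c)" "\<lambda>c. lmult (qc c)" ..

abbreviation ssum :: "L2H set \<Rightarrow> L2H set \<Rightarrow> L2H set" where
  "ssum U V \<equiv> {u + v | u v. u \<in> U \<and> v \<in> V}"

abbreviation clinear :: "(L2H \<Rightarrow> L2H) \<Rightarrow> bool" where
  "clinear \<equiv> Vector_Spaces.linear (\<lambda>c. lmult (qc c)) (\<lambda>c. lmult (qc c))"

lemma clinearI:
  assumes "\<And>f g. T (f + g) = T f + T g" "\<And>a f. T (lmult (qc a) f) = lmult (qc a) (T f)"
  shows "clinear T" using assms cvs.vector_space_axioms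
  by (auto simp: Vector_Spaces.linear_def module_hom_def module_hom_axioms_def cvs.module_axioms)

lemma clinear_proj: "clinear (proj S)" by (rule clinearI) (simp_all add: proj_add proj_lmult)

lemma clinear_rmult: "clinear (\<lambda>f. rmult f g)" by (rule clinearI) (simp_all add: rmult_add rmult_lmult)

lemma csubspace_iff: "cvs.subspace X \<longleftrightarrow> subspace X \<and> (\<forall>f\<in>X. lmult quat_i f \<in> X)"
proof
  assume "cvs.subspace X"
  then show "subspace X \<and> (\<forall>f\<in>X. lmult quat_i f \<in> X)"
    using csubspace_imp_subspace cvs.subspace_scale[of X _ \<i>] by (auto simp: qc_i)
next
  assume "subspace X \<and> (\<forall>f\<in>X. lmult quat_i f \<in> X)"
  then show "cvs.subspace X" by (auto simp: cvs.subspace_def subspace_0 subspace_add intro: lmult_i_closed_qc)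
qed

lemma finite_cdim_csubspace: "finite_cdim S \<Longrightarrow> cvs.subspace S" by (auto simp: finite_cdim_def)

lemma finite_cdim_basis:
  assumes "finite_cdim S"
  obtains B where "finite B" "cvs.independent B" "cspan B = S" "card B = cdim S"
proof -
  obtain B0 where B0: "finite B0" "cspan B0 = S" using assms by (auto simp: finite_cdim_def)
  obtain B where B: "B \<subseteq> S" "cvs.independent B" "S \<subseteq> cspan B" "card B = cdim S"
    using cvs.basis_exists by blast
  have "finite B" using cvs.independent_span_bound[of B0 B] B B0 by auto
  moreover have "cspan B = S" using B B0 by (metis cvs.span_subspace cvs.subspace_span)
  ultimately show ?thesis using B that by blast
qed

lemma finite_cdim_subspace:
  assumes "finite_cdim S" "T \<subseteq> S" "cvs.subspace T"
  shows "finite_cdim T"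
proof -
  obtain B0 where B0: "finite B0" "cspan B0 = S" using assms by (auto simp: finite_cdim_def)
  obtain B where B: "B \<subseteq> T" "cvs.independent B" "T \<subseteq> cspan B" "card B = cdim T"
    using cvs.basis_exists by blast
  have "finite B" using cvs.independent_span_bound[of B0 B] B B0 assms by auto
  moreover have "cspan B = T" using B assms(3) by (metis cvs.span_subspace)
  ultimately show ?thesis by (auto simp: finite_cdim_def)
qed

lemma cdim_mono:
  assumes "finite_cdim S" "T \<subseteq> S" shows "cdim T \<le> cdim S"
proof -
  obtain B where B: "finite B" "cvs.independent B" "cspan B = S" "card B = cdim S"
    using finite_cdim_basis[OF assms(1)] by blast
  then show ?thesis using cvs.dim_le_card[of T B] assms(2) by simp
qed

lemma finite_cdim_image:
  assumes "clinear T" "finite_cdim S" shows "finite_cdim (T ` S)"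
proof -
  interpret T: Vector_Spaces.linear "\<lambda>c. lmult (qc c)" "\<lambda>c. lmult (qc c)" T by fact
  obtain B where "finite B" "cspan B = S" using assms by (auto simp: finite_cdim_def)
  then show ?thesis using T.span_image[of B, folded cspan_def] by (auto simp: finite_cdim_def intro!: exI[of _ "T ` B"])
qed

lemma cdim_image:
  assumes "clinear T" "finite_cdim S" "\<And>f. f \<in> S \<Longrightarrow> T f = 0 \<Longrightarrow> f = 0"
  shows "cdim (T ` S) = cdim S"
proof -
  interpret T: Vector_Spaces.linear "\<lambda>c. lmult (qc c)" "\<lambda>c. lmult (qc c)" T by fact
  obtain B where B: "finite B" "cvs.independent B" "cspan B = S" "card B = cdim S"
    using finite_cdim_basis[OF assms(2)] by blast
  have inj: "inj_on T S"
  proof (rule inj_onI)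
    fix f g assume "f \<in> S" "g \<in> S" "T f = T g"
    then have "f - g \<in> S" "T (f - g) = 0"
      using finite_cdim_csubspace[OF assms(2)] by (auto simp: T.diff cvs.subspace_diff)
    then show "f = g" using assms(3)[of "f - g"] by simp
  qed
  have "cvs.independent (T ` B)" using T.independent_injective_image[of B, folded cspan_def] B inj by simp
  moreover have "T ` S = cspan (T ` B)" using T.span_image[of B, folded cspan_def] B by simp
  moreover have "card (T ` B) = card B"
    using inj B cvs.span_superset[of B] by (intro card_image) (auto intro: inj_on_subset)
  ultimately show ?thesis using B(4) cvs.dim_span_eq_card_independent by simp
qed

lemma cdim_direct_sum:
  assumes "finite_cdim U" "finite_cdim V" "U \<inter> V = {0}"
  shows "finite_cdim (ssum U V)" "cdim (ssum U V) = cdim U + cdim V"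
proof -
  obtain B where B: "finite B" "cvs.independent B" "cspan B = U" "card B = cdim U"
    using finite_cdim_basis[OF assms(1)] by blast
  obtain B' where B': "finite B'" "cvs.independent B'" "cspan B' = V" "card B' = cdim V"
    using finite_cdim_basis[OF assms(2)] by blast
  have sp: "cspan (B \<union> F) = ssum U (cspan F)" for F using B(3) by (simp add: cvs.span_Un)
  have "cvs.independent (B \<union> F)" if "F \<subseteq> B'" for F using finite_subset[OF that B'(1)] that
  proof (induction F)
    case (insert b F)
    then have iF: "cvs.independent (insert b F)" using cvs.independent_mono[OF B'(2)] by blast
    have "b \<notin> cspan (B \<union> F)"
    proof
      assume "b \<in> cspan (B \<union> F)"
      then obtain u v where uv: "b = u + v" "u \<in> U" "v \<in> cspan F" unfolding sp by blast
      have "v \<in> V" using uv(3) cvs.span_mono[of F B'] insert.prems B'(3) by auto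
      moreover have "b \<in> V" using insert.prems B'(3) cvs.span_base[of b B'] by auto
      ultimately have "u \<in> V" using uv(1) cvs.subspace_diff[of V b v] finite_cdim_csubspace[OF assms(2)] by simp
      then have "u = 0" using assms(3) uv(2) by blast
      then show False using uv iF insert.hyps(2) by (simp add: cvs.independent_insert)
    qed
    then show ?case using insert by (simp add: cvs.independent_insert)
  qed (use B in simp)
  then have ind: "cvs.independent (B \<union> B')" by blast
  have "B \<inter> B' = {}"
  proof (rule ccontr)
    assume "\<not> ?thesis"
    then obtain b where "b \<in> B" "b \<in> B'" by blast
    then have "b \<in> U \<inter> V" using B(3) B'(3) cvs.span_base by blast
    then have "b = 0" using assms(3) by blast
    then show False using \<open>b \<in> B\<close> B(2) cvs.dependent_zero by blast
  qed
  moreover have "cspan (B \<union> B') = ssum U V" using sp[of B'] B'(3) by simp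
  ultimately show "finite_cdim (ssum U V)" "cdim (ssum U V) = cdim U + cdim V"
    using B B' ind cvs.dim_span_eq_card_independent[OF ind] card_Un_disjoint[of B B'] by (auto simp: finite_cdim_def)
qed

lemma csubspace_ssum: "cvs.subspace U \<Longrightarrow> cvs.subspace V \<Longrightarrow> cvs.subspace (ssum U V)"
  using cvs.subspace_sums .

text \<open>\<open>U\<close> may have infinite dimension, so the complement is built inside
  \<open>cspan B\<close>, adding a generator only if it is new modulo what has been reached.\<close>

lemma finite_complement:
  assumes "cvs.subspace U" "finite B"
  shows "\<exists>U'. finite_cdim U' \<and> U' \<subseteq> cspan B \<and> U \<inter> U' = {0} \<and> ssum U U' = ssum U (cspan B)"
  using assms(2)
proof (induction B)
  case empty
  have "finite_cdim {0}" unfolding finite_cdim_def by (rule exI[of _ "{}"]) simp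
  then show ?case using cvs.subspace_0[OF assms(1)] by (intro exI[of _ "{0}"]) auto
next
  case (insert b B)
  then obtain U' where U': "finite_cdim U'" "U' \<subseteq> cspan B" "U \<inter> U' = {0}" "ssum U U' = ssum U (cspan B)" by blast
  have sU: "cvs.subspace U'" using finite_cdim_csubspace U' by blast
  have sub: "cspan B \<subseteq> cspan (insert b B)" by (rule cvs.span_mono) auto
  have bspan: "x \<in> cspan (insert b B) \<longleftrightarrow> (\<exists>k. x - lmult (qc k) b \<in> cspan B)" for x
    by (rule cvs.span_breakdown_eq)
  show ?case
  proof (cases "b \<in> ssum U (cspan B)")
    case True
    have "ssum U (cspan (insert b B)) \<subseteq> ssum U (cspan B)"
    proof
      fix z assume "z \<in> ssum U (cspan (insert b B))"
      then obtain u x k where z: "z = u + x" "u \<in> U" "x - lmult (qc k) b \<in> cspan B" by (auto simp: bspan)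
      have sS: "cvs.subspace (ssum U (cspan B))" using assms(1) by (intro csubspace_ssum) auto
      have "u + (x - lmult (qc k) b) \<in> ssum U (cspan B)" using z by blast
      from cvs.subspace_add[OF sS this cvs.subspace_scale[OF sS True]]
      have "u + (x - lmult (qc k) b) + lmult (qc k) b \<in> ssum U (cspan B)" .
      then show "z \<in> ssum U (cspan B)" using z by (simp add: add.assoc)
    qed
    moreover have "ssum U (cspan B) \<subseteq> ssum U (cspan (insert b B))"
    proof
      fix z assume "z \<in> ssum U (cspan B)"
      then obtain u v where "z = u + v" "u \<in> U" "v \<in> cspan B" by blast
      then show "z \<in> ssum U (cspan (insert b B))" using sub by blast
    qed
    ultimately have "ssum U U' = ssum U (cspan (insert b B))" using U'(4) by (simp only: subset_antisym)
    moreover have "U' \<subseteq> cspan (insert b B)" using U'(2) sub by (rule subset_trans)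
    ultimately show ?thesis using U'(1,3) by (intro exI[of _ U'] conjI)
  next
    case False
    let ?L = "cspan {b}"
    have L: "finite_cdim ?L" by (auto simp: finite_cdim_def)
    have Lx: "x \<in> ?L \<longleftrightarrow> (\<exists>k. x = lmult (qc k) b)" for x by (auto simp: cvs.span_singleton)
    have notin: "k = 0" if "lmult (qc k) b \<in> ssum U U'" for k
    proof (rule ccontr)
      assume "k \<noteq> 0"
      have "lmult (qc (inverse k)) (lmult (qc k) b) \<in> ssum U U'"
        by (rule cvs.subspace_scale[OF csubspace_ssum[OF assms(1) sU] that])
      then show False using False U'(4) \<open>k \<noteq> 0\<close> by (simp flip: qc_mult)
    qed
    have UL: "U' \<inter> ?L = {0}"
    proof -
      have "x = 0" if "x \<in> U'" "x \<in> ?L" for x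
      proof -
        obtain k where k: "x = lmult (qc k) b" using \<open>x \<in> ?L\<close> Lx by blast
        have "x \<in> ssum U U'" using that cvs.subspace_0[OF assms(1)] by (intro CollectI exI[of _ 0] exI[of _ x]) auto
        then show ?thesis using notin[of k] k by simp
      qed
      then show ?thesis using cvs.subspace_0[OF sU] cvs.span_zero by blast
    qed
    let ?V = "ssum U' ?L"
    have V: "finite_cdim ?V" using cdim_direct_sum(1)[OF U'(1) L UL] .
    moreover have "?V \<subseteq> cspan (insert b B)"
    proof
      fix z assume "z \<in> ?V"
      then obtain u k where z: "z = u + lmult (qc k) b" "u \<in> U'" by (auto simp: Lx)
      then show "z \<in> cspan (insert b B)" using U'(2) by (auto simp: bspan intro!: exI[of _ k])
    qed
    moreover have "U \<inter> ?V = {0}"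
    proof -
      have "z = 0" if "z \<in> U" "z \<in> ?V" for z
      proof -
        obtain u k where z: "z = u + lmult (qc k) b" "u \<in> U'" using \<open>z \<in> ?V\<close> by (auto simp: Lx)
        then have "lmult (qc k) b = z + (- u)" by simp
        moreover have "- u \<in> U'" using z sU cvs.subspace_neg by blast
        ultimately have "lmult (qc k) b \<in> ssum U U'" using that by blast
        then have "k = 0" by (rule notin)
        then have "z \<in> U \<inter> U'" using z that by simp
        then show ?thesis using U'(3) by blast
      qed
      then show ?thesis using cvs.subspace_0[OF assms(1)] cvs.subspace_0[OF finite_cdim_csubspace[OF V]] by blast
    qed
    moreover have "ssum U ?V = ssum U (cspan (insert b B))"
    proof (intro equalityI subsetI)
      fix z assume "z \<in> ssum U ?V"
      then show "z \<in> ssum U (cspan (insert b B))" using \<open>?V \<subseteq> cspan (insert b B)\<close> by blast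
    next
      fix z assume "z \<in> ssum U (cspan (insert b B))"
      then obtain u x k where z: "z = u + x" "u \<in> U" "x - lmult (qc k) b \<in> cspan B" by (auto simp: bspan)
      then have "u + (x - lmult (qc k) b) \<in> ssum U U'" unfolding U'(4) by blast
      then obtain u1 u2 where u: "u + (x - lmult (qc k) b) = u1 + u2" "u1 \<in> U" "u2 \<in> U'" by blast
      then have "z = u1 + (u2 + lmult (qc k) b)" using z by (simp add: algebra_simps)
      moreover have "u2 + lmult (qc k) b \<in> ?V" using u Lx by blast
      ultimately show "z \<in> ssum U ?V" using u by blast
    qed
    ultimately show ?thesis by blast
  qed
qed

lemma finite_inner_complement:
  assumes E: "finite_cdim E" and S: "cvs.subspace S" "S \<subseteq> E"
  obtains E' where "finite_cdim E'" "E' \<subseteq> E" "S \<inter> E' = {0}" "ssum S E' = E" "cdim E = cdim S + cdim E'"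
proof -
  obtain B where B: "finite B" "cspan B = E" using E by (auto simp: finite_cdim_def)
  have "ssum S E = E"
  proof (intro equalityI subsetI)
    fix z assume "z \<in> ssum S E"
    then show "z \<in> E" using S(2) finite_cdim_csubspace[OF E] by (auto intro: cvs.subspace_add)
  qed (use cvs.subspace_0[OF S(1)] in force)
  then obtain E' where E': "finite_cdim E'" "E' \<subseteq> E" "S \<inter> E' = {0}" "ssum S E' = E"
    using finite_complement[OF S(1) B(1)] B(2) by auto
  moreover have "cdim E = cdim S + cdim E'"
    using cdim_direct_sum(2)[OF finite_cdim_subspace[OF E S(2,1)] E'(1,3)] E'(4) by simp
  ultimately show ?thesis by (rule that)
qed

text \<open>Moving each basis vector of \<open>Q2\<close> along \<open>R\<close> into
  \<open>Q\<close> gives a linear map, injective because \<open>R\<close> meets \<open>Q2\<close>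
  trivially. Hence the codimension of \<open>R\<close> does not depend on the complement that
  measures it.\<close>

lemma complement_dim_le:
  assumes R: "cvs.subspace R" and Q: "finite_cdim Q" and Q2: "cvs.subspace Q2" "R \<inter> Q2 = {0}" "Q2 \<subseteq> ssum R Q"
  shows "finite_cdim Q2 \<and> cdim Q2 \<le> cdim Q"
proof -
  obtain B where B: "B \<subseteq> Q2" "cvs.independent B" "Q2 \<subseteq> cspan B" "card B = cdim Q2"
    using cvs.basis_exists by blast
  have spB: "cspan B = Q2" using B Q2(1) by (metis cvs.span_subspace)
  have "\<forall>b\<in>B. \<exists>q. q \<in> Q \<and> b - q \<in> R" using B(1) Q2(3) by force
  then obtain g where g: "\<And>b. b \<in> B \<Longrightarrow> g b \<in> Q \<and> b - g b \<in> R" by metis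
  obtain G where G: "clinear G" "\<And>b. b \<in> B \<Longrightarrow> G b = g b"
    using cvp.linear_independent_extend[OF B(2)] by blast
  interpret G: Vector_Spaces.linear "\<lambda>c. lmult (qc c)" "\<lambda>c. lmult (qc c)" G by (rule G)
  have sQ: "cvs.subspace Q" using Q by (rule finite_cdim_csubspace)
  have Gq: "G q \<in> Q \<and> q - G q \<in> R" if "q \<in> Q2" for q using that unfolding spB[symmetric]
  proof (induction rule: cvs.span_induct_alt)
    case base
    then show ?case using cvs.subspace_0 sQ R by simp
  next
    case (step c x y)
    have eq: "lmult (qc c) x + y - G (lmult (qc c) x + y) = lmult (qc c) (x - G x) + (y - G y)"
      by (simp add: G.add G.scale lmult_diff)
    have "lmult (qc c) (x - G x) + (y - G y) \<in> R"
      using step g[OF step(1)] G(2)[OF step(1)] by (intro cvs.subspace_add[OF R] cvs.subspace_scale[OF R]) auto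
    moreover have "G (lmult (qc c) x + y) \<in> Q"
      using step g[OF step(1)] G(2)[OF step(1)] sQ by (simp add: G.add G.scale cvs.subspace_add cvs.subspace_scale)
    ultimately show ?case unfolding eq by blast
  qed
  have inj: "q = 0" if "q \<in> Q2" "G q = 0" for q using Gq[OF that(1)] that Q2(2) by auto
  have injB: "inj_on G Q2"
  proof (rule inj_onI)
    fix f h assume "f \<in> Q2" "h \<in> Q2" "G f = G h"
    then show "f = h" using inj[of "f - h"] Q2(1) by (simp add: G.diff cvs.subspace_diff)
  qed
  have "cvs.independent (G ` B)" using G.independent_injective_image[of B, folded cspan_def] B(2) injB spB by auto
  moreover obtain B0 where B0: "finite B0" "cspan B0 = Q" using Q by (auto simp: finite_cdim_def)
  moreover have "G ` B \<subseteq> cspan B0" using B(1) Gq B0 by auto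
  ultimately have "finite (G ` B)" using cvs.independent_span_bound[of B0 "G ` B"] by blast
  then have "finite B" using injB B(1) by (metis finite_imageD inj_on_subset)
  then have fin: "finite_cdim Q2" using spB by (auto simp: finite_cdim_def)
  have "cdim Q2 = cdim (G ` Q2)" using cdim_image[OF G(1) fin] inj by metis
  also have "\<dots> \<le> cdim Q" using Gq by (intro cdim_mono Q) auto
  finally show ?thesis using fin by blast
qed

text \<open>The two lemmas below compare, for a projection \<open>\<pi>\<close> on \<open>H\<close> with finite-dimensional kernel
  \<open>E\<close>, complements of \<open>R\<close> in \<open>H\<close> with complements of \<open>\<pi> R\<close> in \<open>\<pi> H\<close>.\<close>

lemma complement_lift:
  assumes pi: "clinear \<pi>" and R: "cvs.subspace R" "R \<subseteq> H" and H: "cvs.subspace H"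
    and E: "finite_cdim E" "E = {h\<in>H. \<pi> h = 0}"
    and Y: "\<pi> ` H \<subseteq> H" "\<And>h. h \<in> H \<Longrightarrow> \<pi> (\<pi> h) = \<pi> h"
    and C: "finite_cdim C" "\<pi> ` R \<inter> C = {0}" "ssum (\<pi> ` R) C = \<pi> ` H" "cdim C = cdim (R \<inter> E)"
  shows "\<exists>Q. finite_cdim Q \<and> R \<inter> Q = {0} \<and> ssum R Q = H \<and> cdim Q = cdim E"
proof -
  interpret P: Vector_Spaces.linear "\<lambda>c. lmult (qc c)" "\<lambda>c. lmult (qc c)" \<pi> by fact
  have sE: "cvs.subspace E" and sC: "cvs.subspace C" using finite_cdim_csubspace E C by auto
  have RE: "cvs.subspace (R \<inter> E)" using R sE by (auto intro: cvs.subspace_inter)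
  obtain E' where E': "finite_cdim E'" "E' \<subseteq> E" "(R \<inter> E) \<inter> E' = {0}" and Eeq: "ssum (R \<inter> E) E' = E"
    and dE: "cdim E = cdim (R \<inter> E) + cdim E'" using finite_inner_complement[OF E(1) RE Int_lower2] .
  have sE': "cvs.subspace E'" using finite_cdim_csubspace E' by blast
  have CY: "c \<in> H \<and> \<pi> c = c" if "c \<in> C" for c
  proof -
    have "c \<in> ssum (\<pi> ` R) C" using that cvs.subspace_0[OF R(1)] P.zero by (intro CollectI exI[of _ 0] exI[of _ c]) force
    then show ?thesis using C(3) Y by auto
  qed
  have CE: "C \<inter> E' = {0}" using CY E'(2) E(2) cvs.subspace_0[OF sC] cvs.subspace_0[OF sE'] by fastforce
  \<comment> \<open>\<open>C\<close> complements the image of \<open>R\<close>, and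
    \<open>E'\<close> complements \<open>R\<close> inside the kernel of the projection. The
    dimensions add up to that of \<open>E\<close> because \<open>C\<close> has the dimension of
    \<open>R \<inter> E\<close>.\<close>
  let ?Q = "ssum C E'"
  have fQ: "finite_cdim ?Q" and dQ: "cdim ?Q = cdim C + cdim E'" using cdim_direct_sum[OF C(1) E'(1) CE] by auto
  have Q0: "z = 0" if "z \<in> R" "z \<in> ?Q" for z
  proof -
    obtain c e where z: "z = c + e" "c \<in> C" "e \<in> E'" using \<open>z \<in> ?Q\<close> by blast
    then have "\<pi> z = c" using CY[of c] E'(2) E(2) by (auto simp: P.add)
    then have "c \<in> \<pi> ` R \<inter> C" using that z by blast
    then have "c = 0" using C(2) by blast
    then have "z \<in> (R \<inter> E) \<inter> E'" using z that E'(2) by auto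
    then show ?thesis using E'(3) by blast
  qed
  have "R \<inter> ?Q = {0}" using Q0 cvs.subspace_0[OF R(1)] cvs.subspace_0[OF finite_cdim_csubspace[OF fQ]] by blast
  moreover have "ssum R ?Q = H"
  proof (intro equalityI subsetI)
    fix h assume h: "h \<in> H"
    then have "\<pi> h \<in> ssum (\<pi> ` R) C" using C(3) by blast
    then obtain r c where rc: "\<pi> h = \<pi> r + c" "r \<in> R" "c \<in> C" by blast
    have "h - r - c \<in> E" using rc h R H CY[of c] E(2) by (auto simp: P.diff intro!: cvs.subspace_diff)
    then obtain x e where xe: "h - r - c = x + e" "x \<in> R" "e \<in> E'" using Eeq by blast
    then have "h = (r + x) + (c + e)" by (simp add: algebra_simps)
    moreover have "r + x \<in> R" using rc xe R by (intro cvs.subspace_add)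
    ultimately show "h \<in> ssum R ?Q" using rc xe by blast
  next
    fix z assume "z \<in> ssum R ?Q"
    then obtain r c e where "z = r + (c + e)" "r \<in> R" "c \<in> C" "e \<in> E'" by blast
    then show "z \<in> H" using R CY[of c] E' E(2) H by (auto intro!: cvs.subspace_add)
  qed
  ultimately show ?thesis using fQ dQ dE C(4) by (intro exI[of _ ?Q]) auto
qed

lemma complement_push:
  assumes pi: "clinear \<pi>" and R: "cvs.subspace R" "R \<subseteq> H" and H: "cvs.subspace H"
    and E: "finite_cdim E" "E = {h\<in>H. \<pi> h = 0}"
    and Y: "\<pi> ` H \<subseteq> H" "\<And>h. h \<in> H \<Longrightarrow> \<pi> (\<pi> h) = \<pi> h"
    and Q: "finite_cdim Q" "R \<inter> Q = {0}" "ssum R Q = H" "cdim Q = cdim E"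
  shows "finite_cdim (R \<inter> E) \<and> (\<exists>C. finite_cdim C \<and> \<pi> ` R \<inter> C = {0} \<and> ssum (\<pi> ` R) C = \<pi> ` H \<and> cdim C = cdim (R \<inter> E))"
proof -
  interpret P: Vector_Spaces.linear "\<lambda>c. lmult (qc c)" "\<lambda>c. lmult (qc c)" \<pi> by fact
  have sE: "cvs.subspace E" and sQ: "cvs.subspace Q" using finite_cdim_csubspace E Q by auto
  have RE: "cvs.subspace (R \<inter> E)" using R sE by (auto intro: cvs.subspace_inter)
  have fRE: "finite_cdim (R \<inter> E)" using finite_cdim_subspace[OF E(1) _ RE] by blast
  obtain E' where E': "finite_cdim E'" "E' \<subseteq> E" "(R \<inter> E) \<inter> E' = {0}" and Eeq: "ssum (R \<inter> E) E' = E"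
    and dE: "cdim E = cdim (R \<inter> E) + cdim E'" using finite_inner_complement[OF E(1) RE Int_lower2] .
  have sE': "cvs.subspace E'" using finite_cdim_csubspace E' by blast
  let ?U = "ssum R E'"
  have sU: "cvs.subspace ?U" using R sE' by (intro csubspace_ssum)
  have RU: "R \<subseteq> ?U" using cvs.subspace_0[OF sE'] by force
  have EU: "E \<subseteq> ?U" using Eeq by blast
  obtain BQ where BQ: "finite BQ" "cspan BQ = Q" using Q(1) by (auto simp: finite_cdim_def)
  obtain C' where C': "finite_cdim C'" "C' \<subseteq> Q" "?U \<inter> C' = {0}" "ssum ?U C' = ssum ?U Q"
    using finite_complement[OF sU BQ(1)] BQ(2) by auto
  have sC': "cvs.subspace C'" using finite_cdim_csubspace C' by blast
  have EH: "E' \<subseteq> H" using E' E(2) by auto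
  have QH: "Q \<subseteq> H" using Q(3) cvs.subspace_0[OF R(1)] by force
  have UC: "ssum ?U C' = H" unfolding C'(4)
  proof (intro equalityI subsetI)
    fix z assume "z \<in> ssum ?U Q"
    then obtain r e q where "z = r + e + q" "r \<in> R" "e \<in> E'" "q \<in> Q" by blast
    then show "z \<in> H" using R EH QH H by (auto intro!: cvs.subspace_add)
  next
    fix z assume "z \<in> H"
    then show "z \<in> ssum ?U Q" using Q(3) RU by blast
  qed
  have EC: "E' \<inter> C' = {0}"
  proof (intro equalityI subsetI)
    fix x assume "x \<in> E' \<inter> C'"
    then have "x \<in> ?U \<inter> C'" using EU E'(2) by (meson IntD1 IntD2 IntI subsetD)
    then show "x \<in> {0}" using C'(3) by simp
  qed (use cvs.subspace_0[OF sE'] cvs.subspace_0[OF sC'] in simp)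
  \<comment> \<open>A second complement of \<open>R\<close>, adapted to the kernel \<open>E\<close>.
    Its dimension agrees with that of \<open>Q\<close>, which fixes the dimension of
    \<open>C'\<close>, the part on which the projection is injective.\<close>
  let ?Q2 = "ssum E' C'"
  have fQ2: "finite_cdim ?Q2" and dQ2: "cdim ?Q2 = cdim E' + cdim C'" using cdim_direct_sum[OF E'(1) C'(1) EC] by auto
  have sQ2: "cvs.subspace ?Q2" using finite_cdim_csubspace fQ2 by blast
  have RQ2: "z = 0" if "z \<in> R" "z \<in> ?Q2" for z
  proof -
    obtain e c where z: "z = e + c" "e \<in> E'" "c \<in> C'" using \<open>z \<in> ?Q2\<close> by blast
    then have "c = z + (- e)" by simp
    then have "c \<in> ?U" using that z cvs.subspace_neg[OF sE'] by blast
    then have "c = 0" using z C'(3) by blast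
    then have "z \<in> (R \<inter> E) \<inter> E'" using z that E'(2) by auto
    then show ?thesis using E'(3) by blast
  qed
  have RQ20: "R \<inter> ?Q2 = {0}"
  proof (intro equalityI subsetI)
    fix x assume "x \<in> R \<inter> ?Q2"
    then have "x = 0" by (intro RQ2) (rule IntD1 IntD2, assumption)+
    then show "x \<in> {0}" by simp
  qed (use cvs.subspace_0[OF R(1)] cvs.subspace_0[OF sQ2] in simp)
  have RsQ2: "ssum R ?Q2 = H"
  proof -
    have "ssum R ?Q2 = ssum ?U C'"
    proof (intro equalityI subsetI)
      fix z assume "z \<in> ssum R ?Q2"
      then obtain r e c where "z = r + (e + c)" "r \<in> R" "e \<in> E'" "c \<in> C'" by blast
      then show "z \<in> ssum ?U C'" by (intro CollectI exI[of _ "r + e"] exI[of _ c]) (auto simp: add.assoc)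
    next
      fix z assume "z \<in> ssum ?U C'"
      then obtain r e c where "z = (r + e) + c" "r \<in> R" "e \<in> E'" "c \<in> C'" by blast
      then show "z \<in> ssum R ?Q2" by (intro CollectI exI[of _ r] exI[of _ "e + c"]) (auto simp: add.assoc)
    qed
    then show ?thesis using UC by simp
  qed
  have "cdim ?Q2 = cdim Q"
  proof (rule antisym)
    have "?Q2 \<subseteq> H" using RsQ2 cvs.subspace_0[OF R(1)] by force
    then show "cdim ?Q2 \<le> cdim Q" using complement_dim_le[OF R(1) Q(1) sQ2 RQ20] Q(3) by blast
    show "cdim Q \<le> cdim ?Q2" using complement_dim_le[OF R(1) fQ2 sQ Q(2)] RsQ2 QH by blast
  qed
  then have dC': "cdim C' = cdim (R \<inter> E)" using dQ2 dE Q(4) by simp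
  have ker: "c = 0" if "c \<in> C'" "r \<in> R" "\<pi> c = \<pi> r" for c r
  proof -
    have "c \<in> H" using that C'(2) QH by blast
    then have "c - r \<in> E" using that R H E(2) by (auto simp: P.diff intro!: cvs.subspace_diff)
    then have "c - r \<in> ?U" using EU by blast
    then have "c - r + r \<in> ?U" using RU that sU by (intro cvs.subspace_add) auto
    then show ?thesis using C'(3) that by auto
  qed
  have C1: "finite_cdim (\<pi> ` C')" using finite_cdim_image[OF pi C'(1)] .
  have C2: "\<pi> ` R \<inter> \<pi> ` C' = {0}"
  proof (intro equalityI subsetI)
    fix y assume "y \<in> \<pi> ` R \<inter> \<pi> ` C'"
    then obtain r c where rc: "y = \<pi> r" "r \<in> R" "y = \<pi> c" "c \<in> C'" by blast
    then have "c = 0" using ker by metis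
    then show "y \<in> {0}" using rc P.zero by simp
  next
    fix y :: L2H assume "y \<in> {0}"
    then have "y = \<pi> 0" using P.zero by simp
    then show "y \<in> \<pi> ` R \<inter> \<pi> ` C'" using cvs.subspace_0[OF R(1)] cvs.subspace_0[OF sC'] by blast
  qed
  have C3: "ssum (\<pi> ` R) (\<pi> ` C') = \<pi> ` H"
  proof (intro equalityI subsetI)
    fix y assume "y \<in> ssum (\<pi> ` R) (\<pi> ` C')"
    then obtain r c where rc: "y = \<pi> (r + c)" "r \<in> R" "c \<in> C'" by (auto simp: P.add)
    moreover have "r + c \<in> H" using rc R C'(2) QH H by (auto intro!: cvs.subspace_add)
    ultimately show "y \<in> \<pi> ` H" by blast
  next
    fix y assume "y \<in> \<pi> ` H"
    then obtain h where h: "y = \<pi> h" "h \<in> H" by blast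
    then obtain r e c where "h = r + e + c" "r \<in> R" "e \<in> E'" "c \<in> C'" using UC by blast
    moreover have "\<pi> e = 0" using \<open>e \<in> E'\<close> E'(2) E(2) by auto
    ultimately have "y = \<pi> r + \<pi> c" using h by (simp add: P.add)
    then show "y \<in> ssum (\<pi> ` R) (\<pi> ` C')" using \<open>r \<in> R\<close> \<open>c \<in> C'\<close> by blast
  qed
  have C4: "cdim (\<pi> ` C') = cdim C'"
    by (rule cdim_image[OF pi C'(1)]) (use ker[of _ 0] cvs.subspace_0[OF R(1)] P.zero in auto)
  show ?thesis using fRE C1 C2 C3 C4 dC' by (intro conjI exI[of _ "\<pi> ` C'"]) auto
qed

section \<open>The Fredholm index seen in a finite window, and its invariance under
  multiplication\<close>

section \<open>Supports\<close>

definition supp :: "int set \<Rightarrow> L2H set" where "supp S = {f. proj S f = f}"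

lemma supp_iff: "f \<in> supp S \<longleftrightarrow> (\<forall>m. m \<notin> S \<longrightarrow> fourier f m = 0)"
  by (simp add: supp_def proj_id_iff)

lemma csubspace_supp: "cvs.subspace (supp S)" by (auto simp: csubspace_iff subspace_def supp_iff)

lemma closed_supp: "closed (supp S)" unfolding supp_def by (rule proj_fixed_closed)

lemma H_plus_supp: "H_plus = supp {0..}" by (auto simp: supp_def H_plus_iff)
lemma H_minus_supp: "H_minus = supp {..<0}" by (auto simp: supp_def H_minus_iff)

lemma proj_in_supp: "proj S f \<in> supp S" by (simp add: supp_iff)

lemma supp_mono: "S \<subseteq> T \<Longrightarrow> supp S \<subseteq> supp T" unfolding supp_iff subset_iff by blast

lemma cspan_singleton_iff: "x \<in> cspan {a} \<longleftrightarrow> (\<exists>c. x = lmult (qc c) a)"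
  by (auto simp: cvs.span_singleton)

text \<open>Over the complex numbers the exponent \<open>m\<close> carries \<open>zeta^m\<close> and
  \<open>j zeta^m\<close>; the resulting factor 2 returns when lowest exponents are counted.\<close>

lemma supp_singleton: "finite_cdim (supp {m})" "cdim (supp {m}) = 2"
proof -
  let ?a = "zpow m" and ?b = "lmult quat_j (zpow m)"
  have a0: "?a \<noteq> 0" by (metis fourier_0 fourier_zpow zero_neq_one)
  have b0: "?b \<noteq> 0"
  proof
    assume "?b = 0"
    then have "fourier ?b m = 0" by simp
    then show False by (simp add: quat_eq_iff)
  qed
  have fa: "finite_cdim (cspan {?a})" and fb: "finite_cdim (cspan {?b})" by (auto simp: finite_cdim_def)
  have da: "cdim (cspan {?a}) = 1" and db: "cdim (cspan {?b}) = 1" using a0 b0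
    by (subst cvs.dim_span_eq_card_independent; simp)+
  have ab: "cspan {?a} \<inter> cspan {?b} = {0}"
  proof (intro equalityI subsetI)
    fix x assume "x \<in> cspan {?a} \<inter> cspan {?b}"
    then obtain c d where x: "x = lmult (qc c) ?a" "x = lmult (qc d) ?b" unfolding Int_iff cspan_singleton_iff by blast
    then have "fourier (lmult (qc c) ?a) m = fourier (lmult (qc d) ?b) m" by simp
    then have "c = 0" by (simp add: quat_eq_iff)
    then show "x \<in> {0}" using x by simp
  qed (simp add: cvs.span_zero)
  have "ssum (cspan {?a}) (cspan {?b}) = supp {m}"
  proof (intro equalityI subsetI)
    fix x assume "x \<in> ssum (cspan {?a}) (cspan {?b})"
    then show "x \<in> supp {m}" unfolding cspan_singleton_iff by (auto simp: supp_iff)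
  next
    fix x assume x: "x \<in> supp {m}"
    have "x = lmult (qc (cpart (fourier x m))) ?a + lmult (qc (jpart (fourier x m))) ?b"
      using x by (intro L2H_eqI) (auto simp: supp_iff quat_eq_iff)
    then show "x \<in> ssum (cspan {?a}) (cspan {?b})" unfolding cspan_singleton_iff by blast
  qed
  then show "finite_cdim (supp {m})" "cdim (supp {m}) = 2" using cdim_direct_sum[OF fa fb ab] da db by simp_all
qed

lemma supp_finite:
  assumes "finite S" shows "finite_cdim (supp S) \<and> cdim (supp S) = 2 * card S" using assms
proof (induction S)
  case empty
  have "supp {} = {0}" by (auto simp: supp_iff intro: fourier_eq_0_imp)
  moreover have "finite_cdim {0}" unfolding finite_cdim_def by (rule exI[of _ "{}"]) simp
  moreover have "cdim {0} = 0" using cvs.dim_span_eq_card_independent[of "{}"] cvs.span_empty cvs.independent_empty by (metis card.empty)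
  ultimately show ?case by simp
next
  case (insert m S)
  have I: "supp S \<inter> supp {m} = {0}"
  proof (intro equalityI subsetI)
    fix x assume x: "x \<in> supp S \<inter> supp {m}"
    have "fourier x k = 0" for k using x insert.hyps(2) by (cases "k = m") (simp_all add: supp_iff)
    then show "x \<in> {0}" by (simp add: fourier_eq_0_imp)
  qed (simp add: supp_iff)
  have "ssum (supp S) (supp {m}) = supp (insert m S)"
  proof (intro equalityI subsetI)
    fix x assume x: "x \<in> supp (insert m S)"
    have "x = proj S x + proj {m} x" using x insert.hyps(2) by (intro L2H_eqI) (auto simp: supp_iff)
    then show "x \<in> ssum (supp S) (supp {m})" using proj_in_supp by blast
  qed (auto simp: supp_iff)
  then show ?case using cdim_direct_sum[OF _ supp_singleton(1) I] insert supp_singleton(2) by auto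
qed

text \<open>The two Grassmannians share one treatment: the whole of \<open>H\<close> serves
  \<open>Gr_H\<close>, the complex valued functions serve \<open>Gr_C\<close>.\<close>

definition ambient :: "L2H set \<Rightarrow> bool" where
  "ambient A \<longleftrightarrow> A = UNIV \<or> A = Collect complex_valued"

lemma complex_valued_rmult: "complex_valued f \<Longrightarrow> complex_valued (rmult f g)"
  by (transfer fixing: g) (auto elim!: eventually_mono simp: range_qc_iff)

lemma ambient_csubspace: "ambient A \<Longrightarrow> cvs.subspace A"
  by (auto simp: ambient_def csubspace_iff subspace_def complex_valued_iff)

lemma ambient_closed: "ambient A \<Longrightarrow> closed A"
proof -
  have "closed (\<Inter>m. {f. jpart (fourier f m) = 0})"
    by (intro closed_INT ballI closed_Collect_eq continuous_on_const linear_continuous_on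
        bounded_linear_compose[OF bounded_linear_jpart bounded_linear_fourier])
  moreover have "(\<Inter>m. {f. jpart (fourier f m) = 0}) = Collect complex_valued"
    by (auto simp: complex_valued_iff)
  ultimately show "ambient A \<Longrightarrow> closed A" by (auto simp: ambient_def)
qed

lemma ambient_proj: "ambient A \<Longrightarrow> f \<in> A \<Longrightarrow> proj S f \<in> A"
  by (auto simp: ambient_def complex_valued_iff)

lemma ambient_rmult: "ambient A \<Longrightarrow> f \<in> A \<Longrightarrow> rmult f g \<in> A"
  by (auto simp: ambient_def complex_valued_rmult)

section \<open>The index\<close>

text \<open>Square summability of the bounds makes the part of \<open>w\<close> below
  \<open>K\<close> small relative to \<open>w\<close>, uniformly on \<open>X\<close>. This smallness
  is the form in which the index and big cell arguments use the Hilbert-Schmidt condition.\<close>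

lemma HSdom_tail:
  assumes "HSdom X" "e > 0"
  shows "\<exists>K0\<le>0. \<forall>K\<le>K0. \<forall>w\<in>X. norm (proj {..<K} w) \<le> e * norm w"
proof -
  obtain \<nu> where \<nu>: "\<And>m. 0 \<le> \<nu> m" "(\<lambda>m. (\<nu> m)\<^sup>2) summable_on {..<0::int}"
    "\<And>w m. w \<in> X \<Longrightarrow> m < 0 \<Longrightarrow> norm (fourier w m) \<le> \<nu> m * norm w"
    using assms(1) by (auto simp: HSdom_def)
  obtain F where F: "finite F" "F \<subseteq> {..<0}" "dist (\<Sum>m\<in>F. (\<nu> m)\<^sup>2) (\<Sum>\<^sub>\<infinity>m\<in>{..<0}. (\<nu> m)\<^sup>2) \<le> e\<^sup>2"
    using has_sum_finite_approximation[OF has_sum_infsum[OF \<nu>(2)], of "e\<^sup>2"] assms(2) by auto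
  define K0 where "K0 = Min (insert 0 F)"
  have K0: "K0 \<le> 0" "\<And>m. m \<in> F \<Longrightarrow> K0 \<le> m" using F(1) by (auto simp: K0_def)
  have "norm (proj {..<K} w) \<le> e * norm w" if "K \<le> K0" "w \<in> X" for K w
  proof (rule power2_le_imp_le)
    show "(norm (proj {..<K} w))\<^sup>2 \<le> (e * norm w)\<^sup>2"
    proof (rule has_sum_le_finite_sums[OF parseval])
      fix G :: "int set" assume G: "finite G"
      have "(\<Sum>m\<in>G. (norm (fourier (proj {..<K} w) m))\<^sup>2) = (\<Sum>m\<in>G \<inter> {..<K}. (norm (fourier w m))\<^sup>2)"
        using G by (intro sum.mono_neutral_cong_right) auto
      also have "\<dots> \<le> (\<Sum>m\<in>G \<inter> {..<K}. (\<nu> m * norm w)\<^sup>2)"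
        using \<nu>(3)[OF that(2)] that(1) K0 by (intro sum_mono power_mono) auto
      also have "\<dots> = (\<Sum>m\<in>G \<inter> {..<K}. (\<nu> m)\<^sup>2) * (norm w)\<^sup>2"
        by (simp add: power_mult_distrib sum_distrib_right)
      also have "\<dots> \<le> e\<^sup>2 * (norm w)\<^sup>2"
      proof (rule mult_right_mono)
        have "F \<inter> (G \<inter> {..<K}) = {}" using K0(2) that(1) by fastforce
        then have "(\<Sum>m\<in>F. (\<nu> m)\<^sup>2) + (\<Sum>m\<in>G \<inter> {..<K}. (\<nu> m)\<^sup>2) = (\<Sum>m\<in>F \<union> (G \<inter> {..<K}). (\<nu> m)\<^sup>2)"
          using F(1) G by (simp add: sum.union_disjoint)
        also have "\<dots> \<le> (\<Sum>\<^sub>\<infinity>m\<in>{..<0}. (\<nu> m)\<^sup>2)"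
          using F G K0 that by (intro finite_sum_le_infsum \<nu>(2)) auto
        finally show "(\<Sum>m\<in>G \<inter> {..<K}. (\<nu> m)\<^sup>2) \<le> e\<^sup>2"
          using F(3) by (simp add: dist_real_def abs_le_iff)
      qed simp
      finally show "(\<Sum>m\<in>G. (norm (fourier (proj {..<K} w) m))\<^sup>2) \<le> (e * norm w)\<^sup>2"
        by (simp add: power_mult_distrib)
    qed
  qed (use assms in simp)
  then show ?thesis using K0(1) by blast
qed

lemma window_bounded_below:
  assumes "norm (proj {..<K} w) \<le> 1/2 * norm w"
  shows "norm w \<le> 2 * norm (proj {K..} w)"
proof (rule power2_le_imp_le)
  have "- {K..} = {..<K}" by auto
  then have "(norm w)\<^sup>2 = (norm (proj {K..} w))\<^sup>2 + (norm (proj {..<K} w))\<^sup>2"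
    using norm_proj_sq[of w "{K..}"] by simp
  moreover have "(norm (proj {..<K} w))\<^sup>2 \<le> (1/2 * norm w)\<^sup>2" using assms by (intro power_mono) auto
  moreover have "(1/2 * norm w)\<^sup>2 = 1/4 * (norm w)\<^sup>2" "(2 * norm (proj {K..} w))\<^sup>2 = 4 * (norm (proj {K..} w))\<^sup>2"
    by (simp_all add: power_mult_distrib power_divide)
  ultimately show "(norm w)\<^sup>2 \<le> (2 * norm (proj {K..} w))\<^sup>2"
    using zero_le_power2[of "norm (proj {K..} w)"] by linarith
qed simp

lemma closed_image_bounded_below:
  fixes T :: "'a::banach \<Rightarrow> 'b::banach"
  assumes "subspace X" "closed X" "bounded_linear T" "e > 0" "\<And>x. x \<in> X \<Longrightarrow> e * norm x \<le> norm (T x)"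
  shows "closed (T ` X)" using complete_isometric_image[of e X T] assms by (auto simp: complete_eq_closed)

lemma finite_cdim_inj:
  assumes "clinear T" "cvs.subspace S" "\<And>f. f \<in> S \<Longrightarrow> T f = 0 \<Longrightarrow> f = 0" "finite_cdim (T ` S)"
  shows "finite_cdim S"
proof -
  interpret T: Vector_Spaces.linear "\<lambda>c. lmult (qc c)" "\<lambda>c. lmult (qc c)" T by fact
  obtain B where B: "B \<subseteq> S" "cvs.independent B" "S \<subseteq> cspan B" "card B = cdim S"
    using cvs.basis_exists by blast
  have sp: "cspan B = S" using B assms(2) by (metis cvs.span_subspace)
  have inj: "inj_on T S"
  proof (rule inj_onI)
    fix f g assume "f \<in> S" "g \<in> S" "T f = T g"
    then have "f - g \<in> S" "T (f - g) = 0" using assms(2) by (auto simp: T.diff cvs.subspace_diff)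
    then show "f = g" using assms(3)[of "f - g"] by simp
  qed
  have "cvs.independent (T ` B)" using T.independent_injective_image[of B, folded cspan_def] B sp inj by simp
  moreover obtain B0 where B0: "finite B0" "cspan B0 = T ` S" using assms(4) by (auto simp: finite_cdim_def)
  ultimately have "finite (T ` B)" using cvs.independent_span_bound[of B0 "T ` B"] B(1) by blast
  then have "finite B" using inj B(1) by (metis finite_imageD inj_on_subset)
  then show ?thesis using sp by (auto simp: finite_cdim_def)
qed

lemma finite_cdim_real_span:
  assumes "finite_cdim E" shows "\<exists>B. finite B \<and> span B = E"
proof -
  obtain B where B: "finite B" "cspan B = E" using assms by (auto simp: finite_cdim_def)
  have sE: "cvs.subspace E" using B by auto
  then have rE: "subspace E" "\<And>f. f \<in> E \<Longrightarrow> lmult quat_i f \<in> E" by (auto simp: csubspace_iff)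
  let ?B = "B \<union> lmult quat_i ` B"
  have BE: "B \<subseteq> E" using B cvs.span_superset by blast
  have "span ?B \<subseteq> E" using BE rE by (intro span_minimal) auto
  moreover have "E \<subseteq> span ?B"
  proof
    fix x assume "x \<in> E"
    then obtain r t where "x = (\<Sum>a\<in>t. lmult (qc (r a)) a)" "finite t" "t \<subseteq> B"
      using B(2) by (auto simp: cvs.span_explicit)
    then show "x \<in> span ?B" by (auto simp: lmult_qc intro!: span_sum span_add span_scale intro: span_base)
  qed
  ultimately show ?thesis using B(1) by (intro exI[of _ ?B]) auto
qed

text \<open>On \<open>X\<close> the projection to exponents from \<open>K\<close> upwards is
  injective with closed range \<open>R\<close>, although \<open>pr_plus\<close> may have a kernel.
  The index of \<open>pr_plus\<close> is then read off by comparing the codimension of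
  \<open>R\<close> in \<open>HK\<close> with the dimension of the finite window
  \<open>EK\<close>.\<close>

locale window =
  fixes A X :: "L2H set" and K :: int
  assumes A: "ambient A" and X: "cvs.subspace X" "closed X" "X \<subseteq> A" and K: "K \<le> 0"
    and tail: "\<And>w. w \<in> X \<Longrightarrow> norm (proj {..<K} w) \<le> 1/2 * norm w"
begin

abbreviation "R \<equiv> proj {K..} ` X"
abbreviation "HK \<equiv> A \<inter> supp {K..}"
abbreviation "EK \<equiv> A \<inter> supp {K..<0}"

lemma below: "w \<in> X \<Longrightarrow> norm w \<le> 2 * norm (proj {K..} w)" using window_bounded_below[OF tail] .

lemma inj: "w \<in> X \<Longrightarrow> proj {K..} w = 0 \<Longrightarrow> w = 0" using below by force

lemma csubspace_image_clinear:
  assumes "clinear T" "cvs.subspace S" shows "cvs.subspace (T ` S)"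
proof -
  interpret T: Vector_Spaces.linear "\<lambda>c. lmult (qc c)" "\<lambda>c. lmult (qc c)" T by fact
  show ?thesis using T.subspace_image[OF assms(2)] .
qed

lemma R_sub: "cvs.subspace R" by (rule csubspace_image_clinear[OF clinear_proj X(1)])
lemma R_HK: "R \<subseteq> HK" using X(3) ambient_proj[OF A] proj_in_supp by blast
lemma R_closed: "closed R"
  using X below by (intro closed_image_bounded_below[where e = "1/2"] bounded_linear_proj) (auto simp: csubspace_iff mult.commute)
lemma HK_sub: "cvs.subspace HK" using ambient_csubspace[OF A] csubspace_supp by (rule cvs.subspace_inter)
lemma HK_closed: "closed HK" using ambient_closed[OF A] closed_supp by (rule closed_Int)

lemma EK_fin: "finite_cdim EK"
proof (rule finite_cdim_subspace)
  show "finite_cdim (supp {K..<0})" using supp_finite[of "{K..<0}"] by simp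
  show "cvs.subspace EK" using ambient_csubspace[OF A] csubspace_supp by (rule cvs.subspace_inter)
qed auto

lemma EK_ker: "EK = {h \<in> HK. proj {0..} h = 0}"
proof -
  have "h \<in> supp {K..<0} \<longleftrightarrow> h \<in> supp {K..} \<and> proj {0..} h = 0" for h
  proof
    assume h: "h \<in> supp {K..} \<and> proj {0..} h = 0"
    then have "fourier h m = 0" if "m \<ge> 0" for m using that fourier_proj[of "{0..}" h m] by simp
    then show "h \<in> supp {K..<0}" using h by (auto simp: supp_iff)
  qed (auto simp: supp_iff intro!: fourier_eq_0_imp)
  then show ?thesis by blast
qed

lemma proj_HK: "proj {0..} ` HK = H_plus \<inter> A"
proof (intro equalityI subsetI)
  fix y assume "y \<in> proj {0..} ` HK"
  then show "y \<in> H_plus \<inter> A" using ambient_proj[OF A] proj_in_supp by (auto simp: H_plus_supp)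
next
  fix y assume y: "y \<in> H_plus \<inter> A"
  then have "y = proj {0..} y" by (simp add: H_plus_supp supp_def)
  moreover have "y \<in> supp {K..}" using y K supp_mono[of "{0..}" "{K..}"] by (auto simp: H_plus_supp)
  ultimately show "y \<in> proj {0..} ` HK" using y by blast
qed

lemma proj_R: "proj {0..} ` R = pr_plus ` X"
proof -
  have "{0..} \<inter> {K..} = {0..}" using K by auto
  then show ?thesis by (simp add: image_image pr_plus_eq)
qed

lemma ker_R: "proj {K..} ` {f \<in> X. pr_plus f = 0} = R \<inter> EK"
proof -
  have "{0..} \<inter> {K..} = {0..}" using K by auto
  then show ?thesis using R_HK by (auto simp: EK_ker pr_plus_eq)
qed

lemma ker_sub: "cvs.subspace {f \<in> X. pr_plus f = 0}"
  using X(1) by (auto simp: csubspace_iff subspace_def pr_plus_eq proj_add proj_scaleR proj_lmult)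

definition index0 :: bool where
  "index0 \<longleftrightarrow> (\<exists>Q. finite_cdim Q \<and> R \<inter> Q = {0} \<and> ssum R Q = HK \<and> cdim Q = cdim EK)"

lemma index0_fredholm: "fredholm_index_zero pr_plus X (H_plus \<inter> A) \<longleftrightarrow> index0"
proof
  have PHK: "proj {0..} ` HK \<subseteq> HK" using proj_HK K supp_mono[of "{0..}" "{K..}"] by (auto simp: H_plus_supp)
  note ass = clinear_proj R_sub R_HK HK_sub EK_fin EK_ker PHK
  {
    assume "fredholm_index_zero pr_plus X (H_plus \<inter> A)"
    then obtain C where C: "finite_cdim {f \<in> X. pr_plus f = 0}" "finite_cdim C" "pr_plus ` X \<inter> C = {0}"
      "ssum (pr_plus ` X) C = H_plus \<inter> A" "cdim C = cdim {f \<in> X. pr_plus f = 0}"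
      unfolding fredholm_index_zero_def by auto
    have "cdim (R \<inter> EK) = cdim {f \<in> X. pr_plus f = 0}"
      unfolding ker_R[symmetric] using inj by (intro cdim_image clinear_proj C(1)) auto
    then show index0 unfolding index0_def using complement_lift[OF ass _ C(2), unfolded proj_R proj_HK] C by simp
  next
    assume index0
    then obtain Q where Q: "finite_cdim Q" "R \<inter> Q = {0}" "ssum R Q = HK" "cdim Q = cdim EK"
      unfolding index0_def by (elim exE conjE)
    have "finite_cdim (R \<inter> EK) \<and> (\<exists>C. finite_cdim C \<and> proj {0..} ` R \<inter> C = {0} \<and> ssum (proj {0..} ` R) C = proj {0..} ` HK \<and> cdim C = cdim (R \<inter> EK))"
      by (rule complement_push[OF ass _ Q]) simp
    then obtain C where C: "finite_cdim (R \<inter> EK)" "finite_cdim C" "pr_plus ` X \<inter> C = {0}"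
      "ssum (pr_plus ` X) C = H_plus \<inter> A" "cdim C = cdim (R \<inter> EK)"
      unfolding proj_R proj_HK by (elim exE conjE)
    have fk: "finite_cdim {f \<in> X. pr_plus f = 0}"
      by (rule finite_cdim_inj[OF clinear_proj[of "{K..}"] ker_sub]) (use inj C(1) ker_R in auto)
    have dk: "cdim (R \<inter> EK) = cdim {f \<in> X. pr_plus f = 0}"
      unfolding ker_R[symmetric] using inj by (intro cdim_image clinear_proj fk) auto
    have sub: "pr_plus ` X \<subseteq> H_plus \<inter> A"
      using X(3) ambient_proj[OF A] proj_in_supp by (auto simp: pr_plus_eq H_plus_supp)
    \<comment> \<open>The range of \<open>pr_plus\<close> consists of the elements of
      \<open>R + EK\<close> without negative exponents, and a finite-dimensional extension of the
      closed space \<open>R\<close> is closed.\<close>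
    have "closed (pr_plus ` X)"
    proof -
      obtain B where B: "finite B" "span B = EK" using finite_cdim_real_span[OF EK_fin] by blast
      have "closed {x + id e | x e. x \<in> R \<and> e \<in> span B}"
        using R_sub R_closed B(1) by (intro closed_add_image_span) (auto simp: csubspace_iff id_def intro: linear_id[unfolded id_def])
      then have "closed (ssum R EK \<inter> supp {0..})" unfolding B(2) id_apply by (intro closed_Int closed_supp)
      moreover have "ssum R EK \<inter> supp {0..} = pr_plus ` X" unfolding proj_R[symmetric]
      proof (intro equalityI subsetI)
        fix y assume "y \<in> ssum R EK \<inter> supp {0..}"
        then obtain r e where y: "y = r + e" "r \<in> R" "e \<in> EK" "proj {0..} y = y" by (auto simp: supp_def)
        have "proj {0..} e = 0" using y(3) unfolding EK_ker by blast
        then have "y = proj {0..} r" using y(1,4) by (simp add: proj_add)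
        then show "y \<in> proj {0..} ` R" using y by blast
      next
        fix y assume "y \<in> proj {0..} ` R"
        then obtain r where r: "y = proj {0..} r" "r \<in> R" by blast
        have "r \<in> HK" using r R_HK by blast
        then have "y = r + proj {K..<0} (lmult (-1) r)" unfolding r(1) by (intro L2H_eqI) (auto simp: supp_iff)
        moreover have "proj {K..<0} (lmult (-1) r) \<in> EK"
          using \<open>r \<in> HK\<close> ambient_proj[OF A] proj_in_supp ambient_csubspace[OF A]
          by (auto simp: lmult_minus intro!: cvs.subspace_neg)
        moreover have "y \<in> supp {0..}" unfolding r(1) by (rule proj_in_supp)
        ultimately show "y \<in> ssum R EK \<inter> supp {0..}" using r(2) by blast
      qed
      ultimately show ?thesis by simp
    qed
    then show "fredholm_index_zero pr_plus X (H_plus \<inter> A)"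
      unfolding fredholm_index_zero_def using sub fk dk C by auto
  }
qed

text \<open>Among the complements of \<open>R\<close> the orthogonal one makes Pythagoras available
  for the contraction argument. Its elements are moreover orthogonal to \<open>X\<close> itself and
  so impose linear relations on the coefficients of elements of \<open>X\<close>.\<close>

definition Qort :: "L2H set" where
  "Qort = {h \<in> HK. \<forall>r\<in>R. inner h r = 0}"

lemma Qort_sub: "cvs.subspace Qort"
proof -
  have "lmult quat_i h \<in> Qort" if "h \<in> Qort" for h
  proof -
    have cn: "quat_cnj quat_i = - quat_i" by (simp add: quat_eq_iff quat_cnj_def)
    have "inner (lmult quat_i h) r = 0" if "r \<in> R" for r
    proof -
      have "lmult quat_i r \<in> R" using that R_sub unfolding csubspace_iff by blast
      then have "lmult (- quat_i) r \<in> R" unfolding lmult_minus by (rule cvs.subspace_neg[OF R_sub])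
      moreover have "\<forall>r\<in>R. inner h r = 0" using \<open>h \<in> Qort\<close> unfolding Qort_def by blast
      ultimately show ?thesis unfolding inner_lmult cn by blast
    qed
    then show ?thesis using that HK_sub by (simp add: csubspace_iff Qort_def)
  qed
  moreover have "subspace Qort" using HK_sub by (auto simp: csubspace_iff subspace_def Qort_def inner_add_left)
  ultimately show ?thesis by (simp add: csubspace_iff)
qed

lemma Qort_Int: "R \<inter> Qort = {0}"
proof (intro equalityI subsetI)
  fix x assume "x \<in> R \<inter> Qort"
  then have "inner x x = 0" unfolding Qort_def by blast
  then show "x \<in> {0}" by simp
qed (use cvs.subspace_0[OF R_sub] cvs.subspace_0[OF Qort_sub] in simp)

lemma Qort_sum: "ssum R Qort = HK"
proof (intro equalityI subsetI)
  fix x assume "x \<in> ssum R Qort"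
  then obtain r q where "x = r + q" "r \<in> R" "q \<in> Qort" by blast
  then have "x = r + q" "r \<in> HK" "q \<in> HK" using R_HK by (blast, blast, simp add: Qort_def)
  then show "x \<in> HK" using cvs.subspace_add[OF HK_sub] by blast
next
  fix x assume x: "x \<in> HK"
  obtain y where y: "y \<in> R" "\<And>v. v \<in> R \<Longrightarrow> inner (x - y) v = 0"
    using exists_orthogonal_projection[of R x] R_sub R_closed by (auto simp: csubspace_iff)
  have "x - y \<in> HK" by (rule cvs.subspace_diff[OF HK_sub x]) (use y R_HK in blast)
  then have "x - y \<in> Qort" using y(2) unfolding Qort_def by blast
  moreover have "x = y + (x - y)" by simp
  ultimately show "x \<in> ssum R Qort" using y(1) by blast
qed

lemma index0_Qort: "index0 \<longleftrightarrow> finite_cdim Qort \<and> cdim Qort = cdim EK"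
proof
  assume index0
  then obtain Q where Q: "finite_cdim Q" "R \<inter> Q = {0}" "ssum R Q = HK" "cdim Q = cdim EK"
    unfolding index0_def by (elim exE conjE)
  have 1: "finite_cdim Qort \<and> cdim Qort \<le> cdim Q"
    using complement_dim_le[OF R_sub Q(1) Qort_sub Qort_Int] Q(3) by (auto simp: Qort_def)
  have "Q \<subseteq> HK" using Q(3) cvs.subspace_0[OF R_sub] by force
  then have "cdim Q \<le> cdim Qort"
    using complement_dim_le[OF R_sub _ finite_cdim_csubspace[OF Q(1)] Q(2), of Qort] 1 Qort_sum by simp
  then show "finite_cdim Qort \<and> cdim Qort = cdim EK" using 1 Q(4) by simp
next
  assume "finite_cdim Qort \<and> cdim Qort = cdim EK"
  then show index0 unfolding index0_def using Qort_Int Qort_sum by (intro exI[of _ Qort] conjI) simp_all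
qed

end

section \<open>Invariance under \<open>\<Gamma>\<^sub>+\<close>\<close>

lemma pser_sum:
  assumes "summable (\<lambda>n. cmod (a n))"
  shows "pser (\<lambda>x. \<Sum>n. a n * x ^ n) a"
proof -
  have s: "summable (\<lambda>n. a n * x ^ n)" if "cmod x = 1" for x
    by (rule summable_norm_cancel) (use assms that in \<open>simp add: norm_mult norm_power\<close>)
  have "uniform_limit (sphere 0 1) (\<lambda>n x. \<Sum>i<n. a i * x ^ i) (\<lambda>x. \<Sum>i. a i * x ^ i) sequentially"
    by (rule Weierstrass_m_test[OF _ assms]) (simp add: norm_mult norm_power)
  then have "continuous_on (sphere 0 1) (\<lambda>x. \<Sum>i. a i * x ^ i)"
    by (rule uniform_limit_theorem[rotated]) (auto intro!: always_eventually continuous_intros)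
  then show ?thesis unfolding pser_def using assms s by (auto simp: summable_sums)
qed

lemma pser_supp:
  assumes "pser g a" "f \<in> supp {K..}" shows "rmult f g \<in> supp {K..}"
proof -
  have "fourier (rmult f g) m = 0" if "m < K" for m
  proof -
    have "(\<lambda>n. fourier f (m - int n) * qc (a n)) = (\<lambda>n. 0)"
      using assms(2) that by (auto simp: supp_iff)
    then show ?thesis using fourier_rmult_pser[OF assms(1), of f m] by (simp add: sums_iff)
  qed
  then show ?thesis by (auto simp: supp_iff)
qed

text \<open>Units whose inverse has the same kind of expansion, so that both preserve each
  \<open>supp {K..}\<close>. The exponentials \<open>gam c\<close> and \<open>exp (z * x)\<close>
  and the non-zero constants are instances.\<close>

definition punit :: "(complex \<Rightarrow> complex) \<Rightarrow> (complex \<Rightarrow> complex) \<Rightarrow> bool" where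
  "punit g g' \<longleftrightarrow> (\<exists>a. pser g a) \<and> (\<exists>a. pser g' a) \<and> (\<forall>x. cmod x = 1 \<longrightarrow> g x * g' x = 1)"

lemma punit_sym: "punit g g' \<Longrightarrow> punit g' g" by (auto simp: punit_def mult.commute)

lemma punit_continuous: "punit g g' \<Longrightarrow> continuous_on (sphere 0 1) g \<and> continuous_on (sphere 0 1) g'"
  by (auto simp: punit_def pser_def)

lemma punit_cancel: assumes "punit g g'" shows "rmult (rmult f g) g' = f"
proof -
  have "rmult (rmult f g) g' = rmult f (\<lambda>x. g x * g' x)"
    using punit_continuous[OF assms] by (intro rmult_rmult) auto
  also have "\<dots> = rmult f (\<lambda>x. 1)"
    using assms by (intro rmult_cong continuous_intros) (auto simp: punit_def pser_def)
  finally show ?thesis by simp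
qed

lemma punit_supp: "punit g g' \<Longrightarrow> f \<in> supp {K..} \<Longrightarrow> rmult f g \<in> supp {K..}"
  by (auto simp: punit_def intro: pser_supp)

lemma punit_bound: assumes "punit g g'" shows "\<exists>C>0. \<forall>f. norm (rmult f g) \<le> C * norm f"
proof -
  have "bounded_linear (\<lambda>f. rmult f g)" using punit_continuous[OF assms] by (intro bounded_linear_rmult) auto
  from bounded_linear.pos_bounded[OF this] show ?thesis by (auto simp: mult.commute)
qed

lemma punit_closed_image:
  assumes "punit g g'" "cvs.subspace X" "closed X"
  shows "cvs.subspace (gr_act g X)" "closed (gr_act g X)"
proof -
  obtain C where C: "C > 0" "\<And>f. norm (rmult f g') \<le> C * norm f" using punit_bound[OF punit_sym[OF assms(1)]] by blast
  have "norm f \<le> C * norm (rmult f g)" for f using C(2)[of "rmult f g"] punit_cancel[OF assms(1)] by simp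
  then have "(1/C) * norm f \<le> norm (rmult f g)" for f using C(1) by (simp add: field_simps)
  then show "closed (gr_act g X)" unfolding gr_act_def using assms(2,3) C(1) punit_continuous[OF assms(1)]
    by (intro closed_image_bounded_below[where e = "1/C"] bounded_linear_rmult) (auto simp: csubspace_iff)
  show "cvs.subspace (gr_act g X)" unfolding gr_act_def
  proof -
    interpret T: Vector_Spaces.linear "\<lambda>c. lmult (qc c)" "\<lambda>c. lmult (qc c)" "\<lambda>f. rmult f g" by (rule clinear_rmult)
    show "cvs.subspace ((\<lambda>f. rmult f g) ` X)" using T.subspace_image[OF assms(2)] .
  qed
qed

lemma HSdom_rmult:
  assumes "HSdom X" "punit g g'" shows "HSdom (gr_act g X)"
proof -
  obtain \<nu> where \<nu>: "\<And>m. 0 \<le> \<nu> m" "(\<lambda>m. (\<nu> m)\<^sup>2) summable_on {..<0::int}"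
    "\<And>w m. w \<in> X \<Longrightarrow> m < 0 \<Longrightarrow> norm (fourier w m) \<le> \<nu> m * norm w"
    using assms(1) by (auto simp: HSdom_def)
  obtain a where a: "pser g a" using assms(2) by (auto simp: punit_def)
  obtain C where C: "C > 0" "\<And>f. norm (rmult f g') \<le> C * norm f" using punit_bound[OF punit_sym[OF assms(2)]] by blast
  define b where "b = (\<lambda>n. complex_of_real (cmod (a n)))"
  have b: "pser (\<lambda>x. \<Sum>n. b n * x ^ n) b" by (rule pser_sum) (use a in \<open>simp add: b_def pser_def\<close>)
  \<comment> \<open>The bounds become the coefficients of an element \<open>v\<close> of
    \<open>H\<close>. Multiplying \<open>v\<close> by the series of absolute values convolves them,
    and the result is square summable because it consists of Fourier coefficients again.\<close>
  define v where "v = synth (\<lambda>m. if m < 0 then qc (of_real (\<nu> m)) else 0)"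
  have "(\<lambda>m. (norm (if m < 0 then qc (of_real (\<nu> m)) else 0))\<^sup>2) summable_on UNIV"
    by (rule summable_on_cong_neutral[THEN iffD1, OF _ _ _ \<nu>(2)]) auto
  then have fv: "fourier v m = (if m < 0 then qc (of_real (\<nu> m)) else 0)" for m
    unfolding v_def by (rule fourier_synth)
  define r where "r = rmult v (\<lambda>x. \<Sum>n. b n * x ^ n)"
  define \<nu>' where "\<nu>' = (\<lambda>m. C * norm (fourier r m))"
  have "(\<lambda>m. (\<nu>' m)\<^sup>2) summable_on {..<0}" unfolding \<nu>'_def power_mult_distrib
    by (intro summable_on_cmult_right summable_on_subset_banach[OF fourier_square_summable]) auto
  moreover have "norm (fourier w m) \<le> \<nu>' m * norm w" if "w \<in> gr_act g X" "m < 0" for w m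
  proof -
    obtain u where u: "u \<in> X" "w = rmult u g" using \<open>w \<in> gr_act g X\<close> by (auto simp: gr_act_def)
    have nu: "norm u \<le> C * norm w" using C(2)[of w] punit_cancel[OF assms(2)] u by simp
    have 1: "(\<lambda>n. fourier u (m - int n) * qc (a n)) sums fourier w m"
      using fourier_rmult_pser[OF a, of u m] u by simp
    have "(\<lambda>n. fourier v (m - int n) * qc (b n)) sums fourier r m"
      unfolding r_def by (rule fourier_rmult_pser[OF b])
    moreover have "fourier v (m - int n) * qc (b n) = (\<nu> (m - int n) * cmod (a n)) *\<^sub>R 1" for n
      using \<open>m < 0\<close> qc_scaleR[of "\<nu> (m - int n) * cmod (a n)" 1] by (simp add: fv b_def flip: qc_mult of_real_mult)
    ultimately have 2: "(\<lambda>n. (\<nu> (m - int n) * cmod (a n)) *\<^sub>R 1) sums fourier r m" by simp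
    have s: "summable (\<lambda>n. \<nu> (m - int n) * cmod (a n))"
      using sums_summable[OF bounded_linear.sums[OF bounded_linear_compose[OF bounded_linear_Re bounded_linear_cpart] 2]] by simp
    have r: "fourier r m = (\<Sum>n. \<nu> (m - int n) * cmod (a n)) *\<^sub>R 1"
      using sums_unique2[OF 2 bounded_linear.sums[OF bounded_linear_scaleR_left summable_sums[OF s]]] .
    have rn: "norm (fourier r m) = (\<Sum>n. \<nu> (m - int n) * cmod (a n))"
      unfolding r using suminf_nonneg[OF s] \<nu>(1) by simp
    have le: "norm (fourier u (m - int n) * qc (a n)) \<le> norm u * (\<nu> (m - int n) * cmod (a n))" for n
      using mult_right_mono[OF \<nu>(3)[OF u(1), of "m - int n"], of "cmod (a n)"] \<open>m < 0\<close> by (simp add: norm_mult mult_ac)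
    have sn: "summable (\<lambda>n. norm (fourier u (m - int n) * qc (a n)))"
      by (rule summable_comparison_test'[OF summable_mult[OF s, of "norm u"]]) (use le in simp)
    have "norm (fourier w m) \<le> (\<Sum>n. norm (fourier u (m - int n) * qc (a n)))"
      using summable_norm[OF sn] sums_unique[OF 1] by simp
    also have "\<dots> \<le> (\<Sum>n. norm u * (\<nu> (m - int n) * cmod (a n)))"
      by (rule suminf_le[OF le sn summable_mult[OF s]])
    also have "\<dots> = norm u * norm (fourier r m)" unfolding rn by (rule suminf_mult[OF s])
    also have "\<dots> \<le> (C * norm w) * norm (fourier r m)" by (rule mult_right_mono[OF nu]) simp
    finally show ?thesis by (simp add: \<nu>'_def mult_ac)
  qed
  ultimately show ?thesis unfolding HSdom_def using C(1) by (intro exI[of _ \<nu>']) (auto simp: \<nu>'_def)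
qed

text \<open>If the window is low enough, truncation below \<open>K\<close> perturbs multiplication by \<open>g\<close> only by a
  contraction. Hence multiplication carries a complement of \<open>R\<close> to a complement of the truncation of
  \<open>X g\<close>, of the same dimension.\<close>

theorem fredholm_index_zero_rmult:
  assumes A: "ambient A" and X: "cvs.subspace X" "closed X" "X \<subseteq> A" "HSdom X"
    and g: "punit g g'" and fred: "fredholm_index_zero pr_plus X (H_plus \<inter> A)"
  shows "fredholm_index_zero pr_plus (gr_act g X) (H_plus \<inter> A)"
proof -
  let ?X' = "gr_act g X"
  obtain C where C: "C > 0" "\<And>f. norm (rmult f g) \<le> C * norm f" using punit_bound[OF g] by blast
  obtain C' where C': "C' > 0" "\<And>f. norm (rmult f g') \<le> C' * norm f" using punit_bound[OF punit_sym[OF g]] by blast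
  \<comment> \<open>Small enough that the truncation error, multiplied by \<open>C\<close>, by
    \<open>C'\<close> and by the factor 2 of \<open>W.below\<close>, is at most one half.\<close>
  define e where "e = min (1/2) (1 / (4 * C * C'))"
  have e: "e > 0" "e \<le> 1/2" "C' * C * e * 2 \<le> 1/2" using C(1) C'(1) by (auto simp: e_def min_def field_simps)
  obtain K1 where K1: "\<And>K w. K \<le> K1 \<Longrightarrow> w \<in> X \<Longrightarrow> norm (proj {..<K} w) \<le> e * norm w"
    using HSdom_tail[OF X(4) e(1)] by blast
  obtain K2 where K2: "\<And>K w. K \<le> K2 \<Longrightarrow> w \<in> ?X' \<Longrightarrow> norm (proj {..<K} w) \<le> 1/2 * norm w"
    using HSdom_tail[OF HSdom_rmult[OF X(4) g], of "1/2"] by auto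
  define K where "K = min 0 (min K1 K2)"
  have K: "K \<le> 0" "K \<le> K1" "K \<le> K2" by (auto simp: K_def)
  have X'A: "?X' \<subseteq> A" using X(3) ambient_rmult[OF A] by (auto simp: gr_act_def)
  interpret W: window A X K
  proof
    fix w assume "w \<in> X"
    then have "norm (proj {..<K} w) \<le> e * norm w" using K1[OF K(2)] by blast
    also have "\<dots> \<le> 1/2 * norm w" using e by (intro mult_right_mono) auto
    finally show "norm (proj {..<K} w) \<le> 1/2 * norm w" .
  qed (use A X K in auto)
  interpret W': window A ?X' K by standard (use A punit_closed_image[OF g X(1,2)] X'A K K2[OF K(3)] in auto)
  have Q: "finite_cdim W.Qort" "cdim W.Qort = cdim W.EK" using fred W.index0_fredholm W.index0_Qort by auto
  have HKr: "rmult h g \<in> W.HK" "rmult h g' \<in> W.HK" if "h \<in> W.HK" for h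
    using that punit_supp[OF g] punit_supp[OF punit_sym[OF g]] ambient_rmult[OF A] by auto
  \<comment> \<open>The difference between truncating after and before multiplying by
    \<open>g\<close>, divided by \<open>g\<close>; see \<open>key\<close>. It sees only the part of
    \<open>w\<close> below \<open>K\<close> and is therefore small.\<close>
  define B where "B = (\<lambda>w. rmult (proj {K..} (rmult (proj {..<K} w) g)) g')"
  have Bnorm: "norm (B w) \<le> 1/2 * norm (proj {K..} w)" if "w \<in> X" for w
  proof -
    have "norm (B w) \<le> C' * (C * (e * norm w))" unfolding B_def
      using C' C K1[OF K(2) that] order_trans[OF norm_proj_le, of "rmult (proj {..<K} w) g"]
      by (meson less_imp_le mult_left_mono order_trans)
    also have "\<dots> \<le> C' * (C * (e * (2 * norm (proj {K..} w))))"
      using C' C e W.below[OF that] by (intro mult_left_mono) auto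
    also have "\<dots> = (C' * C * e * 2) * norm (proj {K..} w)" by simp
    also have "\<dots> \<le> 1/2 * norm (proj {K..} w)" using e by (intro mult_right_mono) auto
    finally show ?thesis .
  qed
  have BHK: "B w \<in> W.HK" if "w \<in> X" for w
    unfolding B_def using that X(3) ambient_proj[OF A] ambient_rmult[OF A] proj_in_supp punit_supp[OF punit_sym[OF g]] by auto
  have key: "proj {K..} (rmult w g) = rmult (proj {K..} w + B w) g" if "w \<in> X" for w
  proof -
    have "w = proj {K..} w + proj {..<K} w" by (rule L2H_eqI) simp
    then have "rmult w g = rmult (proj {K..} w) g + rmult (proj {..<K} w) g" by (metis rmult_add)
    then have "proj {K..} (rmult w g) = proj {K..} (rmult (proj {K..} w) g) + proj {K..} (rmult (proj {..<K} w) g)"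
      by (simp add: proj_add)
    also have "proj {K..} (rmult (proj {K..} w) g) = rmult (proj {K..} w) g"
      using punit_supp[OF g proj_in_supp] by (simp add: supp_def)
    also have "proj {K..} (rmult (proj {..<K} w) g) = rmult (B w) g"
      unfolding B_def by (rule punit_cancel[OF punit_sym[OF g], symmetric])
    finally show ?thesis by (simp add: rmult_add)
  qed
  have pyth: "norm (proj {K..} w) \<le> norm (proj {K..} w + q)" if "w \<in> X" "q \<in> W.Qort" for w q
  proof (rule power2_le_imp_le)
    have "inner q (proj {K..} w) = 0" using that unfolding W.Qort_def by blast
    then have "(norm (proj {K..} w + q))\<^sup>2 = (norm (proj {K..} w))\<^sup>2 + (norm q)\<^sup>2"
      by (simp add: power2_norm_eq_inner inner_add_left inner_add_right inner_commute)
    then show "(norm (proj {K..} w))\<^sup>2 \<le> (norm (proj {K..} w + q))\<^sup>2" by simp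
  qed simp
  define wf where "wf = (\<lambda>h. SOME w. w \<in> X \<and> h - proj {K..} w \<in> W.Qort)"
  have wf: "wf h \<in> X" "h - proj {K..} (wf h) \<in> W.Qort" if "h \<in> W.HK" for h
  proof -
    have "\<exists>w. w \<in> X \<and> h - proj {K..} w \<in> W.Qort"
    proof -
      obtain r q where "h = r + q" "r \<in> W.R" "q \<in> W.Qort" using \<open>h \<in> W.HK\<close> W.Qort_sum by blast
      then show ?thesis by auto
    qed
    from someI_ex[OF this] show "wf h \<in> X" "h - proj {K..} (wf h) \<in> W.Qort" by (auto simp: wf_def)
  qed
  have B_diff: "B u - B v = B (u - v)" for u v by (simp add: B_def proj_diff rmult_diff)
  have surj: "\<exists>w\<in>X. \<exists>q\<in>W.Qort. y = proj {K..} w + B w + q" if y: "y \<in> W.HK" for y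
  proof -
    \<comment> \<open>Solves \<open>h + B (wf h) = y\<close>, where \<open>wf h\<close> is the
      element of \<open>X\<close> lying over the component of \<open>h\<close> in \<open>R\<close>.
      By \<open>pyth\<close> taking that component does not increase norms, so the map is a
      contraction with constant 1/2.\<close>
    have "\<exists>!h\<in>W.HK. y - B (wf h) = h"
    proof (rule Banach_fix[where c = "1/2"])
      show "complete W.HK" using W.HK_closed by (simp add: complete_eq_closed)
      show "W.HK \<noteq> {}" using y by blast
      show "(\<lambda>h. y - B (wf h)) ` W.HK \<subseteq> W.HK"
        using BHK wf(1) cvs.subspace_diff[OF W.HK_sub y] by blast
      fix h1 h2 assume h: "h1 \<in> W.HK" "h2 \<in> W.HK"
      let ?w = "wf h2 - wf h1"
      have wX: "?w \<in> X" using cvs.subspace_diff[OF X(1)] wf(1) h by blast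
      have "(h2 - proj {K..} (wf h2)) - (h1 - proj {K..} (wf h1)) \<in> W.Qort"
        by (rule cvs.subspace_diff[OF W.Qort_sub]) (use wf(2) h in blast)+
      from pyth[OF wX this] have "norm (proj {K..} ?w) \<le> norm (h2 - h1)" by (simp add: proj_diff algebra_simps)
      have "dist (y - B (wf h1)) (y - B (wf h2)) = norm (B ?w)" by (simp add: dist_norm B_diff[symmetric])
      also have "\<dots> \<le> 1/2 * norm (proj {K..} ?w)" by (rule Bnorm[OF wX])
      also have "\<dots> \<le> 1/2 * dist h1 h2" using \<open>norm (proj {K..} ?w) \<le> norm (h2 - h1)\<close> by (simp add: dist_norm norm_minus_commute)
      finally show "dist (y - B (wf h1)) (y - B (wf h2)) \<le> 1/2 * dist h1 h2" .
    qed auto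
    then obtain h where h: "h \<in> W.HK" "y - B (wf h) = h" by blast
    have "y = proj {K..} (wf h) + B (wf h) + (h - proj {K..} (wf h))" using h(2) by (simp add: algebra_simps)
    then show ?thesis using wf[OF h(1)] by blast
  qed
  have inj: "q = 0" if "w \<in> X" "q \<in> W.Qort" "proj {K..} w + B w + q = 0" for w q
  proof -
    have eq: "proj {K..} w + q = - B w" using that(3) by (simp add: eq_neg_iff_add_eq_0 ac_simps)
    have "norm (proj {K..} w) \<le> norm (B w)" using pyth[OF that(1,2)] eq by simp
    then have "norm (proj {K..} w) = 0" "norm (B w) = 0" using Bnorm[OF that(1)] norm_ge_zero[of "proj {K..} w"] norm_ge_zero[of "B w"] by linarith+
    then show ?thesis using eq by simp
  qed
  let ?Q = "(\<lambda>f. rmult f g) ` W.Qort"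
  have "finite_cdim ?Q" by (rule finite_cdim_image[OF clinear_rmult Q(1)])
  moreover have "cdim ?Q = cdim W'.EK"
  proof -
    have "cdim ?Q = cdim W.Qort" by (rule cdim_image[OF clinear_rmult Q(1)]) (metis punit_cancel[OF g] rmult_0)
    then show ?thesis using Q(2) by simp
  qed
  moreover have "W'.R \<inter> ?Q = {0}"
  proof (intro equalityI subsetI)
    fix x assume "x \<in> W'.R \<inter> ?Q"
    then obtain w q where wq: "w \<in> X" "x = proj {K..} (rmult w g)" "q \<in> W.Qort" "x = rmult q g" by (auto simp: gr_act_def)
    then have "rmult (proj {K..} w + B w) g = rmult q g" using key by simp
    then have "proj {K..} w + B w = q" by (metis punit_cancel[OF g])
    then have z: "proj {K..} w + B w + - q = 0" by simp
    have "- q \<in> W.Qort" by (rule cvs.subspace_neg[OF W.Qort_sub wq(3)])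
    from inj[OF wq(1) this z] have "- q = 0" .
    then show "x \<in> {0}" using wq by simp
  next
    fix x :: L2H assume "x \<in> {0}"
    then show "x \<in> W'.R \<inter> ?Q" using cvs.subspace_0[OF W'.R_sub] cvs.subspace_0[OF W.Qort_sub] by (auto intro: image_eqI[of _ _ 0])
  qed
  moreover have "ssum W'.R ?Q = W'.HK"
  proof (intro equalityI subsetI)
    fix x assume "x \<in> ssum W'.R ?Q"
    then obtain r q where x: "x = r + rmult q g" "r \<in> W'.R" "q \<in> W.Qort" by blast
    have "r \<in> W'.HK" using x(2) W'.R_HK by blast
    moreover have "rmult q g \<in> W'.HK" using x(3) HKr(1) unfolding W.Qort_def by blast
    ultimately show "x \<in> W'.HK" unfolding x(1) by (rule cvs.subspace_add[OF W'.HK_sub])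
  next
    fix x assume x: "x \<in> W'.HK"
    obtain w q where wq: "w \<in> X" "q \<in> W.Qort" "rmult x g' = proj {K..} w + B w + q" using surj HKr(2)[OF x] by blast
    have "x = rmult (rmult x g') g" by (simp add: punit_cancel[OF punit_sym[OF g]])
    also have "\<dots> = proj {K..} (rmult w g) + rmult q g" unfolding wq(3) rmult_add[of _ q] key[OF wq(1)] ..
    finally show "x \<in> ssum W'.R ?Q" using wq(1,2) by (auto simp: gr_act_def)
  qed
  ultimately have "W'.index0" unfolding W'.index0_def by blast
  then show ?thesis using W'.index0_fredholm by simp
qed

declare One_nat_def [simp del]

section \<open>Exponential flows, the big cell and the parameters at which the Baker function
  exists\<close>

section \<open>Exponential multipliers\<close>

lemma valid_times_upd:
  assumes "c \<in> valid_times" shows "c(1 := z) \<in> valid_times"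
proof -
  have "conv_radius (c(1 := z)) = conv_radius c"
    by (rule conv_radius_cong', rule eventually_mono[OF eventually_ge_at_top[of 2]]) auto
  then show ?thesis using assms by (simp add: valid_times_def)
qed

lemma valid_times_0: "(\<lambda>_. 0) \<in> valid_times" by (simp add: valid_times_def)

lemma valid_times_uminus:
  assumes "c \<in> valid_times" shows "(\<lambda>k. - c k) \<in> valid_times"
  using assms conv_radius_cmult_left[of "-1" c] by (simp add: valid_times_def)

lemma valid_times_summable:
  assumes "c \<in> valid_times" "cmod x \<le> 1" shows "summable (\<lambda>k. c k * x ^ k)"
proof (rule summable_in_conv_radius)
  have "ereal (cmod x) \<le> 1" using assms(2) by simp
  also have "1 < conv_radius c" using assms(1) by (simp add: valid_times_def)
  finally show "ereal (norm x) < conv_radius c" .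
qed

lemma gam_uminus: "c \<in> valid_times \<Longrightarrow> cmod x = 1 \<Longrightarrow> gam (\<lambda>k. - c k) x = inverse (gam c x)"
  using suminf_minus[OF valid_times_summable[of c x]] by (simp add: gam_def exp_minus)

lemma gam_shift:
  assumes "c \<in> valid_times" "cmod x = 1"
  shows "gam (c(1 := c 1 + w)) x = gam c x * exp (w * x)"
proof -
  have "(\<lambda>k. c k * x ^ k + (if k = 1 then w * x else 0)) sums ((\<Sum>k. c k * x ^ k) + w * x)"
    by (intro sums_add summable_sums valid_times_summable assms sums_single) (use assms in simp)
  moreover have "(\<lambda>k. c k * x ^ k + (if k = 1 then w * x else 0)) = (\<lambda>k. (c(1 := c 1 + w)) k * x ^ k)"
    by (auto simp: algebra_simps)
  ultimately have "(\<lambda>k. (c(1 := c 1 + w)) k * x ^ k) sums ((\<Sum>k. c k * x ^ k) + w * x)" by (simp only:)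
  then show ?thesis by (simp add: gam_def sums_unique[symmetric] exp_add)
qed

text \<open>Convergence of the exponent beyond the unit disc makes \<open>gam c\<close> holomorphic
  there, so its coefficients decay geometrically. The rate, and not only summability, is spent in
  \<open>transfer\<close>.\<close>

lemma gam_series:
  assumes "c \<in> valid_times"
  shows "\<exists>a s C. s > 1 \<and> (\<forall>n. cmod (a n) * s ^ n \<le> C) \<and> pser (gam c) a"
proof -
  obtain r where r: "1 < ereal r" "ereal r < conv_radius c"
    using assms ereal_dense2[of 1 "conv_radius c"] by (auto simp: valid_times_def)
  then have r1: "r > 1" by simp
  have hol: "gam c holomorphic_on ball 0 r"
  proof -
    have "eval_fps (Abs_fps c) holomorphic_on ball 0 r"
    proof (rule holomorphic_on_eval_fps)
      show "ball (0::complex) r \<subseteq> eball 0 (fps_conv_radius (Abs_fps c))"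
      proof (rule subsetI)
        fix x :: complex assume x: "x \<in> ball 0 r"
        have "ereal (dist 0 x) < conv_radius c" by (rule less_trans[OF _ r(2)]) (use x in simp)
        then show "x \<in> eball 0 (fps_conv_radius (Abs_fps c))" by (simp add: fps_conv_radius_def in_eball_iff)
      qed
    qed
    then have "(\<lambda>z. exp (eval_fps (Abs_fps c) z)) holomorphic_on ball 0 r" by (rule holomorphic_on_exp')
    then show ?thesis by (simp add: gam_def[abs_def] eval_fps_def)
  qed
  define a where "a = (\<lambda>n. (deriv ^^ n) (gam c) 0 / fact n)"
  have ps: "(\<lambda>n. a n * x ^ n) sums gam c x" if "cmod x < r" for x
    using holomorphic_power_series[OF hol, of x] that by (simp add: a_def)
  \<comment> \<open>Strictly between 1 and \<open>r\<close>, so that the series still converges at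
    \<open>s\<close> and its terms stay bounded.\<close>
  define s where "s = (1 + r) / 2"
  have s: "s > 1" "s < r" using r1 by (auto simp: s_def)
  have "(\<lambda>n. a n * of_real s ^ n) \<longlonglongrightarrow> 0"
    using s by (intro summable_LIMSEQ_zero sums_summable[OF ps]) auto
  then have "Bseq (\<lambda>n. a n * of_real s ^ n)" by (intro convergent_imp_Bseq) (auto simp: convergent_def)
  then obtain C where C: "\<And>n. norm (a n * of_real s ^ n) \<le> C" by (auto simp: Bseq_def)
  then have C': "cmod (a n) * s ^ n \<le> C" for n using s C[of n] by (simp add: norm_mult norm_power)
  have "summable (\<lambda>n. cmod (a n))"
  proof (rule summable_comparison_test'[of "\<lambda>n. C * (1/s) ^ n" 0])
    show "summable (\<lambda>n. C * (1/s) ^ n)" using s by (intro summable_mult summable_geometric) simp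
    show "norm (cmod (a n)) \<le> C * (1/s) ^ n" for n using C'[of n] s by (simp add: field_simps power_divide)
  qed
  moreover have "continuous_on (sphere 0 1) (gam c)"
    by (rule continuous_on_subset[OF holomorphic_on_imp_continuous_on[OF hol]]) (use r1 in auto)
  ultimately have "pser (gam c) a" unfolding pser_def using ps r1 by auto
  then show ?thesis using s(1) C' by blast
qed

lemma punit_gam:
  assumes "c \<in> valid_times" shows "punit (gam c) (gam (\<lambda>k. - c k))"
  unfolding punit_def using gam_series[OF assms] gam_series[OF valid_times_uminus[OF assms]] gam_uminus[OF assms]
  by (auto simp: gam_def)

lemma gam_continuous: "c \<in> valid_times \<Longrightarrow> continuous_on (sphere 0 1) (gam c)"
  using punit_continuous[OF punit_gam] by blast

abbreviation (input) Ez :: "complex \<Rightarrow> complex \<Rightarrow> complex" where "Ez z \<equiv> (\<lambda>x. exp (z * x))"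

lemma Ez_continuous [continuous_intros]: "continuous_on S (Ez z)" by (intro continuous_intros)

lemma pser_Ez: "pser (Ez z) (\<lambda>n. z ^ n / fact n)" unfolding pser_def
proof (intro conjI allI impI Ez_continuous)
  show "summable (\<lambda>n. cmod (z ^ n / fact n))"
    using summable_exp[of "cmod z"] by (simp add: norm_divide norm_power inverse_eq_divide mult.commute)
  show "(\<lambda>n. z ^ n / fact n * x ^ n) sums exp (z * x)" for x
    using exp_converges[of "z * x"] by (simp add: power_mult_distrib scaleR_conv_of_real divide_inverse mult_ac)
qed

lemma punit_Ez: "punit (Ez z) (Ez (- z))" unfolding punit_def
proof (intro conjI)
  show "\<exists>a. pser (Ez z) a" "\<exists>a. pser (Ez (- z)) a" using pser_Ez by blast+
qed (simp flip: exp_add)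

lemma rmult_Ez_Ez: "rmult (rmult f (Ez a)) (Ez b) = rmult f (Ez (a + b))"
  by (subst rmult_rmult) (auto intro: Ez_continuous simp: distrib_right exp_add)

lemma rmult_gam_shift:
  assumes "c \<in> valid_times"
  shows "rmult f (gam (c(1 := c 1 + w))) = rmult (rmult f (Ez w)) (gam c)"
proof -
  have "rmult (rmult f (Ez w)) (gam c) = rmult f (\<lambda>x. exp (w * x) * gam c x)"
    by (rule rmult_rmult) (auto intro: Ez_continuous gam_continuous[OF assms])
  also have "\<dots> = rmult f (gam (c(1 := c 1 + w)))"
    using gam_shift[OF assms] by (intro rmult_cong continuous_intros gam_continuous[OF assms]) (auto simp: mult.commute)
  finally show ?thesis ..
qed

section \<open>The big cell\<close>

lemma lmult_H_closed:
  assumes "cvs.subspace W" "\<And>f. f \<in> W \<Longrightarrow> lmult quat_j f \<in> W" "f \<in> W"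
  shows "lmult q f \<in> W"
proof -
  have "lmult q f = lmult (qc (cpart q)) f + lmult (qc (jpart q)) (lmult quat_j f)"
    by (simp add: lmult_add_left[symmetric], rule arg_cong[where f = "\<lambda>q. lmult q f"]) (simp add: quat_eq_iff)
  then show ?thesis using assms by (simp del: lmult_lmult add: cvs.subspace_add cvs.subspace_scale)
qed

lemma lmult_unit_image:
  assumes "\<And>f. f \<in> W \<Longrightarrow> lmult q f \<in> W" "q * q = - 1" "subspace W"
  shows "lmult q ` W = W"
proof (intro equalityI subsetI)
  fix f assume f: "f \<in> W"
  have "- lmult q f \<in> W" using assms(1)[OF f] assms(3) by (simp add: subspace_neg)
  moreover have "lmult q (- lmult q f) = f" by (rule L2H_eqI) (simp add: assms(2) flip: mult.assoc)
  ultimately show "f \<in> lmult q ` W" by (metis imageI)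
qed (use assms(1) in auto)

lemma Gr_H_iff: "W \<in> Gr_H \<longleftrightarrow> cvs.subspace W \<and> closed W \<and> (\<forall>f\<in>W. lmult quat_j f \<in> W) \<and> HSdom W \<and>
    fredholm_index_zero pr_plus W H_plus"
proof
  assume W: "W \<in> Gr_H"
  then show "cvs.subspace W \<and> closed W \<and> (\<forall>f\<in>W. lmult quat_j f \<in> W) \<and> HSdom W \<and> fredholm_index_zero pr_plus W H_plus"
    by (auto simp: Gr_H_def Gr_C2_def csubspace_iff hilbert_schmidt_imp_HSdom)
next
  assume W: "cvs.subspace W \<and> closed W \<and> (\<forall>f\<in>W. lmult quat_j f \<in> W) \<and> HSdom W \<and> fredholm_index_zero pr_plus W H_plus"
  have q: "quat_i * quat_i = - 1" "quat_j * quat_j = - 1" by (simp_all add: quat_eq_iff)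
  show "W \<in> Gr_H"
    using W lmult_unit_image[OF _ q(1), of W] lmult_unit_image[OF _ q(2), of W] HSdom_imp_hilbert_schmidt[of W]
    by (auto simp: Gr_H_def Gr_C2_def csubspace_iff)
qed

lemma Gr_H_D:
  assumes "W \<in> Gr_H"
  shows "cvs.subspace W" "closed W" "\<And>f q. f \<in> W \<Longrightarrow> lmult q f \<in> W" "HSdom W" "fredholm_index_zero pr_plus W H_plus"
  using assms lmult_H_closed by (auto simp: Gr_H_iff)

lemma Gr_H_rmult:
  assumes W: "W \<in> Gr_H" and g: "punit g g'" shows "gr_act g W \<in> Gr_H"
proof -
  have amb: "ambient UNIV" by (simp add: ambient_def)
  have "fredholm_index_zero pr_plus (gr_act g W) (H_plus \<inter> UNIV)"
    by (rule fredholm_index_zero_rmult[OF amb]) (use Gr_H_D[OF W] g in auto)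
  moreover have "lmult quat_j f \<in> gr_act g W" if "f \<in> gr_act g W" for f
    using that Gr_H_D(3)[OF W] by (auto simp: gr_act_def rmult_lmult[symmetric])
  ultimately show ?thesis using punit_closed_image[OF g] HSdom_rmult[OF _ g] Gr_H_D[OF W] by (auto simp: Gr_H_iff)
qed

text \<open>This is \<open>W\<close> divided by \<open>gam c\<close>, written as a preimage: the
  Baker function over \<open>gam c\<close> is its element with non-negative part 1.\<close>

definition W_gam :: "L2H set \<Rightarrow> times \<Rightarrow> L2H set" where
  "W_gam W c = {f. rmult f (gam c) \<in> W}"

lemma W_gam_eq:
  assumes "c \<in> valid_times" shows "W_gam W c = gr_act (gam (\<lambda>k. - c k)) W"
proof (intro equalityI subsetI)
  fix f assume "f \<in> W_gam W c"
  then show "f \<in> gr_act (gam (\<lambda>k. - c k)) W"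
    unfolding W_gam_def gr_act_def using punit_cancel[OF punit_gam[OF assms], of f]
    by (auto intro!: image_eqI[of _ _ "rmult f (gam c)"])
next
  fix f assume "f \<in> gr_act (gam (\<lambda>k. - c k)) W"
  then show "f \<in> W_gam W c"
    unfolding W_gam_def gr_act_def by (auto simp: punit_cancel[OF punit_sym[OF punit_gam[OF assms]]])
qed

lemma W_gam_Gr_H: "W \<in> Gr_H \<Longrightarrow> c \<in> valid_times \<Longrightarrow> W_gam W c \<in> Gr_H"
  using Gr_H_rmult[OF _ punit_sym[OF punit_gam]] by (simp add: W_gam_eq)

lemma W_gam_shift:
  "c \<in> valid_times \<Longrightarrow> f \<in> W_gam W (c(1 := c 1 + w)) \<longleftrightarrow> rmult f (Ez w) \<in> W_gam W c"
  by (simp add: W_gam_def rmult_gam_shift)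

text \<open>Only injectivity of \<open>pr_plus\<close> is demanded; index zero turns it into
  bijectivity onto \<open>H_plus\<close>.\<close>

definition bigcell :: "L2H set \<Rightarrow> bool" where
  "bigcell V \<longleftrightarrow> V \<in> Gr_H \<and> V \<inter> H_minus = {0}"

lemma bigcellI: "V \<in> Gr_H \<Longrightarrow> (\<And>f. f \<in> V \<Longrightarrow> f \<in> H_minus \<Longrightarrow> f = 0) \<Longrightarrow> bigcell V"
  unfolding bigcell_def using cvs.subspace_0[OF Gr_H_D(1)] by (auto simp: H_minus_supp supp_iff)

lemma bigcell_eqI:
  assumes V: "bigcell V" and "f \<in> V" "g \<in> V" "proj {0..} f = proj {0..} g"
  shows "f = g"
proof -
  have "f - g \<in> V" using V assms Gr_H_D(1) by (auto simp: bigcell_def intro: cvs.subspace_diff)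
  moreover have "f - g \<in> H_minus"
  proof -
    have "fourier f m = fourier g m" if "m \<ge> 0" for m
      using arg_cong[OF assms(4), of "\<lambda>h. fourier h m"] that by simp
    then show ?thesis by (simp add: H_minus_supp supp_iff)
  qed
  ultimately have fg: "f - g \<in> V \<inter> H_minus" by (rule IntI)
  have VH: "V \<inter> H_minus = {0}" using V unfolding bigcell_def by (rule conjunct2)
  show ?thesis using fg unfolding VH by simp
qed

lemma cdim_0_imp:
  assumes "finite_cdim C" "cdim C = 0" shows "C = {0}"
proof -
  obtain B where B: "finite B" "cvs.independent B" "cspan B = C" "card B = cdim C"
    using finite_cdim_basis[OF assms(1)] by blast
  then have "B = {}" using assms(2) by simp
  then show ?thesis using B(3) cvs.span_empty by metis
qed

lemma bigcell_surj:
  assumes V: "bigcell V" shows "pr_plus ` V = H_plus"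
proof -
  have VG: "V \<in> Gr_H" using V by (simp add: bigcell_def)
  obtain C where C: "finite_cdim C" "pr_plus ` V \<inter> C = {0}" "ssum (pr_plus ` V) C = H_plus" "cdim C = cdim {f \<in> V. pr_plus f = 0}"
    using Gr_H_D(5)[OF VG] unfolding fredholm_index_zero_def by (elim conjE exE)
  have k0: "{f \<in> V. pr_plus f = 0} = {0}"
  proof (intro equalityI subsetI)
    fix f assume f: "f \<in> {f \<in> V. pr_plus f = 0}"
    then have "f = 0" using cvs.subspace_0[OF Gr_H_D(1)[OF VG]] by - (rule bigcell_eqI[OF V], auto simp: pr_plus_eq)
    then show "f \<in> {0}" by simp
  qed (use cvs.subspace_0[OF Gr_H_D(1)[OF VG]] in \<open>simp add: pr_plus_eq\<close>)
  have d0: "cdim {0} = 0" using cvs.dim_span_eq_card_independent[of "{}"] cvs.span_empty cvs.independent_empty by (metis card.empty)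
  have C0: "C = {0}" by (rule cdim_0_imp[OF C(1)]) (simp only: C(4) k0 d0)
  show ?thesis using C(3) unfolding C0 by simp
qed

text \<open>The part of \<open>w\<close> below \<open>K\<close> is dominated by the rest, and the
  window \<open>EK\<close> meets \<open>R\<close> only in 0, so
  \<open>finite_span_bounded_below\<close> controls what lies between \<open>K\<close> and
  0.\<close>

lemma bigcell_bound:
  assumes V: "bigcell V" shows "\<exists>C>0. \<forall>w\<in>V. norm w \<le> C * norm (proj {0..} w)"
proof -
  have VG: "V \<in> Gr_H" using V by (simp add: bigcell_def)
  obtain K where K: "K \<le> 0" "\<And>w. w \<in> V \<Longrightarrow> norm (proj {..<K} w) \<le> 1/2 * norm w"
    using HSdom_tail[OF Gr_H_D(4)[OF VG], of "1/2"] by auto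
  interpret W: window UNIV V K by standard (use K Gr_H_D[OF VG] in \<open>auto simp: ambient_def\<close>)
  obtain B where B: "finite B" "span B = W.EK" using finite_cdim_real_span[OF W.EK_fin] by blast
  have "\<exists>\<delta>>0. \<forall>x\<in>W.R. \<forall>e\<in>span B. \<delta> * norm e \<le> norm (x + id e)"
  proof (rule finite_span_bounded_below)
    show "subspace W.R" using W.R_sub by (simp add: csubspace_iff)
    fix e assume e: "e \<in> span B" "id e \<in> W.R"
    then have "e \<in> W.R \<inter> W.EK" using B(2) by simp
    then obtain w where w: "w \<in> V" "pr_plus w = 0" "e = proj {K..} w" unfolding W.ker_R[symmetric] by blast
    then have "w = 0" using cvs.subspace_0[OF Gr_H_D(1)[OF VG]] by - (rule bigcell_eqI[OF V], auto simp: pr_plus_eq)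
    then show "e = 0" using w by simp
  qed (use W.R_closed B in \<open>auto simp: id_def intro: linear_id[unfolded id_def]\<close>)
  then obtain d where d: "d > 0" "\<And>x e. x \<in> W.R \<Longrightarrow> e \<in> W.EK \<Longrightarrow> d * norm e \<le> norm (x + e)"
    unfolding B(2) by auto
  have "norm w \<le> (2 + 2 / d) * norm (proj {0..} w)" if w: "w \<in> V" for w
  proof -
    \<comment> \<open>Minus the window part of \<open>w\<close>, so that adding it to the truncation
      at \<open>K\<close> leaves the non-negative part.\<close>
    let ?e = "proj {K..<0} (- w)"
    have eq: "proj {K..} w + ?e = proj {0..} w" using K(1) by (intro L2H_eqI) auto
    have "d * norm ?e \<le> norm (proj {0..} w)" unfolding eq[symmetric] by (rule d(2)) (use w proj_in_supp in auto)
    then have ne: "norm ?e \<le> norm (proj {0..} w) / d" using d(1) by (simp add: field_simps)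
    have "norm w \<le> 2 * norm (proj {K..} w)" by (rule W.below[OF w])
    also have "proj {K..} w = proj {0..} w - ?e" using eq by (simp add: algebra_simps)
    also have "norm (proj {0..} w - ?e) \<le> norm (proj {0..} w) + norm ?e" by (rule norm_triangle_ineq4)
    finally show ?thesis using ne by (simp add: algebra_simps)
  qed
  then show ?thesis using d(1) by (intro exI[of _ "2 + 2/d"]) (auto intro!: add_pos_pos)
qed

text \<open>The normalised elements \<open>w_k\<close>; for \<open>V = W_gam W c\<close> the case
  \<open>k = 0\<close> is the Baker function divided by \<open>gam c\<close>.\<close>

definition bel :: "L2H set \<Rightarrow> nat \<Rightarrow> L2H" where
  "bel V k = (THE f. f \<in> V \<and> proj {0..} f = zpow (int k))"

lemma bel:
  assumes V: "bigcell V"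
  shows "bel V k \<in> V" "proj {0..} (bel V k) = zpow (int k)"
proof -
  have "zpow (int k) \<in> H_plus" by (simp add: H_plus_supp supp_iff)
  then have "zpow (int k) \<in> pr_plus ` V" using bigcell_surj[OF V] by simp
  then obtain f where f: "f \<in> V \<and> proj {0..} f = zpow (int k)" by (auto simp: pr_plus_eq)
  then have "\<exists>!f. f \<in> V \<and> proj {0..} f = zpow (int k)" using bigcell_eqI[OF V] by metis
  from theI'[OF this] show "bel V k \<in> V" "proj {0..} (bel V k) = zpow (int k)" by (auto simp: bel_def)
qed

lemma bel_nonneg:
  assumes "bigcell V" "m \<ge> 0" shows "fourier (bel V k) m = (if m = int k then 1 else 0)"
  using arg_cong[OF bel(2)[OF assms(1)], of "\<lambda>f. fourier f m" k] assms(2) by simp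

lemma bel_unique: "bigcell V \<Longrightarrow> f \<in> V \<Longrightarrow> proj {0..} f = zpow (int k) \<Longrightarrow> f = bel V k"
  using bigcell_eqI[of V f "bel V k"] bel by simp

text \<open>Non-negative parts are approximated by finite left combinations of monomials, and the
  bounded inverse of \<open>pr_plus\<close> lifts the approximation to \<open>V\<close>.\<close>

lemma bel_dense:
  assumes V: "bigcell V" and Z: "closed Z" "cvs.subspace Z" "\<And>q k. lmult q (bel V k) \<in> Z"
  shows "V \<subseteq> Z"
proof
  fix w assume w: "w \<in> V"
  obtain C where C: "C > 0" "\<And>w. w \<in> V \<Longrightarrow> norm w \<le> C * norm (proj {0..} w)" using bigcell_bound[OF V] by blast
  have sV: "cvs.subspace V" and hV: "\<And>f q. f \<in> V \<Longrightarrow> lmult q f \<in> V" using V Gr_H_D by (auto simp: bigcell_def)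
  have "\<exists>z\<in>Z. dist z w < e" if e: "e > 0" for e
  proof -
    have eC: "0 < e / (2 * C)" using e C by simp
    obtain F where F: "finite F" "dist (\<Sum>m\<in>F. lmult (fourier (proj {0..} w) m) (zpow m)) (proj {0..} w) \<le> e / (2 * C)"
      using has_sum_finite_approximation[OF has_sum_fourier[of "proj {0..} w"] eC] by auto
    define z where "z = (\<Sum>m\<in>F. lmult (fourier (proj {0..} w) m) (bel V (nat m)))"
    have zV: "z \<in> V" unfolding z_def by (intro cvs.subspace_sum[OF sV] hV bel(1)[OF V])
    have zZ: "z \<in> Z" unfolding z_def by (intro cvs.subspace_sum[OF Z(2)] Z(3))
    have "proj {0..} z = (\<Sum>m\<in>F. lmult (fourier (proj {0..} w) m) (zpow m))"
    proof (rule L2H_eqI)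
      fix k
      show "fourier (proj {0..} z) k = fourier (\<Sum>m\<in>F. lmult (fourier (proj {0..} w) m) (zpow m)) k"
      proof (cases "k \<ge> 0")
        case True
        then have "fourier (proj {0..} z) k = (\<Sum>m\<in>F. fourier (proj {0..} w) m * fourier (bel V (nat m)) k)" by (simp add: z_def)
        also have "\<dots> = (\<Sum>m\<in>F. fourier (proj {0..} w) m * fourier (zpow m) k)"
          using bel_nonneg[OF V True] by (intro sum.cong) auto
        finally show ?thesis by simp
      qed (auto intro!: sum.neutral)
    qed
    then have "norm (proj {0..} (z - w)) \<le> e / (2 * C)" using F(2) by (simp add: dist_norm proj_diff)
    moreover have "norm (z - w) \<le> C * norm (proj {0..} (z - w))" by (rule C(2)) (rule cvs.subspace_diff[OF sV zV w])
    ultimately have "norm (z - w) \<le> C * (e / (2 * C))" using C(1) by (meson less_imp_le mult_left_mono order_trans)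
    then have "dist z w < e" using C(1) e by (simp add: dist_norm)
    then show ?thesis using zZ by blast
  qed
  then have "w \<in> closure Z" by (simp add: closure_approachable)
  then show "w \<in> Z" using Z(1) by simp
qed

lemma bel_bounded:
  assumes V: "bigcell V" shows "\<exists>C>0. \<forall>k. norm (bel V k) \<le> C"
proof -
  obtain C where C: "C > 0" "\<And>w. w \<in> V \<Longrightarrow> norm w \<le> C * norm (proj {0..} w)" using bigcell_bound[OF V] by blast
  then have "norm (bel V k) \<le> C" for k using C(2)[OF bel(1)[OF V]] bel(2)[OF V] by simp
  then show ?thesis using C(1) by blast
qed

section \<open>Dependence on the flow parameter\<close>

lemma norm_rmult_Ez_diff:
  assumes "\<bar>h\<bar> \<le> 1"
  shows "norm (rmult f (Ez (of_real h * \<theta>)) - f) \<le> exp (cmod \<theta>) * cmod \<theta> * \<bar>h\<bar> * norm f"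
    "norm (rmult f (Ez (of_real h * \<theta>)) - f - h *\<^sub>R rmult f (\<lambda>x. \<theta> * x)) \<le> exp (cmod \<theta>) * (cmod \<theta>)\<^sup>2 * h\<^sup>2 * norm f"
proof -
  have Re: "exp \<bar>Re (of_real h * \<theta> * x)\<bar> \<le> exp (cmod \<theta>)" if "cmod x = 1" for x
  proof -
    have "\<bar>Re (of_real h * \<theta> * x)\<bar> \<le> cmod (of_real h * \<theta> * x)" by (rule abs_Re_le_cmod)
    also have "\<dots> \<le> cmod \<theta>" using that assms mult_right_mono[of "\<bar>h\<bar>" 1 "cmod \<theta>"] by (simp add: norm_mult)
    finally show ?thesis by simp
  qed
  have "rmult f (Ez (of_real h * \<theta>)) = rmult f (\<lambda>x. (exp (of_real h * \<theta> * x) - 1) + 1)" by simp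
  also have "\<dots> = rmult f (\<lambda>x. exp (of_real h * \<theta> * x) - 1) + rmult f (\<lambda>x. 1)"
    by (intro rmult_add_right continuous_intros)
  finally have 1: "rmult f (Ez (of_real h * \<theta>)) - f = rmult f (\<lambda>x. exp (of_real h * \<theta> * x) - 1)" by simp
  show "norm (rmult f (Ez (of_real h * \<theta>)) - f) \<le> exp (cmod \<theta>) * cmod \<theta> * \<bar>h\<bar> * norm f"
    unfolding 1
  proof (rule norm_rmult_le)
    fix x :: complex assume x: "cmod x = 1"
    have "cmod (exp (of_real h * \<theta> * x) - 1) \<le> exp \<bar>Re (of_real h * \<theta> * x)\<bar> * cmod (of_real h * \<theta> * x)"
      using Taylor_exp[of "of_real h * \<theta> * x" 0] by simp
    also have "\<dots> \<le> exp (cmod \<theta>) * cmod (of_real h * \<theta> * x)" using Re[OF x] by (rule mult_right_mono) simp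
    finally show "cmod (exp (of_real h * \<theta> * x) - 1) \<le> exp (cmod \<theta>) * cmod \<theta> * \<bar>h\<bar>" using x by (simp add: norm_mult mult_ac)
  qed (intro continuous_intros)
  have "rmult f (\<lambda>x. exp (of_real h * \<theta> * x) - 1) = rmult f (\<lambda>x. (exp (of_real h * \<theta> * x) - 1 - of_real h * \<theta> * x) + of_real h * \<theta> * x)" by simp
  also have "\<dots> = rmult f (\<lambda>x. exp (of_real h * \<theta> * x) - 1 - of_real h * \<theta> * x) + rmult f (\<lambda>x. of_real h * \<theta> * x)"
    by (intro rmult_add_right continuous_intros)
  also have "rmult f (\<lambda>x. of_real h * \<theta> * x) = h *\<^sub>R rmult f (\<lambda>x. \<theta> * x)"
  proof (rule L2H_eqI)
    fix m show "fourier (rmult f (\<lambda>x. of_real h * \<theta> * x)) m = fourier (h *\<^sub>R rmult f (\<lambda>x. \<theta> * x)) m"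
      using fourier_rmult_powi[of f "of_real h * \<theta>" 1 m] fourier_rmult_powi[of f \<theta> 1 m] by (simp add: qc_scaleR)
  qed
  finally have 2: "rmult f (Ez (of_real h * \<theta>)) - f - h *\<^sub>R rmult f (\<lambda>x. \<theta> * x) = rmult f (\<lambda>x. exp (of_real h * \<theta> * x) - 1 - of_real h * \<theta> * x)"
    unfolding 1 by simp
  show "norm (rmult f (Ez (of_real h * \<theta>)) - f - h *\<^sub>R rmult f (\<lambda>x. \<theta> * x)) \<le> exp (cmod \<theta>) * (cmod \<theta>)\<^sup>2 * h\<^sup>2 * norm f"
    unfolding 2
  proof (rule norm_rmult_le)
    fix x :: complex assume x: "cmod x = 1"
    have "cmod (exp (of_real h * \<theta> * x) - 1 - of_real h * \<theta> * x) \<le> exp \<bar>Re (of_real h * \<theta> * x)\<bar> * (cmod (of_real h * \<theta> * x))\<^sup>2"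
      using Taylor_exp[of "of_real h * \<theta> * x" 1] by (simp add: One_nat_def power2_eq_square diff_diff_eq)
    also have "\<dots> \<le> exp (cmod \<theta>) * (cmod (of_real h * \<theta> * x))\<^sup>2" using Re[OF x] by (rule mult_right_mono) simp
    finally show "cmod (exp (of_real h * \<theta> * x) - 1 - of_real h * \<theta> * x) \<le> exp (cmod \<theta>) * (cmod \<theta>)\<^sup>2 * h\<^sup>2"
      using x by (simp add: norm_mult power_mult_distrib mult_ac)
  qed (intro continuous_intros)
qed

text \<open>This is \<open>V e^(-z zeta)\<close>, hence \<open>W_z\<close> with the opposite sign:
  dividing the Baker function by the flow moves the space backwards.\<close>

definition V_shift :: "L2H set \<Rightarrow> complex \<Rightarrow> L2H set" where
  "V_shift V z = {f. rmult f (Ez z) \<in> V}"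

lemma V_shift_Gr_H: assumes "V \<in> Gr_H" shows "V_shift V z \<in> Gr_H"
proof -
  have "V_shift V z = gr_act (Ez (- z)) V"
  proof (intro equalityI subsetI)
    fix f assume "f \<in> V_shift V z"
    then show "f \<in> gr_act (Ez (- z)) V" unfolding V_shift_def gr_act_def
      using punit_cancel[OF punit_Ez[of z], of f] by (auto intro!: image_eqI[of _ _ "rmult f (Ez z)"])
  next
    fix f assume "f \<in> gr_act (Ez (- z)) V"
    then show "f \<in> V_shift V z" unfolding V_shift_def gr_act_def using punit_cancel[OF punit_Ez[of "- z"]] by auto
  qed
  then show ?thesis using Gr_H_rmult[OF assms punit_Ez[of "- z"]] by simp
qed

lemma V_shift_0 [simp]: "V_shift V 0 = V" by (simp add: V_shift_def)

text \<open>Let \<open>v\<close> lie in the shifted space and have no non-negative part. Then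
  \<open>v e^(h theta zeta)\<close> lies in \<open>V\<close> and differs from \<open>v\<close> by at
  most a constant times \<open>|h|\<close> times the norm of \<open>v\<close>, so
  \<open>bigcell_bound\<close> forces \<open>v = 0\<close> for small \<open>h\<close>, uniformly in
  the direction \<open>theta\<close>.\<close>

lemma bigcell_nearby:
  assumes V: "bigcell V"
  shows "\<exists>e>0. \<forall>h. \<bar>h\<bar> < e \<longrightarrow> (\<forall>\<theta>. cmod \<theta> \<le> 1 \<longrightarrow> bigcell (V_shift V (of_real h * \<theta>)))"
proof -
  obtain C where C: "C > 0" "\<And>w. w \<in> V \<Longrightarrow> norm w \<le> C * norm (proj {0..} w)" using bigcell_bound[OF V] by blast
  define e where "e = min 1 (1 / ((C + 1) * exp 1 + 1))"
  have e: "e > 0" "e \<le> 1" using C(1) by (auto simp: e_def intro!: add_pos_pos)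
  have eC: "(C + 1) * exp 1 * \<bar>h\<bar> < 1" if "\<bar>h\<bar> < e" for h
  proof -
    have "\<bar>h\<bar> < 1 / ((C + 1) * exp 1 + 1)" using that by (simp add: e_def)
    then have "\<bar>h\<bar> * ((C + 1) * exp 1 + 1) < 1" using C(1) by (subst (asm) pos_less_divide_eq) (auto intro!: add_pos_pos)
    then show ?thesis using abs_ge_zero[of h] by (simp add: algebra_simps)
  qed
  have "bigcell (V_shift V (of_real h * \<theta>))" if h: "\<bar>h\<bar> < e" and \<theta>: "cmod \<theta> \<le> 1" for h \<theta>
  proof (rule bigcellI)
    show "V_shift V (of_real h * \<theta>) \<in> Gr_H" using V by (auto simp: bigcell_def intro: V_shift_Gr_H)
    fix v assume v: "v \<in> V_shift V (of_real h * \<theta>)" "v \<in> H_minus"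
    let ?w = "rmult v (Ez (of_real h * \<theta>))"
    have d: "norm (?w - v) \<le> exp 1 * \<bar>h\<bar> * norm v"
    proof -
      have "norm (?w - v) \<le> exp (cmod \<theta>) * cmod \<theta> * \<bar>h\<bar> * norm v"
        using norm_rmult_Ez_diff(1)[of h v \<theta>] h e by simp
      also have "\<dots> \<le> exp 1 * 1 * \<bar>h\<bar> * norm v" using \<theta> by (intro mult_right_mono mult_mono) auto
      finally show ?thesis by simp
    qed
    have "proj {0..} v = 0" using v(2) by (intro L2H_eqI) (simp add: H_minus_supp supp_iff)
    then have "proj {0..} ?w = proj {0..} (?w - v)" by (simp add: proj_diff)
    then have "norm ?w \<le> C * norm (?w - v)" using C(2)[of ?w] v(1) C(1) norm_proj_le[of "{0..}" "?w - v"]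
      by (auto simp: V_shift_def) (meson less_imp_le mult_left_mono order_trans)
    then have "norm v \<le> (C + 1) * norm (?w - v)" using norm_triangle_ineq4[of ?w "?w - v"] by (simp add: algebra_simps)
    also have "\<dots> \<le> (C + 1) * (exp 1 * \<bar>h\<bar> * norm v)" using d C(1) by (intro mult_left_mono) auto
    finally have "norm v \<le> ((C + 1) * exp 1 * \<bar>h\<bar>) * norm v" by (simp add: mult_ac)
    then show "v = 0" using eC[OF h] by (metis mult_le_cancel_right1 norm_le_zero_iff not_le)
  qed
  then show ?thesis using e(1) by blast
qed

lemma has_vector_derivative_quadratic:
  assumes "e > 0" "\<And>h. \<bar>h\<bar> < e \<Longrightarrow> norm (f h - f 0 - h *\<^sub>R d) \<le> K * h\<^sup>2"
  shows "(f has_vector_derivative d) (at 0)" unfolding has_vector_derivative_def has_derivative_at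
proof (intro conjI bounded_linear_scaleR_left)
  have "((\<lambda>h. \<bar>K\<bar> * \<bar>h\<bar>) \<longlongrightarrow> \<bar>K\<bar> * \<bar>0\<bar>) (at 0)" by (intro tendsto_intros)
  then have "((\<lambda>h. \<bar>K\<bar> * \<bar>h\<bar>) \<longlongrightarrow> 0) (at 0)" by simp
  then show "((\<lambda>h. norm (f (0 + h) - f 0 - h *\<^sub>R d) / norm h) \<longlongrightarrow> 0) (at 0)"
  proof (rule Lim_null_comparison[rotated])
    show "\<forall>\<^sub>F h in at 0. norm (norm (f (0 + h) - f 0 - h *\<^sub>R d) / norm h) \<le> \<bar>K\<bar> * \<bar>h\<bar>"
      unfolding eventually_at
    proof (intro exI conjI ballI impI)
      fix h :: real assume h: "h \<noteq> 0 \<and> dist h 0 < e"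
      have "norm (f h - f 0 - h *\<^sub>R d) \<le> K * h\<^sup>2" using assms(2) h by simp
      also have "\<dots> \<le> \<bar>K\<bar> * h\<^sup>2" by (rule mult_right_mono) auto
      also have "\<dots> = (\<bar>K\<bar> * \<bar>h\<bar>) * \<bar>h\<bar>" by (simp add: power2_eq_square)
      finally show "norm (norm (f (0 + h) - f 0 - h *\<^sub>R d) / norm h) \<le> \<bar>K\<bar> * \<bar>h\<bar>"
        using h by (simp add: divide_le_eq)
    qed (rule assms(1))
  qed
qed

text \<open>Differentiating \<open>w_k e^(h theta zeta)\<close>, which stays in \<open>V\<close>,
  shows that \<open>w_k' + theta zeta w_k\<close> lies in \<open>V\<close>. Its non-negative part
  comes from \<open>theta zeta w_k\<close> alone: \<open>theta\<close> at exponent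
  \<open>k + 1\<close>, and at exponent 0 the coefficient of \<open>w_k\<close> at -1 times
  \<open>theta\<close>. So it is the corresponding combination of \<open>w_(k+1)\<close> and
  \<open>w_0\<close>.\<close>

lemma bel_deriv:
  assumes V: "bigcell V" and \<theta>: "cmod \<theta> \<le> 1"
  shows "((\<lambda>h. bel (V_shift V (of_real h * \<theta>)) k) has_vector_derivative
     (lmult (qc \<theta>) (bel V (Suc k)) + lmult (fourier (bel V k) (-1) * qc \<theta>) (bel V 0) - rmult (bel V k) (\<lambda>x. \<theta> * x))) (at 0)"
proof -
  obtain C where C: "C > 0" "\<And>w. w \<in> V \<Longrightarrow> norm w \<le> C * norm (proj {0..} w)" using bigcell_bound[OF V] by blast
  obtain e0 where e0: "e0 > 0" "\<And>h. \<bar>h\<bar> < e0 \<Longrightarrow> bigcell (V_shift V (of_real h * \<theta>))"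
    using bigcell_nearby[OF V] \<theta> by blast
  define M where "M = exp (cmod \<theta>) + 1"
  have M: "M \<ge> 1" "exp (cmod \<theta>) * cmod \<theta> \<le> M" "exp (cmod \<theta>) * (cmod \<theta>)\<^sup>2 \<le> M"
  proof -
    have "exp (cmod \<theta>) * cmod \<theta> \<le> exp (cmod \<theta>) * 1" using \<theta> by (intro mult_left_mono) auto
    moreover have "exp (cmod \<theta>) * (cmod \<theta>)\<^sup>2 \<le> exp (cmod \<theta>) * 1" using \<theta> by (intro mult_left_mono) (auto simp: power_le_one)
    ultimately show "M \<ge> 1" "exp (cmod \<theta>) * cmod \<theta> \<le> M" "exp (cmod \<theta>) * (cmod \<theta>)\<^sup>2 \<le> M"
      unfolding M_def using exp_ge_zero[of "cmod \<theta>"] by linarith+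
  qed
  \<comment> \<open>Bounds the relative change of \<open>f\<close> per unit of \<open>h\<close>. The
    radius \<open>e\<close> keeps \<open>D * |h|\<close> at most 1/2, whence
    \<open>norm (f h) <= 2 * norm (f 0)\<close>.\<close>
  define D where "D = (C + 1) * M"
  have D: "D > 0" using C(1) M(1) by (simp add: D_def)
  define e where "e = min e0 (min 1 (1 / (2 * D)))"
  have e: "e > 0" "e \<le> e0" "e \<le> 1" "\<And>h. \<bar>h\<bar> < e \<Longrightarrow> D * \<bar>h\<bar> \<le> 1/2"
    using e0(1) D by (auto simp: e_def field_simps)
  define f where "f = (\<lambda>h. bel (V_shift V (of_real h * \<theta>)) k)"
  have f0: "f 0 = bel V k" by (simp add: f_def)
  define dd where "dd = lmult (qc \<theta>) (bel V (Suc k)) + lmult (fourier (bel V k) (-1) * qc \<theta>) (bel V 0)"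
  let ?t = "\<lambda>g. rmult g (\<lambda>x. \<theta> * x)"
  have tf: "fourier (?t g) m = fourier g (m - 1) * qc \<theta>" for g m
    using fourier_rmult_powi[of g \<theta> 1 m] by simp
  have tn: "norm (?t g) \<le> norm g" for g
    using norm_rmult_le[of "\<lambda>x. \<theta> * x" 1 g] \<theta> by (auto simp: norm_mult intro!: continuous_intros)
  have sV: "cvs.subspace V" and hV: "\<And>f q. f \<in> V \<Longrightarrow> lmult q f \<in> V" using V Gr_H_D by (auto simp: bigcell_def)
  have ddV: "dd \<in> V" unfolding dd_def by (intro cvs.subspace_add[OF sV] hV bel(1)[OF V])
  have pdd: "proj {0..} dd = proj {0..} (?t (bel V k))"
  proof (rule L2H_eqI)
    fix m show "fourier (proj {0..} dd) m = fourier (proj {0..} (?t (bel V k))) m"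
    proof (cases "m = 0")
      case False
      then show ?thesis using bel_nonneg[OF V] by (auto simp: dd_def tf)
    qed (use bel_nonneg[OF V] in \<open>simp add: dd_def tf\<close>)
  qed
  have main: "norm (f h - f 0 - h *\<^sub>R (dd - ?t (bel V k))) \<le> ((C + 1) * ((2 * M + 2 * D) * norm (f 0))) * h\<^sup>2" if h: "\<bar>h\<bar> < e" for h
  proof -
    have bc: "bigcell (V_shift V (of_real h * \<theta>))" using e0(2) e(2) h by simp
    have h1: "\<bar>h\<bar> \<le> 1" using h e(3) by simp
    \<comment> \<open>The normalised element of the shifted space, brought back into
      \<open>V\<close>, where norms are controlled by non-negative parts.\<close>
    define u where "u = rmult (f h) (Ez (of_real h * \<theta>))"
    have uV: "u \<in> V" using bel(1)[OF bc] by (simp add: u_def f_def V_shift_def)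
    have pf: "proj {0..} (f h) = proj {0..} (f 0)" using bel(2)[OF bc] bel(2)[OF V] by (simp add: f_def)
    have n1: "norm (u - f h) \<le> M * \<bar>h\<bar> * norm (f h)"
    proof -
      have "norm (u - f h) \<le> exp (cmod \<theta>) * cmod \<theta> * \<bar>h\<bar> * norm (f h)" unfolding u_def by (rule norm_rmult_Ez_diff(1)[OF h1])
      also have "\<dots> \<le> M * \<bar>h\<bar> * norm (f h)" using M by (intro mult_right_mono) auto
      finally show ?thesis .
    qed
    have n2: "norm (u - f h - h *\<^sub>R ?t (f h)) \<le> M * h\<^sup>2 * norm (f h)"
    proof -
      have "norm (u - f h - h *\<^sub>R ?t (f h)) \<le> exp (cmod \<theta>) * (cmod \<theta>)\<^sup>2 * h\<^sup>2 * norm (f h)" unfolding u_def by (rule norm_rmult_Ez_diff(2)[OF h1])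
      also have "\<dots> \<le> M * h\<^sup>2 * norm (f h)" using M by (intro mult_right_mono) auto
      finally show ?thesis .
    qed
    have gV: "u - f 0 \<in> V" using uV bel(1)[OF V] by (simp add: f0 cvs.subspace_diff[OF sV])
    have CV: "norm x \<le> C * norm y" if "x \<in> V" "proj {0..} x = proj {0..} y" for x y
      using C(2)[OF that(1)] that(2) norm_proj_le[of "{0..}" y] C(1) by (metis less_imp_le mult_left_mono order_trans)
    have "norm (u - f 0) \<le> C * norm (u - f h)" by (rule CV[OF gV]) (simp add: proj_diff pf)
    then have "norm (f h - f 0) \<le> (C + 1) * norm (u - f h)"
      using norm_triangle_ineq4[of "u - f 0" "u - f h"] by (simp add: algebra_simps)
    also have "\<dots> \<le> (C + 1) * (M * \<bar>h\<bar> * norm (f h))" using n1 C(1) by (intro mult_left_mono) auto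
    finally have n3: "norm (f h - f 0) \<le> D * \<bar>h\<bar> * norm (f h)" by (simp add: D_def mult_ac)
    also have "\<dots> \<le> 1/2 * norm (f h)" using e(4)[OF h] by (rule mult_right_mono) simp
    finally have "norm (f h) \<le> 2 * norm (f 0)" using norm_triangle_ineq2[of "f h" "f 0"] by linarith
    note fh = this
    have n4: "norm (f h - f 0) \<le> 2 * D * \<bar>h\<bar> * norm (f 0)"
    proof -
      have "D * \<bar>h\<bar> * norm (f h) \<le> D * \<bar>h\<bar> * (2 * norm (f 0))" using D by (intro mult_left_mono fh) auto
      also have "\<dots> = 2 * D * \<bar>h\<bar> * norm (f 0)" by simp
      finally show ?thesis using n3 by linarith
    qed
    define r where "r = u - f h - h *\<^sub>R ?t (f 0)"
    have "r = (u - f h - h *\<^sub>R ?t (f h)) + h *\<^sub>R ?t (f h - f 0)"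
      by (simp add: r_def rmult_diff algebra_simps)
    then have "norm r \<le> norm (u - f h - h *\<^sub>R ?t (f h)) + norm (h *\<^sub>R ?t (f h - f 0))"
      using norm_triangle_ineq by metis
    also have "\<dots> \<le> M * h\<^sup>2 * norm (f h) + \<bar>h\<bar> * norm (f h - f 0)"
      using n2 tn[of "f h - f 0"] by (auto intro!: add_mono mult_left_mono)
    also have "\<dots> \<le> M * h\<^sup>2 * (2 * norm (f 0)) + \<bar>h\<bar> * (2 * D * \<bar>h\<bar> * norm (f 0))"
      using fh n4 M(1) by (intro add_mono mult_left_mono) auto
    also have "\<dots> = (2 * M + 2 * D) * norm (f 0) * h\<^sup>2"
      by (simp add: algebra_simps power2_eq_square abs_mult_self_eq)
    finally have nr: "norm r \<le> (2 * M + 2 * D) * norm (f 0) * h\<^sup>2" .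
    have "u - f 0 - h *\<^sub>R dd \<in> V" using gV ddV sV by (auto simp: csubspace_iff intro!: subspace_diff subspace_scale)
    moreover have "proj {0..} (u - f 0 - h *\<^sub>R dd) = proj {0..} r"
      using pdd by (simp add: r_def proj_diff proj_scaleR pf f0)
    ultimately have nx: "norm (u - f 0 - h *\<^sub>R dd) \<le> C * norm r" by (rule CV)
    have "f h - f 0 - h *\<^sub>R (dd - ?t (bel V k)) = (u - f 0 - h *\<^sub>R dd) - r"
      by (simp add: r_def f0 algebra_simps)
    then have "norm (f h - f 0 - h *\<^sub>R (dd - ?t (bel V k))) \<le> norm (u - f 0 - h *\<^sub>R dd) + norm r"
      using norm_triangle_ineq4 by metis
    also have "\<dots> \<le> (C + 1) * norm r" using nx by (simp add: algebra_simps)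
    also have "\<dots> \<le> (C + 1) * ((2 * M + 2 * D) * norm (f 0) * h\<^sup>2)" using nr C(1) by (intro mult_left_mono) auto
    finally show ?thesis by (simp only: mult.assoc)
  qed
  have "(f has_vector_derivative (dd - ?t (bel V k))) (at 0)" by (rule has_vector_derivative_quadratic[OF e(1) main])
  then show ?thesis by (simp add: f_def dd_def)
qed

section \<open>The domain of the Baker function\<close>

lemma baker_pre_iff: "baker_pre W c f \<longleftrightarrow> f \<in> W_gam W c \<and> proj {0..} f = zpow 0"
proof -
  have "fourier f 0 = 1 \<and> (\<forall>m>0. fourier f m = 0) \<longleftrightarrow> proj {0..} f = zpow 0"
  proof
    assume "fourier f 0 = 1 \<and> (\<forall>m>0. fourier f m = 0)"
    then show "proj {0..} f = zpow 0" by (intro L2H_eqI) auto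
  next
    assume p: "proj {0..} f = zpow 0"
    have "fourier f m = (if m = 0 then 1 else 0)" if "m \<ge> 0" for m
      using arg_cong[OF p, of "\<lambda>g. fourier g m"] that by simp
    then show "fourier f 0 = 1 \<and> (\<forall>m>0. fourier f m = 0)" by auto
  qed
  then show ?thesis by (auto simp: baker_pre_def W_gam_def)
qed

text \<open>An element of the kernel could be added to a solution, so uniqueness excludes a kernel;
  conversely, without a kernel index zero gives existence.\<close>

lemma baker_dom_iff:
  assumes W: "W \<in> Gr_H"
  shows "c \<in> baker_dom W \<longleftrightarrow> c \<in> valid_times \<and> bigcell (W_gam W c)"
proof (cases "c \<in> valid_times")
  case c: True
  have VG: "W_gam W c \<in> Gr_H" by (rule W_gam_Gr_H[OF W c])
  have "(\<exists>!f. baker_pre W c f) \<longleftrightarrow> bigcell (W_gam W c)"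
  proof
    assume b: "bigcell (W_gam W c)"
    show "\<exists>!f. baker_pre W c f"
    proof (rule ex1I[of _ "bel (W_gam W c) 0"])
      show "baker_pre W c (bel (W_gam W c) 0)" using bel[OF b, of 0] by (simp add: baker_pre_iff)
      fix f assume "baker_pre W c f"
      then show "f = bel (W_gam W c) 0" using bel_unique[OF b, of f 0] by (simp add: baker_pre_iff)
    qed
  next
    assume ex: "\<exists>!f. baker_pre W c f"
    then obtain f where f: "baker_pre W c f" by blast
    show "bigcell (W_gam W c)"
    proof (rule bigcellI[OF VG])
      fix v assume v: "v \<in> W_gam W c" "v \<in> H_minus"
      have "proj {0..} v = 0" using v(2) by (intro L2H_eqI) (simp add: H_minus_supp supp_iff)
      moreover have "f + v \<in> W_gam W c" using f v cvs.subspace_add[OF Gr_H_D(1)[OF VG]] by (simp add: baker_pre_iff)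
      ultimately have "baker_pre W c (f + v)" using f by (simp add: baker_pre_iff proj_add)
      then have "f + v = f" using ex f by blast
      then show "v = 0" by simp
    qed
  qed
  then show ?thesis using c by (simp add: baker_dom_def)
qed (simp add: baker_dom_def)

definition pt :: "complex \<Rightarrow> times" where "pt z = (\<lambda>_. 0)(1 := z)"

lemma pt_valid: "pt z \<in> valid_times" unfolding pt_def by (rule valid_times_upd[OF valid_times_0])

lemma pt_upd: "(pt z)(1 := pt z 1 + w) = pt (z + w)" by (simp add: pt_def)

lemma W_gam_pt: "W_gam W (pt z) = V_shift W z"
proof -
  have g0: "gam (\<lambda>_. 0) = (\<lambda>x. 1)" by (rule ext) (simp add: gam_def)
  have "pt z = (\<lambda>_. 0)(1 := (\<lambda>_. 0) (1::nat) + z)" by (simp add: pt_def)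
  then show ?thesis using rmult_gam_shift[OF valid_times_0, of _ z] by (auto simp: W_gam_def V_shift_def g0)
qed

lemma V_shift_V_shift: "V_shift (V_shift V a) b = V_shift V (a + b)"
  by (simp add: V_shift_def rmult_Ez_Ez add.commute)

lemma W_gam_upd: "c \<in> valid_times \<Longrightarrow> W_gam W (c(1 := c 1 + w)) = V_shift (W_gam W c) w"
  using W_gam_shift[of c _ W w] by (auto simp: V_shift_def)

section \<open>Nearby points of the big cell\<close>

text \<open>A real polynomial of degree below \<open>N\<close> with \<open>N\<close> zeros is 0. The
  products are monic of degree \<open>i\<close>, so the last non-zero \<open>c i\<close> would be
  the leading coefficient.\<close>

lemma newton_basis_vanish:
  fixes c :: "nat \<Rightarrow> real"
  assumes X: "finite X" "card X = N" and v: "\<And>x. x \<in> X \<Longrightarrow> (\<Sum>i<N. c i * (\<Prod>l<i. x - real l)) = 0"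
    and "i < N"
  shows "c i = 0"
proof (rule ccontr)
  assume "c i \<noteq> 0"
  define q :: "nat \<Rightarrow> real poly" where "q = (\<lambda>i. \<Prod>l<i. [:- real l, 1:])"
  have qd: "degree (q i) = i \<and> coeff (q i) i = 1" for i
  proof (induction i)
    case (Suc i)
    have "q (Suc i) = q i * [:- real i, 1:]" by (simp add: q_def)
    have "q i \<noteq> 0" using Suc by auto
    then have d: "degree (q (Suc i)) = Suc i"
      using Suc \<open>q (Suc i) = _\<close> by (simp add: degree_mult_eq del: mult_pCons_right)
    have l: "lead_coeff (q (Suc i)) = lead_coeff (q i) * lead_coeff [:- real i, 1:]"
      unfolding \<open>q (Suc i) = _\<close> by (rule lead_coeff_mult)
    have "lead_coeff (q (Suc i)) = 1" unfolding l using Suc by simp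
    then show ?case using d by metis
  qed (simp add: q_def)
  define p where "p = (\<Sum>i<N. smult (c i) (q i))"
  have pe: "poly p x = (\<Sum>i<N. c i * (\<Prod>l<i. x - real l))" for x
    by (simp add: p_def poly_sum q_def poly_prod algebra_simps)
  define n where "n = Max {i. i < N \<and> c i \<noteq> 0}"
  have fin: "finite {i. i < N \<and> c i \<noteq> 0}" by simp
  have n: "n < N" "c n \<noteq> 0" using Max_in[OF fin] \<open>i < N\<close> \<open>c i \<noteq> 0\<close> unfolding n_def by blast+
  have nmax: "c k = 0" if "k < N" "k > n" for k using Max_ge[OF fin, of k] that by (force simp: n_def[symmetric])
  have "coeff p n = (\<Sum>i<N. c i * coeff (q i) n)" by (simp add: p_def coeff_sum)
  also have "\<dots> = (\<Sum>i<N. if i = n then c n else 0)"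
  proof (rule sum.cong[OF refl])
    fix k assume "k \<in> {..<N}"
    then show "c k * coeff (q k) n = (if k = n then c n else 0)"
      using qd[of k] nmax[of k] coeff_eq_0[of "q k" n] by (cases k n rule: linorder_cases) auto
  qed
  also have "\<dots> = c n" using n(1) by simp
  finally have p0: "p \<noteq> 0" using n(2) by auto
  have "degree p \<le> N - 1"
    unfolding p_def by (rule degree_sum_le) (use qd in \<open>auto intro: order_trans[OF degree_smult_le]\<close>)
  then have "card {x. poly p x = 0} < N" using card_poly_roots_bound[OF p0] n(1) by linarith
  moreover have "X \<subseteq> {x. poly p x = 0}" using v pe by auto
  ultimately show False using card_mono[OF poly_roots_finite[OF p0], of X] X by auto
qed

lemma fact_ratio: "i \<le> x \<Longrightarrow> fact x / fact (x - i) = (\<Prod>l<i. real x - real l)"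
proof (induction i)
  case (Suc i)
  then have "fact (x - i) = (real x - real i) * fact (x - Suc i)"
    by (subst fact_reduce) (auto simp: of_nat_diff One_nat_def)
  then have "fact x / fact (x - Suc i) = (fact x / fact (x - i)) * (real x - real i)" using Suc.prems by simp
  then show ?case using Suc by simp
qed simp

text \<open>Multiplying by \<open>x!\<close>, where \<open>x = m - K\<close>, turns the entries
  \<open>1 / (x - i)!\<close> of the exponential into falling factorials of \<open>x\<close>,
  polynomials of degree \<open>i\<close>. Invertibility of the matrix becomes a matter of
  interpolation.\<close>

lemma fourier_rmult_exp_finite:
  assumes e: "e \<in> supp {K..<0}" and m: "m \<ge> K"
  shows "fact (nat (m - K)) *\<^sub>R fourier (rmult e (Ez 1)) m =
     (\<Sum>i<nat (- K). (\<Prod>l<i. real (nat (m - K)) - real l) *\<^sub>R fourier e (K + int i))"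
proof -
  define x where "x = nat (m - K)"
  have mx: "m = K + int x" using m by (simp add: x_def)
  have "(\<lambda>n. fourier e (m - int n) * qc (1 ^ n / fact n)) sums fourier (rmult e (Ez 1)) m"
    by (rule fourier_rmult_pser[OF pser_Ez])
  moreover have "(\<lambda>n. fourier e (m - int n) * qc (1 ^ n / fact n)) sums (\<Sum>n\<in>{..x}. fourier e (m - int n) * qc (1 ^ n / fact n))"
    by (rule sums_finite) (use e mx in \<open>auto simp: supp_iff\<close>)
  ultimately have "fourier (rmult e (Ez 1)) m = (\<Sum>n\<in>{..x}. fourier e (m - int n) * qc (1 ^ n / fact n))"
    by (rule sums_unique2)
  also have "\<dots> = (\<Sum>i\<in>{..x}. (1 / fact (x - i)) *\<^sub>R fourier e (K + int i))"
  proof (rule sum.reindex_bij_witness[of _ "\<lambda>i. x - i" "\<lambda>i. x - i"])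
    fix n assume n: "n \<in> {..x}"
    have "qc (1 / fact n) = (1 / fact n) *\<^sub>R 1" using qc_scaleR[of "1 / fact n" 1] by simp
    moreover have eq: "K + int (x - n) = m - int n" using n mx by auto
    ultimately show "(1 / fact (x - (x - n))) *\<^sub>R fourier e (K + int (x - n)) = fourier e (m - int n) * qc (1 ^ n / fact n)"
      unfolding eq using n by simp
  qed auto
  finally have "fact x *\<^sub>R fourier (rmult e (Ez 1)) m = (\<Sum>i\<in>{..x}. (fact x / fact (x - i)) *\<^sub>R fourier e (K + int i))"
    by (simp add: scaleR_sum_right)
  also have "\<dots> = (\<Sum>i\<in>{..x}. (\<Prod>l<i. real x - real l) *\<^sub>R fourier e (K + int i))"
    by (intro sum.cong refl) (simp add: fact_ratio)
  \<comment> \<open>The two index ranges may be exchanged: beyond \<open>x\<close> the falling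
    factorial contains the factor 0, and from \<open>- K\<close> on the element \<open>e\<close> has
    no coefficients.\<close>
  also have "\<dots> = (\<Sum>i\<in>{..x} \<union> {..<nat (- K)}. (\<Prod>l<i. real x - real l) *\<^sub>R fourier e (K + int i))"
  proof (rule sum.mono_neutral_left)
    show "\<forall>i\<in>{..x} \<union> {..<nat (- K)} - {..x}. (\<Prod>l<i. real x - real l) *\<^sub>R fourier e (K + int i) = 0"
      by (auto intro!: prod_zero bexI[of _ x])
  qed auto
  also have "\<dots> = (\<Sum>i<nat (- K). (\<Prod>l<i. real x - real l) *\<^sub>R fourier e (K + int i))"
    by (rule sum.mono_neutral_right) (use e in \<open>auto simp: supp_iff\<close>)
  finally show ?thesis by (simp add: x_def)
qed

lemma exp_window_injective:
  assumes e: "e \<in> supp {K..<0}" and M: "finite M" "card M = nat (- K)" "M \<subseteq> {K..}"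
    and z: "\<And>m. m \<in> M \<Longrightarrow> fourier (rmult e (Ez 1)) m = 0"
  shows "e = 0"
proof (rule fourier_eq_0_imp)
  fix j
  show "fourier e j = 0"
  proof (cases "j \<in> {K..<0}")
    case True
    define X where "X = (\<lambda>m. real (nat (m - K))) ` M"
    have inj: "inj_on (\<lambda>m. real (nat (m - K))) M" using M(3) by (auto simp: inj_on_def subset_iff eq_nat_nat_iff)
    have X: "finite X" "card X = nat (- K)" using M card_image[OF inj] by (auto simp: X_def)
    \<comment> \<open>Pairing with a fixed quaternion reduces the vanishing to real
      coefficients.\<close>
    have "inner (fourier e (K + int i)) u = 0" if i: "i < nat (- K)" for i u
    proof (rule newton_basis_vanish[OF X _ i])
      fix x assume "x \<in> X"
      then obtain m where m: "m \<in> M" "x = real (nat (m - K))" by (auto simp: X_def)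
      have "(\<Sum>i<nat (- K). (\<Prod>l<i. x - real l) *\<^sub>R fourier e (K + int i)) = 0"
        using fourier_rmult_exp_finite[OF e, of m] z[OF m(1)] M(3) m by auto
      then have "inner (\<Sum>i<nat (- K). (\<Prod>l<i. x - real l) *\<^sub>R fourier e (K + int i)) u = 0" by simp
      then show "(\<Sum>i<nat (- K). inner (fourier e (K + int i)) u * (\<Prod>l<i. x - real l)) = 0"
        by (simp add: inner_sum_left mult.commute)
    qed
    from this[of "nat (j - K)" "fourier e j"] True show ?thesis by simp
  qed (use e in \<open>auto simp: supp_iff\<close>)
qed

text \<open>Counts the lowest exponents of elements of \<open>Qort\<close>: projecting to the set of
  these exponents is injective on \<open>Qort\<close>. By index zero \<open>Qort\<close> has complex
  dimension \<open>2 * nat (- K)\<close>, and each exponent accounts for dimension 2, so there are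
  at least \<open>nat (- K)\<close> of them.\<close>

lemma (in window) exists_orders:
  assumes "A = UNIV" "index0"
  shows "\<exists>M. finite M \<and> card M = nat (- K) \<and> M \<subseteq> {K..} \<and>
     (\<forall>m\<in>M. \<exists>q\<in>Qort. fourier q m \<noteq> 0 \<and> (\<forall>n<m. fourier q n = 0))"
proof -
  define M0 where "M0 = {m. \<exists>q\<in>Qort. fourier q m \<noteq> 0 \<and> (\<forall>n<m. fourier q n = 0)}"
  have M0K: "M0 \<subseteq> {K..}" by (auto simp: M0_def Qort_def supp_iff)
  have lowest: "\<exists>m\<in>M0. fourier q m \<noteq> 0" if q: "q \<in> Qort" "q \<noteq> 0" for q
  proof -
    have s: "q \<in> supp {K..}" using q by (simp add: Qort_def)
    obtain j where j: "fourier q j \<noteq> 0" using q fourier_eq_0_imp by blast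
    then have "j \<ge> K" using s by (force simp: supp_iff)
    define n where "n = (LEAST n. fourier q (K + int n) \<noteq> 0)"
    have ex: "fourier q (K + int (nat (j - K))) \<noteq> 0" using j \<open>j \<ge> K\<close> by simp
    have n: "fourier q (K + int n) \<noteq> 0" unfolding n_def by (rule LeastI[of _ "nat (j - K)"]) (rule ex)
    have "fourier q l = 0" if "l < K + int n" for l
    proof (cases "l \<ge> K")
      case True
      then have "nat (l - K) < n" using that by simp
      then have "\<not> fourier q (K + int (nat (l - K))) \<noteq> 0" unfolding n_def by (rule not_less_Least)
      then show ?thesis using True by simp
    qed (use s in \<open>simp add: supp_iff\<close>)
    then show ?thesis using n q(1) by (auto simp: M0_def)
  qed
  have Q: "finite_cdim Qort" "cdim Qort = 2 * nat (- K)" using index0_Qort assms supp_finite[of "{K..<0}"] by auto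
  have "\<exists>M\<subseteq>M0. finite M \<and> card M = nat (- K)"
  proof (cases "finite M0")
    case True
    have "cdim Qort = cdim (proj M0 ` Qort)"
    proof (rule cdim_image[OF clinear_proj Q(1), symmetric])
      fix q assume q: "q \<in> Qort" "proj M0 q = 0"
      have "fourier q m = 0" if "m \<in> M0" for m using arg_cong[OF q(2), of "\<lambda>g. fourier g m"] that by simp
      then show "q = 0" using lowest[OF q(1)] by blast
    qed
    also have "\<dots> \<le> cdim (supp M0)" using supp_finite[OF True] proj_in_supp by (intro cdim_mono) auto
    also have "\<dots> = 2 * card M0" using supp_finite[OF True] by simp
    finally have "nat (- K) \<le> card M0" using Q(2) by simp
    then show ?thesis using obtain_subset_with_card_n by metis
  next
    case False
    then show ?thesis using infinite_arbitrarily_large by blast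
  qed
  then obtain M where M: "M \<subseteq> M0" "finite M" "card M = nat (- K)" by blast
  then show ?thesis using M0K unfolding M0_def by blast
qed

text \<open>Orthogonality to \<open>q\<close> balances the coefficient of \<open>w\<close> at the
  lowest exponent of \<open>q\<close> against strictly higher coefficients of \<open>w\<close>;
  after rescaling these carry an additional factor \<open>z\<close>.\<close>

lemma order_bound:
  assumes W: "cvs.subspace W" "\<And>f q. f \<in> W \<Longrightarrow> lmult q f \<in> W"
    and w: "w \<in> W" and q: "\<And>f. f \<in> W \<Longrightarrow> inner f q = 0" "fourier q m \<noteq> 0" "\<And>n. n < m \<Longrightarrow> fourier q n = 0"
  shows "norm (fourier w m) * norm (fourier q m) \<le> norm (proj {m<..} w) * norm q"
proof (cases "fourier w m = 0")
  case False
  define a where "a = fourier w m"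
  define b where "b = fourier q m"
  have ab: "a \<noteq> 0" "b \<noteq> 0" using False q by (auto simp: a_def b_def)
  \<comment> \<open>A unit quaternion turning the coefficient of \<open>w\<close> into the direction
    of that of \<open>q\<close>. Left multiplication by it stays in \<open>W\<close>, and real
    orthogonality then sees the full product of the norms.\<close>
  define p where "p = (norm a / norm b) *\<^sub>R (b * inverse a)"
  have np: "norm p = 1" using ab by (simp add: p_def norm_mult norm_inverse)
  have pa: "p * a = (norm a / norm b) *\<^sub>R b" using ab by (simp add: p_def mult.assoc)
  have qd: "q = lmult b (zpow m) + proj {m<..} q" using q(3) by (intro L2H_eqI) (auto simp: b_def)
  have "0 = inner (lmult p w) q" using q(1) W(2)[OF w] by simp
  also have "\<dots> = inner (lmult p w) (lmult b (zpow m)) + inner (lmult p w) (proj {m<..} q)"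
    by (subst qd) (simp add: inner_add_right)
  also have "inner (lmult p w) (lmult b (zpow m)) = norm a * norm b"
    using ab by (simp add: inner_lmult_zpow a_def[symmetric] pa power2_eq_square flip: power2_norm_eq_inner)
  also have "inner (lmult p w) (proj {m<..} q) = inner (lmult p (proj {m<..} w)) q"
    by (simp add: inner_proj[symmetric] proj_lmult)
  finally have "norm a * norm b = - inner (lmult p (proj {m<..} w)) q" by simp
  also have "\<dots> \<le> norm (lmult p (proj {m<..} w)) * norm q"
    using Cauchy_Schwarz_ineq2[of "lmult p (proj {m<..} w)" q] by linarith
  finally show ?thesis by (simp add: np a_def b_def)
qed simp

lemma norm_proj_weighted:
  assumes "0 \<le> t" "\<And>m. m \<in> S \<Longrightarrow> norm (fourier f m) \<le> t * norm (fourier g m)"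
  shows "norm (proj S f) \<le> t * norm (proj S g)"
proof -
  have "norm (proj S f) \<le> norm (t *\<^sub>R proj S g)" by (rule norm_le_fourier) (use assms in auto)
  then show ?thesis using assms(1) by simp
qed

lemma norm_proj_finite_le: "finite M \<Longrightarrow> norm (proj M f) \<le> (\<Sum>m\<in>M. norm (fourier f m))"
proof -
  assume M: "finite M"
  have "proj M f = (\<Sum>m\<in>M. lmult (fourier f m) (zpow m))"
  proof (rule L2H_eqI)
    fix k
    have "(\<Sum>m\<in>M. fourier f m * (if k = m then 1 else 0)) = (\<Sum>m\<in>M. if k = m then fourier f k else 0)"
      by (rule sum.cong) auto
    then show "fourier (proj M f) k = fourier (\<Sum>m\<in>M. lmult (fourier f m) (zpow m)) k" using M by simp
  qed
  then show ?thesis using norm_sum[of "\<lambda>m. lmult (fourier f m) (zpow m)" M] by simp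
qed

text \<open>After the rescaling \<open>\<zeta> \<mapsto> z \<zeta>\<close> a nonzero element of the kernel at a small \<open>z\<close> becomes almost an element
  of a finite window that multiplication by \<open>exp \<zeta>\<close> sends to something vanishing at the orders \<open>M\<close>;
  there is none, because the matrix \<open>1 / (m + j)!\<close> is invertible.\<close>

theorem bigcell_punctured_nbhd:
  assumes W: "W \<in> Gr_H"
  shows "\<exists>e>0. \<forall>z. 0 < cmod z \<and> cmod z < e \<longrightarrow> bigcell (V_shift W z)"
proof -
  obtain K where K: "K \<le> 0" "\<And>w. w \<in> W \<Longrightarrow> norm (proj {..<K} w) \<le> 1/2 * norm w"
    using HSdom_tail[OF Gr_H_D(4)[OF W], of "1/2"] by auto
  interpret W: window UNIV W K by standard (use K Gr_H_D[OF W] in \<open>auto simp: ambient_def\<close>)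
  have "W.index0" using W.index0_fredholm Gr_H_D(5)[OF W] by simp
  then obtain M where M: "finite M" "card M = nat (- K)" "M \<subseteq> {K..}"
     "\<forall>m\<in>M. \<exists>q\<in>W.Qort. fourier q m \<noteq> 0 \<and> (\<forall>n<m. fourier q n = 0)"
    using W.exists_orders by auto
  from M(4) obtain q where q: "\<And>m. m \<in> M \<Longrightarrow> q m \<in> W.Qort" "\<And>m. m \<in> M \<Longrightarrow> fourier (q m) m \<noteq> 0"
    "\<And>m n. m \<in> M \<Longrightarrow> n < m \<Longrightarrow> fourier (q m) n = 0" by metis
  define \<kappa> where "\<kappa> = (\<Sum>m\<in>M. norm (q m) / norm (fourier (q m) m))"
  have \<kappa>: "\<kappa> \<ge> 0" unfolding \<kappa>_def by (intro sum_nonneg) auto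
  obtain C1 where C1: "C1 > 0" "\<And>f. norm (rmult f (Ez 1)) \<le> C1 * norm f" using punit_bound[OF punit_Ez] by blast
  obtain C2 where C2: "C2 > 0" "\<And>f. norm (rmult f (Ez (- 1))) \<le> C2 * norm f" using punit_bound[OF punit_Ez] by blast
  have "\<exists>\<delta>>0. \<forall>x\<in>{0}. \<forall>e\<in>supp {K..<0}. \<delta> * norm e \<le> norm (x + proj M (rmult e (Ez 1)))"
  proof -
    have fs: "finite_cdim (supp {K..<0})" using supp_finite[of "{K..<0}"] by simp
    obtain B where B: "finite B" "span B = supp {K..<0}" using finite_cdim_real_span[OF fs] by blast
    have "linear (\<lambda>e. proj M (rmult e (Ez 1)))"
      by (rule linearI) (simp_all add: rmult_add proj_add rmult_scaleR proj_scaleR)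
    then have "\<exists>\<delta>>0. \<forall>x\<in>{0}. \<forall>e\<in>span B. \<delta> * norm e \<le> norm (x + proj M (rmult e (Ez 1)))"
    proof (rule finite_span_bounded_below[rotated 2])
      fix e assume e: "e \<in> span B" "proj M (rmult e (Ez 1)) \<in> {0}"
      then have "fourier (rmult e (Ez 1)) m = 0" if "m \<in> M" for m
      proof -
        have z: "proj M (rmult e (Ez 1)) = 0" using e(2) by blast
        have "fourier (proj M (rmult e (Ez 1))) m = 0" unfolding z by simp
        then show ?thesis using that by simp
      qed
      then show "e = 0" using exp_window_injective[OF _ M(1-3)] e(1) B(2) by blast
    qed (use B in auto)
    then show ?thesis unfolding B(2) .
  qed
  then obtain \<delta> where \<delta>: "\<delta> > 0" "\<And>e. e \<in> supp {K..<0} \<Longrightarrow> \<delta> * norm e \<le> norm (proj M (rmult e (Ez 1)))"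
    by auto
  \<comment> \<open>Collects the constants of the final estimate
    \<open>norm h' <= cmod z * T * norm h'\<close>.\<close>
  define T where "T = ((\<kappa> + C1 * C2) / \<delta> + C2) * C1"
  have T: "T > 0" unfolding T_def using \<kappa> C1(1) C2(1) \<delta>(1) by (intro mult_pos_pos add_nonneg_pos divide_nonneg_pos add_nonneg_nonneg) auto
  define e where "e = min 1 (1 / T)"
  have e: "e > 0" "e \<le> 1" "\<And>z. cmod z < e \<Longrightarrow> cmod z * T < 1" using T by (auto simp: e_def field_simps)
  have "h = 0" if z: "0 < cmod z" "cmod z < e" and h: "h \<in> H_minus" "rmult h (Ez z) \<in> W" for z h
  proof -
    define w where "w = rmult h (Ez z)"
    have wW: "w \<in> W" using h by (simp add: w_def)
    have z0: "z \<noteq> 0" and z1: "cmod z \<le> 1" using z e by auto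
    \<comment> \<open>The rescaled element. It exists because \<open>h\<close> has negative
      exponents only and \<open>cmod z <= 1\<close>, so the factors \<open>z powi (- m)\<close> are
      bounded by 1.\<close>
    define h' where "h' = synth (\<lambda>m. fourier h m * qc (z powi (- m)))"
    have fh': "fourier h' m = fourier h m * qc (z powi (- m))" for m
    proof -
      have "norm (fourier h m * qc (z powi (- m))) \<le> norm (fourier h m)" for m
      proof (cases "m < 0")
        case True
        then have "z powi (- m) = z ^ nat (- m)" by (simp add: power_int_def)
        then have "cmod (z powi (- m)) \<le> 1" using power_le_one[OF norm_ge_zero z1] by (simp only: norm_power)
        then show ?thesis by (simp add: norm_mult mult_left_le)
      qed (use h(1) in \<open>simp add: H_minus_supp supp_iff\<close>)
      then show ?thesis unfolding h'_def by (intro fourier_synth square_summable_le[OF _ fourier_square_summable[of h]])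
    qed
    define w' where "w' = rmult h' (Ez 1)"
    have ww': "fourier w m = fourier w' m * qc (z powi m)" for m
    proof -
      have 1: "(\<lambda>n. fourier h (m - int n) * qc (z ^ n / fact n)) sums fourier w m"
        unfolding w_def by (rule fourier_rmult_pser[OF pser_Ez])
      have "(\<lambda>n. fourier h' (m - int n) * qc (1 ^ n / fact n)) sums fourier w' m"
        unfolding w'_def by (rule fourier_rmult_pser[OF pser_Ez])
      then have "(\<lambda>n. fourier h' (m - int n) * qc (1 ^ n / fact n) * qc (z powi m)) sums (fourier w' m * qc (z powi m))"
        by (rule sums_mult2)
      moreover have "fourier h' (m - int n) * qc (1 ^ n / fact n) * qc (z powi m) = fourier h (m - int n) * qc (z ^ n / fact n)" for n
      proof -
        have "z powi (- (m - int n)) * (1 ^ n / fact n) * z powi m = z ^ n / fact n"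
          using z0 by (simp add: power_int_diff field_simps)
        then show ?thesis unfolding fh' mult.assoc by (simp flip: qc_mult mult.assoc)
      qed
      ultimately show ?thesis using sums_unique2[OF 1] by simp
    qed
    have nw: "norm (fourier w m) = norm (fourier w' m) * cmod z powi m" for m
      by (simp add: ww' norm_mult norm_power_int)
    have nw': "norm (fourier w' m) = norm (fourier w m) * cmod z powi (- m)" for m
      using z(1) by (simp add: nw power_int_minus)
    have up: "norm (proj S w) \<le> cmod z powi k * norm w'" if "\<And>s. s \<in> S \<Longrightarrow> s \<ge> k" for S k
    proof -
      have "norm (proj S w) \<le> cmod z powi k * norm (proj S w')"
      proof (rule norm_proj_weighted)
        fix s assume "s \<in> S"
        then have "cmod z powi s \<le> cmod z powi k" using that z(1) z1 by (intro power_int_decreasing) auto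
        then show "norm (fourier w s) \<le> cmod z powi k * norm (fourier w' s)"
          unfolding nw by (simp add: mult.commute mult_right_mono)
      qed simp
      also have "\<dots> \<le> cmod z powi k * norm w'" by (intro mult_left_mono norm_proj_le) simp
      finally show ?thesis .
    qed
    \<comment> \<open>Below the window, passing from \<open>w\<close> to \<open>w'\<close>
      multiplies by at most \<open>cmod z powi (1 - K)\<close>, while \<open>w\<close> there is
      dominated by its part from \<open>K\<close> upwards, of size \<open>cmod z powi K\<close>. One
      factor \<open>cmod z\<close> remains.\<close>
    have t1: "norm (proj {..<K} w') \<le> cmod z * norm w'"
    proof -
      have "norm (proj {..<K} w') \<le> cmod z powi (1 - K) * norm (proj {..<K} w)"
      proof (rule norm_proj_weighted)
        fix m assume "m \<in> {..<K}"
        then have "cmod z powi (- m) \<le> cmod z powi (1 - K)" using z(1) z1 by (intro power_int_decreasing) auto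
        then have "norm (fourier w m) * cmod z powi (- m) \<le> norm (fourier w m) * cmod z powi (1 - K)"
          by (rule mult_left_mono) simp
        then show "norm (fourier w' m) \<le> cmod z powi (1 - K) * norm (fourier w m)"
          unfolding nw' by (simp only: mult.commute[of "cmod z powi (1 - K)"])
      qed simp
      also have "\<dots> \<le> cmod z powi (1 - K) * norm (proj {K..} w)"
        using K(2)[OF wW] W.below[OF wW] by (intro mult_left_mono) auto
      also have "\<dots> \<le> cmod z powi (1 - K) * (cmod z powi K * norm w')" by (intro mult_left_mono up) auto
      also have "\<dots> = cmod z * norm w'" using z(1) by (simp add: power_int_diff)
      finally show ?thesis .
    qed
    \<comment> \<open>By \<open>order_bound\<close> the coefficient at \<open>m\<close> is
      controlled by exponents above \<open>m\<close>, which again leaves one factor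
      \<open>cmod z\<close>.\<close>
    have t2: "norm (fourier w' m) \<le> cmod z * norm w' * (norm (q m) / norm (fourier (q m) m))" if m: "m \<in> M" for m
    proof -
      have orth: "inner f (q m) = 0" if f: "f \<in> W" for f
      proof -
        have "inner (q m) (proj {K..} f) = 0" using q(1)[OF m] f unfolding W.Qort_def by blast
        moreover have "proj {K..} (q m) = q m" using q(1)[OF m] by (simp add: W.Qort_def supp_def)
        ultimately show ?thesis by (metis inner_commute inner_proj)
      qed
      have "norm (fourier w m) * norm (fourier (q m) m) \<le> norm (proj {m<..} w) * norm (q m)"
        by (rule order_bound[OF Gr_H_D(1,3)[OF W] wW orth q(2)[OF m] q(3)[OF m]])
      also have "\<dots> \<le> (cmod z powi (m + 1) * norm w') * norm (q m)" by (intro mult_right_mono up) auto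
      finally have "norm (fourier w m) \<le> cmod z powi (m + 1) * norm w' * norm (q m) / norm (fourier (q m) m)"
        using q(2)[OF m] by (simp add: field_simps)
      then have "norm (fourier w' m) \<le> (cmod z powi (m + 1) * norm w' * norm (q m) / norm (fourier (q m) m)) * cmod z powi (- m)"
        unfolding nw' by (rule mult_right_mono) simp
      also have "\<dots> = (cmod z powi (m + 1) * cmod z powi (- m)) * norm w' * (norm (q m) / norm (fourier (q m) m))" by simp
      also have "cmod z powi (m + 1) * cmod z powi (- m) = cmod z" using z(1) by (simp add: power_int_minus power_int_add)
      finally show ?thesis .
    qed
    have t3: "norm (proj M w') \<le> cmod z * norm w' * \<kappa>"
    proof -
      have "norm (proj M w') \<le> (\<Sum>m\<in>M. norm (fourier w' m))" by (rule norm_proj_finite_le[OF M(1)])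
      also have "\<dots> \<le> (\<Sum>m\<in>M. cmod z * norm w' * (norm (q m) / norm (fourier (q m) m)))" by (intro sum_mono t2)
      also have "\<dots> = cmod z * norm w' * \<kappa>" by (simp add: \<kappa>_def sum_distrib_left)
      finally show ?thesis .
    qed
    have h's: "h' \<in> supp {..<0}" using h(1) by (simp add: supp_iff fh' H_minus_supp)
    define hf where "hf = proj {K..<0} h'"
    define ht where "ht = proj {..<K} h'"
    have hd: "h' = hf + ht" using h's K(1) by (intro L2H_eqI) (auto simp: hf_def ht_def supp_iff)
    have h'w': "h' = rmult w' (Ez (- 1))" unfolding w'_def by (rule punit_cancel[OF punit_Ez, symmetric])
    \<comment> \<open>Multiplication by an exponential never lowers exponents, so the part of
      \<open>h'\<close> below \<open>K\<close> depends only on that of \<open>w'\<close>.\<close>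
    have "ht = proj {..<K} (rmult (proj {..<K} w') (Ez (- 1)))"
    proof -
      have "w' = proj {K..} w' + proj {..<K} w'" by (rule L2H_eqI) simp
      then have "h' = rmult (proj {K..} w') (Ez (- 1)) + rmult (proj {..<K} w') (Ez (- 1))"
        unfolding h'w' by (metis rmult_add)
      moreover have "proj {..<K} (rmult (proj {K..} w') (Ez (- 1))) = 0"
      proof -
        have "rmult (proj {K..} w') (Ez (- 1)) \<in> supp {K..}" by (rule pser_supp[OF pser_Ez proj_in_supp])
        then show ?thesis by (intro L2H_eqI) (simp add: supp_iff)
      qed
      ultimately show ?thesis by (simp add: ht_def proj_add)
    qed
    then have "norm ht \<le> norm (rmult (proj {..<K} w') (Ez (- 1)))" by (simp add: norm_proj_le)
    also have "\<dots> \<le> C2 * norm (proj {..<K} w')" by (rule C2(2))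
    also have "\<dots> \<le> C2 * (cmod z * norm w')" using t1 C2(1) by (intro mult_left_mono) auto
    finally have nht: "norm ht \<le> C2 * (cmod z * norm w')" .
    have hfs: "hf \<in> supp {K..<0}" unfolding hf_def by (rule proj_in_supp)
    have "w' = rmult hf (Ez 1) + rmult ht (Ez 1)" unfolding w'_def by (subst hd) (rule rmult_add)
    then have "rmult hf (Ez 1) = w' - rmult ht (Ez 1)" by (metis add_diff_cancel_right')
    then have "proj M (rmult hf (Ez 1)) = proj M w' - proj M (rmult ht (Ez 1))" by (simp add: proj_diff)
    then have "norm (proj M (rmult hf (Ez 1))) \<le> norm (proj M w') + norm (proj M (rmult ht (Ez 1)))"
      by (simp add: norm_triangle_ineq4)
    also have "norm (proj M (rmult ht (Ez 1))) \<le> norm (rmult ht (Ez 1))" by (rule norm_proj_le)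
    also have "norm (rmult ht (Ez 1)) \<le> C1 * norm ht" by (rule C1(2))
    also have "\<dots> \<le> C1 * (C2 * (cmod z * norm w'))" using nht C1(1) by (intro mult_left_mono) auto
    also note t3
    finally have "norm (proj M (rmult hf (Ez 1))) \<le> cmod z * norm w' * \<kappa> + C1 * (C2 * (cmod z * norm w'))" by simp
    then have "\<delta> * norm hf \<le> cmod z * norm w' * (\<kappa> + C1 * C2)"
      using \<delta>(2)[OF hfs] by (simp add: algebra_simps)
    then have nhf: "norm hf \<le> cmod z * norm w' * ((\<kappa> + C1 * C2) / \<delta>)" using \<delta>(1) by (simp add: field_simps)
    have "norm h' \<le> norm hf + norm ht" unfolding hd by (rule norm_triangle_ineq)
    also have "\<dots> \<le> cmod z * norm w' * ((\<kappa> + C1 * C2) / \<delta>) + C2 * (cmod z * norm w')" using nhf nht by (rule add_mono)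
    also have "\<dots> = cmod z * ((\<kappa> + C1 * C2) / \<delta> + C2) * norm w'" by (simp add: algebra_simps)
    also have "\<dots> \<le> cmod z * ((\<kappa> + C1 * C2) / \<delta> + C2) * (C1 * norm h')"
      unfolding w'_def using C1 C2(1) \<kappa> \<delta>(1) by (intro mult_left_mono) auto
    also have "\<dots> = (cmod z * T) * norm h'" by (simp add: T_def mult_ac)
    finally have "norm h' \<le> (cmod z * T) * norm h'" .
    then have "h' = 0" using e(3)[OF z(2)] by (metis mult_le_cancel_right1 norm_le_zero_iff not_le)
    then show "h = 0" using fh' z0 by (intro fourier_eq_0_imp) (metis fourier_0 mult_eq_0_iff norm_eq_zero norm_quat_of_complex power_int_eq_0_iff)
  qed
  then have "\<forall>z. 0 < cmod z \<and> cmod z < e \<longrightarrow> bigcell (V_shift W z)"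
    by (intro allI impI bigcellI V_shift_Gr_H[OF W]) (auto simp: V_shift_def)
  then show ?thesis using e(1) by blast
qed

definition Omega :: "L2H set \<Rightarrow> complex set" where
  "Omega W = {z. bigcell (V_shift W z)}"

lemma Omega_iff: "W \<in> Gr_H \<Longrightarrow> pt z \<in> baker_dom W \<longleftrightarrow> z \<in> Omega W"
  by (simp add: baker_dom_iff pt_valid W_gam_pt Omega_def)

lemma Omega_punctured:
  assumes "W \<in> Gr_H" shows "\<exists>e>0. \<forall>z. 0 < dist z z0 \<and> dist z z0 < e \<longrightarrow> z \<in> Omega W"
proof -
  obtain e where e: "e > 0" "\<And>z. 0 < cmod z \<Longrightarrow> cmod z < e \<Longrightarrow> bigcell (V_shift (V_shift W z0) z)"
    using bigcell_punctured_nbhd[OF V_shift_Gr_H[OF assms]] by blast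
  have "z \<in> Omega W" if "0 < dist z z0 \<and> dist z z0 < e" for z
    using e(2)[of "z - z0"] that by (simp add: Omega_def V_shift_V_shift dist_norm)
  then show ?thesis using e(1) by blast
qed

lemma Omega_open:
  assumes "W \<in> Gr_H" shows "open (Omega W)" unfolding open_dist
proof
  fix z0 assume z0: "z0 \<in> Omega W"
  obtain e where "e > 0" "\<And>z. 0 < dist z z0 \<and> dist z z0 < e \<Longrightarrow> z \<in> Omega W" using Omega_punctured[OF assms, of z0] by blast
  then show "\<exists>e>0. \<forall>y. dist y z0 < e \<longrightarrow> y \<in> Omega W" using z0 by (metis zero_less_dist_iff)
qed

lemma Omega_nonempty: assumes "W \<in> Gr_H" shows "Omega W \<noteq> {}"
proof -
  obtain e where e: "e > 0" "\<And>z. 0 < dist z 0 \<and> dist z 0 < e \<Longrightarrow> z \<in> Omega W" using Omega_punctured[OF assms, of 0] by blast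
  have "of_real (e/2) \<in> Omega W" by (rule e(2)) (use e(1) in \<open>simp add: dist_norm\<close>)
  then show ?thesis by blast
qed

text \<open>Every point has a punctured neighbourhood inside \<open>Omega W\<close>, so the
  complement is sparse, hence countable, and the plane minus a countable set is path
  connected.\<close>

lemma Omega_connected:
  assumes "W \<in> Gr_H" shows "connected (Omega W)"
proof -
  have "(- Omega W) sparse_in UNIV" unfolding sparse_in_def
  proof (intro ballI)
    fix z0 :: complex
    obtain e where e: "e > 0" "\<And>z. 0 < dist z z0 \<and> dist z z0 < e \<Longrightarrow> z \<in> Omega W" using Omega_punctured[OF assms, of z0] by blast
    show "\<exists>B. z0 \<in> B \<and> open B \<and> (\<forall>y\<in>B. \<not> y islimpt - Omega W)"
    proof (intro exI[of _ "ball z0 e"] conjI ballI)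
      fix y assume y: "y \<in> ball z0 e"
      show "\<not> y islimpt - Omega W"
      proof
        assume "y islimpt - Omega W"
        moreover have "- Omega W \<inter> ball z0 e \<subseteq> {z0}"
        proof
          fix x assume x: "x \<in> - Omega W \<inter> ball z0 e"
          show "x \<in> {z0}"
          proof (rule ccontr)
            assume "x \<notin> {z0}"
            then have "0 < dist x z0 \<and> dist x z0 < e" using x by (simp add: dist_commute)
            then show False using e(2) x by blast
          qed
        qed
        ultimately have "y islimpt {z0}"
          using y islimpt_subset by (metis islimpt_Int_eventually eventually_at_topological inf_commute open_ball)
        then show False by (simp add: islimpt_finite)
      qed
    qed (use e(1) in auto)
  qed
  then have "countable (- Omega W)" using sparse_imp_countable[of UNIV "- Omega W"] by simp
  then have "connected (- (- Omega W))" by (intro path_connected_imp_connected path_connected_complement_countable) auto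
  then show ?thesis by simp
qed

section \<open>Calculus of formal pseudo-differential operators\<close>

section \<open>Iterated derivatives along the flow\<close>

definition ysh :: "times \<Rightarrow> real \<Rightarrow> times" where
  "ysh c h = c(1 := c 1 + \<i> * of_real h)"

lemma ysh_0 [simp]: "ysh c 0 = c" by (simp add: ysh_def)

lemma pd_y_ysh: "pd_y U f c = (if c \<in> U then vector_derivative (\<lambda>h. f (ysh c h)) (at 0) else 0)"
  by (simp add: pd_y_def ysh_def)

lemma pd_y_off [simp]: "c \<notin> U \<Longrightarrow> pd_y U f c = 0" by (simp add: pd_y_ysh)

text \<open>\<open>pd_y\<close> is total and returns a value even where no derivative exists, so
  differentiability of each order is tracked separately; the rules for sums and products depend on
  it.\<close>

fun ydiff :: "times set \<Rightarrow> nat \<Rightarrow> (times \<Rightarrow> quat) \<Rightarrow> bool" where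
  "ydiff U 0 f = True"
| "ydiff U (Suc n) f = ((\<forall>c\<in>U. (\<lambda>h. f (ysh c h)) differentiable (at 0)) \<and> ydiff U n (pd_y U f))"

definition ysmooth :: "times set \<Rightarrow> (times \<Rightarrow> quat) \<Rightarrow> bool" where
  "ysmooth U f \<longleftrightarrow> (\<forall>n. ydiff U n f) \<and> (\<forall>c. c \<notin> U \<longrightarrow> f c = 0)"

text \<open>Openness along the lines in direction \<open>y\<close>, the only direction in which the
  operators differentiate.\<close>

definition yopen :: "times set \<Rightarrow> bool" where
  "yopen U \<longleftrightarrow> (\<forall>c\<in>U. \<exists>e>0. \<forall>h. \<bar>h\<bar> < e \<longrightarrow> ysh c h \<in> U)"

lemma ydiff_antimono: "ydiff U (Suc n) f \<Longrightarrow> ydiff U n f" by (induction n arbitrary: f) auto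

lemma ydiff_deriv:
  assumes "ydiff U (Suc n) f" "c \<in> U"
  shows "((\<lambda>h. f (ysh c h)) has_vector_derivative pd_y U f c) (at 0)"
  using assms by (simp add: pd_y_ysh vector_derivative_works[symmetric])

lemma pd_y_eqI: "c \<in> U \<Longrightarrow> ((\<lambda>h. f (ysh c h)) has_vector_derivative d) (at 0) \<Longrightarrow> pd_y U f c = d"
  by (simp add: pd_y_ysh vector_derivative_at)

lemma pd_y_add:
  assumes "ydiff U (Suc n) f" "ydiff U (Suc n) g"
  shows "pd_y U (\<lambda>c. f c + g c) = (\<lambda>c. pd_y U f c + pd_y U g c)"
proof
  fix c show "pd_y U (\<lambda>c. f c + g c) c = pd_y U f c + pd_y U g c"
    by (cases "c \<in> U") (auto intro!: pd_y_eqI has_vector_derivative_add ydiff_deriv[OF assms(1)] ydiff_deriv[OF assms(2)])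
qed

lemma ydiff_add: "ydiff U n f \<Longrightarrow> ydiff U n g \<Longrightarrow> ydiff U n (\<lambda>c. f c + g c)"
proof (induction n arbitrary: f g)
  case (Suc n)
  have "ydiff U n (\<lambda>c. pd_y U f c + pd_y U g c)" using Suc by simp
  then show ?case using Suc.prems pd_y_add[OF Suc.prems] by auto
qed simp

lemma pd_y_bounded_linear:
  assumes "ydiff U (Suc n) f" "bounded_linear T"
  shows "pd_y U (\<lambda>c. T (f c)) = (\<lambda>c. T (pd_y U f c))"
proof
  fix c show "pd_y U (\<lambda>c. T (f c)) c = T (pd_y U f c)" using linear_0[OF bounded_linear.linear[OF assms(2)]]
    by (cases "c \<in> U") (auto intro!: pd_y_eqI bounded_linear.has_vector_derivative[OF assms(2)] ydiff_deriv[OF assms(1)])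
qed

lemma ydiff_bounded_linear:
  assumes "bounded_linear T" shows "ydiff U n f \<Longrightarrow> ydiff U n (\<lambda>c. T (f c))"
proof (induction n arbitrary: f)
  case (Suc n)
  have "(\<lambda>h. T (f (ysh c h))) differentiable (at 0)" if "c \<in> U" for c
    using bounded_linear.has_vector_derivative[OF assms ydiff_deriv[OF Suc.prems that]] by (rule differentiableI_vector)
  then show ?case using Suc pd_y_bounded_linear[OF Suc.prems assms] by auto
qed simp

lemma pd_y_mult:
  assumes "ydiff U (Suc n) f" "ydiff U (Suc n) g"
  shows "pd_y U (\<lambda>c. f c * g c) = (\<lambda>c. f c * pd_y U g c + pd_y U f c * g c)"
proof
  fix c show "pd_y U (\<lambda>c. f c * g c) c = f c * pd_y U g c + pd_y U f c * g c"
  proof (cases "c \<in> U")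
    case True
    show ?thesis using has_vector_derivative_mult[OF ydiff_deriv[OF assms(1) True] ydiff_deriv[OF assms(2) True]]
      by (intro pd_y_eqI[OF True]) simp
  qed simp
qed

lemma ydiff_mult: "ydiff U n f \<Longrightarrow> ydiff U n g \<Longrightarrow> ydiff U n (\<lambda>c. f c * g c)"
proof (induction n arbitrary: f g)
  case (Suc n)
  have "(\<lambda>h. f (ysh c h) * g (ysh c h)) differentiable (at 0)" if "c \<in> U" for c
    using has_vector_derivative_mult[OF ydiff_deriv[OF Suc.prems(1) that] ydiff_deriv[OF Suc.prems(2) that]]
    by (rule differentiableI_vector)
  moreover have "ydiff U n (\<lambda>c. f c * pd_y U g c + pd_y U f c * g c)"
    using Suc ydiff_antimono[OF Suc.prems(1)] ydiff_antimono[OF Suc.prems(2)] by (intro ydiff_add Suc.IH) auto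
  ultimately show ?case using pd_y_mult[OF Suc.prems] by simp
qed simp

lemma ysmooth_pd_y: "ysmooth U f \<Longrightarrow> ysmooth U (pd_y U f)"
  unfolding ysmooth_def by (metis pd_y_off ydiff.simps(2))

lemma ysmooth_pd_y_pow: "ysmooth U f \<Longrightarrow> ysmooth U ((pd_y U ^^ k) f)"
  by (induction k) (auto intro: ysmooth_pd_y)

lemma ysmooth_add: "ysmooth U f \<Longrightarrow> ysmooth U g \<Longrightarrow> ysmooth U (\<lambda>c. f c + g c)"
  by (auto simp: ysmooth_def intro: ydiff_add)

lemma ysmooth_mult: "ysmooth U f \<Longrightarrow> ysmooth U g \<Longrightarrow> ysmooth U (\<lambda>c. f c * g c)"
  by (auto simp: ysmooth_def intro: ydiff_mult)

lemma ysmooth_linear: "ysmooth U f \<Longrightarrow> bounded_linear T \<Longrightarrow> ysmooth U (\<lambda>c. T (f c))"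
  using linear_0[OF bounded_linear.linear] by (auto simp: ysmooth_def intro: ydiff_bounded_linear)

lemma ysmooth_scaleR: "ysmooth U f \<Longrightarrow> ysmooth U (\<lambda>c. r *\<^sub>R f c)"
  by (rule ysmooth_linear[OF _ bounded_linear_scaleR_right])

lemma ydiff_0: "ydiff U n (\<lambda>c. 0)"
proof (induction n)
  case (Suc n)
  have "pd_y U (\<lambda>c. 0) = (\<lambda>c. 0)" by (auto simp: pd_y_ysh fun_eq_iff)
  then show ?case using Suc by simp
qed simp

lemma ysmooth_0: "ysmooth U (\<lambda>c. 0)" by (simp add: ysmooth_def ydiff_0)

lemma pd_y_pow_0 [simp]: "(pd_y U ^^ k) (\<lambda>c. 0) = (\<lambda>c. 0)"
proof (induction k)
  case (Suc k)
  have "pd_y U (\<lambda>c. 0) = (\<lambda>c. 0)" by (auto simp: pd_y_ysh fun_eq_iff)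
  then show ?case using Suc by simp
qed simp

lemma ysmooth_sum: "(\<And>i. i \<in> I \<Longrightarrow> ysmooth U (f i)) \<Longrightarrow> ysmooth U (\<lambda>c. \<Sum>i\<in>I. f i c)"
  by (induction I rule: infinite_finite_induct) (auto intro: ysmooth_0 ysmooth_add)

lemma ysmooth_deriv:
  "ysmooth U f \<Longrightarrow> c \<in> U \<Longrightarrow> ((\<lambda>h. f (ysh c h)) has_vector_derivative pd_y U f c) (at 0)"
  using ydiff_deriv[of U 0] unfolding ysmooth_def by blast

lemma pd_y_smooth_add: "ysmooth U f \<Longrightarrow> ysmooth U g \<Longrightarrow> pd_y U (\<lambda>c. f c + g c) = (\<lambda>c. pd_y U f c + pd_y U g c)"
  using pd_y_add[of U 0] unfolding ysmooth_def by blast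

lemma pd_y_smooth_mult: "ysmooth U f \<Longrightarrow> ysmooth U g \<Longrightarrow> pd_y U (\<lambda>c. f c * g c) = (\<lambda>c. f c * pd_y U g c + pd_y U f c * g c)"
  using pd_y_mult[of U 0] unfolding ysmooth_def by blast

lemma pd_y_smooth_linear: "ysmooth U f \<Longrightarrow> bounded_linear T \<Longrightarrow> pd_y U (\<lambda>c. T (f c)) = (\<lambda>c. T (pd_y U f c))"
  using pd_y_bounded_linear[of U 0] unfolding ysmooth_def by blast

lemma pd_y_pow_linear: "ysmooth U f \<Longrightarrow> bounded_linear T \<Longrightarrow> (pd_y U ^^ k) (\<lambda>c. T (f c)) = (\<lambda>c. T ((pd_y U ^^ k) f c))"
  by (induction k) (simp_all add: pd_y_smooth_linear ysmooth_pd_y_pow)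

lemma pd_y_pow_scaleR: "ysmooth U f \<Longrightarrow> (pd_y U ^^ k) (\<lambda>c. r *\<^sub>R f c) = (\<lambda>c. r *\<^sub>R (pd_y U ^^ k) f c)"
  by (rule pd_y_pow_linear) (auto intro: bounded_linear_scaleR_right)

lemma pd_y_pow_add: "ysmooth U f \<Longrightarrow> ysmooth U g \<Longrightarrow> (pd_y U ^^ k) (\<lambda>c. f c + g c) = (\<lambda>c. (pd_y U ^^ k) f c + (pd_y U ^^ k) g c)"
  by (induction k) (simp_all add: pd_y_smooth_add ysmooth_pd_y_pow)

lemma pd_y_pow_sum:
  "(\<And>i. i \<in> I \<Longrightarrow> ysmooth U (f i)) \<Longrightarrow> (pd_y U ^^ k) (\<lambda>c. \<Sum>i\<in>I. f i c) = (\<lambda>c. \<Sum>i\<in>I. (pd_y U ^^ k) (f i) c)"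
  by (induction I rule: infinite_finite_induct) (simp_all add: pd_y_pow_add ysmooth_sum)

lemma pd_y_pow_mult:
  assumes "ysmooth U f" "ysmooth U g"
  shows "(pd_y U ^^ k) (\<lambda>c. f c * g c) = (\<lambda>c. \<Sum>i\<le>k. real (k choose i) *\<^sub>R ((pd_y U ^^ i) f c * (pd_y U ^^ (k - i)) g c))"
proof (induction k)
  case (Suc k)
  let ?t = "\<lambda>i j c. (pd_y U ^^ i) f c * (pd_y U ^^ j) g c"
  have sm: "ysmooth U (?t i j)" for i j by (intro ysmooth_mult ysmooth_pd_y_pow assms)
  have dt: "pd_y U (?t i j) = (\<lambda>c. ?t i (Suc j) c + ?t (Suc i) j c)" for i j
    using pd_y_smooth_mult[OF ysmooth_pd_y_pow[OF assms(1)] ysmooth_pd_y_pow[OF assms(2)], of i j] by simp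
  have "(pd_y U ^^ Suc k) (\<lambda>c. f c * g c) = (pd_y U ^^ 1) (\<lambda>c. \<Sum>i\<le>k. real (k choose i) *\<^sub>R ?t i (k - i) c)"
    using Suc by (simp add: One_nat_def)
  also have "\<dots> = (\<lambda>c. \<Sum>i\<le>k. (pd_y U ^^ 1) (\<lambda>c. real (k choose i) *\<^sub>R ?t i (k - i) c) c)"
    by (rule pd_y_pow_sum) (intro ysmooth_scaleR sm)
  also have "\<dots> = (\<lambda>c. \<Sum>i\<le>k. real (k choose i) *\<^sub>R (?t i (Suc (k - i)) c + ?t (Suc i) (k - i) c))"
  proof -
    have "(pd_y U ^^ 1) (\<lambda>c. r *\<^sub>R ?t i (k - i) c) = (\<lambda>c. r *\<^sub>R (pd_y U ^^ 1) (?t i (k - i)) c)" for i r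
      by (rule pd_y_pow_scaleR[OF sm])
    moreover have "(pd_y U ^^ 1) (?t i (k - i)) = (\<lambda>c. ?t i (Suc (k - i)) c + ?t (Suc i) (k - i) c)" for i
      using dt[of i "k - i"] by (simp add: One_nat_def)
    ultimately show ?thesis by simp
  qed
  also have "\<dots> = (\<lambda>c. \<Sum>i\<le>Suc k. real (Suc k choose i) *\<^sub>R ?t i (Suc k - i) c)"
  proof
    fix c
    have "(\<Sum>i\<le>Suc k. real (Suc k choose i) *\<^sub>R ?t i (Suc k - i) c)
       = ?t 0 (Suc k) c + (\<Sum>i\<le>k. real (Suc k choose Suc i) *\<^sub>R ?t (Suc i) (k - i) c)"
      by (subst sum.atMost_Suc_shift) simp
    also have "\<dots> = ?t 0 (Suc k) c + (\<Sum>i\<le>k. real (k choose Suc i) *\<^sub>R ?t (Suc i) (k - i) c) + (\<Sum>i\<le>k. real (k choose i) *\<^sub>R ?t (Suc i) (k - i) c)"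
      by (simp add: sum.distrib scaleR_add_left algebra_simps)
    also have "?t 0 (Suc k) c + (\<Sum>i\<le>k. real (k choose Suc i) *\<^sub>R ?t (Suc i) (k - i) c) = (\<Sum>i\<le>Suc k. real (k choose i) *\<^sub>R ?t i (Suc k - i) c)"
      by (subst sum.atMost_Suc_shift) simp
    also have "\<dots> = (\<Sum>i\<le>k. real (k choose i) *\<^sub>R ?t i (Suc (k - i)) c)" by (simp add: Suc_diff_le)
    finally show "(\<Sum>i\<le>k. real (k choose i) *\<^sub>R (?t i (Suc (k - i)) c + ?t (Suc i) (k - i) c)) = (\<Sum>i\<le>Suc k. real (Suc k choose i) *\<^sub>R ?t i (Suc k - i) c)"
      by (simp add: scaleR_add_right sum.distrib)
  qed
  finally show ?case .
qed simp

lemma yconst: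
  assumes "yopen U"
  shows "ysmooth U (\<lambda>c. if c \<in> U then q else 0)" "k > 0 \<Longrightarrow> (pd_y U ^^ k) (\<lambda>c. if c \<in> U then q else 0) = (\<lambda>c. 0)"
proof -
  let ?f = "\<lambda>c. if c \<in> U then q else 0"
  have d: "((\<lambda>h. ?f (ysh c h)) has_vector_derivative 0) (at 0)" if c: "c \<in> U" for c
  proof -
    obtain e where e: "e > 0" "\<And>h. \<bar>h\<bar> < e \<Longrightarrow> ysh c h \<in> U" using assms c by (auto simp: yopen_def)
    show ?thesis by (rule has_vector_derivative_quadratic[OF e(1), of _ _ 0]) (use e c in auto)
  qed
  have z: "pd_y U ?f = (\<lambda>c. 0)"
  proof
    fix c show "pd_y U ?f c = 0" by (cases "c \<in> U") (auto intro!: pd_y_eqI d)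
  qed
  have "ydiff U n ?f" for n using z d by (cases n) (auto simp: ydiff_0 intro: differentiableI_vector)
  then show "ysmooth U ?f" by (simp add: ysmooth_def)
  show "k > 0 \<Longrightarrow> (pd_y U ^^ k) ?f = (\<lambda>c. 0)"
    by (cases k) (simp_all del: funpow.simps add: funpow_Suc_right z)
qed

section \<open>The algebra of formal pseudo-differential operators\<close>

definition tri :: "nat \<Rightarrow> (nat \<times> nat \<times> nat) set" where
  "tri k = {(i, j, l). i + j + l = k}"

lemma finite_tri [simp]: "finite (tri k)"
  by (rule finite_subset[of _ "{..k} \<times> {..k} \<times> {..k}"]) (auto simp: tri_def)

definition psord :: "int \<Rightarrow> psdo \<Rightarrow> bool" where
  "psord a A \<longleftrightarrow> (\<forall>n>a. A n = (\<lambda>_. 0))"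

text \<open>Counting orders downwards from the leading ones gives an index set \<open>tri k\<close>
  that does not depend on which coefficients vanish, so that sums can be rearranged
  uniformly.\<close>

lemma psdo_mult_tri:
  assumes "psord a A" "psord b B"
  shows "psdo_mult U A B (a + b - int k) c =
    (\<Sum>(i, j, l)\<in>tri k. (real_of_int (a - int i) gchoose l) *\<^sub>R (A (a - int i) c * (pd_y U ^^ l) (B (b - int j)) c))"
proof -
  let ?n = "a + b - int k"
  let ?S = "{(m, p). A m \<noteq> (\<lambda>_. 0) \<and> B p \<noteq> (\<lambda>_. 0) \<and> ?n \<le> m + p}"
  let ?T = "{(m, p). m \<le> a \<and> p \<le> b \<and> ?n \<le> m + p}"
  let ?g = "\<lambda>(m, p). (real_of_int m gchoose nat (m + p - ?n)) *\<^sub>R (A m c * (pd_y U ^^ nat (m + p - ?n)) (B p) c)"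
  have fT: "finite ?T" by (rule finite_subset[of _ "{a - int k..a} \<times> {b - int k..b}"]) auto
  have "psdo_mult U A B ?n c = sum ?g ?S" by (simp add: psdo_mult_def)
  also have "\<dots> = sum ?g ?T"
  proof (rule sum.mono_neutral_left[OF fT])
    show "?S \<subseteq> ?T" using assms by (force simp: psord_def not_le[symmetric])
    show "\<forall>x\<in>?T - ?S. ?g x = 0" by auto
  qed
  also have "\<dots> = (\<Sum>(i, j, l)\<in>tri k. (real_of_int (a - int i) gchoose l) *\<^sub>R (A (a - int i) c * (pd_y U ^^ l) (B (b - int j)) c))"
    by (rule sum.reindex_bij_witness[of _ "\<lambda>(i, j, l). (a - int i, b - int j)" "\<lambda>(m, p). (nat (a - m), nat (b - p), nat (m + p - ?n))"])
       (auto simp: tri_def)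
  finally show ?thesis .
qed

lemma psdo_mult_tri_on:
  assumes "psord a A" "psord b B" and T: "T \<subseteq> tri k"
    and z: "\<And>i j l. (i, j, l) \<in> tri k \<Longrightarrow> (i, j, l) \<notin> T \<Longrightarrow>
      real_of_int (a - int i) gchoose l = 0 \<or> A (a - int i) c = 0 \<or> (pd_y U ^^ l) (B (b - int j)) c = 0"
  shows "psdo_mult U A B (a + b - int k) c =
    (\<Sum>(i, j, l)\<in>T. (real_of_int (a - int i) gchoose l) *\<^sub>R (A (a - int i) c * (pd_y U ^^ l) (B (b - int j)) c))"
  unfolding psdo_mult_tri[OF assms(1,2)]
proof (rule sum.mono_neutral_right[OF finite_tri T], rule ballI)
  fix x assume x: "x \<in> tri k - T"
  obtain i j l where xx: "x = (i, j, l)" by (cases x)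
  show "(case x of (i, j, l) \<Rightarrow> (real_of_int (a - int i) gchoose l) *\<^sub>R (A (a - int i) c * (pd_y U ^^ l) (B (b - int j)) c)) = 0"
    using z[of i j l] x unfolding xx prod.case by auto
qed

lemma psdo_mult_high:
  assumes "psord a A" "psord b B" "n > a + b"
  shows "psdo_mult U A B n c = 0" unfolding psdo_mult_def
proof (rule sum.neutral, safe)
  fix m p assume "A m \<noteq> (\<lambda>_. 0)" "B p \<noteq> (\<lambda>_. 0)" "n \<le> m + p"
  then show "(real_of_int m gchoose nat (m + p - n)) *\<^sub>R (A m c * (pd_y U ^^ nat (m + p - n)) (B p) c) = 0"
    using assms by (force simp: psord_def not_le[symmetric])
qed

lemma psord_mult: "psord a A \<Longrightarrow> psord b B \<Longrightarrow> psord (a + b) (psdo_mult U A B)"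
  unfolding psord_def[of "a + b"] using psdo_mult_high by blast

definition sps :: "times set \<Rightarrow> int \<Rightarrow> psdo \<Rightarrow> bool" where
  "sps U a A \<longleftrightarrow> psord a A \<and> (\<forall>n. ysmooth U (A n))"

lemma psdos_eqI:
  assumes "psord a A" "psord a B" "\<And>k c. A (a - int k) c = B (a - int k) c"
  shows "A = B"
proof (intro ext)
  fix n c show "A n c = B n c"
  proof (cases "n \<le> a")
    case True
    then show ?thesis using assms(3)[of "nat (a - n)" c] by simp
  qed (use assms(1,2) in \<open>simp add: psord_def\<close>)
qed

lemma ysmooth_cong: "(\<And>c. f c = g c) \<Longrightarrow> ysmooth U f \<Longrightarrow> ysmooth U g" by (metis ext)

lemma sps_mult:
  assumes A: "sps U a A" and B: "sps U b B"
  shows "sps U (a + b) (psdo_mult U A B)" unfolding sps_def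
proof (intro conjI allI)
  show o: "psord (a + b) (psdo_mult U A B)" using psord_mult A B by (auto simp: sps_def)
  fix n show "ysmooth U (psdo_mult U A B n)"
  proof (cases "n \<le> a + b")
    case True
    then have n: "n = a + b - int (nat (a + b - n))" by simp
    show ?thesis
      by (rule ysmooth_cong[of "\<lambda>c. \<Sum>(i, j, l)\<in>tri (nat (a + b - n)). (real_of_int (a - int i) gchoose l) *\<^sub>R (A (a - int i) c * (pd_y U ^^ l) (B (b - int j)) c)"])
         (subst n, subst psdo_mult_tri, use A B in \<open>auto simp: sps_def intro!: ysmooth_sum ysmooth_scaleR ysmooth_mult ysmooth_pd_y_pow\<close>)
  next
    case False
    then have "psdo_mult U A B n = (\<lambda>_. 0)" using o by (simp add: psord_def)
    then show ?thesis by (simp add: ysmooth_0)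
  qed
qed

text \<open>The scalar identity behind associativity: trinomial revision extracts the factor with
  \<open>l\<close>, Vandermonde sums the rest.\<close>

lemma gbinomial_assoc_identity:
  fixes \<alpha> \<beta> :: real
  shows "(\<Sum>u\<le>s. (\<alpha> gchoose (l + s - u)) * real ((l + s - u) choose l) * (\<beta> gchoose u)) = (\<alpha> gchoose l) * ((\<alpha> + \<beta> - real l) gchoose s)"
proof -
  have "(\<Sum>u\<le>s. (\<alpha> gchoose (l + s - u)) * real ((l + s - u) choose l) * (\<beta> gchoose u)) = (\<Sum>u\<le>s. (\<alpha> gchoose l) * ((\<beta> gchoose u) * ((\<alpha> - real l) gchoose (s - u))))"
  proof (rule sum.cong[OF refl])
    fix u assume u: "u \<in> {..s}"
    have "(\<alpha> gchoose (l + s - u)) * (of_nat (l + s - u) gchoose l) = (\<alpha> gchoose l) * ((\<alpha> - of_nat l) gchoose ((l + s - u) - l))"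
      by (rule gbinomial_trinomial_revision) (use u in auto)
    moreover have "(l + s - u) - l = s - u" using u by auto
    ultimately show "(\<alpha> gchoose (l + s - u)) * real ((l + s - u) choose l) * (\<beta> gchoose u) = (\<alpha> gchoose l) * ((\<beta> gchoose u) * ((\<alpha> - real l) gchoose (s - u)))"
      by (simp add: binomial_gbinomial)
  qed
  also have "\<dots> = (\<alpha> gchoose l) * (\<Sum>u\<in>{0..s}. (\<beta> gchoose u) * ((\<alpha> - real l) gchoose (s - u)))"
    by (simp add: sum_distrib_left atLeast0AtMost)
  also have "(\<Sum>u\<in>{0..s}. (\<beta> gchoose u) * ((\<alpha> - real l) gchoose (s - u))) = (\<beta> + (\<alpha> - real l)) gchoose s"
    by (rule gbinomial_Vandermonde)
  finally show ?thesis by (simp add: algebra_simps)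
qed

lemma sum_atMost_Sigma:
  fixes h :: "nat \<Rightarrow> nat \<Rightarrow> nat \<Rightarrow> nat \<Rightarrow> nat \<Rightarrow> nat \<Rightarrow> 'a::comm_monoid_add"
  assumes "finite S"
  shows "(\<Sum>(i, j, q, l, s)\<in>S. \<Sum>u\<le>s. h i j q l s u) =
    (\<Sum>((i, j, q, l, s), u)\<in>Sigma S (\<lambda>(i, j, q, l, s). {..s}). h i j q l s u)"
proof -
  have "(\<Sum>(i, j, q, l, s)\<in>S. \<Sum>u\<le>s. h i j q l s u) =
      (\<Sum>x\<in>S. \<Sum>y\<in>(case x of (i, j, q, l, s) \<Rightarrow> {..s}). (case (x, y) of ((i, j, q, l, s), u) \<Rightarrow> h i j q l s u))"
    by (intro sum.cong refl) (auto simp: case_prod_unfold)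
  also have "\<dots> = (\<Sum>((i, j, q, l, s), u)\<in>Sigma S (\<lambda>(i, j, q, l, s). {..s}). h i j q l s u)"
    using assms by (subst sum.Sigma) (auto simp: case_prod_unfold)
  finally show ?thesis .
qed

lemma tri_sum_Sigma:
  fixes h :: "nat \<Rightarrow> nat \<Rightarrow> nat \<Rightarrow> nat \<Rightarrow> nat \<Rightarrow> nat \<Rightarrow> 'a::comm_monoid_add"
  shows "(\<Sum>(i, r, t)\<in>tri k. \<Sum>(j, q, u)\<in>tri r. \<Sum>l\<le>t. h i t j q u l) =
    (\<Sum>((i, r, t), (j, q, u), l)\<in>Sigma (tri k) (\<lambda>(i, r, t). Sigma (tri r) (\<lambda>_. {..t})). h i t j q u l)"
proof -
  have "(\<Sum>(i, r, t)\<in>tri k. \<Sum>(j, q, u)\<in>tri r. \<Sum>l\<le>t. h i t j q u l) =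
      (\<Sum>x\<in>tri k. \<Sum>y\<in>(case x of (i, r, t) \<Rightarrow> Sigma (tri r) (\<lambda>_. {..t})). (case (x, y) of ((i, r, t), (j, q, u), l) \<Rightarrow> h i t j q u l))"
    by (intro sum.cong refl) (auto simp: sum.Sigma case_prod_unfold)
  also have "\<dots> = (\<Sum>((i, r, t), (j, q, u), l)\<in>Sigma (tri k) (\<lambda>(i, r, t). Sigma (tri r) (\<lambda>_. {..t})). h i t j q u l)"
    by (subst sum.Sigma) (auto simp: case_prod_unfold intro!: finite_SigmaI)
  finally show ?thesis .
qed

text \<open>Both sides expand into terms with \<open>l\<close> derivatives on \<open>B\<close> and
  \<open>s\<close> on \<open>C\<close>. On the left the coefficient is a product of two binomials.
  On the right it is a sum over the number \<open>u\<close> of derivatives that \<open>C\<close>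
  receives inside the product of \<open>B\<close> and \<open>C\<close>;
  \<open>gbinomial_assoc_identity\<close> makes the two agree.\<close>

lemma psdo_mult_assoc:
  assumes A: "sps U a A" and B: "sps U b B" and C: "sps U d C"
  shows "psdo_mult U (psdo_mult U A B) C = psdo_mult U A (psdo_mult U B C)"
proof (rule psdos_eqI[of "a + b + d"])
  have AB: "sps U (a + b) (psdo_mult U A B)" and BC: "sps U (b + d) (psdo_mult U B C)" using sps_mult assms by auto
  have oA: "psord a A" and oB: "psord b B" and oC: "psord d C" and oAB: "psord (a + b) (psdo_mult U A B)" and oBC: "psord (b + d) (psdo_mult U B C)"
    using A B C AB BC by (auto simp: sps_def)
  have sm: "ysmooth U (B n)" "ysmooth U (C n)" for n using B C by (auto simp: sps_def)
  show "psord (a + b + d) (psdo_mult U (psdo_mult U A B) C)" by (rule psord_mult[OF oAB oC])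
  show "psord (a + b + d) (psdo_mult U A (psdo_mult U B C))" using psord_mult[OF oA oBC, of U] by (simp add: add.assoc)
  fix k :: nat and c :: times
  let ?A = "\<lambda>i. A (a - int i)" and ?B = "\<lambda>j. B (b - int j)" and ?C = "\<lambda>q. C (d - int q)"
  let ?D = "\<lambda>l f. (pd_y U ^^ l) f"
  let ?t = "\<lambda>i j q l s. ?A i c * ?D l (?B j) c * ?D s (?C q) c"
  define S5 where "S5 = {(i, j, q, l, s). i + j + q + l + s = k}"
  have "finite S5" unfolding S5_def
    by (rule finite_subset[of _ "{..k} \<times> {..k} \<times> {..k} \<times> {..k} \<times> {..k}"]) auto
  define coef where "coef = (\<lambda>i j l s. (real_of_int (a - int i) gchoose l) * ((real_of_int (a - int i) + real_of_int (b - int j) - real l) gchoose s))"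
  have L: "psdo_mult U (psdo_mult U A B) C (a + b + d - int k) c = (\<Sum>(i, j, q, l, s)\<in>S5. coef i j l s *\<^sub>R ?t i j q l s)"
  proof -
    have "psdo_mult U (psdo_mult U A B) C (a + b + d - int k) c =
      (\<Sum>(r, q, s)\<in>tri k. (real_of_int (a + b - int r) gchoose s) *\<^sub>R ((\<Sum>(i, j, l)\<in>tri r. (real_of_int (a - int i) gchoose l) *\<^sub>R (?A i c * ?D l (?B j) c)) * ?D s (?C q) c))"
      unfolding psdo_mult_tri[OF oAB oC] psdo_mult_tri[OF oA oB] ..
    also have "\<dots> = (\<Sum>(r, q, s)\<in>tri k. \<Sum>(i, j, l)\<in>tri r. ((real_of_int (a - int i) gchoose l) * (real_of_int (a + b - int r) gchoose s)) *\<^sub>R ?t i j q l s)"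
      by (intro sum.cong refl) (auto simp: sum_distrib_right scaleR_sum_right mult.commute intro!: sum.cong)
    also have "\<dots> = (\<Sum>((r, q, s), (i, j, l))\<in>Sigma (tri k) (\<lambda>(r, q, s). tri r). ((real_of_int (a - int i) gchoose l) * (real_of_int (a + b - int r) gchoose s)) *\<^sub>R ?t i j q l s)"
      by (subst sum.Sigma[symmetric]) (auto simp: case_prod_unfold)
    also have "\<dots> = (\<Sum>(i, j, q, l, s)\<in>S5. coef i j l s *\<^sub>R ?t i j q l s)"
      by (rule sum.reindex_bij_witness[of _ "\<lambda>(i, j, q, l, s). ((i + j + l, q, s), (i, j, l))" "\<lambda>((r, q, s), (i, j, l)). (i, j, q, l, s)"])
         (auto simp: tri_def S5_def coef_def algebra_simps)
    finally show ?thesis .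
  qed
  have R: "psdo_mult U A (psdo_mult U B C) (a + b + d - int k) c = (\<Sum>(i, j, q, l, s)\<in>S5. coef i j l s *\<^sub>R ?t i j q l s)"
  proof -
    have BCr: "psdo_mult U B C (b + d - int r) = (\<lambda>c. \<Sum>(j, q, u)\<in>tri r. (real_of_int (b - int j) gchoose u) *\<^sub>R (?B j c * ?D u (?C q) c))" for r
      by (rule ext) (rule psdo_mult_tri[OF oB oC])
    have Dt: "?D t (psdo_mult U B C (b + d - int r)) c = (\<Sum>(j, q, u)\<in>tri r. \<Sum>l\<le>t. ((real_of_int (b - int j) gchoose u) * real (t choose l)) *\<^sub>R (?D l (?B j) c * ?D (t - l + u) (?C q) c))" for t r
    proof -
      have "?D t (psdo_mult U B C (b + d - int r)) = (\<lambda>c. \<Sum>x\<in>tri r. ?D t (\<lambda>c. case x of (j, q, u) \<Rightarrow> (real_of_int (b - int j) gchoose u) *\<^sub>R (?B j c * ?D u (?C q) c)) c)"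
        unfolding BCr by (rule pd_y_pow_sum) (auto intro!: ysmooth_scaleR ysmooth_mult ysmooth_pd_y_pow sm)
      then have "?D t (psdo_mult U B C (b + d - int r)) c = (\<Sum>(j, q, u)\<in>tri r. ?D t (\<lambda>c. (real_of_int (b - int j) gchoose u) *\<^sub>R (?B j c * ?D u (?C q) c)) c)"
        by (simp add: case_prod_unfold)
      also have "\<dots> = (\<Sum>(j, q, u)\<in>tri r. \<Sum>l\<le>t. ((real_of_int (b - int j) gchoose u) * real (t choose l)) *\<^sub>R (?D l (?B j) c * ?D (t - l + u) (?C q) c))"
      proof (intro sum.cong refl, clarify)
        fix j q u
        have s1: "ysmooth U (\<lambda>c. ?B j c * ?D u (?C q) c)" by (intro ysmooth_mult ysmooth_pd_y_pow sm)
        show "?D t (\<lambda>c. (real_of_int (b - int j) gchoose u) *\<^sub>R (?B j c * ?D u (?C q) c)) c = (\<Sum>l\<le>t. ((real_of_int (b - int j) gchoose u) * real (t choose l)) *\<^sub>R (?D l (?B j) c * ?D (t - l + u) (?C q) c))"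
        proof -
          have fa: "?D x (?D u f) = ?D (x + u) f" for x f by (simp only: funpow_add o_apply)
          show ?thesis unfolding pd_y_pow_scaleR[OF s1] pd_y_pow_mult[OF sm(1) ysmooth_pd_y_pow[OF sm(2)]] fa
            by (simp add: scaleR_sum_right)
        qed
      qed
      finally show ?thesis .
    qed
    have "psdo_mult U A (psdo_mult U B C) (a + b + d - int k) c = psdo_mult U A (psdo_mult U B C) (a + (b + d) - int k) c" by (simp add: add.assoc)
    also have "\<dots> = (\<Sum>(i, r, t)\<in>tri k. (real_of_int (a - int i) gchoose t) *\<^sub>R (?A i c * ?D t (psdo_mult U B C (b + d - int r)) c))"
      by (rule psdo_mult_tri[OF oA oBC])
    also have "\<dots> = (\<Sum>(i, r, t)\<in>tri k. \<Sum>(j, q, u)\<in>tri r. \<Sum>l\<le>t. ((real_of_int (a - int i) gchoose t) * real (t choose l) * (real_of_int (b - int j) gchoose u)) *\<^sub>R ?t i j q l (t - l + u))"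
      unfolding Dt by (intro sum.cong refl) (auto simp: sum_distrib_left scaleR_sum_right mult_ac case_prod_unfold intro!: sum.cong)
    also have "\<dots> = (\<Sum>((i, r, t), (j, q, u), l)\<in>Sigma (tri k) (\<lambda>(i, r, t). Sigma (tri r) (\<lambda>_. {..t})). ((real_of_int (a - int i) gchoose t) * real (t choose l) * (real_of_int (b - int j) gchoose u)) *\<^sub>R ?t i j q l (t - l + u))"
      by (rule tri_sum_Sigma)
    \<comment> \<open>Of the \<open>t\<close> outer derivatives \<open>l\<close> fall on
      \<open>B\<close> and \<open>t - l\<close> on \<open>C\<close>, so that \<open>C\<close>
      carries \<open>s = t - l + u\<close> in all.\<close>
    also have "\<dots> = (\<Sum>((i, j, q, l, s), u)\<in>Sigma S5 (\<lambda>(i, j, q, l, s). {..s}). ((real_of_int (a - int i) gchoose (l + s - u)) * real ((l + s - u) choose l) * (real_of_int (b - int j) gchoose u)) *\<^sub>R ?t i j q l s)"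
      by (rule sum.reindex_bij_witness[of _ "\<lambda>((i, j, q, l, s), u). ((i, j + q + u, l + s - u), (j, q, u), l)" "\<lambda>((i, r, t), (j, q, u), l). ((i, j, q, l, t - l + u), u)"])
         (auto simp: tri_def S5_def)
    also have "\<dots> = (\<Sum>(i, j, q, l, s)\<in>S5. \<Sum>u\<le>s. ((real_of_int (a - int i) gchoose (l + s - u)) * real ((l + s - u) choose l) * (real_of_int (b - int j) gchoose u)) *\<^sub>R ?t i j q l s)"
      by (rule sum_atMost_Sigma[OF \<open>finite S5\<close>, symmetric])
    also have "\<dots> = (\<Sum>(i, j, q, l, s)\<in>S5. coef i j l s *\<^sub>R ?t i j q l s)"
      by (intro sum.cong refl) (auto simp: scaleR_sum_left[symmetric] gbinomial_assoc_identity coef_def)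
    finally show ?thesis .
  qed
  show "psdo_mult U (psdo_mult U A B) C (a + b + d - int k) c = psdo_mult U A (psdo_mult U B C) (a + b + d - int k) c"
    unfolding L R ..
qed

section \<open>Units, inverses and the operator \<open>L\<close>\<close>

lemma psord_one: "psord 0 (psdo_one U)" by (auto simp: psord_def psdo_one_def)

lemma psdo_one_0: "psdo_one U 0 = (\<lambda>c. if c \<in> U then 1 else 0)" by (auto simp: psdo_one_def)

lemma psdo_mult_const_right:
  assumes U: "yopen U" and A: "psord a A" "\<And>n c. c \<notin> U \<Longrightarrow> A n c = 0"
    and B: "B = (\<lambda>n c. if n = b \<and> c \<in> U then q else 0)"
  shows "psdo_mult U A B n c = A (n - b) c * q"
proof (cases "n \<le> a + b")
  case True
  define k where "k = nat (a + b - n)"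
  have n: "n = a + b - int k" using True by (simp add: k_def)
  have oB: "psord b B" by (auto simp: psord_def B)
  have Bj: "(pd_y U ^^ l) (B (b - int j)) c = (if j = 0 \<and> l = 0 \<and> c \<in> U then q else 0)" for j l
  proof (cases "j = 0")
    case True
    then show ?thesis using yconst(2)[OF U, of l q] by (cases "l = 0") (auto simp: B)
  next
    case False
    then have "B (b - int j) = (\<lambda>c. 0)" by (auto simp: B)
    then show ?thesis using False by simp
  qed
  have "psdo_mult U A B n c = (\<Sum>(i, j, l)\<in>{(k, 0, 0)}. (real_of_int (a - int i) gchoose l) *\<^sub>R (A (a - int i) c * (pd_y U ^^ l) (B (b - int j)) c))"
    unfolding n by (rule psdo_mult_tri_on[OF A(1) oB]) (auto simp: Bj tri_def)
  also have "\<dots> = A (n - b) c * q" using A(2) n by (auto simp: Bj)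
  finally show ?thesis .
next
  case False
  then have "A (n - b) = (\<lambda>_. 0)" using A(1) by (simp add: psord_def)
  moreover have "psord b B" by (auto simp: psord_def B)
  ultimately show ?thesis using psdo_mult_high[OF A(1)] False by simp
qed

lemma psdo_mult_one_right:
  assumes "yopen U" "psord a A" "\<And>n c. c \<notin> U \<Longrightarrow> A n c = 0"
  shows "psdo_mult U A (psdo_one U) = A"
  by (intro ext) (subst psdo_mult_const_right[OF assms, of "psdo_one U" 0 1], auto simp: psdo_one_def fun_eq_iff)

lemma psdo_mult_i_right:
  assumes "yopen U" "psord a A" "\<And>n c. c \<notin> U \<Longrightarrow> A n c = 0"
  shows "psdo_mult U A (i_pd_y U) n c = A (n - 1) c * quat_i"
  by (subst psdo_mult_const_right[OF assms, of "i_pd_y U" 1 quat_i]) (auto simp: i_pd_y_def fun_eq_iff)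

lemma psdo_mult_one_left:
  assumes B: "psord b B" "\<And>n c. c \<notin> U \<Longrightarrow> B n c = 0"
  shows "psdo_mult U (psdo_one U) B = B"
proof (rule psdos_eqI[of b])
  show "psord b (psdo_mult U (psdo_one U) B)" using psord_mult[OF psord_one B(1), of U] by simp
  fix k c
  have "(0::real) gchoose l = 0" if "l > 0" for l using that by (cases l) (simp_all add: gbinomial_0)
  then have "psdo_mult U (psdo_one U) B (0 + b - int k) c = (\<Sum>(i, j, l)\<in>{(0, k, 0)}. (real_of_int (0 - int i) gchoose l) *\<^sub>R (psdo_one U (0 - int i) c * (pd_y U ^^ l) (B (b - int j)) c))"
    by (intro psdo_mult_tri_on[OF psord_one B(1)]) (auto simp: tri_def psdo_one_def)
  also have "\<dots> = B (b - int k) c" using B(2) by (auto simp: psdo_one_def)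
  finally show "psdo_mult U (psdo_one U) B (b - int k) c = B (b - int k) c" by simp
qed (rule B(1))

definition monic :: "times set \<Rightarrow> psdo \<Rightarrow> bool" where
  "monic U K \<longleftrightarrow> psord 0 K \<and> K 0 = (\<lambda>c. if c \<in> U then 1 else 0) \<and> (\<forall>n c. c \<notin> U \<longrightarrow> K n c = 0)"

text \<open>The terms of \<open>K B\<close> involving lower order coefficients of the monic operator \<open>K\<close>.\<close>

definition lower_part :: "times set \<Rightarrow> psdo \<Rightarrow> (nat \<Rightarrow> times \<Rightarrow> quat) \<Rightarrow> nat \<Rightarrow> times \<Rightarrow> quat" where
  "lower_part U K \<beta> k c = (\<Sum>j<k. \<Sum>i\<in>{1..k - j}. (real_of_int (- int i) gchoose (k - j - i)) *\<^sub>R (K (- int i) c * (pd_y U ^^ (k - j - i)) (\<beta> j) c))"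

text \<open>The leading term of \<open>K\<close> has order 0 and does not differentiate, since
  \<open>0 gchoose l\<close> vanishes for \<open>l > 0\<close>. What remains involves only earlier
  coefficients of \<open>B\<close>, which permits recursion.\<close>

lemma psdo_mult_monic:
  assumes K: "monic U K" and B: "psord b B" "\<And>n c. c \<notin> U \<Longrightarrow> B n c = 0"
  shows "psdo_mult U K B (b - int k) c = B (b - int k) c + lower_part U K (\<lambda>j. B (b - int j)) k c"
proof -
  let ?t = "\<lambda>(i, j, l). (real_of_int (0 - int i) gchoose l) *\<^sub>R (K (0 - int i) c * (pd_y U ^^ l) (B (b - int j)) c)"
  have oK: "psord 0 K" using K by (simp add: monic_def)
  have "psdo_mult U K B (b - int k) c = sum ?t (tri k)" using psdo_mult_tri[OF oK B(1), of U k c] by simp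
  also have "\<dots> = sum ?t ((tri k \<inter> {(i, j, l). i \<noteq> 0}) \<union> (tri k \<inter> {(i, j, l). i = 0}))"
    by (rule sum.cong) auto
  also have "\<dots> = sum ?t (tri k \<inter> {(i, j, l). i \<noteq> 0}) + sum ?t (tri k \<inter> {(i, j, l). i = 0})"
    by (rule sum.union_disjoint) auto
  also have "sum ?t (tri k \<inter> {(i, j, l). i = 0}) = sum ?t {(0, k, 0)}"
  proof (rule sum.mono_neutral_right)
    show "\<forall>x\<in>tri k \<inter> {(i, j, l). i = 0} - {(0, k, 0)}. ?t x = 0"
    proof (rule ballI)
      fix x assume x: "x \<in> tri k \<inter> {(i, j, l). i = 0} - {(0, k, 0)}"
      obtain j l where xx: "x = (0, j, l)" using x by auto
      have "(0::real) gchoose l = 0" using x by (cases l) (auto simp: xx tri_def gbinomial_0)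
      then show "?t x = 0" by (simp add: xx)
    qed
  qed (auto simp: tri_def intro: finite_tri[unfolded tri_def])
  also have "sum ?t {(0, k, 0)} = B (b - int k) c" using K B(2) by (auto simp: monic_def)
  also have "sum ?t (tri k \<inter> {(i, j, l). i \<noteq> 0}) = lower_part U K (\<lambda>j. B (b - int j)) k c"
  proof -
    have "lower_part U K (\<lambda>j. B (b - int j)) k c = (\<Sum>(j, i)\<in>Sigma {..<k} (\<lambda>j. {1..k - j}). (real_of_int (- int i) gchoose (k - j - i)) *\<^sub>R (K (- int i) c * (pd_y U ^^ (k - j - i)) (B (b - int j)) c))"
      unfolding lower_part_def by (subst sum.Sigma) auto
    also have "\<dots> = sum ?t (tri k \<inter> {(i, j, l). i \<noteq> 0})"
      by (rule sum.reindex_bij_witness[of _ "\<lambda>(i, j, l). (j, i)" "\<lambda>(j, i). (i, j, k - j - i)"]) (auto simp: tri_def)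
    finally show ?thesis by simp
  qed
  finally show ?thesis by simp
qed

lemma lower_part_cong: "(\<And>j. j < k \<Longrightarrow> \<beta> j = \<beta>' j) \<Longrightarrow> lower_part U K \<beta> k c = lower_part U K \<beta>' k c"
  unfolding lower_part_def by (intro sum.cong refl) auto

lemma monic_inverse_unique:
  assumes K: "monic U K" and B: "B \<in> psdos U" "psdo_mult U K B = psdo_one U"
    and B': "B' \<in> psdos U" "psdo_mult U K B' = psdo_one U"
  shows "B = B'"
proof -
  obtain N N' where N: "\<forall>n>N. B n = (\<lambda>_. 0)" "\<forall>n>N'. B' n = (\<lambda>_. 0)" using B B' by (auto simp: psdos_def)
  define b where "b = max N N'"
  have o: "psord b B" "psord b B'" using N by (auto simp: psord_def b_def)
  have z: "\<And>n c. c \<notin> U \<Longrightarrow> B n c = 0" "\<And>n c. c \<notin> U \<Longrightarrow> B' n c = 0" using B B' by (auto simp: psdos_def)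
  have "B (b - int k) = B' (b - int k)" for k
  proof (induction k rule: less_induct)
    case (less k)
    have "B (b - int k) c = B' (b - int k) c" for c
    proof -
      have "lower_part U K (\<lambda>j. B (b - int j)) k c = lower_part U K (\<lambda>j. B' (b - int j)) k c"
        by (rule lower_part_cong) (rule less)
      moreover have "psdo_mult U K B (b - int k) c = psdo_mult U K B' (b - int k) c" using B B' by simp
      ultimately show ?thesis using psdo_mult_monic[OF K o(1) z(1), of k c] psdo_mult_monic[OF K o(2) z(2), of k c] by simp
    qed
    then show ?case by blast
  qed
  then show ?thesis by (intro psdos_eqI[OF o]) simp
qed

text \<open>The equation \<open>K R = 1\<close> for monic \<open>K\<close>, solved for the
  coefficient of \<open>R\<close> of order \<open>- k\<close> in terms of the earlier ones.\<close>

fun rinv :: "times set \<Rightarrow> psdo \<Rightarrow> nat \<Rightarrow> times \<Rightarrow> quat" where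
  "rinv U K k = (\<lambda>c. (if k = 0 \<and> c \<in> U then 1 else 0) -
     (\<Sum>j\<in>{..<k}. \<Sum>i\<in>{1..k - j}. (real_of_int (- int i) gchoose (k - j - i)) *\<^sub>R (K (- int i) c * (pd_y U ^^ (k - j - i)) (rinv U K j) c)))"

declare rinv.simps [simp del]

lemma sps_zero_off: "sps U a A \<Longrightarrow> c \<notin> U \<Longrightarrow> A n c = 0"
  by (auto simp: sps_def ysmooth_def)

lemma sps_psdos: "sps U a A \<Longrightarrow> A \<in> psdos U" by (auto simp: psdos_def sps_def psord_def ysmooth_def)

lemma monic_right_inverse:
  assumes U: "yopen U" and K: "monic U K" "sps U 0 K"
  shows "\<exists>R. sps U 0 R \<and> monic U R \<and> psdo_mult U K R = psdo_one U"
proof -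
  define R where "R = (\<lambda>n. if n \<le> 0 then rinv U K (nat (- n)) else (\<lambda>_. 0))"
  have sK: "ysmooth U (K n)" for n using K(2) by (simp add: sps_def)
  have sm: "ysmooth U (rinv U K k)" for k
  proof (induction k rule: less_induct)
    case (less k)
    have "ysmooth U (\<lambda>c. (if c \<in> U then (if k = 0 then 1 else 0) else 0) + (- 1) *\<^sub>R (\<Sum>j\<in>{..<k}. \<Sum>i\<in>{1..k - j}. (real_of_int (- int i) gchoose (k - j - i)) *\<^sub>R (K (- int i) c * (pd_y U ^^ (k - j - i)) (rinv U K j) c)))"
      by (intro ysmooth_add yconst(1)[OF U] ysmooth_scaleR ysmooth_sum ysmooth_mult sK ysmooth_pd_y_pow less) auto
    then show ?case by (rule ysmooth_cong[rotated]) (subst rinv.simps, simp)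
  qed
  have oR: "psord 0 R" by (auto simp: psord_def R_def)
  have "ysmooth U (R n)" for n using sm ysmooth_0 by (simp add: R_def)
  then have sR: "sps U 0 R" using oR by (simp add: sps_def)
  have zR: "\<And>n c. c \<notin> U \<Longrightarrow> R n c = 0" using sps_zero_off[OF sR] .
  have Rk: "R (0 - int k) = rinv U K k" for k by (simp add: R_def)
  have R0: "R 0 = (\<lambda>c. if c \<in> U then 1 else 0)" by (simp add: R_def rinv.simps[of U K 0])
  have mR: "monic U R" using oR R0 zR by (simp add: monic_def)
  have "psdo_mult U K R = psdo_one U"
  proof (rule psdos_eqI[of 0])
    show "psord 0 (psdo_mult U K R)" using psord_mult[of 0 K 0 R U] K(2) oR by (simp add: sps_def)
    fix k c
    have "psdo_mult U K R (0 - int k) c = R (0 - int k) c + lower_part U K (\<lambda>j. R (0 - int j)) k c"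
      by (rule psdo_mult_monic[OF K(1) oR zR])
    also have "\<dots> = (if k = 0 \<and> c \<in> U then 1 else 0)"
      unfolding Rk lower_part_def by (subst rinv.simps) simp
    finally show "psdo_mult U K R (0 - int k) c = psdo_one U (0 - int k) c" by (simp add: psdo_one_def)
  qed (rule psord_one)
  then show ?thesis using sR mR by blast
qed

text \<open>The right inverse \<open>R\<close> is again monic and has a right inverse
  \<open>R'\<close> of its own. Associativity gives \<open>K = R'\<close>, so \<open>R\<close> is a
  two-sided inverse.\<close>

lemma monic_inverse:
  assumes U: "yopen U" and K: "monic U K" "sps U 0 K"
  shows "sps U 0 (psdo_inverse U K)" "monic U (psdo_inverse U K)"
    "psdo_mult U K (psdo_inverse U K) = psdo_one U" "psdo_mult U (psdo_inverse U K) K = psdo_one U"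
proof -
  obtain R where R: "sps U 0 R" "monic U R" "psdo_mult U K R = psdo_one U" using monic_right_inverse[OF U K] by blast
  obtain R' where R': "sps U 0 R'" "monic U R'" "psdo_mult U R R' = psdo_one U" using monic_right_inverse[OF U R(2,1)] by blast
  have "K = psdo_mult U K (psdo_one U)" using psdo_mult_one_right[OF U, of 0 K] K sps_zero_off by (auto simp: sps_def)
  also have "\<dots> = psdo_mult U (psdo_mult U K R) R'" unfolding R'(3)[symmetric] by (rule psdo_mult_assoc[OF K(2) R(1) R'(1), symmetric])
  also have "\<dots> = R'" unfolding R(3) using R'(1) sps_zero_off[OF R'(1)] by (intro psdo_mult_one_left[of 0]) (auto simp: sps_def)
  finally have RK: "psdo_mult U R K = psdo_one U" using R'(3) by simp
  have "psdo_inverse U K = R" unfolding psdo_inverse_def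
  proof (rule the_equality)
    show "R \<in> psdos U \<and> psdo_mult U K R = psdo_one U \<and> psdo_mult U R K = psdo_one U"
      using sps_psdos[OF R(1)] R(3) RK by blast
    fix B assume "B \<in> psdos U \<and> psdo_mult U K B = psdo_one U \<and> psdo_mult U B K = psdo_one U"
    then show "B = R" using monic_inverse_unique[OF K(1)] sps_psdos[OF R(1)] R(3) by blast
  qed
  then show "sps U 0 (psdo_inverse U K)" "monic U (psdo_inverse U K)"
    "psdo_mult U K (psdo_inverse U K) = psdo_one U" "psdo_mult U (psdo_inverse U K) K = psdo_one U"
    using R RK by simp_all
qed

lemma psdo_inverse_eqI:
  assumes "monic U K" "B \<in> psdos U" "psdo_mult U K B = psdo_one U" "psdo_mult U B K = psdo_one U"
  shows "psdo_inverse U K = B" unfolding psdo_inverse_def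
  by (rule the_equality) (use assms monic_inverse_unique[OF assms(1)] in blast)+

definition Lax :: "times set \<Rightarrow> psdo \<Rightarrow> psdo" where
  "Lax U K = psdo_mult U (psdo_mult U K (i_pd_y U)) (psdo_inverse U K)"

lemma sps_i: "yopen U \<Longrightarrow> sps U 1 (i_pd_y U)"
proof -
  assume U: "yopen U"
  have "ysmooth U (i_pd_y U n)" for n
  proof (cases "n = 1")
    case True
    then have "i_pd_y U n = (\<lambda>c. if c \<in> U then quat_i else 0)" by (auto simp: i_pd_y_def)
    then show ?thesis using yconst(1)[OF U] by simp
  next
    case False
    then have "i_pd_y U n = (\<lambda>_. 0)" by (auto simp: i_pd_y_def)
    then show ?thesis by (simp add: ysmooth_0)
  qed
  then show ?thesis by (auto simp: sps_def psord_def i_pd_y_def)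
qed

lemma Lax_props:
  assumes U: "yopen U" and K: "monic U K" "sps U 0 K"
  shows "sps U 1 (Lax U K)" "psdo_mult U (Lax U K) K = psdo_mult U K (i_pd_y U)"
    "Lax U K 1 c = (if c \<in> U then quat_i else 0)"
proof -
  note inv = monic_inverse[OF U K]
  have Ki: "sps U 1 (psdo_mult U K (i_pd_y U))" using sps_mult[OF K(2) sps_i[OF U]] by simp
  show sL: "sps U 1 (Lax U K)" unfolding Lax_def using sps_mult[OF Ki inv(1)] by simp
  have "psdo_mult U (Lax U K) K = psdo_mult U (psdo_mult U K (i_pd_y U)) (psdo_mult U (psdo_inverse U K) K)"
    unfolding Lax_def by (rule psdo_mult_assoc[OF Ki inv(1) K(2)])
  also have "\<dots> = psdo_mult U K (i_pd_y U)"
    unfolding inv(4) using Ki sps_zero_off[OF Ki] by (intro psdo_mult_one_right[OF U]) (auto simp: sps_def)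
  finally show LK: "psdo_mult U (Lax U K) K = psdo_mult U K (i_pd_y U)" .
  have oL: "psord 1 (Lax U K)" and oK: "psord 0 K" using sL K by (auto simp: sps_def)
  have "psdo_mult U (Lax U K) K (1 + 0 - int 0) c = Lax U K 1 c * K 0 c"
    unfolding psdo_mult_tri[OF oL oK] by (simp add: tri_def)
  moreover have "psdo_mult U K (i_pd_y U) 1 c = K 0 c * quat_i"
    using psdo_mult_i_right[OF U oK] sps_zero_off[OF K(2)] by simp
  ultimately have "Lax U K 1 c * K 0 c = K 0 c * quat_i" using LK by simp
  then show "Lax U K 1 c = (if c \<in> U then quat_i else 0)"
    using K(1) sps_zero_off[OF sL] by (auto simp: monic_def split: if_splits)
qed

text \<open>The operator is pinned down by its intertwining relation with \<open>K\<close>, so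
  operators can be compared without computing an inverse.\<close>

lemma Lax_unique:
  assumes U: "yopen U" and K: "monic U K" "sps U 0 K" and L: "sps U 1 L" "psdo_mult U L K = psdo_mult U K (i_pd_y U)"
  shows "Lax U K = L"
proof -
  note inv = monic_inverse[OF U K]
  have "Lax U K = psdo_mult U L (psdo_mult U K (psdo_inverse U K))"
    unfolding Lax_def L(2)[symmetric] by (rule psdo_mult_assoc[OF L(1) K(2) inv(1)])
  also have "\<dots> = L" unfolding inv(3) using L(1) sps_zero_off[OF L(1)] by (intro psdo_mult_one_right[OF U]) (auto simp: sps_def)
  finally show ?thesis .
qed

lemma Lax_tri:
  assumes U: "yopen U" and L: "sps U 1 L" and X: "psord 0 X" "\<And>n c. c \<notin> U \<Longrightarrow> X n c = 0"
    and eq: "psdo_mult U L X = psdo_mult U X (i_pd_y U)"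
  shows "(\<Sum>(i, j, l)\<in>tri k. (real_of_int (1 - int i) gchoose l) *\<^sub>R (L (1 - int i) c * (pd_y U ^^ l) (X (- int j)) c)) = X (- int k) c * quat_i"
proof -
  have oL: "psord 1 L" using L by (simp add: sps_def)
  have "psdo_mult U L X (1 + 0 - int k) c = X (- int k) c * quat_i"
    unfolding eq using psdo_mult_i_right[OF U X] by simp
  then show ?thesis unfolding psdo_mult_tri[OF oL X(1)] by simp
qed

section \<open>Conjugation and translation\<close>

lemma bounded_linear_conj: "bounded_linear (\<lambda>q. inverse (qc u) * q * qc u)"
  by (intro bounded_linear_mult_left bounded_linear_compose[OF bounded_linear_mult_left bounded_linear_mult_right] | simp)+

lemma conj_by_mult:
  assumes u: "u \<noteq> 0" and B: "\<And>n. ysmooth U (B n)"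
  shows "psdo_mult U (conj_by u A) (conj_by u B) = conj_by u (psdo_mult U A B)"
proof (intro ext)
  fix n c
  have qu: "qc u \<noteq> 0" using u by (metis qc_0 qc_inject)
  have inj: "inverse (qc u) * q * qc u = 0 \<longleftrightarrow> q = 0" for q using qu by simp
  have z: "conj_by u A m = (\<lambda>_. 0) \<longleftrightarrow> A m = (\<lambda>_. 0)" for A :: psdo and m
    using inj by (auto simp: conj_by_def fun_eq_iff)
  have D: "(pd_y U ^^ k) (conj_by u B p) = (\<lambda>c. inverse (qc u) * (pd_y U ^^ k) (B p) c * qc u)" for k p
  proof -
    have "conj_by u B p = (\<lambda>c. inverse (qc u) * B p c * qc u)" by (rule ext) (simp add: conj_by_def)
    then show ?thesis using pd_y_pow_linear[OF B bounded_linear_conj, of k u p] by simp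
  qed
  have m: "(inverse (qc u) * a * qc u) * (inverse (qc u) * b * qc u) = inverse (qc u) * (a * b) * qc u" for a b
    using qu by (simp add: mult.assoc) (simp add: mult.assoc[symmetric])
  show "psdo_mult U (conj_by u A) (conj_by u B) n c = conj_by u (psdo_mult U A B) n c" unfolding psdo_mult_def z D
    by (simp add: conj_by_def m sum_distrib_left sum_distrib_right case_prod_unfold)
qed

lemma conj_by_Lax:
  assumes u: "u \<noteq> 0" and U: "yopen U" and K: "monic U K" "sps U 0 K"
  shows "Lax U (conj_by u K) = conj_by u (Lax U K)"
proof -
  note inv = monic_inverse[OF U K]
  have qu: "qc u \<noteq> 0" using u by (metis qc_0 qc_inject)
  have c1: "conj_by u (psdo_one U) = psdo_one U" using qu by (auto simp: conj_by_def psdo_one_def fun_eq_iff)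
  have ci: "conj_by u (i_pd_y U) = i_pd_y U"
  proof (intro ext)
    fix n c
    have "inverse (qc u) * quat_i * qc u = quat_i"
      using u by (simp add: qc_i[symmetric] qc_inverse[symmetric] qc_mult[symmetric])
    then show "conj_by u (i_pd_y U) n c = i_pd_y U n c" by (simp add: conj_by_def i_pd_y_def)
  qed
  have mc: "monic U (conj_by u K)" using K(1) qu by (auto simp: monic_def psord_def conj_by_def fun_eq_iff)
  have "psdo_inverse U (conj_by u K) = conj_by u (psdo_inverse U K)"
  proof (rule psdo_inverse_eqI[OF mc])
    have "psord 0 (psdo_inverse U K)" "\<And>n c. c \<notin> U \<Longrightarrow> psdo_inverse U K n c = 0"
      using inv(1) sps_zero_off[OF inv(1)] by (auto simp: sps_def)
    then show "conj_by u (psdo_inverse U K) \<in> psdos U"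
      unfolding psdos_def psord_def by (auto intro!: exI[of _ 0] simp: conj_by_def fun_eq_iff)
    show "psdo_mult U (conj_by u K) (conj_by u (psdo_inverse U K)) = psdo_one U"
      using conj_by_mult[OF u, of U "psdo_inverse U K" K] inv(1,3) c1 by (simp add: sps_def)
    show "psdo_mult U (conj_by u (psdo_inverse U K)) (conj_by u K) = psdo_one U"
      using conj_by_mult[OF u, of U K "psdo_inverse U K"] K(2) inv(4) c1 by (simp add: sps_def)
  qed
  moreover have "psdo_mult U (conj_by u K) (i_pd_y U) = conj_by u (psdo_mult U K (i_pd_y U))"
    using conj_by_mult[OF u, of U "i_pd_y U" K] sps_i[OF U] ci by (simp add: sps_def)
  ultimately show ?thesis
    unfolding Lax_def using conj_by_mult[OF u, of U "psdo_inverse U K"] inv(1) by (simp add: sps_def)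
qed

definition translate :: "complex \<Rightarrow> times \<Rightarrow> times" where "translate w c = c(1 := c 1 + w)"

lemma translate_trans [simp]: "translate w (translate w' c) = translate (w + w') c"
  by (simp add: translate_def algebra_simps)
lemma translate_0 [simp]: "translate 0 c = c" by (simp add: translate_def)

lemma translate_ysh: "translate w (ysh c h) = ysh (translate w c) h"
  by (simp add: translate_def ysh_def algebra_simps)

lemma pd_y_trans: "(pd_y {c. translate w c \<in> U} ^^ k) (\<lambda>c. f (translate w c)) = (\<lambda>c. (pd_y U ^^ k) f (translate w c))"
proof (induction k)
  case (Suc k)
  have "pd_y {c. translate w c \<in> U} (\<lambda>c. g (translate w c)) = (\<lambda>c. pd_y U g (translate w c))" for g
    by (simp add: pd_y_ysh translate_ysh fun_eq_iff)
  then show ?case using Suc by simp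
qed simp

lemma translate_zero_iff: "(\<lambda>c. f (translate w c)) = (\<lambda>_. 0) \<longleftrightarrow> f = (\<lambda>_. 0::quat)"
proof
  assume h: "(\<lambda>c. f (translate w c)) = (\<lambda>_. 0)"
  show "f = (\<lambda>_. 0)"
  proof
    fix c show "f c = 0" using fun_cong[OF h, of "translate (- w) c"] by simp
  qed
qed simp

lemma psdo_mult_trans:
  "psdo_mult {c. translate w c \<in> U} (\<lambda>n c. A n (translate w c)) (\<lambda>n c. B n (translate w c)) = (\<lambda>n c. psdo_mult U A B n (translate w c))"
  unfolding psdo_mult_def translate_zero_iff pd_y_trans ..

lemma Lax_trans:
  assumes U: "yopen U" and K: "monic U K" "sps U 0 K"
  shows "Lax {c. translate w c \<in> U} (\<lambda>n c. K n (translate w c)) = (\<lambda>n c. Lax U K n (translate w c))"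
proof -
  note inv = monic_inverse[OF U K]
  let ?U = "{c. translate w c \<in> U}"
  have one: "(\<lambda>n c. psdo_one U n (translate w c)) = psdo_one ?U" by (simp add: psdo_one_def fun_eq_iff)
  have i: "(\<lambda>n c. i_pd_y U n (translate w c)) = i_pd_y ?U" by (simp add: i_pd_y_def fun_eq_iff)
  have mc: "monic ?U (\<lambda>n c. K n (translate w c))" using K(1) by (auto simp: monic_def psord_def fun_eq_iff)
  have "psdo_inverse ?U (\<lambda>n c. K n (translate w c)) = (\<lambda>n c. psdo_inverse U K n (translate w c))"
  proof (rule psdo_inverse_eqI[OF mc])
    have "psord 0 (psdo_inverse U K)" "\<And>n c. c \<notin> U \<Longrightarrow> psdo_inverse U K n c = 0"
      using inv(1) sps_zero_off[OF inv(1)] by (auto simp: sps_def)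
    then show "(\<lambda>n c. psdo_inverse U K n (translate w c)) \<in> psdos ?U"
      unfolding psdos_def psord_def by (auto intro!: exI[of _ 0] simp: fun_eq_iff)
  qed (unfold psdo_mult_trans inv(3,4) one, rule refl, rule refl)
  then show ?thesis unfolding Lax_def by (simp add: i[symmetric] psdo_mult_trans)
qed

section \<open>Baker coefficients, the action of constants and its stabilisers\<close>

section \<open>The coefficients of the Baker function\<close>

lemma baker_dom_valid: "c \<in> baker_dom W \<Longrightarrow> c \<in> valid_times" by (simp add: baker_dom_def)

lemma baker_dom_bigcell: "W \<in> Gr_H \<Longrightarrow> c \<in> baker_dom W \<Longrightarrow> bigcell (W_gam W c)"
  by (simp add: baker_dom_iff)

lemma baker_dom_nearby:
  assumes W: "W \<in> Gr_H" and c: "c \<in> baker_dom W"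
  shows "\<exists>e>0. \<forall>h. \<bar>h\<bar> < e \<longrightarrow> (\<forall>\<theta>. cmod \<theta> \<le> 1 \<longrightarrow> c(1 := c 1 + of_real h * \<theta>) \<in> baker_dom W)"
proof -
  note v = baker_dom_valid[OF c]
  obtain e where "e > 0" "\<And>h \<theta>. \<bar>h\<bar> < e \<Longrightarrow> cmod \<theta> \<le> 1 \<Longrightarrow> bigcell (V_shift (W_gam W c) (of_real h * \<theta>))"
    using bigcell_nearby[OF baker_dom_bigcell[OF W c]] by blast
  then show ?thesis using W_gam_upd[OF v] valid_times_upd[OF v] by (auto simp: baker_dom_iff[OF W])
qed

lemma yopen_baker_dom: "W \<in> Gr_H \<Longrightarrow> yopen (baker_dom W)" unfolding yopen_def ysh_def
proof
  fix c assume "W \<in> Gr_H" "c \<in> baker_dom W"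
  then obtain e where "e > 0" "\<And>h \<theta>. \<bar>h\<bar> < e \<Longrightarrow> cmod \<theta> \<le> 1 \<Longrightarrow> c(1 := c 1 + of_real h * \<theta>) \<in> baker_dom W"
    using baker_dom_nearby by blast
  then have "e > 0" "\<And>h. \<bar>h\<bar> < e \<Longrightarrow> c(1 := c 1 + of_real h * \<i>) \<in> baker_dom W" by simp_all
  then show "\<exists>e>0. \<forall>h. \<bar>h\<bar> < e \<longrightarrow> c(1 := c 1 + \<i> * of_real h) \<in> baker_dom W" by (auto simp: mult.commute)
qed

text \<open>The coefficients of all \<open>w_k\<close>: the derivative of \<open>w_k\<close>
  involves \<open>w_(k+1)\<close>, so the Baker function alone is not closed under
  \<open>pd_y\<close>. The value 0 off the domain matches the convention of
  \<open>psdos\<close>.\<close>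

definition alpha :: "L2H set \<Rightarrow> nat \<Rightarrow> int \<Rightarrow> times \<Rightarrow> quat" where
  "alpha W k m c = (if c \<in> baker_dom W then fourier (bel (W_gam W c) k) m else 0)"

lemma alpha_off [simp]: "c \<notin> baker_dom W \<Longrightarrow> alpha W k m c = 0" by (simp add: alpha_def)

lemma alpha_nonneg:
  "W \<in> Gr_H \<Longrightarrow> c \<in> baker_dom W \<Longrightarrow> m \<ge> 0 \<Longrightarrow> alpha W k m c = (if m = int k then 1 else 0)"
  by (simp add: alpha_def bel_nonneg baker_dom_bigcell)

lemma alpha_deriv:
  assumes W: "W \<in> Gr_H" and c: "c \<in> baker_dom W" and \<theta>: "cmod \<theta> \<le> 1"
  shows "((\<lambda>h. alpha W k m (c(1 := c 1 + of_real h * \<theta>))) has_vector_derivative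
    (qc \<theta> * alpha W (Suc k) m c + alpha W k (-1) c * qc \<theta> * alpha W 0 m c - alpha W k (m - 1) c * qc \<theta>)) (at 0)"
proof -
  let ?V = "W_gam W c"
  note v = baker_dom_valid[OF c]
  obtain e where e: "e > 0" "\<And>h. \<bar>h\<bar> < e \<Longrightarrow> c(1 := c 1 + of_real h * \<theta>) \<in> baker_dom W"
    using baker_dom_nearby[OF W c] \<theta> by blast
  have "fourier (rmult f (\<lambda>x. \<theta> * x)) m = fourier f (m - 1) * qc \<theta>" for f
    using fourier_rmult_powi[of f \<theta> 1 m] by simp
  then have "((\<lambda>h. fourier (bel (V_shift ?V (of_real h * \<theta>)) k) m) has_vector_derivative
      (qc \<theta> * alpha W (Suc k) m c + alpha W k (-1) c * qc \<theta> * alpha W 0 m c - alpha W k (m - 1) c * qc \<theta>)) (at 0)"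
    using bounded_linear.has_vector_derivative[OF bounded_linear_fourier[of m] bel_deriv[OF baker_dom_bigcell[OF W c] \<theta>, of k]] c
    by (simp add: alpha_def)
  then show ?thesis
  proof (rule has_vector_derivative_transform_within_open[where S = "ball 0 e"])
    fix h assume "h \<in> ball (0::real) e"
    then have "c(1 := c 1 + of_real h * \<theta>) \<in> baker_dom W" by (intro e) simp
    then show "fourier (bel (V_shift ?V (of_real h * \<theta>)) k) m = alpha W k m (c(1 := c 1 + of_real h * \<theta>))"
      by (simp add: alpha_def W_gam_upd[OF v])
  qed (use e in auto)
qed

lemma alpha_ysh:
  assumes "W \<in> Gr_H" "c \<in> baker_dom W"
  shows "((\<lambda>h. alpha W k m (ysh c h)) has_vector_derivative
    (quat_i * alpha W (Suc k) m c + alpha W k (-1) c * quat_i * alpha W 0 m c - alpha W k (m - 1) c * quat_i)) (at 0)"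
  using alpha_deriv[OF assms, of \<i> k m] by (simp add: ysh_def mult.commute qc_i)

lemma alpha_pd_y:
  assumes "W \<in> Gr_H"
  shows "pd_y (baker_dom W) (alpha W k m) =
    (\<lambda>c. quat_i * alpha W (Suc k) m c + alpha W k (-1) c * quat_i * alpha W 0 m c + (- (alpha W k (m - 1) c * quat_i)))"
proof
  fix c show "pd_y (baker_dom W) (alpha W k m) c = quat_i * alpha W (Suc k) m c + alpha W k (-1) c * quat_i * alpha W 0 m c + (- (alpha W k (m - 1) c * quat_i))"
    using pd_y_eqI[OF _ alpha_ysh[OF assms], of c] by (cases "c \<in> baker_dom W") simp_all
qed

text \<open>Induction on the order for all \<open>k\<close> and \<open>m\<close> at once: by
  \<open>alpha_pd_y\<close> each derivative is a polynomial in coefficients of the same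
  family.\<close>

lemma ysmooth_alpha:
  assumes W: "W \<in> Gr_H" shows "ysmooth (baker_dom W) (alpha W k m)"
proof -
  have "ydiff (baker_dom W) n (alpha W k m)" for n k m
  proof (induction n arbitrary: k m)
    case (Suc n)
    have "ydiff (baker_dom W) n (\<lambda>c. quat_i * alpha W (Suc k) m c + alpha W k (-1) c * quat_i * alpha W 0 m c + (- (alpha W k (m - 1) c * quat_i)))"
      by (intro ydiff_add ydiff_mult Suc ydiff_bounded_linear[of "\<lambda>q. quat_i * q"] ydiff_bounded_linear[of "\<lambda>q. q * quat_i"]
          ydiff_bounded_linear[of "\<lambda>q. - (q * quat_i)"] bounded_linear_mult_right bounded_linear_mult_left bounded_linear_minus)
    then have "ydiff (baker_dom W) n (pd_y (baker_dom W) (alpha W k m))" unfolding alpha_pd_y[OF W] .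
    then show ?case using differentiableI_vector[OF alpha_ysh[OF W]] by simp
  qed simp
  then show ?thesis by (simp add: ysmooth_def)
qed

lemma K_op_alpha:
  assumes W: "W \<in> Gr_H" shows "K_op W n = (\<lambda>c. if n > 0 then 0 else alpha W 0 n c * quat_i ^ nat (- n))"
proof
  fix c
  have "(THE f. baker_pre W c f) = bel (W_gam W c) 0" by (simp add: bel_def baker_pre_iff)
  then show "K_op W n c = (if n > 0 then 0 else alpha W 0 n c * quat_i ^ nat (- n))"
    using alpha_nonneg[OF W, of c 0 0] by (auto simp: K_op_def alpha_def baker_coeff_def)
qed

lemma K_op_neg: "W \<in> Gr_H \<Longrightarrow> K_op W (- int k) c = alpha W 0 (- int k) c * quat_i ^ k"
  by (simp add: K_op_alpha)

lemma K_op_monic: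
  assumes W: "W \<in> Gr_H" shows "monic (baker_dom W) (K_op W)" "sps (baker_dom W) 0 (K_op W)"
proof -
  show "monic (baker_dom W) (K_op W)"
    using alpha_nonneg[OF W, of _ 0 0] by (auto simp: monic_def psord_def K_op_alpha[OF W] fun_eq_iff)
  moreover have "ysmooth (baker_dom W) (K_op W n)" for n unfolding K_op_alpha[OF W]
    using ysmooth_linear[OF ysmooth_alpha[OF W] bounded_linear_mult_left[of "quat_i ^ nat (- n)"], of 0 n] ysmooth_0
    by (cases "n > 0") simp_all
  ultimately show "sps (baker_dom W) 0 (K_op W)" by (simp add: sps_def monic_def)
qed

lemma L_op_Lax: "L_op W = Lax (baker_dom W) (K_op W)" by (simp add: L_op_def Lax_def Let_def)

lemma L_op_props:
  assumes W: "W \<in> Gr_H"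
  shows "sps (baker_dom W) 1 (L_op W)"
    "psdo_mult (baker_dom W) (L_op W) (K_op W) = psdo_mult (baker_dom W) (K_op W) (i_pd_y (baker_dom W))"
    "L_op W 1 c = (if c \<in> baker_dom W then quat_i else 0)"
  using Lax_props[OF yopen_baker_dom[OF W] K_op_monic[OF W]] by (simp_all add: L_op_Lax)

lemma L_op_tri:
  assumes W: "W \<in> Gr_H"
  shows "(\<Sum>(i, j, l)\<in>tri k. (real_of_int (1 - int i) gchoose l) *\<^sub>R (L_op W (1 - int i) c * (pd_y (baker_dom W) ^^ l) (K_op W (- int j)) c)) = K_op W (- int k) c * quat_i"
proof -
  have "psord 0 (K_op W)" using K_op_monic[OF W] by (simp add: sps_def)
  then show ?thesis
    using Lax_tri[OF yopen_baker_dom[OF W] L_op_props(1)[OF W] _ sps_zero_off[OF K_op_monic(2)[OF W]] L_op_props(2)[OF W]] by blast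
qed

section \<open>The action of constants\<close>

lemma punit_const: "u \<noteq> 0 \<Longrightarrow> punit (\<lambda>_. u) (\<lambda>_. inverse u)"
proof -
  have "pser (\<lambda>_. v) (\<lambda>n. if n = 0 then v else 0)" for v
  proof -
    have "(\<lambda>n. (if n = 0 then v else 0) * x ^ n) sums v" for x
      using sums_If_finite_set[of "{0}" "\<lambda>n. v * x ^ n"] by (simp add: if_distrib[of "\<lambda>y. y * _"] cong: if_cong)
    moreover have "summable (\<lambda>n. cmod (if n = (0::nat) then v else 0))"
      by (rule summable_finite[of "{0}"]) auto
    ultimately show ?thesis by (simp add: pser_def)
  qed
  then show "u \<noteq> 0 \<Longrightarrow> punit (\<lambda>_. u) (\<lambda>_. inverse u)" unfolding punit_def by (intro conjI exI) auto
qed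

lemma rmult_const_const: "rmult (rmult f (\<lambda>_. a)) (\<lambda>_. b) = rmult f (\<lambda>_. a * b)"
  by (rule rmult_rmult) auto

lemma gr_act_const_iff: "u \<noteq> 0 \<Longrightarrow> f \<in> gr_act (\<lambda>_. u) W \<longleftrightarrow> rmult f (\<lambda>_. inverse u) \<in> W"
proof
  assume u: "u \<noteq> 0"
  show "f \<in> gr_act (\<lambda>_. u) W \<Longrightarrow> rmult f (\<lambda>_. inverse u) \<in> W"
    using u by (auto simp: gr_act_def rmult_const_const)
  assume "rmult f (\<lambda>_. inverse u) \<in> W"
  moreover have "f = rmult (rmult f (\<lambda>_. inverse u)) (\<lambda>_. u)" using u by (simp add: rmult_const_const)
  ultimately show "f \<in> gr_act (\<lambda>_. u) W" unfolding gr_act_def by (rule rev_image_eqI)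
qed

lemma gr_act_const_const: "gr_act (\<lambda>_. a) (gr_act (\<lambda>_. b) W) = gr_act (\<lambda>_. b * a) W"
  unfolding gr_act_def image_image rmult_const_const ..

lemma gr_act_const_Gr_H: "W \<in> Gr_H \<Longrightarrow> u \<noteq> 0 \<Longrightarrow> gr_act (\<lambda>_. u) W \<in> Gr_H"
  by (rule Gr_H_rmult[OF _ punit_const])

lemma W_gam_const:
  assumes u: "u \<noteq> 0" and c: "c \<in> valid_times"
  shows "W_gam (gr_act (\<lambda>_. u) W) c = gr_act (\<lambda>_. u) (W_gam W c)"
proof (rule set_eqI)
  fix f
  have "rmult (rmult f (gam c)) (\<lambda>_. inverse u) = rmult (rmult f (\<lambda>_. inverse u)) (gam c)"
    by (simp add: rmult_rmult gam_continuous[OF c] mult.commute)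
  then show "f \<in> W_gam (gr_act (\<lambda>_. u) W) c \<longleftrightarrow> f \<in> gr_act (\<lambda>_. u) (W_gam W c)"
    by (simp add: W_gam_def gr_act_const_iff[OF u])
qed

lemma bigcell_const:
  assumes V: "bigcell V" and u: "u \<noteq> 0" shows "bigcell (gr_act (\<lambda>_. u) V)"
proof (rule bigcellI)
  show "gr_act (\<lambda>_. u) V \<in> Gr_H" using V u by (auto simp: bigcell_def intro: gr_act_const_Gr_H)
  fix f assume f: "f \<in> gr_act (\<lambda>_. u) V" "f \<in> H_minus"
  then have "rmult f (\<lambda>_. inverse u) \<in> V \<inter> H_minus" using u by (auto simp: gr_act_const_iff H_minus_def)
  then have "rmult f (\<lambda>_. inverse u) = 0" using V by (auto simp: bigcell_def)
  then have "rmult (rmult f (\<lambda>_. inverse u)) (\<lambda>_. u) = 0" by simp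
  then show "f = 0" using u by (simp add: rmult_const_const)
qed

lemma baker_dom_const:
  assumes W: "W \<in> Gr_H" and u: "u \<noteq> 0"
  shows "baker_dom (gr_act (\<lambda>_. u) W) = baker_dom W"
proof (rule set_eqI)
  fix c
  have "bigcell (gr_act (\<lambda>_. u) V) \<longleftrightarrow> bigcell V" for V
    using bigcell_const[of V u] bigcell_const[of "gr_act (\<lambda>_. u) V" "inverse u"] u
    by (auto simp: gr_act_const_const) (simp add: gr_act_def)
  then show "c \<in> baker_dom (gr_act (\<lambda>_. u) W) \<longleftrightarrow> c \<in> baker_dom W"
    using W_gam_const[OF u] by (auto simp: baker_dom_iff gr_act_const_Gr_H W u)
qed

text \<open>Right multiplication by \<open>u\<close> spoils the normalisation; the left factor
  restores it and is allowed since the space is a left module over the quaternions.\<close>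

lemma bel_const:
  assumes V: "bigcell V" and u: "u \<noteq> 0"
  shows "bel (gr_act (\<lambda>_. u) V) k = lmult (inverse (qc u)) (rmult (bel V k) (\<lambda>_. u))"
proof (rule bel_unique[OF bigcell_const[OF V u], symmetric])
  have VG: "V \<in> Gr_H" using V by (simp add: bigcell_def)
  show "lmult (inverse (qc u)) (rmult (bel V k) (\<lambda>_. u)) \<in> gr_act (\<lambda>_. u) V"
    using u Gr_H_D(3)[OF VG bel(1)[OF V]] by (simp add: gr_act_const_iff rmult_lmult rmult_const_const)
  have "qc u \<noteq> 0" using u by (metis qc_0 qc_inject)
  then show "proj {0..} (lmult (inverse (qc u)) (rmult (bel V k) (\<lambda>_. u))) = zpow (int k)"
    by (intro L2H_eqI) (simp add: bel_nonneg[OF V])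
qed

text \<open>\<open>u\<close> commutes with \<open>i\<close>, so conjugating the Baker coefficients
  conjugates \<open>K_op\<close>, and with it the operator; the domain does not change.\<close>

theorem L_op_const:
  assumes W: "W \<in> Gr_H" and u: "u \<noteq> 0"
  shows "L_op (gr_act (\<lambda>_. u) W) = conj_by u (L_op W)"
proof -
  have a: "alpha (gr_act (\<lambda>_. u) W) k m c = inverse (qc u) * alpha W k m c * qc u" for k m c
    using bel_const[OF baker_dom_bigcell[OF W] u, of c k] W_gam_const[OF u baker_dom_valid, of c W W]
    by (auto simp: alpha_def baker_dom_const[OF W u] mult.assoc)
  have iu: "qc u * quat_i ^ n = quat_i ^ n * qc u" for n
    by (simp add: qc_i[symmetric] qc_power[symmetric] qc_mult[symmetric] mult.commute)
  have "K_op (gr_act (\<lambda>_. u) W) = conj_by u (K_op W)"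
    by (intro ext) (simp add: K_op_alpha W gr_act_const_Gr_H[OF W u] a conj_by_def mult.assoc iu)
  then show ?thesis unfolding L_op_Lax baker_dom_const[OF W u]
    by (simp add: conj_by_Lax[OF u yopen_baker_dom[OF W] K_op_monic[OF W]])
qed

lemma conj_by_conj_by: "conj_by u (conj_by v L) = conj_by (v * u) L"
proof -
  have "inverse (qc (v * u)) = inverse (qc u) * inverse (qc v)"
    by (simp add: qc_inverse[symmetric] qc_mult[symmetric] mult.commute)
  then show ?thesis by (intro ext) (simp add: conj_by_def qc_mult mult.assoc)
qed

lemma conj_by_1 [simp]: "conj_by 1 L = L" by (intro ext) (simp add: conj_by_def)

lemma conj_by_uminus: "conj_by (- u) L = conj_by u L" by (intro ext) (simp add: conj_by_def qc_minus)

text \<open>The description defining \<open>M_act\<close> has a value because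
  \<open>conj_by u L\<close> does not refer to the space chosen to represent
  \<open>L\<close>.\<close>

lemma M_act_const:
  assumes L: "L \<in> M_space" and u: "u \<noteq> 0" shows "M_act (\<lambda>_. u) L = conj_by u L" unfolding M_act_def
proof (rule the_equality)
  show "\<exists>W\<in>Gr_H. L = L_op W \<and> conj_by u L = L_op (gr_act (\<lambda>_. u) W)"
    using L L_op_const[OF _ u] by (auto simp: M_space_def)
  show "L' = conj_by u L" if "\<exists>W\<in>Gr_H. L = L_op W \<and> L' = L_op (gr_act (\<lambda>_. u) W)" for L'
    using that L_op_const[OF _ u] by auto
qed

lemma rmult_const_complex:
  assumes "complex_valued f" shows "rmult f (\<lambda>_. u) = lmult (qc u) f"
  using assms by (intro L2H_eqI) (simp add: complex_valued_iff quat_eq_iff)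

text \<open>On complex valued functions right and left multiplication by \<open>u\<close> agree, so
  \<open>V\<close> and \<open>j V\<close> are preserved; the reverse inclusion comes from
  \<open>inverse u\<close>.\<close>

lemma Gr_KP_const:
  assumes W: "W \<in> Gr_KP" and u: "u \<noteq> 0" shows "gr_act (\<lambda>_. u) W = W"
proof -
  obtain V where V: "V \<in> Gr_C" "W = {v + lmult quat_j v' | v v'. v \<in> V \<and> v' \<in> V}"
    using W by (auto simp: Gr_KP_def)
  have sub: "subspace V" "\<And>f. f \<in> V \<Longrightarrow> lmult quat_i f \<in> V" and cv: "\<And>f. f \<in> V \<Longrightarrow> complex_valued f"
    using V(1) by (auto simp: Gr_C_def)
  have s: "gr_act (\<lambda>_. a) W \<subseteq> W" for a
  proof
    fix f assume "f \<in> gr_act (\<lambda>_. a) W"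
    then obtain v v' where v: "v \<in> V" "v' \<in> V" "f = rmult (v + lmult quat_j v') (\<lambda>_. a)"
      unfolding gr_act_def V(2) by blast
    have "f = lmult (qc a) v + lmult quat_j (lmult (qc a) v')"
      unfolding v(3) rmult_add rmult_lmult rmult_const_complex[OF cv[OF v(1)]] rmult_const_complex[OF cv[OF v(2)]] ..
    moreover have "lmult (qc a) v \<in> V" "lmult (qc a) v' \<in> V" using lmult_i_closed_qc[OF sub] v by auto
    ultimately show "f \<in> W" unfolding V(2) by blast
  qed
  have "W = gr_act (\<lambda>_. u) (gr_act (\<lambda>_. inverse u) W)" using u by (simp add: gr_act_const_const) (simp add: gr_act_def)
  also have "\<dots> \<subseteq> gr_act (\<lambda>_. u) W" using s[of "inverse u"] unfolding gr_act_def by (rule image_mono)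
  finally show ?thesis using s[of u] by (rule antisym[rotated])
qed

lemma Gr_QKP_const:
  assumes W: "W \<in> Gr_QKP" and u: "u \<noteq> 0" shows "gr_act (\<lambda>_. u) W \<in> Gr_QKP"
proof -
  have WG: "W \<in> Gr_H" using W by (simp add: Gr_QKP_def)
  have "gr_act (\<lambda>_. u) W \<notin> Gr_KP"
  proof
    assume k: "gr_act (\<lambda>_. u) W \<in> Gr_KP"
    have "gr_act (\<lambda>_. u) W = gr_act (\<lambda>_. inverse u) (gr_act (\<lambda>_. u) W)" using Gr_KP_const[OF k, of "inverse u"] u by simp
    also have "\<dots> = W" using u by (simp add: gr_act_const_const) (simp add: gr_act_def)
    finally show False using k W by (simp add: Gr_QKP_def)
  qed
  then show ?thesis using gr_act_const_Gr_H[OF WG u] by (simp add: Gr_QKP_def)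
qed

section \<open>Operators with complex coefficients\<close>

lemma conj_i_fixed_iff: "inverse (qc \<i>) * q * qc \<i> = q \<longleftrightarrow> jpart q = 0"
  by (auto simp: quat_eq_iff algebra_simps simp flip: qc_inverse)

lemma jpart_pd_y_pow:
  assumes "ysmooth U f" "\<And>c. jpart (f c) = 0" shows "jpart ((pd_y U ^^ k) f c) = 0"
proof -
  have "(\<lambda>c. inverse (qc \<i>) * f c * qc \<i>) = f" using assms(2) by (auto simp: conj_i_fixed_iff)
  then have "(pd_y U ^^ k) f = (\<lambda>c. inverse (qc \<i>) * (pd_y U ^^ k) f c * qc \<i>)"
    using pd_y_pow_linear[OF assms(1) bounded_linear_conj[of "\<i>"], where k = k] by simp
  then show ?thesis using conj_i_fixed_iff by metis
qed

text \<open>The coefficient of \<open>K\<close> of order \<open>- k\<close> enters the relation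
  between \<open>L K\<close> and \<open>K i d/dy\<close> only through its commutator with
  \<open>i\<close>; all other terms are complex by induction. Such a commutator has no complex part
  and determines the \<open>j\<close>-part, which therefore vanishes.\<close>

lemma K_op_complex:
  assumes W: "W \<in> Gr_H" and L: "\<And>n c. jpart (L_op W n c) = 0"
  shows "jpart (K_op W (- int k) c) = 0"
proof (induction k arbitrary: c rule: less_induct)
  case (less k c)
  let ?U = "baker_dom W"
  let ?t = "\<lambda>(i, j, l). (real_of_int (1 - int i) gchoose l) *\<^sub>R (L_op W (1 - int i) c * (pd_y ?U ^^ l) (K_op W (- int j)) c)"
  have sm: "ysmooth ?U (K_op W n)" for n using K_op_monic[OF W] by (simp add: sps_def)
  show ?case
  proof (cases "c \<in> ?U")
    case True
    have "sum ?t (tri k) = ?t (0, k, 0) + sum ?t (tri k - {(0, k, 0)})"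
      by (rule sum.remove) (simp_all, simp add: tri_def)
    then have e: "K_op W (- int k) c * quat_i - quat_i * K_op W (- int k) c = sum ?t (tri k - {(0, k, 0)})"
      using L_op_tri[OF W, of c k] L_op_props(3)[OF W, of c] True by (simp add: algebra_simps)
    have z: "jpart (?t x) = 0" if "x \<in> tri k - {(0, k, 0)}" for x
    proof -
      obtain i j l where x: "x = (i, j, l)" by (cases x)
      have "j < k" using that by (auto simp: tri_def x)
      then have "jpart ((pd_y ?U ^^ l) (K_op W (- int j)) c) = 0" by (intro jpart_pd_y_pow sm less)
      then show ?thesis using L by (simp add: x)
    qed
    have "jpart (sum f A) = (\<Sum>x\<in>A. jpart (f x))" for f :: "nat \<times> nat \<times> nat \<Rightarrow> quat" and A
      by (induction A rule: infinite_finite_induct) auto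
    then have "jpart (sum ?t (tri k - {(0, k, 0)})) = 0" using z by (simp add: sum.neutral)
    then show ?thesis unfolding e[symmetric] by simp
  qed (simp add: sps_zero_off[OF K_op_monic(2)[OF W]])
qed

text \<open>The derivative formula expresses \<open>quat_i * w_(k+1)\<close> through
  \<open>w_k\<close>, \<open>w_0\<close> and a derivative, so that absence of a
  \<open>j\<close>-part passes from the Baker function to all \<open>w_k\<close>.\<close>

lemma alpha_complex:
  assumes W: "W \<in> Gr_H" and L: "\<And>n c. jpart (L_op W n c) = 0"
  shows "jpart (alpha W k m c) = 0"
proof -
  have z: "jpart (alpha W 0 m c) = 0" for m c
  proof (cases "m > 0")
    case True
    then show ?thesis using alpha_nonneg[OF W, of c m 0] by (cases "c \<in> baker_dom W") auto
  next
    case False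
    define k where "k = nat (- m)"
    have m: "m = - int k" using False by (simp add: k_def)
    have "jpart (alpha W 0 m c * qc (\<i> ^ k)) = 0"
      using K_op_complex[OF W L, of k c] by (simp add: K_op_neg[OF W] m qc_power qc_i)
    then show ?thesis by simp
  qed
  show ?thesis
  proof (induction k arbitrary: m c)
    case (Suc k)
    have "jpart ((pd_y (baker_dom W) ^^ 1) (alpha W k m) c) = 0" by (rule jpart_pd_y_pow[OF ysmooth_alpha[OF W] Suc])
    then show ?case using Suc z by (simp add: alpha_pd_y[OF W] One_nat_def)
  qed (rule z)
qed

text \<open>The map \<open>f \<mapsto> \<i>\<^sup>-\<^sup>1 f \<i>\<close>, whose fixed points are the complex valued functions.\<close>

definition iconj :: "L2H \<Rightarrow> L2H" where
  "iconj f = lmult (inverse (qc \<i>)) (rmult f (\<lambda>_. \<i>))"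

lemma fourier_iconj: "fourier (iconj f) m = inverse (qc \<i>) * fourier f m * qc \<i>"
  by (simp add: iconj_def mult.assoc)

lemma i_mult_i: "\<i> * (x * \<i>) = - x" "\<i> * x * \<i> = - x" by (simp_all add: complex_eq_iff)

lemma bounded_linear_iconj: "bounded_linear iconj"
  unfolding iconj_def by (rule bounded_linear_compose[OF bounded_linear_lmult bounded_linear_rmult]) simp

lemma complex_split:
  assumes W: "W \<in> Gr_H" and Z: "\<And>f. f \<in> W \<Longrightarrow> iconj f \<in> W" and f: "f \<in> W"
  shows "\<exists>v v'. v \<in> W \<and> complex_valued v \<and> v' \<in> W \<and> complex_valued v' \<and> f = v + lmult quat_j v'"
proof (intro exI conjI)
  let ?v = "(1/2) *\<^sub>R (f + iconj f)" and ?w = "lmult (- quat_j) ((1/2) *\<^sub>R (f - iconj f))"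
  have sub: "subspace W" using Gr_H_D(1)[OF W] by (rule csubspace_imp_subspace)
  show "?v \<in> W" "?w \<in> W"
    using Z[OF f] f sub by (auto intro!: Gr_H_D(3)[OF W] subspace_scale subspace_add subspace_diff)
  show "complex_valued ?v" "complex_valued ?w"
    by (auto simp: complex_valued_iff fourier_iconj i_mult_i simp flip: qc_inverse)
  show "f = ?v + lmult quat_j ?w"
    by (intro L2H_eqI) (simp add: fourier_iconj quat_eq_iff algebra_simps flip: qc_inverse add_divide_distrib)
qed

text \<open>The shift matters because \<open>W\<close> itself may lie outside the big cell. On
  \<open>V_shift W z\<close> density of the \<open>w_k\<close> gives invariance under
  \<open>iconj\<close>, hence a splitting into complex points \<open>V1\<close> and
  \<open>j V1\<close>. There \<open>pr_plus\<close> maps \<open>V1\<close> bijectively onto the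
  complex part of \<open>H_plus\<close>, so the index is evident, and the exponential carries it
  back.\<close>

lemma Gr_KP_criterion:
  assumes W: "W \<in> Gr_H" and z: "z \<in> Omega W" and cv: "\<And>k. complex_valued (bel (V_shift W z) k)"
  shows "W \<in> Gr_KP"
proof -
  let ?A = "Collect complex_valued"
  define V0 where "V0 = V_shift W z"
  have V0: "bigcell V0" and V0G: "V0 \<in> Gr_H" using z by (simp_all add: Omega_def V0_def bigcell_def)
  note s0 = Gr_H_D[OF V0G]
  have iV0: "iconj f \<in> V0" if "f \<in> V0" for f
  proof -
    have lin: "linear iconj" by (rule bounded_linear.linear[OF bounded_linear_iconj])
    have sub: "subspace V0" using s0(1) by (rule csubspace_imp_subspace)
    have "V0 \<subseteq> {f. iconj f \<in> V0}"
    proof (rule bel_dense[OF V0])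
      show "closed {f. iconj f \<in> V0}"
        using continuous_closed_vimage[OF s0(2) linear_continuous_at[OF bounded_linear_iconj]] by (simp add: vimage_def)
      have "iconj (lmult quat_i f) = lmult quat_i (iconj f)" for f
        by (intro L2H_eqI) (simp add: fourier_iconj quat_eq_iff i_mult_i flip: qc_inverse)
      then show "cvs.subspace {f. iconj f \<in> V0}"
        using linear_subspace_vimage[OF lin sub] s0(3) by (simp add: csubspace_iff vimage_def)
      fix q k
      have "iconj (lmult q (bel V0 k)) = lmult (inverse (qc \<i>) * q * qc \<i>) (bel V0 k)"
        using cv[of k] by (intro L2H_eqI) (simp add: fourier_iconj V0_def complex_valued_iff quat_eq_iff flip: qc_inverse)
      then show "lmult q (bel V0 k) \<in> {f. iconj f \<in> V0}" using s0(3) bel(1)[OF V0] by simp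
    qed
    then show ?thesis using that by auto
  qed
  have split: "\<exists>v v'. v \<in> V0 \<and> complex_valued v \<and> v' \<in> V0 \<and> complex_valued v' \<and> f = v + lmult quat_j v'" if "f \<in> V0" for f
    by (rule complex_split[OF V0G _ that]) (rule iV0)
  define V1 where "V1 = V0 \<inter> ?A"
  have A: "ambient ?A" by (simp add: ambient_def)
  have sub1: "cvs.subspace V1" unfolding V1_def using s0(1) ambient_csubspace[OF A] by (rule cvs.subspace_inter)
  have cl1: "closed V1" unfolding V1_def using s0(2) ambient_closed[OF A] by (rule closed_Int)
  have HS1: "HSdom V1" using s0(4) unfolding HSdom_def V1_def by blast
  have im: "pr_plus ` V1 = H_plus \<inter> ?A"
  proof (rule set_eqI, rule iffI)
    fix h assume "h \<in> pr_plus ` V1"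
    then show "h \<in> H_plus \<inter> ?A" using ambient_proj[OF A] by (auto simp: pr_plus_eq H_plus_iff V1_def)
  next
    fix h assume h: "h \<in> H_plus \<inter> ?A"
    then obtain f where f: "f \<in> V0" "h = proj {0..} f" using bigcell_surj[OF V0] unfolding pr_plus_eq by blast
    obtain v v' where v: "v \<in> V0" "complex_valued v" "complex_valued v'" "f = v + lmult quat_j v'" using split[OF f(1)] by blast
    have "proj {0..} v = h" using h f v by (intro L2H_eqI) (auto simp: complex_valued_iff quat_eq_iff)
    then show "h \<in> pr_plus ` V1" using v unfolding V1_def pr_plus_eq by blast
  qed
  have ker: "{f \<in> V1. pr_plus f = 0} = {0}"
    using bigcell_eqI[OF V0, of _ 0] sub1 by (auto simp: V1_def pr_plus_eq cvs.subspace_def)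
  have fin0: "finite_cdim {0}" unfolding finite_cdim_def by (intro exI[of _ "{}"]) simp
  have fred: "fredholm_index_zero pr_plus V1 (H_plus \<inter> ?A)" unfolding fredholm_index_zero_def im ker
  proof (intro conjI exI[of _ "{0}"] fin0 refl subset_refl)
    show "closed (H_plus \<inter> ?A)" using closed_supp ambient_closed[OF A] unfolding H_plus_supp by (rule closed_Int)
    show "H_plus \<inter> ?A \<inter> {0} = {0}" by (auto simp: H_plus_def complex_valued_iff)
    show "{f + g |f g. f \<in> H_plus \<inter> ?A \<and> g \<in> {0}} = H_plus \<inter> ?A" by auto
  qed
  define V where "V = gr_act (Ez z) V1"
  have pu: "punit (Ez z) (Ez (- z))" by (rule punit_Ez)
  have V1A: "V1 \<subseteq> ?A" by (simp add: V1_def)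
  have subV: "cvs.subspace V" and clV: "closed V" unfolding V_def by (rule punit_closed_image[OF pu sub1 cl1])+
  have sV: "subspace V" using subV by (rule csubspace_imp_subspace)
  have iV: "lmult quat_i f \<in> V" if "f \<in> V" for f using subV that by (simp add: csubspace_iff)
  have "V \<in> Gr_C" unfolding Gr_C_def
  proof (intro CollectI conjI)
    show "V \<subseteq> ?A" unfolding V_def gr_act_def using V1A complex_valued_rmult by auto
    show "lmult quat_i ` V = V" by (rule lmult_unit_image[OF _ _ sV]) (auto simp: quat_eq_iff intro: iV)
    show "fredholm_index_zero pr_plus V (H_plus \<inter> ?A)"
      unfolding V_def by (rule fredholm_index_zero_rmult[OF A sub1 cl1 V1A HS1 pu fred])
    show "hilbert_schmidt pr_minus V"
      by (rule HSdom_imp_hilbert_schmidt[OF sV clV]) (rule iV, assumption, unfold V_def, rule HSdom_rmult[OF HS1 pu])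
  qed (use sV clV in auto)
  moreover have "W = {v + lmult quat_j v' | v v'. v \<in> V \<and> v' \<in> V}"
  proof (rule antisym)
    show "{v + lmult quat_j v' | v v'. v \<in> V \<and> v' \<in> V} \<subseteq> W"
    proof clarify
      fix v v' assume "v \<in> V" "v' \<in> V"
      then obtain w w' where "w \<in> V0" "w' \<in> V0" "v = rmult w (Ez z)" "v' = rmult w' (Ez z)" by (auto simp: V_def gr_act_def V1_def)
      then show "v + lmult quat_j v' \<in> W"
        using Gr_H_D(3)[OF W] by (auto simp: V0_def V_shift_def intro!: subspace_add csubspace_imp_subspace[OF Gr_H_D(1)[OF W]])
    qed
    show "W \<subseteq> {v + lmult quat_j v' | v v'. v \<in> V \<and> v' \<in> V}"
    proof
      fix f assume f: "f \<in> W"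
      have fz: "f = rmult (rmult f (Ez (- z))) (Ez z)" by (simp only: rmult_Ez_Ez) simp
      then have "rmult f (Ez (- z)) \<in> V0" using f unfolding V0_def V_shift_def by (simp only: mem_Collect_eq)
      then obtain v v' where v: "v \<in> V1" "v' \<in> V1" "rmult f (Ez (- z)) = v + lmult quat_j v'"
        using split unfolding V1_def by blast
      have "f = rmult (rmult f (Ez (- z))) (Ez z)" by (rule fz)
      also have "\<dots> = rmult v (Ez z) + lmult quat_j (rmult v' (Ez z))" unfolding v(3) by (simp add: rmult_add rmult_lmult)
      finally show "f \<in> {v + lmult quat_j v' | v v'. v \<in> V \<and> v' \<in> V}" using v unfolding V_def gr_act_def by blast
    qed
  qed
  ultimately show ?thesis using W unfolding Gr_KP_def by blast
qed

theorem stabilizer_imp_Gr_KP: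
  assumes W: "W \<in> Gr_H" and u: "cmod u = 1" "u\<^sup>2 \<noteq> 1" and fix_u: "conj_by u (L_op W) = L_op W"
  shows "W \<in> Gr_KP"
proof -
  have "jpart (L_op W n c) = 0" for n c
  proof -
    have u0: "u \<noteq> 0" using u by auto
    have "inverse (qc u) * L_op W n c * qc u = L_op W n c" using fun_cong[OF fun_cong[OF fix_u]] by (simp add: conj_by_def)
    \<comment> \<open>Conjugation by \<open>u\<close> multiplies the \<open>j\<close>-part by
      \<open>inverse u * cnj u = u^(-2)\<close>, so a non-real \<open>u\<close> on the circle kills
      it.\<close>
    then have "inverse u * jpart (L_op W n c) * cnj u = jpart (L_op W n c)"
      by (simp add: quat_eq_iff flip: qc_inverse)
    moreover have "u * cnj u = 1" using complex_norm_square[of u] u(1) by simp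
    then have "cnj u = inverse u" by (rule inverse_unique[symmetric])
    ultimately have "jpart (L_op W n c) = u\<^sup>2 * jpart (L_op W n c)" using u0 by (simp add: field_simps power2_eq_square)
    then show ?thesis using u(2) by auto
  qed
  note L = this
  obtain z where z: "z \<in> Omega W" using Omega_nonempty[OF W] by blast
  have "jpart (alpha W k m (pt z)) = 0" for k m by (rule alpha_complex[OF W L])
  then have "complex_valued (bel (V_shift W z) k)" for k
    using z Omega_iff[OF W, of z] by (simp add: alpha_def complex_valued_iff W_gam_pt)
  then show ?thesis by (rule Gr_KP_criterion[OF W z])
qed

section \<open>Rigidity: the operator on the plane of \<open>x\<close> and \<open>y\<close>
  determines the operator\<close>

section \<open>Translations\<close>

lemma translate_valid_iff [simp]: "translate w c \<in> valid_times \<longleftrightarrow> c \<in> valid_times"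
  using valid_times_upd[of c "c 1 + w"] valid_times_upd[of "translate w c" "c 1"] by (auto simp: translate_def)

lemma W_gam_V_shift:
  assumes "c \<in> valid_times" shows "W_gam (V_shift W w) c = W_gam W (translate w c)"
proof (rule set_eqI)
  fix f
  have "rmult (rmult f (gam c)) (Ez w) = rmult f (gam (translate w c))"
    unfolding translate_def rmult_gam_shift[OF assms] rmult_rmult[OF gam_continuous[OF assms] Ez_continuous]
      rmult_rmult[OF Ez_continuous gam_continuous[OF assms]] mult.commute[of "gam c _"] ..
  then show "f \<in> W_gam (V_shift W w) c \<longleftrightarrow> f \<in> W_gam W (translate w c)" by (simp add: W_gam_def V_shift_def)
qed

lemma baker_dom_shift: "W \<in> Gr_H \<Longrightarrow> baker_dom (V_shift W w) = {c. translate w c \<in> baker_dom W}"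
  by (rule set_eqI) (auto simp: baker_dom_iff V_shift_Gr_H W_gam_V_shift)

lemma alpha_shift: "W \<in> Gr_H \<Longrightarrow> alpha (V_shift W w) k m c = alpha W k m (translate w c)"
  using W_gam_V_shift[of c W w] baker_dom_valid[of "translate w c" W] by (auto simp: alpha_def baker_dom_shift)

theorem L_op_shift:
  assumes W: "W \<in> Gr_H" shows "L_op (V_shift W w) = (\<lambda>n c. L_op W n (translate w c))"
proof -
  have "K_op (V_shift W w) = (\<lambda>n c. K_op W n (translate w c))"
    by (simp add: K_op_alpha[OF W] K_op_alpha[OF V_shift_Gr_H[OF W]] alpha_shift[OF W] fun_eq_iff)
  then show ?thesis
    unfolding L_op_Lax baker_dom_shift[OF W] using Lax_trans[OF yopen_baker_dom[OF W] K_op_monic[OF W]] by simp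
qed

lemma W_z_eq: "W_z W z = V_shift W (- z)"
proof (rule set_eqI)
  fix f
  have "f \<in> V_shift W (- z) \<Longrightarrow> f \<in> W_z W z" unfolding W_z_def gr_act_def V_shift_def
    by (rule image_eqI[of _ _ "rmult f (Ez (- z))"]) (simp_all only: rmult_Ez_Ez mem_Collect_eq, simp)
  moreover have "f \<in> W_z W z \<Longrightarrow> f \<in> V_shift W (- z)"
    unfolding W_z_def gr_act_def V_shift_def by (elim imageE) (simp only: rmult_Ez_Ez mem_Collect_eq, simp)
  ultimately show "f \<in> W_z W z \<longleftrightarrow> f \<in> V_shift W (- z)" by blast
qed

section \<open>Restriction to the plane of the parameters \<open>x, y\<close>\<close>

lemma translate_pt: "translate w (pt z) = pt (z + w)" by (simp add: translate_def pt_upd)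

lemma ysh_pt: "ysh (pt z) h = pt (z + of_real h * \<i>)" by (simp add: ysh_def pt_upd mult.commute)

lemma ysh_range_pt: "ysh c h \<in> range pt \<longleftrightarrow> c \<in> range pt"
proof -
  have "c = ysh (ysh c h) (- h)" for c h by (simp add: ysh_def)
  then show ?thesis using ysh_pt by (metis rangeE rangeI)
qed

text \<open>The plane is stable under \<open>ysh\<close>, so restricted operators obey the same
  calculus over \<open>U \<inter> range pt\<close>, and the results on operators apply to them
  unchanged.\<close>

definition res :: "(times \<Rightarrow> quat) \<Rightarrow> times \<Rightarrow> quat" where
  "res F c = (if c \<in> range pt then F c else 0)"

lemma pd_y_res: "pd_y (U \<inter> range pt) (res F) = res (pd_y U F)"
proof
  fix c
  have "c \<in> range pt \<Longrightarrow> res F (ysh c h) = F (ysh c h)" for h by (simp add: res_def ysh_range_pt)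
  then show "pd_y (U \<inter> range pt) (res F) c = res (pd_y U F) c"
    by (cases "c \<in> range pt") (simp_all add: pd_y_ysh res_def[of "pd_y U F"])
qed

lemma pd_y_pow_res: "(pd_y (U \<inter> range pt) ^^ k) (res F) = res ((pd_y U ^^ k) F)"
  by (induction k) (simp_all add: pd_y_res)

lemma ysmooth_res:
  assumes "ysmooth U F" shows "ysmooth (U \<inter> range pt) (res F)"
proof -
  have "ydiff U n F \<Longrightarrow> ydiff (U \<inter> range pt) n (res F)" for n
  proof (induction n arbitrary: F)
    case (Suc n)
    have "c \<in> range pt \<Longrightarrow> (\<lambda>h. res F (ysh c h)) = (\<lambda>h. F (ysh c h))" for c
      by (simp add: res_def ysh_range_pt)
    then show ?case using Suc by (simp add: pd_y_res)
  qed simp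
  then show ?thesis using assms by (auto simp: ysmooth_def res_def)
qed

lemma yopen_res: "yopen U \<Longrightarrow> yopen (U \<inter> range pt)"
  unfolding yopen_def by (auto simp: ysh_range_pt)

lemma sps_res: "sps U a A \<Longrightarrow> sps (U \<inter> range pt) a (\<lambda>n. res (A n))"
  by (auto simp: sps_def psord_def ysmooth_res) (simp add: res_def fun_eq_iff)

lemma psdo_mult_res:
  assumes A: "psord a A" and B: "psord b B"
  shows "psdo_mult (U \<inter> range pt) (\<lambda>n. res (A n)) (\<lambda>n. res (B n)) = (\<lambda>n. res (psdo_mult U A B n))"
proof -
  have z: "res (\<lambda>_. 0) = (\<lambda>_. 0)" by (simp add: res_def fun_eq_iff)
  have A': "psord a (\<lambda>n. res (A n))" and B': "psord b (\<lambda>n. res (B n))" using A B z by (auto simp: psord_def)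
  show ?thesis
  proof (rule psdos_eqI[OF psord_mult[OF A' B']])
    show "psord (a + b) (\<lambda>n. res (psdo_mult U A B n))" using psord_mult[OF A B, of U] z by (auto simp: psord_def)
    fix k c
    show "psdo_mult (U \<inter> range pt) (\<lambda>n. res (A n)) (\<lambda>n. res (B n)) (a + b - int k) c = res (psdo_mult U A B (a + b - int k)) c"
      unfolding psdo_mult_tri[OF A' B'] pd_y_pow_res
      by (cases "c \<in> range pt") (simp_all add: res_def psdo_mult_tri[OF A B] case_prod_unfold)
  qed
qed

text \<open>Comparing coefficients gives \<open>i m\<^bsub>k+1\<^esub> - m\<^bsub>k+1\<^esub> i = - i \<partial>\<^sub>y m\<^sub>k\<close>: the left hand side has no complex part, and by
  induction the right hand side is complex, so both vanish.\<close>

lemma commute_i_pd_y: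
  assumes U: "yopen U" and M: "sps U 0 M" "M 0 = (\<lambda>c. if c \<in> U then 1 else 0)"
    and comm: "psdo_mult U (i_pd_y U) M = psdo_mult U M (i_pd_y U)"
  shows "jpart (M (- int k) c) = 0 \<and> pd_y U (M (- int k)) = (\<lambda>_. 0)"
proof -
  have oM: "psord 0 M" and oi: "psord 1 (i_pd_y U)" using M sps_i[OF U] by (auto simp: sps_def)
  have smM: "ysmooth U (M n)" for n using M by (simp add: sps_def)
  have eq: "quat_i * M (- int (Suc k)) c - M (- int (Suc k)) c * quat_i = - (quat_i * pd_y U (M (- int k)) c)" if c: "c \<in> U" for k c
  proof -
    have l2: "(1::real) gchoose l = 0" if "l \<noteq> 0" "l \<noteq> 1" for l
      using binomial_gbinomial[of 1 l, where 'a = real] that by (simp add: binomial_eq_0)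
    have "psdo_mult U (i_pd_y U) M (1 + 0 - int (Suc k)) c =
      (\<Sum>(i, j, l)\<in>{(0, Suc k, 0), (0, k, 1)}. (real_of_int (1 - int i) gchoose l) *\<^sub>R (i_pd_y U (1 - int i) c * (pd_y U ^^ l) (M (0 - int j)) c))"
    proof (rule psdo_mult_tri_on[OF oi oM])
      fix i j l assume "(i, j, l) \<in> tri (Suc k)" "(i, j, l) \<notin> {(0, Suc k, 0), (0, k, 1)}"
      then have "i \<noteq> 0 \<or> (l \<noteq> 0 \<and> l \<noteq> 1)" by (auto simp: tri_def)
      then show "real_of_int (1 - int i) gchoose l = 0 \<or> i_pd_y U (1 - int i) c = 0 \<or> (pd_y U ^^ l) (M (0 - int j)) c = 0"
        using l2[of l] by (cases "i = 0") (simp_all add: i_pd_y_def)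
    qed (auto simp: tri_def)
    also have "\<dots> = quat_i * M (- int (Suc k)) c + quat_i * pd_y U (M (- int k)) c"
      using c by (simp add: i_pd_y_def One_nat_def)
    finally have "psdo_mult U M (i_pd_y U) (- int k) c = quat_i * M (- int (Suc k)) c + quat_i * pd_y U (M (- int k)) c"
      unfolding comm by simp
    moreover have "psdo_mult U M (i_pd_y U) (- int k) c = M (- int (Suc k)) c * quat_i"
      using psdo_mult_i_right[OF U oM sps_zero_off[OF M(1)], of "- int k"] by (simp add: minus_diff_commute)
    ultimately show ?thesis by simp
  qed
  have step: "pd_y U (M (- int k)) c = 0 \<and> jpart (M (- int (Suc k)) c) = 0" if IH: "\<And>c. jpart (M (- int k) c) = 0" for k c
  proof (cases "c \<in> U")
    case True
    have "jpart ((pd_y U ^^ 1) (M (- int k)) c) = 0" by (rule jpart_pd_y_pow[OF smM IH])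
    then show ?thesis using eq[OF True, of k] by (simp add: quat_eq_iff One_nat_def mult.commute)
  qed (simp add: sps_zero_off[OF M(1)])
  have j: "jpart (M (- int k) c) = 0" for k c
  proof (induction k arbitrary: c)
    case 0 then show ?case using M(2) by simp
  next
    case (Suc k) then show ?case using step by blast
  qed
  show ?thesis using step j by blast
qed

lemma psdo_mult_const_coeffs:
  assumes K: "psord 0 K" and M: "psord 0 M" "\<And>k. pd_y U (M (- int k)) = (\<lambda>_. 0)"
  shows "psdo_mult U K M (- int k) c = (\<Sum>s\<le>k. K (- int (k - s)) c * M (- int s) c)"
proof -
  have z: "(pd_y U ^^ l) (M (- int j)) = (\<lambda>_. 0)" if "l > 0" for l j
    using that by (cases l) (simp_all del: funpow.simps add: funpow_Suc_right M)
  have "psdo_mult U K M (0 + 0 - int k) c = (\<Sum>(i, j, l)\<in>tri k \<inter> {(i, j, l). l = 0}. (real_of_int (0 - int i) gchoose l) *\<^sub>R (K (0 - int i) c * (pd_y U ^^ l) (M (0 - int j)) c))"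
    by (rule psdo_mult_tri_on[OF K M(1)]) (simp_all add: z)
  also have "\<dots> = (\<Sum>s\<le>k. K (- int (k - s)) c * M (- int s) c)"
    by (rule sum.reindex_bij_witness[of _ "\<lambda>s. (k - s, s, 0)" "\<lambda>(i, j, l). j"]) (auto simp: tri_def)
  finally show ?thesis by simp
qed

text \<open>Only derivatives in the directions 1 and \<open>i\<close> are known, not total
  differentiability; inside a ball any point is reached by a horizontal segment followed by a
  vertical one.\<close>

lemma connected_constant_directional:
  fixes f :: "complex \<Rightarrow> 'a::real_normed_vector"
  assumes "open S" "connected S"
    and x: "\<And>z. z \<in> S \<Longrightarrow> ((\<lambda>h. f (z + of_real h)) has_vector_derivative 0) (at 0)"
    and y: "\<And>z. z \<in> S \<Longrightarrow> ((\<lambda>h. f (z + of_real h * \<i>)) has_vector_derivative 0) (at 0)"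
    and "a \<in> S" "b \<in> S"
  shows "f a = f b"
proof (rule connected_local_const[OF assms(2)], goal_cases)
  case 3
  show ?case
  proof
    fix a assume "a \<in> S"
    then obtain e where e: "e > 0" "ball a e \<subseteq> S" using assms(1) by (auto simp: open_contains_ball)
    have line: "f (p + of_real t * \<theta>) = f p"
      if d: "\<And>s. 0 \<le> s \<Longrightarrow> s \<le> 1 \<Longrightarrow> p + of_real (s * t) * \<theta> \<in> S"
        and \<theta>: "\<And>z. z \<in> S \<Longrightarrow> ((\<lambda>h. f (z + of_real h * \<theta>)) has_vector_derivative 0) (at 0)" for p t \<theta>
    proof -
      let ?g = "\<lambda>s. f (p + of_real (s * t) * \<theta>)"
      have "(?g has_vector_derivative 0) (at s within {0..1})" if s: "s \<in> {0..1}" for s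
      proof -
        let ?z = "p + of_real (s * t) * \<theta>"
        have "?z \<in> S" using d s by auto
        then have "((\<lambda>h. f (?z + of_real h * \<theta>)) has_vector_derivative 0) (at ((\<lambda>s'. (s' - s) * t) s) within (\<lambda>s'. (s' - s) * t) ` {0..1})"
          using \<theta>[of ?z] by (simp add: has_vector_derivative_at_within)
        moreover have "((\<lambda>s'. (s' - s) * t) has_real_derivative t) (at s within {0..1})"
          by (auto intro!: derivative_eq_intros)
        ultimately have "((\<lambda>h. f (?z + of_real h * \<theta>)) \<circ> (\<lambda>s'. (s' - s) * t) has_vector_derivative t *\<^sub>R 0) (at s within {0..1})"
          using vector_diff_chain_within has_real_derivative_iff_has_vector_derivative by blast
        then show ?thesis by (simp add: o_def algebra_simps)
      qed
      then obtain k where "\<And>s. s \<in> {0..1} \<Longrightarrow> ?g s = k"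
        using has_vector_derivative_zero_constant[of "{0..1::real}" ?g] by auto
      from this[of 0] this[of 1] show ?thesis by simp
    qed
    have "f a = f b" if "b \<in> ball a e" for b
    proof -
      let ?u = "Re b - Re a" and ?v = "Im b - Im a"
      have nb: "cmod (b - a) < e" using that by (simp add: dist_norm norm_minus_commute)
      have "f (a + of_real ?u * 1) = f a"
      proof (rule line)
        fix s :: real assume s: "0 \<le> s" "s \<le> 1"
        have "\<bar>s * ?u\<bar> \<le> 1 * cmod (b - a)" unfolding abs_mult using s abs_Re_le_cmod[of "b - a"] by (intro mult_mono) auto
        then have "norm (of_real (s * ?u) :: complex) < e" using nb by (simp only: norm_of_real)
        then show "a + of_real (s * ?u) * 1 \<in> S" using e(2) by (auto simp: dist_norm subset_iff norm_minus_commute simp del: of_real_mult)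
      qed (use x in simp)
      moreover have "f ((a + of_real ?u * 1) + of_real ?v * \<i>) = f (a + of_real ?u * 1)"
      proof (rule line)
        fix s :: real assume s: "0 \<le> s" "s \<le> 1"
        let ?d = "of_real ?u + of_real (s * ?v) * \<i>"
        have "\<bar>s * ?v\<bar> \<le> 1 * \<bar>?v\<bar>" unfolding abs_mult using s by (intro mult_mono) auto
        then have "(s * ?v)\<^sup>2 \<le> ?v\<^sup>2" by (simp add: abs_le_square_iff)
        then have "cmod ?d \<le> cmod (b - a)" by (simp add: cmod_def)
        then have "norm ?d < e" using nb by simp
        then have "a + ?d \<in> S" using e(2) by (auto simp: dist_norm subset_iff norm_minus_commute simp del: of_real_mult of_real_diff)
        then show "(a + of_real ?u * 1) + of_real (s * ?v) * \<i> \<in> S" by (simp add: add.assoc)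
      qed (rule y)
      moreover have "(a + of_real ?u * 1) + of_real ?v * \<i> = b" by (simp add: complex_eq_iff)
      ultimately show ?thesis by simp
    qed
    then show "\<forall>\<^sub>F b in at a within S. f a = f b"
      unfolding eventually_at using e(1) by (auto simp: dist_commute intro!: exI[of _ e])
  qed
qed (use assms in auto)

section \<open>Operators agreeing on the plane\<close>

text \<open>The leading coefficient is \<open>i\<close> exactly where the Baker function exists and
  0 elsewhere, so equality of operators includes equality of domains.\<close>

lemma L_z_eq_dom:
  assumes W: "W \<in> Gr_H" and W': "W' \<in> Gr_H" and L: "L_z W = L_z W'"
  shows "baker_dom W \<inter> range pt = baker_dom W' \<inter> range pt" "Omega W = Omega W'"
proof -
  have "L_op W 1 (pt z) = L_op W' 1 (pt z)" for z
    using fun_cong[OF fun_cong[OF L, of 1], of z] by (simp add: L_z_def pt_def)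
  moreover have "quat_i \<noteq> 0" by (simp add: quat_eq_iff)
  ultimately have pt: "pt z \<in> baker_dom W \<longleftrightarrow> pt z \<in> baker_dom W'" for z
    unfolding L_op_props(3)[OF W] L_op_props(3)[OF W'] by metis
  then show "baker_dom W \<inter> range pt = baker_dom W' \<inter> range pt" by auto
  show "Omega W = Omega W'" using pt Omega_iff[OF W] Omega_iff[OF W'] by blast
qed

lemma plane_factor:
  assumes W: "W \<in> Gr_H" and W': "W' \<in> Gr_H" and L: "L_z W = L_z W'"
  shows "\<exists>g :: nat \<Rightarrow> complex \<Rightarrow> complex. \<forall>z\<in>Omega W. g 0 z = 1 \<and>
    (\<forall>k. alpha W' 0 (- int k) (pt z) = (\<Sum>s\<le>k. alpha W 0 (- int (k - s)) (pt z) * qc (g s z))) \<and>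
    (\<forall>k. ((\<lambda>h. qc (g k (z + of_real h * \<i>))) has_vector_derivative 0) (at 0))"
proof -
  let ?U = "baker_dom W \<inter> range pt" and ?r = "\<lambda>A (n::int). res (A n)"
  note dom = L_z_eq_dom[OF assms]
  have U: "yopen ?U" by (rule yopen_res[OF yopen_baker_dom[OF W]])
  have ri: "?r (i_pd_y V) = i_pd_y (V \<inter> range pt)" for V by (auto simp: res_def i_pd_y_def fun_eq_iff)
  have oi: "psord 1 (i_pd_y V)" for V by (simp add: psord_def i_pd_y_def fun_eq_iff)
  have K: "monic (V \<inter> range pt) (?r (K_op X))" "sps (V \<inter> range pt) 0 (?r (K_op X))"
    and LK: "sps (V \<inter> range pt) 1 (?r (L_op X))"
      "psdo_mult (V \<inter> range pt) (?r (L_op X)) (?r (K_op X)) = psdo_mult (V \<inter> range pt) (?r (K_op X)) (i_pd_y (V \<inter> range pt))"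
    if X: "X \<in> Gr_H" and V: "V = baker_dom X" for X V
  proof -
    note k = K_op_monic[OF X] and l = L_op_props[OF X]
    have o: "psord 0 (K_op X)" "psord 1 (L_op X)" using k l by (auto simp: sps_def)
    show s: "sps (V \<inter> range pt) 0 (?r (K_op X))" unfolding V by (rule sps_res[OF k(2)])
    show "monic (V \<inter> range pt) (?r (K_op X))"
      using k(1) s unfolding monic_def V by (auto simp: res_def fun_eq_iff sps_def)
    show "sps (V \<inter> range pt) 1 (?r (L_op X))" unfolding V by (rule sps_res[OF l(1)])
    show "psdo_mult (V \<inter> range pt) (?r (L_op X)) (?r (K_op X)) = psdo_mult (V \<inter> range pt) (?r (K_op X)) (i_pd_y (V \<inter> range pt))"
      unfolding ri[symmetric] psdo_mult_res[OF o(2,1)] psdo_mult_res[OF o(1) oi] V l(2) ..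
  qed
  note K0 = K[OF W refl] and L0 = LK[OF W refl] and K1 = K[OF W' refl, folded dom(1)] and L1 = LK[OF W' refl, folded dom(1)]
  have rL: "?r (L_op W') = ?r (L_op W)"
    using fun_cong[OF fun_cong[OF L]] by (auto simp: res_def fun_eq_iff L_z_def pt_def)
  note inv = monic_inverse[OF U K0]
  let ?K = "?r (K_op W)" and ?K' = "?r (K_op W')" and ?L = "?r (L_op W)" and ?i = "i_pd_y ?U"
  define M where "M = psdo_mult ?U (psdo_inverse ?U ?K) ?K'"
  have sM: "sps ?U 0 M" using sps_mult[OF inv(1) K1(2)] by (simp add: M_def)
  have oM: "psord 0 M" and oK: "psord 0 ?K" "psord 0 ?K'" using sM K0(2) K1(2) by (auto simp: sps_def)
  note si = sps_i[OF U]
  have one: "psdo_mult ?U (psdo_one ?U) X = X" if "sps ?U a X" for a X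
    using that sps_zero_off[OF that] by (intro psdo_mult_one_left[of a]) (auto simp: sps_def)
  have KM: "psdo_mult ?U ?K M = ?K'"
    unfolding M_def psdo_mult_assoc[OF K0(2) inv(1) K1(2), symmetric] inv(3) by (rule one[OF K1(2)])
  have iM: "sps ?U 1 (psdo_mult ?U ?i M)" and Mi: "sps ?U 1 (psdo_mult ?U M ?i)"
    using sps_mult[OF si sM] sps_mult[OF sM si] by simp_all
  \<comment> \<open>Commutation of \<open>M\<close> with \<open>i d/dy\<close> is checked after
    multiplying by \<open>K\<close> on the left, where both sides become \<open>L K'\<close>;
    invertibility of \<open>K\<close> removes the factor again.\<close>
  have "psdo_mult ?U ?K (psdo_mult ?U ?i M) = psdo_mult ?U ?L (psdo_mult ?U ?K M)"
    unfolding psdo_mult_assoc[OF K0(2) si sM, symmetric] L0(2)[symmetric] by (rule psdo_mult_assoc[OF L0(1) K0(2) sM])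
  also have "\<dots> = psdo_mult ?U (psdo_mult ?U ?K M) ?i" unfolding KM rL[symmetric] by (rule L1(2))
  also have "\<dots> = psdo_mult ?U ?K (psdo_mult ?U M ?i)" by (rule psdo_mult_assoc[OF K0(2) sM si])
  finally have KiM: "psdo_mult ?U ?K (psdo_mult ?U ?i M) = psdo_mult ?U ?K (psdo_mult ?U M ?i)" .
  have "psdo_mult ?U ?i M = psdo_mult ?U (psdo_inverse ?U ?K) (psdo_mult ?U ?K (psdo_mult ?U ?i M))"
    unfolding psdo_mult_assoc[OF inv(1) K0(2) iM, symmetric] inv(4) by (rule one[OF iM, symmetric])
  also have "\<dots> = psdo_mult ?U M ?i"
    unfolding KiM psdo_mult_assoc[OF inv(1) K0(2) Mi, symmetric] inv(4) by (rule one[OF Mi])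
  finally have comm: "psdo_mult ?U ?i M = psdo_mult ?U M ?i" .
  have "psdo_mult ?U ?K M (0 + 0 - int 0) c = ?K 0 c * M 0 c" for c
    unfolding psdo_mult_tri[OF oK(1) oM] by (simp add: tri_def)
  then have "?K' 0 c = ?K 0 c * M 0 c" for c unfolding KM by simp
  then have M0: "M 0 = (\<lambda>c. if c \<in> ?U then 1 else 0)"
    using K0(1) K1(1) sps_zero_off[OF sM, of _ 0] unfolding monic_def fun_eq_iff by (metis mult_1)
  have MM: "jpart (M (- int k) c) = 0" "pd_y ?U (M (- int k)) = (\<lambda>_. 0)" for k c
    using commute_i_pd_y[OF U sM M0 comm] by auto
  \<comment> \<open>\<open>K_op\<close> pairs the coefficient of \<open>zeta^(-s)\<close> with the
    power \<open>s\<close> of \<open>i\<close>; dividing that power out of \<open>M\<close> recovers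
    the coefficient belonging to \<open>zeta^(-s)\<close>.\<close>
  define g where "g = (\<lambda>s z. cpart (M (- int s) (pt z)) * inverse \<i> ^ s)"
  have Mg: "M (- int s) (pt z) = qc (g s z) * quat_i ^ s" for s z
  proof -
    have "M (- int s) (pt z) = qc (cpart (M (- int s) (pt z)))" using MM(1) by (simp add: quat_eq_iff)
    then show ?thesis by (simp add: g_def qc_i[symmetric] qc_power[symmetric] qc_mult[symmetric] mult.assoc power_mult_distrib[symmetric])
  qed
  show ?thesis
  proof (intro exI[of _ g] ballI conjI allI)
    fix z k assume z: "z \<in> Omega W"
    then have zU: "pt z \<in> ?U" by (simp add: Omega_iff[OF W])
    show "g 0 z = 1" using M0 zU by (simp add: g_def)
    have "K_op W' (- int k) (pt z) = (\<Sum>s\<le>k. K_op W (- int (k - s)) (pt z) * M (- int s) (pt z))"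
      using psdo_mult_const_coeffs[OF oK(1) oM MM(2), of k "pt z"] unfolding KM by (simp add: res_def)
    then have "alpha W' 0 (- int k) (pt z) * quat_i ^ k = (\<Sum>s\<le>k. alpha W 0 (- int (k - s)) (pt z) * quat_i ^ (k - s) * (qc (g s z) * quat_i ^ s))"
      unfolding K_op_neg[OF W] K_op_neg[OF W'] Mg .
    also have "\<dots> = (\<Sum>s\<le>k. alpha W 0 (- int (k - s)) (pt z) * qc (g s z)) * quat_i ^ k"
      unfolding sum_distrib_right
    proof (rule sum.cong[OF refl])
      fix s assume "s \<in> {..k}"
      then have "\<i> ^ (k - s) * (g s z * \<i> ^ s) = g s z * \<i> ^ k" by (simp add: power_add[symmetric])
      then have "quat_i ^ (k - s) * (qc (g s z) * quat_i ^ s) = qc (g s z) * quat_i ^ k"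
        by (simp add: qc_i[symmetric] qc_power[symmetric] qc_mult[symmetric])
      then show "alpha W 0 (- int (k - s)) (pt z) * quat_i ^ (k - s) * (qc (g s z) * quat_i ^ s) = alpha W 0 (- int (k - s)) (pt z) * qc (g s z) * quat_i ^ k"
        by (simp add: mult.assoc)
    qed
    finally show "alpha W' 0 (- int k) (pt z) = (\<Sum>s\<le>k. alpha W 0 (- int (k - s)) (pt z) * qc (g s z))"
      by (simp add: quat_eq_iff[of quat_i])
    have "ysmooth ?U (M (- int k))" using sM by (simp add: sps_def)
    then have "((\<lambda>h. M (- int k) (ysh (pt z) h)) has_vector_derivative pd_y ?U (M (- int k)) (pt z)) (at 0)"
      using zU by (rule ysmooth_deriv)
    then have "((\<lambda>h. M (- int k) (ysh (pt z) h)) has_vector_derivative 0) (at 0)" by (simp only: MM(2))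
    then have "((\<lambda>h. qc (cpart (M (- int k) (pt (z + of_real h * \<i>))) * inverse \<i> ^ k)) has_vector_derivative qc (cpart 0 * inverse \<i> ^ k)) (at 0)"
      unfolding ysh_pt
      by (intro bounded_linear.has_vector_derivative[OF bounded_linear_qc] bounded_linear.has_vector_derivative[OF bounded_linear_mult_left]
          bounded_linear.has_vector_derivative[OF bounded_linear_cpart])
    then show "((\<lambda>h. qc (g k (z + of_real h * \<i>))) has_vector_derivative 0) (at 0)" by (simp add: g_def)
  qed
qed

lemma plane_constants:
  assumes W: "W \<in> Gr_H" and W': "W' \<in> Gr_H" and L: "L_z W = L_z W'"
  shows "\<exists>d :: nat \<Rightarrow> complex. d 0 = 1 \<and> (\<forall>z\<in>Omega W. \<forall>k.
    alpha W' 0 (- int k) (pt z) = (\<Sum>s\<le>k. alpha W 0 (- int (k - s)) (pt z) * qc (d s)))"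
proof -
  define a where "a = (\<lambda>k z. alpha W 0 (- int k) (pt z))"
  define a' where "a' = (\<lambda>k z. alpha W' 0 (- int k) (pt z))"
  obtain g :: "nat \<Rightarrow> complex \<Rightarrow> complex" where g0: "\<And>z. z \<in> Omega W \<Longrightarrow> g 0 z = 1"
    and ga: "\<And>z k. z \<in> Omega W \<Longrightarrow> a' k z = (\<Sum>s\<le>k. a (k - s) z * qc (g s z))"
    and gy: "\<And>z k. z \<in> Omega W \<Longrightarrow> ((\<lambda>h. qc (g k (z + of_real h * \<i>))) has_vector_derivative 0) (at 0)"
    using plane_factor[OF assms] unfolding a_def a'_def by blast
  \<comment> \<open>\<open>P\<close> annihilates complex numbers. In the Dirac equation at level
    \<open>k\<close> the next coefficient \<open>a' (Suc k)\<close> occurs only under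
    \<open>P\<close>, so the still unknown \<open>g (Suc k)\<close> drops out.\<close>
  define P where "P = (\<lambda>q. q + quat_i * q * quat_i)"
  define D where "D = (\<lambda>X k z \<theta>. qc \<theta> * alpha X (Suc 0) (- int k) (pt z) + alpha X 0 (-1) (pt z) * qc \<theta> * alpha X 0 (- int k) (pt z) - alpha X 0 (- int k - 1) (pt z) * qc \<theta>)"
  note dom = L_z_eq_dom[OF assms]
  have Om: "pt z \<in> baker_dom W" "pt z \<in> baker_dom W'" if "z \<in> Omega W" for z
    using that Omega_iff[OF W] Omega_iff[OF W'] dom(2) by auto
  have der: "((\<lambda>h. alpha X 0 (- int k) (pt (z + of_real h * \<theta>))) has_vector_derivative D X k z \<theta>) (at 0)"
    if "X \<in> Gr_H" "pt z \<in> baker_dom X" "cmod \<theta> \<le> 1" for X k z \<theta>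
    using alpha_deriv[OF that, of 0 "- int k"] by (simp add: D_def pt_upd)
  \<comment> \<open>The terms with \<open>alpha X (Suc 0)\<close> cancel because
    \<open>i * i = -1\<close>, which leaves coefficients of the Baker function only.\<close>
  have dirac: "D X k z 1 + quat_i * D X k z \<i> = P (alpha X 0 (-1) (pt z)) * alpha X 0 (- int k) (pt z) - P (alpha X 0 (- int k - 1) (pt z))" for X k z
  proof -
    have ii: "quat_i * (quat_i * q) = - q" for q by (simp add: quat_eq_iff flip: mult.assoc)
    show ?thesis by (simp add: D_def P_def qc_i algebra_simps ii)
  qed
  have P_mult: "P (q * qc w) = P q * qc w" for q w by (simp add: P_def quat_eq_iff algebra_simps)
  have P_qc: "P (qc w) = 0" for w by (simp add: P_def quat_eq_iff i_mult_i)
  have P_add: "P (p + q) = P p + P q" for p q by (simp add: P_def algebra_simps)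
  have P_sum: "P (\<Sum>s\<in>A. f s) = (\<Sum>s\<in>A. P (f s))" for f :: "nat \<Rightarrow> quat" and A
    by (simp add: P_def sum.distrib sum_distrib_left sum_distrib_right)
  have const: "\<exists>w. \<forall>z\<in>Omega W. g k z = w" for k
  proof (induction k rule: less_induct)
    case (less k)
    then obtain d where d: "\<And>s z. s < k \<Longrightarrow> z \<in> Omega W \<Longrightarrow> g s z = d s" by metis
    let ?f = "\<lambda>z. a' k z - (\<Sum>s<k. a (k - s) z * qc (d s))"
    have gk: "qc (g k z) = ?f z" if z: "z \<in> Omega W" for z
    proof -
      have a0: "a 0 z = 1" using alpha_nonneg[OF W Om(1)[OF z], of 0 0] by (simp add: a_def)
      have "{..k} = insert k {..<k}" by auto
      then show ?thesis using ga[OF z, of k] d[OF _ z] a0 by simp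
    qed
    have fder: "((\<lambda>h. ?f (z + of_real h * \<theta>)) has_vector_derivative (D W' k z \<theta> - (\<Sum>s<k. D W (k - s) z \<theta> * qc (d s)))) (at 0)"
      if "z \<in> Omega W" "cmod \<theta> \<le> 1" for z \<theta> unfolding a_def a'_def
      by (intro has_vector_derivative_diff has_vector_derivative_sum der W W' Om that
          bounded_linear.has_vector_derivative[OF bounded_linear_mult_left])
    have gder: "((\<lambda>h. qc (g k (z + of_real h * \<theta>))) has_vector_derivative (D W' k z \<theta> - (\<Sum>s<k. D W (k - s) z \<theta> * qc (d s)))) (at 0)"
      if z: "z \<in> Omega W" and \<theta>: "cmod \<theta> \<le> 1" for z \<theta>
    proof -
      obtain e where e: "e > 0" "ball z e \<subseteq> Omega W" using Omega_open[OF W] z by (auto simp: open_contains_ball)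
      show ?thesis
      proof (rule has_vector_derivative_transform_within_open[OF fder[OF z \<theta>], of "ball 0 e"])
        fix h assume "h \<in> ball (0::real) e"
        then have "\<bar>h\<bar> * cmod \<theta> < e" using mult_left_mono[OF \<theta>, of "\<bar>h\<bar>"] by simp
        then have "z + of_real h * \<theta> \<in> Omega W" using e(2) by (auto simp: subset_iff dist_norm norm_mult)
        then show "?f (z + of_real h * \<theta>) = qc (g k (z + of_real h * \<theta>))" by (rule gk[symmetric])
      qed (use e in auto)
    qed
    have y0: "D W' k z \<i> - (\<Sum>s<k. D W (k - s) z \<i> * qc (d s)) = 0" if "z \<in> Omega W" for z
      using vector_derivative_unique_at[OF gder[OF that] gy[OF that]] by simp
    have x0: "D W' k z 1 - (\<Sum>s<k. D W (k - s) z 1 * qc (d s)) = 0" if z: "z \<in> Omega W" for z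
    proof -
      have a0: "a 0 z = 1" using alpha_nonneg[OF W Om(1)[OF z], of 0 0] by (simp add: a_def)
      have m1: "alpha X 0 (- int k - 1) (pt z) = alpha X 0 (- int (Suc k)) (pt z)" for X k
        by (rule arg_cong[where f = "\<lambda>m. alpha X 0 m (pt z)"]) simp
      have "{..Suc 0} = {0, Suc 0}" by auto
      then have "P (a' 1 z) = P (a 1 z)" using ga[OF z, of 1] a0 g0[OF z] by (simp add: P_add P_qc One_nat_def)
      then have b: "P (alpha W' 0 (-1) (pt z)) = P (alpha W 0 (-1) (pt z))" by (simp add: a_def a'_def)
      let ?b = "P (alpha W 0 (-1) (pt z))"
      have "{..Suc k} = insert (Suc k) (insert k {..<k})" by auto
      then have "P (a' (Suc k) z) = (\<Sum>s<k. P (a (Suc k - s) z) * qc (d s)) + P (a 1 z) * qc (g k z)"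
        using ga[OF z, of "Suc k"] d[OF _ z] a0 by (simp add: P_add P_qc P_sum P_mult One_nat_def Suc_diff_le algebra_simps)
      moreover have "P (a 1 z) = ?b" by (simp add: a_def)
      moreover have "a' k z = qc (g k z) + (\<Sum>s<k. a (k - s) z * qc (d s))" using gk[OF z] by simp
      ultimately have "?b * a' k z - P (a' (Suc k) z) = (\<Sum>s<k. (?b * a (k - s) z - P (a (Suc k - s) z)) * qc (d s))"
        by (simp add: algebra_simps sum_distrib_left sum_subtractf)
      moreover have "Suc k - s = Suc (k - s)" if "s < k" for s using that by simp
      ultimately have "D W' k z 1 + quat_i * D W' k z \<i> = (\<Sum>s<k. (D W (k - s) z 1 + quat_i * D W (k - s) z \<i>) * qc (d s))"
        unfolding dirac b m1 a_def a'_def by simp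
      then have "(D W' k z 1 - (\<Sum>s<k. D W (k - s) z 1 * qc (d s))) + quat_i * (D W' k z \<i> - (\<Sum>s<k. D W (k - s) z \<i> * qc (d s))) = 0"
        by (simp add: algebra_simps sum.distrib sum_distrib_left)
      then show ?thesis unfolding y0[OF z] by simp
    qed
    have "qc (g k z) = qc (g k z')" if "z \<in> Omega W" "z' \<in> Omega W" for z z'
      by (rule connected_constant_directional[OF Omega_open[OF W] Omega_connected[OF W] _ _ that])
         (use gder[of _ 1] gder[of _ \<i>] x0 y0 in auto)
    then show ?case using Omega_nonempty[OF W] by (metis qc_inject)
  qed
  then obtain d where d: "\<And>k z. z \<in> Omega W \<Longrightarrow> g k z = d k" by metis
  have "d 0 = 1" using d g0 Omega_nonempty[OF W] by (metis all_not_in_conv)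
  then show ?thesis using ga d unfolding a_def a'_def by auto
qed

text \<open>With \<open>C = \<Sum>s. c\<^sub>s \<zeta>\<^sup>-\<^sup>s\<close> the equations say \<open>w\<^sub>k C = \<Sum>s\<le>k. c\<^sub>s w'\<^bsub>k-s\<^esub>\<close> for the normalised elements
  \<open>w\<^sub>k\<close>, \<open>w'\<^sub>k\<close> of the two spaces; the sum on the left is effectively finite.\<close>

lemma plane_convolution:
  assumes W: "W \<in> Gr_H" and W': "W' \<in> Gr_H" and Om: "Omega W = Omega W'" and d0: "d 0 = 1"
    and base: "\<And>z k. z \<in> Omega W \<Longrightarrow> alpha W' 0 (- int k) (pt z) = (\<Sum>s\<le>k. alpha W 0 (- int (k - s)) (pt z) * qc (d s))"
    and N: "int k - m < int N"
  shows "(\<Sum>s<N. alpha W k (m + int s) (pt z) * qc (d s)) = (\<Sum>s\<le>k. qc (d s) * alpha W' (k - s) m (pt z))"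
proof -
  have off: "alpha W k m (pt z) = 0" "alpha W' k m (pt z) = 0" if "z \<notin> Omega W" for k m z
    using that Om Omega_iff[OF W, of z] Omega_iff[OF W', of z] by simp_all
  have base0: "(\<Sum>s<N. alpha W 0 (m + int s) (pt z) * qc (d s)) = alpha W' 0 m (pt z)" if N: "- m < int N" for m N z
  proof (cases "z \<in> Omega W")
    case True
    then have z: "pt z \<in> baker_dom W" "pt z \<in> baker_dom W'" using Om by (simp_all add: Omega_iff[OF W] Omega_iff[OF W'])
    show ?thesis
    proof (cases "m \<le> 0")
      case le: True
      define k where "k = nat (- m)"
      have m: "m = - int k" using le by (simp add: k_def)
      have "(\<Sum>s<N. alpha W 0 (m + int s) (pt z) * qc (d s)) = (\<Sum>s\<le>k. alpha W 0 (m + int s) (pt z) * qc (d s))"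
        by (rule sum.mono_neutral_right) (use N m alpha_nonneg[OF W z(1)] in auto)
      also have "\<dots> = (\<Sum>s\<le>k. alpha W 0 (- int (k - s)) (pt z) * qc (d s))"
        by (rule sum.cong[OF refl]) (simp add: m of_nat_diff algebra_simps)
      finally show ?thesis using base[OF True, of k] by (simp add: m)
    next
      case False
      then show ?thesis using alpha_nonneg[OF W z(1), of _ 0] alpha_nonneg[OF W' z(2), of m 0] by simp
    qed
  qed (simp add: off)
  show ?thesis using N
  proof (induction k arbitrary: m N z)
    case 0
    then show ?case using base0[of m N z] d0 by simp
  next
    case (Suc k)
    let ?A = "\<lambda>k m z. alpha W k m (pt z)" and ?B = "\<lambda>k m z. alpha W' k m (pt z)"
    show ?case
    proof (cases "z \<in> Omega W")
      case False
      then show ?thesis by (simp add: off)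
    next
      case True
      then have z: "pt z \<in> baker_dom W" "pt z \<in> baker_dom W'" using Om by (simp_all add: Omega_iff[OF W] Omega_iff[OF W'])
      have ci: "qc w * quat_i = quat_i * qc w" for w by (simp add: qc_i[symmetric] qc_mult[symmetric] mult.commute)
      have IH0: "(\<Sum>s<N. ?A 0 (m + int s) z * qc (d s)) = ?B 0 m z" by (rule base0) (use Suc.prems in simp)
      have IH1: "(\<Sum>s<N. ?A k (m - 1 + int s) z * qc (d s)) = (\<Sum>s\<le>k. qc (d s) * ?B (k - s) (m - 1) z)"
        using Suc.IH[of "m - 1" N z] Suc.prems by simp
      \<comment> \<open>The identity for \<open>k\<close> at exponent -1. Among the non-negative
        exponents only \<open>k\<close> contributes, which brings in \<open>d (Suc k)\<close>, the
        new term of the sum for \<open>Suc k\<close>.\<close>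
      have e1: "?A k (-1) z + qc (d (Suc k)) = (\<Sum>s\<le>k. qc (d s) * ?B (k - s) (-1) z)"
      proof -
        have "(\<Sum>s<Suc (Suc k). ?A k (-1 + int s) z * qc (d s)) = (\<Sum>s\<in>{0, Suc k}. ?A k (-1 + int s) z * qc (d s))"
          by (rule sum.mono_neutral_right) (use alpha_nonneg[OF W z(1)] in auto)
        also have "\<dots> = ?A k (-1) z + qc (d (Suc k))" using alpha_nonneg[OF W z(1), of "int k" k] d0 by simp
        finally show ?thesis using Suc.IH[of "-1" "Suc (Suc k)" z] by simp
      qed
      let ?dA = "\<lambda>k m. quat_i * ?A (Suc k) m z + ?A k (-1) z * quat_i * ?A 0 m z - ?A k (m - 1) z * quat_i"
      let ?dB = "\<lambda>k m. quat_i * ?B (Suc k) m z + ?B k (-1) z * quat_i * ?B 0 m z - ?B k (m - 1) z * quat_i"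
      have dA: "((\<lambda>h. \<Sum>s<N. alpha W k (m + int s) (ysh (pt z) h) * qc (d s)) has_vector_derivative (\<Sum>s<N. ?dA k (m + int s) * qc (d s))) (at 0)"
        by (intro has_vector_derivative_sum bounded_linear.has_vector_derivative[OF bounded_linear_mult_left] alpha_ysh[OF W z(1)])
      have dB: "((\<lambda>h. \<Sum>s\<le>k. qc (d s) * alpha W' (k - s) m (ysh (pt z) h)) has_vector_derivative (\<Sum>s\<le>k. qc (d s) * ?dB (k - s) m)) (at 0)"
        by (intro has_vector_derivative_sum bounded_linear.has_vector_derivative[OF bounded_linear_mult_right] alpha_ysh[OF W' z(2)])
      have same: "(\<lambda>h. \<Sum>s<N. alpha W k (m + int s) (ysh (pt z) h) * qc (d s)) = (\<lambda>h. \<Sum>s\<le>k. qc (d s) * alpha W' (k - s) m (ysh (pt z) h))"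
        unfolding ysh_pt using Suc.IH Suc.prems by (intro ext) simp
      \<comment> \<open>Differentiates the identity for \<open>k\<close> along \<open>y\<close>. The
        terms covered by \<open>IH0\<close>, \<open>IH1\<close> and \<open>e1\<close> cancel, and
        those with \<open>quat_i\<close> on the left form the identity for
        \<open>Suc k\<close>.\<close>
      have eq: "(\<Sum>s<N. ?dA k (m + int s) * qc (d s)) = (\<Sum>s\<le>k. qc (d s) * ?dB (k - s) m)"
        by (rule vector_derivative_unique_at[OF dA[unfolded same] dB])
      have "(\<Sum>s<N. ?dA k (m + int s) * qc (d s)) = quat_i * (\<Sum>s<N. ?A (Suc k) (m + int s) z * qc (d s))
          + ?A k (-1) z * quat_i * (\<Sum>s<N. ?A 0 (m + int s) z * qc (d s)) - (\<Sum>s<N. ?A k (m - 1 + int s) z * qc (d s)) * quat_i"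
        by (simp add: sum_distrib_left sum_distrib_right sum.distrib sum_subtractf algebra_simps ci)
      moreover have "(\<Sum>s\<le>k. qc (d s) * ?dB (k - s) m) = quat_i * (\<Sum>s\<le>k. qc (d s) * ?B (Suc (k - s)) m z)
          + (\<Sum>s\<le>k. qc (d s) * ?B (k - s) (-1) z) * quat_i * ?B 0 m z - (\<Sum>s\<le>k. qc (d s) * ?B (k - s) (m - 1) z) * quat_i"
      proof -
        have "qc w * (quat_i * q) = quat_i * (qc w * q)" for w q by (simp only: mult.assoc[symmetric] ci)
        then show ?thesis by (simp add: sum_distrib_left sum_distrib_right sum.distrib sum_subtractf algebra_simps)
      qed
      ultimately have "quat_i * (\<Sum>s<N. ?A (Suc k) (m + int s) z * qc (d s)) =
          quat_i * (\<Sum>s\<le>k. qc (d s) * ?B (Suc (k - s)) m z) + qc (d (Suc k)) * quat_i * ?B 0 m z"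
        using eq unfolding IH0 IH1 e1[symmetric] by (simp add: algebra_simps)
      also have "\<dots> = quat_i * ((\<Sum>s\<le>k. qc (d s) * ?B (Suc k - s) m z) + qc (d (Suc k)) * ?B 0 m z)"
        unfolding ci by (simp add: Suc_diff_le algebra_simps)
      also have "\<dots> = quat_i * (\<Sum>s\<le>Suc k. qc (d s) * ?B (Suc k - s) m z)" by simp
      finally show ?thesis by (simp add: quat_eq_iff[of quat_i])
    qed
  qed
qed

section \<open>Transfer between the two spaces\<close>

text \<open>For large \<open>k\<close> the coefficients of \<open>w\<^sub>k \<zeta>\<^sup>-\<^sup>k - 1\<close>, weighted by powers of \<open>r > 1\<close>, have small sum.\<close>

lemma convolution_growth:
  fixes a b :: "nat \<Rightarrow> int \<Rightarrow> quat"
  assumes r: "r > 1" and bound: "\<And>k m. norm (a k m) \<le> B" "\<And>k m. norm (b k m) \<le> B"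
    and nonneg: "\<And>k m. m \<ge> 0 \<Longrightarrow> a k m = (if m = int k then 1 else 0)"
    and conv: "\<And>k m N. int k - m < int N \<Longrightarrow> (\<Sum>s<N. a k (m + int s) * qc (d s)) = (\<Sum>s\<le>k. qc (d s) * b (k - s) m)"
  shows "\<exists>M>0. \<forall>n. cmod (d n) \<le> M * r ^ n"
proof -
  have B: "B \<ge> 0" using norm_ge_zero bound(1) by (rule order_trans)
  \<comment> \<open>Makes \<open>B / ((r - 1) * r ^ k)\<close>, a bound for the weighted sum of the
    negative coefficients of \<open>w_k\<close>, less than one half.\<close>
  obtain k where k: "2 * B / (r - 1) < r ^ k" using real_arch_pow[OF r] by blast
  define M0 where "M0 = (\<Sum>s\<le>k. cmod (d s))"
  have M0: "M0 \<ge> 0" by (simp add: M0_def sum_nonneg)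
  define M where "M = 2 * (1 + B) * M0 + 1"
  have "B * M0 \<ge> 0" using M0 B by simp
  then have M: "M0 \<le> M" "B * M0 \<le> M / 2" "M > 0" using M0 by (simp_all add: M_def algebra_simps)
  have "cmod (d n) \<le> M * r ^ n" for n
  proof (induction n rule: less_induct)
    case (less n)
    have rn: "1 \<le> r ^ n" using r by simp
    show ?case
    proof (cases "n \<le> k")
      case True
      then have "cmod (d n) \<le> M0" unfolding M0_def by (intro member_le_sum) auto
      also have "M0 \<le> M * 1" using M by simp
      also have "\<dots> \<le> M * r ^ n" using rn M(3) by (intro mult_left_mono) auto
      finally show ?thesis .
    next
      case False
      \<comment> \<open>At exponent \<open>k - n\<close> the number \<open>d n\<close> appears with
        the coefficient 1 of \<open>w_k\<close> at \<open>k\<close>. The coefficients at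
        \<open>0, ..., k - 1\<close> vanish, so the other terms stop before
        \<open>s = n - k\<close>.\<close>
      have "(\<Sum>s<Suc n. a k (int k - int n + int s) * qc (d s)) = (\<Sum>s\<in>insert n {..<n - k}. a k (int k - int n + int s) * qc (d s))"
        by (rule sum.mono_neutral_right) (use nonneg False in auto)
      also have "\<dots> = qc (d n) + (\<Sum>s<n - k. a k (int k - int n + int s) * qc (d s))" using nonneg by simp
      finally have "qc (d n) = (\<Sum>s\<le>k. qc (d s) * b (k - s) (int k - int n)) - (\<Sum>s<n - k. a k (int k - int n + int s) * qc (d s))"
        using conv[of k "int k - int n" "Suc n"] by (simp add: eq_diff_eq)
      then have "cmod (d n) = norm ((\<Sum>s\<le>k. qc (d s) * b (k - s) (int k - int n)) - (\<Sum>s<n - k. a k (int k - int n + int s) * qc (d s)))"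
        by (metis norm_quat_of_complex)
      also have "\<dots> \<le> norm (\<Sum>s\<le>k. qc (d s) * b (k - s) (int k - int n)) + norm (\<Sum>s<n - k. a k (int k - int n + int s) * qc (d s))"
        by (rule norm_triangle_ineq4)
      also have "norm (\<Sum>s\<le>k. qc (d s) * b (k - s) (int k - int n)) \<le> (\<Sum>s\<le>k. B * cmod (d s))"
        by (rule sum_norm_le) (use mult_left_mono[OF bound(2)] in \<open>simp add: norm_mult mult.commute[of B]\<close>)
      also have "\<dots> = B * M0" by (simp add: M0_def sum_distrib_left)
      also have "norm (\<Sum>s<n - k. a k (int k - int n + int s) * qc (d s)) \<le> (\<Sum>s<n - k. B * (M * r ^ s))"
      proof (rule sum_norm_le)
        fix s assume "s \<in> {..<n - k}"
        then have "cmod (d s) \<le> M * r ^ s" by (intro less) auto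
        then show "norm (a k (int k - int n + int s) * qc (d s)) \<le> B * (M * r ^ s)"
          unfolding norm_mult using bound(1) B by (intro mult_mono) auto
      qed
      also have "\<dots> = B * M * ((r ^ (n - k) - 1) / (r - 1))"
        using r geometric_sum[of r "n - k"] by (simp add: sum_distrib_left[symmetric] mult.assoc)
      also have "\<dots> \<le> B * M * (r ^ (n - k) / (r - 1))"
        using r B M by (intro mult_left_mono divide_right_mono) auto
      also have "B * M0 + B * M * (r ^ (n - k) / (r - 1)) \<le> M / 2 + M / 2 * r ^ n"
      proof -
        have "B * M * (r ^ (n - k) / (r - 1)) = M / 2 * (2 * B / (r - 1) * r ^ (n - k))" by simp
        also have "\<dots> \<le> M / 2 * (r ^ k * r ^ (n - k))"
          using k M(3) r by (intro mult_left_mono mult_right_mono) auto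
        also have "r ^ k * r ^ (n - k) = r ^ n" using False by (simp add: power_add[symmetric])
        finally show ?thesis by (rule add_mono[OF M(2)])
      qed
      also have "\<dots> \<le> M * r ^ n"
      proof -
        have "M * 1 \<le> M * r ^ n" using rn M(3) by (intro mult_left_mono) auto
        moreover have "M / 2 * r ^ n = M * r ^ n / 2" by simp
        ultimately show ?thesis by linarith
      qed
      finally show ?thesis by simp
    qed
  qed
  then show ?thesis using M(3) by blast
qed

text \<open>Half of the decay of the coefficients pays for the distance from \<open>P\<close> to
  \<open>m\<close>, the other half for summing the geometric series.\<close>

lemma fourier_rmult_tail:
  assumes g: "pser g a" and t: "0 < t" "t < 1" and a: "\<And>n. cmod (a n) \<le> A * t ^ (2 * n)"
    and f: "\<And>p. p \<ge> P \<Longrightarrow> fourier f p = 0"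
  shows "norm (fourier (rmult f g) m) \<le> norm f * A / (1 - t) * t ^ nat (m - P + 1)"
proof -
  let ?J = "nat (m - P + 1)"
  have A: "A \<ge> 0" using a[of 0] by (simp add: order_trans[OF norm_ge_zero])
  have "norm (fourier (rmult f g) m) \<le> norm f * A * t ^ ?J * (1 / (1 - t))"
  proof (rule norm_sums_le[OF fourier_rmult_pser[OF g]])
    show "(\<lambda>n. norm f * A * t ^ ?J * t ^ n) sums (norm f * A * t ^ ?J * (1 / (1 - t)))"
      using t by (intro sums_mult geometric_sums) auto
    fix n
    show "norm (fourier f (m - int n) * qc (a n)) \<le> norm f * A * t ^ ?J * t ^ n"
    proof (cases "n < ?J")
      case True
      then show ?thesis using f[of "m - int n"] A t by simp
    next
      case False
      have "norm (fourier f (m - int n) * qc (a n)) \<le> norm f * (A * t ^ (2 * n))"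
        unfolding norm_mult norm_quat_of_complex by (intro mult_mono norm_fourier_le a) auto
      also have "t ^ (2 * n) = t ^ n * t ^ n" by (simp add: mult_2 power_add)
      also have "norm f * (A * (t ^ n * t ^ n)) \<le> norm f * (A * (t ^ ?J * t ^ n))"
        using False t A by (intro mult_left_mono mult_right_mono power_decreasing) auto
      finally show ?thesis by (simp add: mult.assoc)
    qed
  qed
  then show ?thesis by (simp add: mult_ac)
qed

definition Cpoly :: "(nat \<Rightarrow> complex) \<Rightarrow> nat \<Rightarrow> complex \<Rightarrow> complex" where
  "Cpoly d S x = (\<Sum>s\<le>S. d s * x powi (- int s))"

lemma Cpoly_continuous: "continuous_on (sphere 0 1) (Cpoly d S)"
  unfolding Cpoly_def[abs_def] by (intro continuous_intros)

lemma fourier_rmult_Cpoly: "fourier (rmult f (Cpoly d S)) m = (\<Sum>s\<le>S. fourier f (m + int s) * qc (d s))"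
proof (induction S)
  case 0
  have "Cpoly d 0 = (\<lambda>x. d 0 * x powi (- int 0))" by (auto simp: Cpoly_def)
  then show ?case using fourier_rmult_powi[of f "d 0" "- int 0" m] by simp
next
  case (Suc S)
  have "Cpoly d (Suc S) = (\<lambda>x. Cpoly d S x + d (Suc S) * x powi (- int (Suc S)))" by (auto simp: Cpoly_def)
  moreover have "continuous_on (sphere 0 1) (\<lambda>x. d (Suc S) * x powi (- int (Suc S)))" by (intro continuous_intros)
  moreover have "fourier (rmult f (\<lambda>x. d (Suc S) * x powi (- int (Suc S)))) m = fourier f (m + int (Suc S)) * qc (d (Suc S))"
    using fourier_rmult_powi[of f "d (Suc S)" "- int (Suc S)" m] by (simp add: algebra_simps)
  ultimately show ?case using rmult_add_right[OF Cpoly_continuous] Suc by (simp only: fourier_add sum.atMost_Suc)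
qed

lemma sum_powers_le:
  assumes t: "0 < t" "t < (1::real)" and d: "\<And>n. cmod (d n) \<le> M * (1 / t) ^ n"
  shows "(\<Sum>s\<le>S. cmod (d s)) \<le> M / (1 - t) * (1 / t) ^ S"
proof -
  have M: "M \<ge> 0" using d[of 0] by (simp add: order_trans[OF norm_ge_zero])
  have "(\<Sum>s\<le>S. (1 / t) ^ s) = ((1 / t) ^ Suc S - 1) / (1 / t - 1)"
    using t geometric_sum[of "1 / t" "Suc S"] by (simp add: lessThan_Suc_atMost)
  also have "\<dots> \<le> (1 / t) ^ Suc S / (1 / t - 1)" using t by (intro divide_right_mono) auto
  also have "\<dots> = 1 / (1 - t) * (1 / t) ^ S" using t by (simp add: field_simps)
  finally have "M * (\<Sum>s\<le>S. (1 / t) ^ s) \<le> M * (1 / (1 - t) * (1 / t) ^ S)" using M by (rule mult_left_mono)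
  moreover have "(\<Sum>s\<le>S. cmod (d s)) \<le> M * (\<Sum>s\<le>S. (1 / t) ^ s)" unfolding sum_distrib_left by (rule sum_mono) (rule d)
  ultimately show ?thesis by simp
qed

text \<open>Stated for every \<open>t\<close> from \<open>t0\<close> up to 1, so that one
  \<open>t\<close> serves both \<open>c\<close> and its negative.\<close>

lemma gam_series_power:
  assumes "c \<in> valid_times"
  shows "\<exists>a A t0. 0 < t0 \<and> t0 < 1 \<and> pser (gam c) a \<and> (\<forall>t\<ge>t0. t < 1 \<longrightarrow> (\<forall>n. cmod (a n) \<le> A * (t ^ 4) ^ (2 * n)))"
proof -
  obtain a s C where s: "s > 1" and C: "\<And>n. cmod (a n) * s ^ n \<le> C" and a: "pser (gam c) a" using gam_series[OF assms] by blast
  \<comment> \<open>The eighth root provides for the exponent \<open>8 n\<close>: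
    \<open>fourier_rmult_tail\<close> halves it, and \<open>transfer\<close> then plays four powers
    of \<open>t\<close> against the growth of the \<open>d s\<close>.\<close>
  define t0 where "t0 = root 8 (1 / s)"
  have t0: "0 < t0" "t0 < 1" "t0 ^ 8 = 1 / s" using s by (auto simp: t0_def)
  have C0: "C \<ge> 0" using C[of 0] by (simp add: order_trans[OF norm_ge_zero])
  have "cmod (a n) \<le> C * (t ^ 4) ^ (2 * n)" if "t \<ge> t0" for t n
  proof -
    have "cmod (a n) \<le> C * (1 / s) ^ n" using C[of n] s by (simp add: field_simps)
    also have "\<dots> = C * t0 ^ (8 * n)" by (simp add: t0(3)[symmetric] power_mult)
    also have "\<dots> \<le> C * t ^ (8 * n)" using that t0 C0 by (intro mult_left_mono power_mono) auto
    also have "t ^ (8 * n) = (t ^ 4) ^ (2 * n)" by (simp add: power_mult[symmetric])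
    finally show ?thesis .
  qed
  then show ?thesis using t0 a by blast
qed

lemma bounded_linear_series:
  fixes T :: "'a::banach \<Rightarrow> 'b::banach"
  assumes "bounded_linear T" "summable (\<lambda>n. norm (f n))"
  shows "(\<lambda>n. T (f n)) sums T (\<Sum>n. f n)"
  using bounded_linear.sums[OF assms(1) summable_sums[OF summable_norm_cancel[OF assms(2)]]] .

lemma closed_subspace_suminf:
  fixes f :: "nat \<Rightarrow> 'a::real_normed_vector"
  assumes "subspace X" "closed X" "\<And>n. f n \<in> X" "summable f"
  shows "suminf f \<in> X"
  by (rule closed_sequentially[OF assms(2) _ summable_LIMSEQ[OF assms(4)]]) (intro subspace_sum assms)

text \<open>\<open>C\<close> need not converge on the circle, but its truncations do, and after division by \<open>gam c\<close> the error
  of the truncation at \<open>S\<close> is of order \<open>t ^ S\<close>.\<close>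

lemma transfer:
  fixes d :: "nat \<Rightarrow> complex"
  assumes V: "bigcell V" and V': "bigcell V'" and c: "c \<in> valid_times"
    and conv: "\<And>k m N. int k - m < int N \<Longrightarrow>
      (\<Sum>s<N. fourier (bel V k) (m + int s) * qc (d s)) = (\<Sum>s\<le>k. qc (d s) * fourier (bel V' (k - s)) m)"
    and h: "h \<in> W_gam V c" "\<And>m. m > 0 \<Longrightarrow> fourier h m = 0"
  shows "\<exists>h'\<in>W_gam V' c. \<forall>m S. - m \<le> int S \<longrightarrow> fourier h' m = (\<Sum>s\<le>S. fourier h (m + int s) * qc (d s))"
proof -
  have VG: "V \<in> Gr_H" "V' \<in> Gr_H" using V V' by (simp_all add: bigcell_def)
  note gV = Gr_H_D[OF VG(1)] and gV' = Gr_H_D[OF VG(2)]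
  let ?c' = "\<lambda>k. - c k"
  obtain a A t1 where a: "0 < t1" "t1 < 1" "pser (gam c) a" "\<And>t n. t \<ge> t1 \<Longrightarrow> t < 1 \<Longrightarrow> cmod (a n) \<le> A * (t ^ 4) ^ (2 * n)"
    using gam_series_power[OF c] by blast
  obtain a' A' t2 where a': "0 < t2" "t2 < 1" "pser (gam ?c') a'" "\<And>t n. t \<ge> t2 \<Longrightarrow> t < 1 \<Longrightarrow> cmod (a' n) \<le> A' * (t ^ 4) ^ (2 * n)"
    using gam_series_power[OF valid_times_uminus[OF c]] by blast
  define t where "t = max t1 t2"
  have t: "0 < t" "t < 1" "t \<ge> t1" "t \<ge> t2" using a(1,2) a'(1,2) by (auto simp: t_def)
  have t4: "0 < t ^ 4" "t ^ 4 < 1" using t by (simp_all add: power_less_one_iff)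
  note tail = fourier_rmult_tail[OF a(3) t4 a(4)[OF t(3,2)]] and tail' = fourier_rmult_tail[OF a'(3) t4 a'(4)[OF t(4,2)]]
  have A0: "A' \<ge> 0" using a'(4)[OF t(4,2), of 0] by (simp add: order_trans[OF norm_ge_zero])
  obtain B1 B2 where "\<And>k. norm (bel V k) \<le> B1" "\<And>k. norm (bel V' k) \<le> B2"
    using bel_bounded[OF V] bel_bounded[OF V'] by blast
  then have B: "norm (bel V k) \<le> max B1 B2" "norm (bel V' k) \<le> max B1 B2" for k by (meson le_max_iff_disj)+
  define B where "B = max B1 B2"
  note B = B[folded B_def]
  have B0: "B \<ge> 0" using norm_ge_zero B(1) by (rule order_trans)
  have "1 / t > 1" using t by simp
  then obtain M where M: "M > 0" "\<And>n. cmod (d n) \<le> M * (1 / t) ^ n"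
    using convolution_growth[OF _ order_trans[OF norm_fourier_le B(1)] order_trans[OF norm_fourier_le B(2)] bel_nonneg[OF V] conv] by blast
  note dsum = sum_powers_le[OF t(1,2) M(2)]
  define E where "E = B * (M / (1 - t))"
  have E0: "E \<ge> 0" using B0 M t by (simp add: E_def)
  \<comment> \<open>The element of \<open>V'\<close> that \<open>w_n C\<close> would be: by
    \<open>conv\<close> it agrees with \<open>w_n\<close> times the truncation
    \<open>Cpoly d S\<close> at all exponents from \<open>n - S\<close> upwards.\<close>
  define u where "u = (\<lambda>n. \<Sum>l\<le>n. lmult (qc (d l)) (bel V' (n - l)))"
  have uV: "u n \<in> V'" for n unfolding u_def by (intro subspace_sum csubspace_imp_subspace gV' bel(1)[OF V'])
  have un: "norm (u n) \<le> E * (1 / t) ^ n" for n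
  proof -
    have "norm (u n) \<le> (\<Sum>l\<le>n. B * cmod (d l))"
      unfolding u_def by (rule sum_norm_le) (use mult_left_mono[OF B(2)] in \<open>simp add: mult.commute[of B]\<close>)
    also have "\<dots> = B * (\<Sum>l\<le>n. cmod (d l))" by (simp add: sum_distrib_left)
    also have "\<dots> \<le> B * (M / (1 - t) * (1 / t) ^ n)" by (intro mult_left_mono dsum B0)
    finally show ?thesis by (simp add: E_def)
  qed
  have Cn: "norm (rmult (bel V n) (Cpoly d S)) \<le> E * (1 / t) ^ S" for n S
  proof -
    have "norm (rmult (bel V n) (Cpoly d S)) \<le> (M / (1 - t) * (1 / t) ^ S) * norm (bel V n)"
    proof (rule norm_rmult_le[OF Cpoly_continuous])
      fix x :: complex assume "cmod x = 1"
      then have "cmod (Cpoly d S x) \<le> (\<Sum>s\<le>S. cmod (d s))"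
        unfolding Cpoly_def by (intro sum_norm_le) (simp add: norm_mult norm_power_int)
      then show "cmod (Cpoly d S x) \<le> M / (1 - t) * (1 / t) ^ S" using dsum by (rule order_trans)
    qed
    also have "\<dots> \<le> (M / (1 - t) * (1 / t) ^ S) * B" using M t by (intro mult_left_mono B) auto
    finally show ?thesis by (simp add: E_def mult_ac)
  qed
  define f where "f = rmult h (gam c)"
  have fV: "f \<in> V" using h(1) by (simp add: f_def W_gam_def)
  \<comment> \<open>The coefficients of \<open>f\<close> in its expansion in the \<open>w_n\<close>.
    Since \<open>h\<close> has no positive exponents, they inherit the decay of
    \<open>gam c\<close>, which outweighs the growth of \<open>u\<close>.\<close>
  define x where "x = (\<lambda>n. fourier f (int n))"
  define X where "X = norm h * A / (1 - t ^ 4)"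
  have xn: "norm (x n) \<le> X * t ^ (4 * n)" for n
    using tail[of 1 h "int n"] h(2) by (simp add: x_def f_def X_def power_mult)
  have X0: "X \<ge> 0" using xn[of 0] by (simp add: order_trans[OF norm_ge_zero])
  have sw: "summable (\<lambda>n. norm (lmult (x n) (bel V n)))"
  proof (rule summable_comparison_test')
    show "summable (\<lambda>n. X * B * (t ^ 4) ^ n)" using t4 by (intro summable_mult summable_geometric) auto
    show "norm (norm (lmult (x n) (bel V n))) \<le> X * B * (t ^ 4) ^ n" for n
      using mult_mono[OF xn[of n] B(1)[of n]] X0 t by (simp add: power_mult[symmetric] mult_ac)
  qed
  have su: "summable (\<lambda>n. norm (lmult (x n) (u n)))"
  proof (rule summable_comparison_test')
    show "summable (\<lambda>n. X * E * t ^ n)" using t by (intro summable_mult summable_geometric) auto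
    fix n
    have "norm (x n) * norm (u n) \<le> (X * t ^ (4 * n)) * (E * (1 / t) ^ n)"
      using X0 t by (intro mult_mono xn un) auto
    also have "\<dots> = X * E * t ^ (3 * n)"
    proof -
      have "4 * n = 3 * n + n" by simp
      then have "t ^ (4 * n) * (1 / t) ^ n = t ^ (3 * n)" using t by (simp only: power_add) (simp add: power_divide)
      then show ?thesis by (simp add: mult_ac)
    qed
    also have "\<dots> \<le> X * E * t ^ n" using t X0 E0 by (intro mult_left_mono power_decreasing) auto
    finally show "norm (norm (lmult (x n) (u n))) \<le> X * E * t ^ n" by simp
  qed
  have f_eq: "f = (\<Sum>n. lmult (x n) (bel V n))"
  proof (rule bigcell_eqI[OF V fV])
    show "(\<Sum>n. lmult (x n) (bel V n)) \<in> V"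
      by (rule closed_subspace_suminf[OF csubspace_imp_subspace[OF gV(1)] gV(2) gV(3)[OF bel(1)[OF V]] summable_norm_cancel[OF sw]])
    show "proj {0..} f = proj {0..} (\<Sum>n. lmult (x n) (bel V n))"
    proof (rule L2H_eqI)
      fix m
      have "fourier (\<Sum>n. lmult (x n) (bel V n)) m = fourier f m" if "m \<ge> 0"
      proof -
        have "(\<lambda>n. fourier (lmult (x n) (bel V n)) m) sums fourier (\<Sum>n. lmult (x n) (bel V n)) m"
          by (rule bounded_linear_series[OF bounded_linear_fourier sw])
        moreover have "(\<lambda>n. fourier (lmult (x n) (bel V n)) m) = (\<lambda>n. if n = nat m then x n else 0)"
          using that by (auto simp: bel_nonneg[OF V])
        ultimately have "(\<lambda>n. if n = nat m then x n else 0) sums fourier (\<Sum>n. lmult (x n) (bel V n)) m" by simp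
        then show ?thesis using sums_unique2[OF _ sums_single[of "nat m" x]] that by (simp add: x_def)
      qed
      then show "fourier (proj {0..} f) m = fourier (proj {0..} (\<Sum>n. lmult (x n) (bel V n))) m" by simp
    qed
  qed
  define G where "G = (\<Sum>n. lmult (x n) (u n))"
  have GV: "G \<in> V'"
    unfolding G_def by (rule closed_subspace_suminf[OF csubspace_imp_subspace[OF gV'(1)] gV'(2) gV'(3)[OF uV] summable_norm_cancel[OF su]])
  have cc: "continuous_on (sphere 0 1) (gam c)" "continuous_on (sphere 0 1) (gam ?c')"
    using gam_continuous c valid_times_uminus by auto
  have pu: "punit (gam c) (gam ?c')" by (rule punit_gam[OF c])
  let ?\<phi> = "\<lambda>m f. fourier (rmult f (gam ?c')) m"
  have bl\<phi>: "bounded_linear (?\<phi> m)" for m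
    by (rule bounded_linear_compose[OF bounded_linear_fourier bounded_linear_rmult[OF cc(2)]])
  have \<phi>C: "?\<phi> m (rmult f (Cpoly d S)) = (\<Sum>s\<le>S. fourier h (m + int s) * qc (d s))" for m S
  proof -
    have "rmult (rmult f (Cpoly d S)) (gam ?c') = rmult (rmult f (gam ?c')) (Cpoly d S)"
      by (simp add: rmult_rmult cc Cpoly_continuous mult.commute)
    also have "rmult f (gam ?c') = h" unfolding f_def by (rule punit_cancel[OF pu])
    finally show ?thesis by (simp add: fourier_rmult_Cpoly)
  qed
  define K where "K = X * (2 * E) * A' / (1 - t ^ 4)"
  \<comment> \<open>Each summand of the error has exponents below \<open>n - S\<close> only. After
    division by \<open>gam c\<close> its coefficient at \<open>m\<close> carries a high power of
    \<open>t\<close>, which beats the growth \<open>(1 / t) ^ max n S\<close>.\<close>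
  have diff: "norm (?\<phi> m G - ?\<phi> m (rmult f (Cpoly d S))) \<le> K * (1 / t) ^ (4 * nat \<bar>m\<bar>) * t ^ S * (1 / (1 - t))" for m S
  proof (rule norm_sums_le)
    let ?e = "\<lambda>n. u n - rmult (bel V n) (Cpoly d S)"
    have "(\<lambda>n. ?\<phi> m (lmult (x n) (u n)) - ?\<phi> m (rmult (lmult (x n) (bel V n)) (Cpoly d S))) sums (?\<phi> m G - ?\<phi> m (rmult f (Cpoly d S)))"
      unfolding G_def f_eq by (intro sums_diff bounded_linear_series[OF bl\<phi> su]
          bounded_linear_series[OF bounded_linear_compose[OF bl\<phi> bounded_linear_rmult[OF Cpoly_continuous]] sw])
    moreover have "?\<phi> m (lmult (x n) (u n)) - ?\<phi> m (rmult (lmult (x n) (bel V n)) (Cpoly d S)) = x n * ?\<phi> m (?e n)" for n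
      by (simp add: rmult_lmult rmult_diff right_diff_distrib)
    ultimately show "(\<lambda>n. x n * ?\<phi> m (?e n)) sums (?\<phi> m G - ?\<phi> m (rmult f (Cpoly d S)))" by simp
    show "(\<lambda>n. K * (1 / t) ^ (4 * nat \<bar>m\<bar>) * t ^ S * t ^ n) sums (K * (1 / t) ^ (4 * nat \<bar>m\<bar>) * t ^ S * (1 / (1 - t)))"
      using t by (intro sums_mult geometric_sums) auto
    fix n
    let ?J = "nat (m - (int n - int S) + 1)"
    have "fourier (?e n) p = 0" if "p \<ge> int n - int S" for p
      using conv[of n p "Suc S"] that by (simp add: u_def fourier_rmult_Cpoly lessThan_Suc_atMost)
    then have "norm (?\<phi> m (?e n)) \<le> norm (?e n) * A' / (1 - t ^ 4) * (t ^ 4) ^ ?J" by (rule tail')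
    also have "\<dots> \<le> (E * (1 / t) ^ n + E * (1 / t) ^ S) * A' / (1 - t ^ 4) * (t ^ 4) ^ ?J"
      using A0 t4 order_trans[OF norm_triangle_ineq4 add_mono[OF un Cn]] t
      by (intro mult_right_mono divide_right_mono) auto
    also have "\<dots> \<le> (2 * E * (1 / t) ^ max n S) * A' / (1 - t ^ 4) * (t ^ 4) ^ ?J"
    proof -
      have "(1 / t) ^ n \<le> (1 / t) ^ max n S" "(1 / t) ^ S \<le> (1 / t) ^ max n S"
        using t by (auto intro!: power_increasing)
      then have "E * (1 / t) ^ n + E * (1 / t) ^ S \<le> 2 * E * (1 / t) ^ max n S"
        using mult_left_mono[OF _ E0] by (metis add_mono mult.assoc mult_2)
      then show ?thesis using A0 t4 t by (intro mult_right_mono divide_right_mono) auto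
    qed
    finally have p: "norm (?\<phi> m (?e n)) \<le> (2 * E * (1 / t) ^ max n S) * A' / (1 - t ^ 4) * (t ^ 4) ^ ?J" .
    have "norm (x n * ?\<phi> m (?e n)) \<le> (X * t ^ (4 * n)) * ((2 * E * (1 / t) ^ max n S) * A' / (1 - t ^ 4) * (t ^ 4) ^ ?J)"
      unfolding norm_mult using X0 t by (intro mult_mono xn p) auto
    also have "\<dots> = K * (t ^ (4 * n) * (1 / t) ^ max n S * t ^ (4 * ?J))" by (simp add: K_def power_mult)
    also have "\<dots> \<le> K * ((1 / t) ^ (4 * nat \<bar>m\<bar>) * t ^ (S + n))"
    proof (rule mult_left_mono)
      \<comment> \<open>The budget of exponents: \<open>max n S\<close> pays for the growth,
        \<open>S + n\<close> is what remains for summing over \<open>n\<close> and for the limit in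
        \<open>S\<close>.\<close>
      have "max n S + (S + n) \<le> 4 * n + 4 * ?J + 4 * nat \<bar>m\<bar>" by (cases "n \<le> S") (auto simp: max_def)
      then have "t ^ (4 * n + 4 * ?J + 4 * nat \<bar>m\<bar>) \<le> t ^ (max n S + (S + n))" using t by (intro power_decreasing) auto
      then show "t ^ (4 * n) * (1 / t) ^ max n S * t ^ (4 * ?J) \<le> (1 / t) ^ (4 * nat \<bar>m\<bar>) * t ^ (S + n)"
        using t by (simp add: power_add power_divide field_simps)
      show "K \<ge> 0" using X0 E0 A0 t4 by (simp add: K_def)
    qed
    finally show "norm (x n * ?\<phi> m (?e n)) \<le> K * (1 / t) ^ (4 * nat \<bar>m\<bar>) * t ^ S * t ^ n"
      by (simp add: power_add mult.assoc)
  qed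
  show ?thesis
  proof (intro bexI[of _ "rmult G (gam ?c')"] allI impI)
    show "rmult G (gam ?c') \<in> W_gam V' c" using GV punit_cancel[OF punit_sym[OF pu]] by (simp add: W_gam_def)
    fix m S assume S: "- m \<le> int S"
    \<comment> \<open>The coefficient at \<open>m\<close> is stationary from \<open>S\<close> on
      because \<open>h\<close> has no positive exponents, so letting \<open>S'\<close> grow removes
      the error altogether.\<close>
    have "?\<phi> m (rmult f (Cpoly d S')) = ?\<phi> m (rmult f (Cpoly d S))" if "S' \<ge> S" for S'
      unfolding \<phi>C by (rule sum.mono_neutral_right) (use S that h(2) in auto)
    then have "\<forall>\<^sub>F S' in sequentially. norm (?\<phi> m G - ?\<phi> m (rmult f (Cpoly d S))) \<le> K * (1 / t) ^ (4 * nat \<bar>m\<bar>) * t ^ S' * (1 / (1 - t))"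
      using diff by (intro eventually_sequentiallyI[of S]) metis
    moreover have "(\<lambda>S'. K * (1 / t) ^ (4 * nat \<bar>m\<bar>) * t ^ S' * (1 / (1 - t))) \<longlonglongrightarrow> K * (1 / t) ^ (4 * nat \<bar>m\<bar>) * 0 * (1 / (1 - t))"
      using t by (intro tendsto_intros LIMSEQ_power_zero) auto
    ultimately have "norm (?\<phi> m G - ?\<phi> m (rmult f (Cpoly d S))) \<le> K * (1 / t) ^ (4 * nat \<bar>m\<bar>) * 0 * (1 / (1 - t))"
      by (intro tendsto_lowerbound) auto
    then show "?\<phi> m G = (\<Sum>s\<le>S. fourier h (m + int s) * qc (d s))" by (simp add: \<phi>C)
  qed
qed

section \<open>An operator is determined by its restriction to the plane\<close>

text \<open>As \<open>d 0 = 1\<close>, passing from \<open>h\<close> to \<open>h'\<close> is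
  multiplication by a unipotent triangular matrix: it sends elements without non-negative part
  injectively to such elements, and it preserves the normalisation of \<open>w_0\<close>.\<close>

lemma bel_transfer:
  fixes d :: "nat \<Rightarrow> complex"
  assumes d0: "d 0 = 1" and V: "V' \<in> Gr_H"
    and tr: "\<And>h. h \<in> V \<Longrightarrow> (\<And>m. m > 0 \<Longrightarrow> fourier h m = 0) \<Longrightarrow>
      \<exists>h'\<in>V'. \<forall>m S. - m \<le> int S \<longrightarrow> fourier h' m = (\<Sum>s\<le>S. fourier h (m + int s) * qc (d s))"
    and b: "bigcell V'" and VG: "V \<in> Gr_H"
  shows "bigcell V" "fourier (bel V' 0) (- int k) = (\<Sum>s\<le>k. fourier (bel V 0) (- int (k - s)) * qc (d s))"
proof -
  show bV: "bigcell V"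
  proof (rule bigcellI[OF VG])
    fix h assume h: "h \<in> V" "h \<in> H_minus"
    then have pos: "fourier h m = 0" if "m \<ge> 0" for m using that by (simp add: H_minus_def)
    obtain h' where h': "h' \<in> V'" "\<And>m S. - m \<le> int S \<Longrightarrow> fourier h' m = (\<Sum>s\<le>S. fourier h (m + int s) * qc (d s))"
      using tr[OF h(1)] pos by (metis order_less_imp_le)
    have "h' \<in> H_minus" using h'(2) pos by (auto simp: H_minus_def)
    then have h0: "h' = 0" using h'(1) b by (auto simp: bigcell_def)
    have "fourier h (- int n) = 0" for n
    proof (induction n rule: less_induct)
      case (less n)
      have "0 = (\<Sum>s\<le>n. fourier h (- int n + int s) * qc (d s))" using h'(2)[of "- int n" n] h0 by simp
      also have "\<dots> = (\<Sum>s\<in>{0}. fourier h (- int n + int s) * qc (d s))"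
      proof (rule sum.mono_neutral_right)
        show "\<forall>s\<in>{..n} - {0}. fourier h (- int n + int s) * qc (d s) = 0"
        proof
          fix s assume s: "s \<in> {..n} - {0}"
          then have e: "- int n + int s = - int (n - s)" and "n - s < n" by auto
          then have "fourier h (- int n + int s) = 0" unfolding e by (intro less)
          then show "fourier h (- int n + int s) * qc (d s) = 0" by simp
        qed
      qed auto
      finally show ?case using d0 by simp
    qed
    then have "fourier h m = 0" for m using pos by (metis linear minus_minus neg_0_le_iff_le nonneg_int_cases)
    then show "h = 0" by (rule fourier_eq_0_imp)
  qed
  have bpos: "fourier (bel V 0) m = (if m = 0 then 1 else 0)" if "m \<ge> 0" for m using bel_nonneg[OF bV that, of 0] by simp
  obtain h' where h': "h' \<in> V'" "\<And>m S. - m \<le> int S \<Longrightarrow> fourier h' m = (\<Sum>s\<le>S. fourier (bel V 0) (m + int s) * qc (d s))"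
    using tr[OF bel(1)[OF bV], of 0] bpos by (metis less_irrefl order_less_imp_le)
  have "fourier h' m = (if m = 0 then 1 else 0)" if "m \<ge> 0" for m
    using h'(2)[of m 0] bpos[OF that] that d0 by simp
  then have "proj {0..} h' = zpow (int 0)" by (intro L2H_eqI) auto
  then have "h' = bel V' 0" by (rule bel_unique[OF b h'(1)])
  then have "fourier (bel V' 0) (- int k) = (\<Sum>s\<le>k. fourier (bel V 0) (- int k + int s) * qc (d s))" using h'(2)[of "- int k" k] by simp
  then show "fourier (bel V' 0) (- int k) = (\<Sum>s\<le>k. fourier (bel V 0) (- int (k - s)) * qc (d s))"
    by (simp add: of_nat_diff algebra_simps)
qed

lemma L_z_transfer:
  assumes W: "W \<in> Gr_H" and W': "W' \<in> Gr_H" and L: "L_z W = L_z W'"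
  shows "\<exists>d. \<forall>c\<in>baker_dom W'. c \<in> baker_dom W \<and>
    (\<forall>k. alpha W' 0 (- int k) c = (\<Sum>s\<le>k. alpha W 0 (- int (k - s)) c * qc (d s)))"
proof -
  obtain d where d: "d 0 = 1" "\<And>z k. z \<in> Omega W \<Longrightarrow> alpha W' 0 (- int k) (pt z) = (\<Sum>s\<le>k. alpha W 0 (- int (k - s)) (pt z) * qc (d s))"
    using plane_constants[OF assms] by blast
  note Om = L_z_eq_dom(2)[OF assms]
  obtain z0 where z0: "z0 \<in> Omega W" using Omega_nonempty[OF W] by blast
  have dom: "pt z0 \<in> baker_dom W" "pt z0 \<in> baker_dom W'" using z0 Om by (simp_all add: Omega_iff[OF W] Omega_iff[OF W'])
  have big: "bigcell (V_shift W z0)" "bigcell (V_shift W' z0)" using z0 Om by (auto simp: Omega_def)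
  have conv: "(\<Sum>s<N. fourier (bel (V_shift W z0) k) (m + int s) * qc (d s)) = (\<Sum>s\<le>k. qc (d s) * fourier (bel (V_shift W' z0) (k - s)) m)"
    if "int k - m < int N" for k m N
    using plane_convolution[OF W W' Om d that, of z0] dom by (simp add: alpha_def W_gam_pt)
  show ?thesis
  proof (intro exI[of _ d] ballI)
    fix c assume c: "c \<in> baker_dom W'"
    then have v: "c \<in> valid_times" by (rule baker_dom_valid)
    \<comment> \<open>\<open>transfer\<close> starts from spaces in the big cell, which
      \<open>W\<close> and \<open>W'\<close> need not be. Shifting both by \<open>z0\<close> and the
      parameter back by \<open>z0\<close> leaves the spaces at \<open>c\<close> unchanged.\<close>
    have gam: "W_gam (V_shift X z0) (translate (- z0) c) = W_gam X c" for X
      using W_gam_V_shift[of "translate (- z0) c" X z0] v by simp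
    have tr: "\<exists>h'\<in>W_gam W' c. \<forall>m S. - m \<le> int S \<longrightarrow> fourier h' m = (\<Sum>s\<le>S. fourier h (m + int s) * qc (d s))"
      if "h \<in> W_gam W c" "\<And>m. m > 0 \<Longrightarrow> fourier h m = 0" for h
      using transfer[OF big, of "translate (- z0) c" d h] conv v that unfolding gam by simp
    note t = bel_transfer[OF d(1) W_gam_Gr_H[OF W' v] tr baker_dom_bigcell[OF W' c] W_gam_Gr_H[OF W v]]
    have cW: "c \<in> baker_dom W" using t(1) v by (simp add: baker_dom_iff[OF W])
    then show "c \<in> baker_dom W \<and> (\<forall>k. alpha W' 0 (- int k) c = (\<Sum>s\<le>k. alpha W 0 (- int (k - s)) c * qc (d s)))"
      using t(2) c by (simp add: alpha_def)
  qed
qed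

text \<open>On the common domain \<open>K' = K C\<close> with \<open>C\<close> of constant complex
  coefficients. Then \<open>C\<close> commutes with \<open>i d/dy\<close> and cancels from the
  operator.\<close>

theorem L_z_determines_L_op:
  assumes W: "W \<in> Gr_H" and W': "W' \<in> Gr_H" and L: "L_z W = L_z W'"
  shows "L_op W = L_op W'"
proof -
  obtain d where d: "\<And>c. c \<in> baker_dom W' \<Longrightarrow> c \<in> baker_dom W"
    "\<And>c k. c \<in> baker_dom W' \<Longrightarrow> alpha W' 0 (- int k) c = (\<Sum>s\<le>k. alpha W 0 (- int (k - s)) c * qc (d s))"
    using L_z_transfer[OF assms] by blast
  \<comment> \<open>Transfer yields one inclusion of domains; exchanging the two spaces yields the
    other.\<close>
  have dom: "baker_dom W' = baker_dom W" using d(1) L_z_transfer[OF W' W L[symmetric]] by blast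
  let ?U = "baker_dom W"
  note U = yopen_baker_dom[OF W] and K = K_op_monic[OF W] and Lp = L_op_props[OF W]
  have oK: "psord 0 (K_op W)" using K by (simp add: sps_def)
  define C :: psdo where "C = (\<lambda>n c. if n \<le> 0 \<and> c \<in> ?U then qc (d (nat (- n))) * quat_i ^ nat (- n) else 0)"
  have Cn: "C n = (\<lambda>c. if c \<in> ?U then if n \<le> 0 then qc (d (nat (- n))) * quat_i ^ nat (- n) else 0 else 0)" for n
    by (auto simp: C_def)
  have oC: "psord 0 C" by (auto simp: psord_def C_def)
  then have sC: "sps ?U 0 C" unfolding sps_def using yconst(1)[OF U] by (auto simp: Cn)
  have dC: "pd_y ?U (C n) = (\<lambda>_. 0)" for n using yconst(2)[OF U, of 1] unfolding Cn by (simp add: One_nat_def)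
  have KC: "psdo_mult ?U (K_op W) C = K_op W'"
  proof (rule psdos_eqI[of 0])
    show "psord 0 (psdo_mult ?U (K_op W) C)" using psord_mult[OF oK oC] by simp
    show "psord 0 (K_op W')" using K_op_monic[OF W'] by (simp add: sps_def)
    fix k c
    show "psdo_mult ?U (K_op W) C (0 - int k) c = K_op W' (0 - int k) c"
    proof (cases "c \<in> ?U")
      case False
      then show ?thesis using sps_zero_off[OF sps_mult[OF K(2) sC]] sps_zero_off[OF K_op_monic(2)[OF W']] dom by simp
    next
      case True
      have "psdo_mult ?U (K_op W) C (- int k) c = (\<Sum>s\<le>k. K_op W (- int (k - s)) c * C (- int s) c)"
        by (rule psdo_mult_const_coeffs[OF oK oC dC])
      also have "\<dots> = (\<Sum>s\<le>k. alpha W 0 (- int (k - s)) c * qc (d s) * quat_i ^ k)"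
      proof (rule sum.cong[OF refl])
        fix s assume "s \<in> {..k}"
        then have "\<i> ^ (k - s) * (d s * \<i> ^ s) = d s * \<i> ^ k" by (simp add: power_add[symmetric])
        then have "quat_i ^ (k - s) * (qc (d s) * quat_i ^ s) = qc (d s) * quat_i ^ k"
          by (simp add: qc_i[symmetric] qc_power[symmetric] qc_mult[symmetric])
        then show "K_op W (- int (k - s)) c * C (- int s) c = alpha W 0 (- int (k - s)) c * qc (d s) * quat_i ^ k"
          using True unfolding K_op_neg[OF W] by (simp add: C_def mult.assoc)
      qed
      also have "\<dots> = K_op W' (- int k) c"
        using d(2)[of c k] True dom by (simp add: K_op_neg[OF W'] sum_distrib_right)
      finally show ?thesis by simp
    qed
  qed
  have iC: "psdo_mult ?U (i_pd_y ?U) C = psdo_mult ?U C (i_pd_y ?U)"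
  proof (rule psdos_eqI[of 1])
    have oi: "psord 1 (i_pd_y ?U)" by (simp add: psord_def i_pd_y_def fun_eq_iff)
    show "psord 1 (psdo_mult ?U (i_pd_y ?U) C)" "psord 1 (psdo_mult ?U C (i_pd_y ?U))"
      using psord_mult[OF oi oC] psord_mult[OF oC oi] by simp_all
    fix k c
    have z: "(pd_y ?U ^^ l) (C n) = (\<lambda>_. 0)" if "l > 0" for l n
      using that by (cases l) (simp_all del: funpow.simps add: funpow_Suc_right dC)
    have "psdo_mult ?U (i_pd_y ?U) C (1 + 0 - int k) c =
        (\<Sum>(i, j, l)\<in>{(0, k, 0)}. (real_of_int (1 - int i) gchoose l) *\<^sub>R (i_pd_y ?U (1 - int i) c * (pd_y ?U ^^ l) (C (0 - int j)) c))"
    proof (rule psdo_mult_tri_on[OF oi oC])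
      fix i j l assume "(i, j, l) \<in> tri k" "(i, j, l) \<notin> {(0, k, 0)}"
      then have "i \<noteq> 0 \<or> l > 0" by (auto simp: tri_def)
      then show "real_of_int (1 - int i) gchoose l = 0 \<or> i_pd_y ?U (1 - int i) c = 0 \<or> (pd_y ?U ^^ l) (C (0 - int j)) c = 0"
        using z[of l] by (auto simp: i_pd_y_def)
    qed (auto simp: tri_def)
    also have "\<dots> = C (- int k) c * quat_i"
      by (simp add: i_pd_y_def C_def qc_i[symmetric] qc_power[symmetric] qc_mult[symmetric] mult_ac)
    finally show "psdo_mult ?U (i_pd_y ?U) C (1 - int k) c = psdo_mult ?U C (i_pd_y ?U) (1 - int k) c"
      using psdo_mult_i_right[OF U oC sps_zero_off[OF sC]] by simp
  qed
  have "psdo_mult ?U (L_op W) (K_op W') = psdo_mult ?U (psdo_mult ?U (K_op W) (i_pd_y ?U)) C"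
    unfolding KC[symmetric] Lp(2)[symmetric] by (rule psdo_mult_assoc[OF Lp(1) K(2) sC, symmetric])
  also have "\<dots> = psdo_mult ?U (K_op W) (psdo_mult ?U C (i_pd_y ?U))"
    unfolding iC[symmetric] by (rule psdo_mult_assoc[OF K(2) sps_i[OF U] sC])
  also have "\<dots> = psdo_mult ?U (K_op W') (i_pd_y ?U)"
    unfolding KC[symmetric] by (rule psdo_mult_assoc[OF K(2) sC sps_i[OF U], symmetric])
  finally have "Lax ?U (K_op W') = L_op W" using Lax_unique[OF U] K_op_monic[OF W'] Lp(1) unfolding dom by blast
  then show ?thesis unfolding L_op_Lax[of W'] dom ..
qed

section \<open>The circle action, lattices and characters\<close>

section \<open>The circle action\<close>

lemma Gr_KP_Gr_H: "W \<in> Gr_KP \<Longrightarrow> W \<in> Gr_H" by (simp add: Gr_KP_def)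

lemma M_KP_sub: "M_KP \<subseteq> M_space" and M_QKP_sub: "M_QKP \<subseteq> M_space"
  by (auto simp: M_KP_def M_QKP_def M_space_def Gr_QKP_def Gr_KP_def)

lemma conj_by_M_QKP:
  assumes L: "L \<in> M_QKP" and u: "u \<noteq> 0" shows "conj_by u L \<in> M_QKP"
proof -
  obtain W where W: "W \<in> Gr_QKP" "L = L_op W" using L by (auto simp: M_QKP_def)
  then have "conj_by u L = L_op (gr_act (\<lambda>_. u) W)" by (simp add: L_op_const Gr_QKP_def u)
  then show ?thesis using Gr_QKP_const[OF W(1) u] by (simp add: M_QKP_def)
qed

lemma conj_by_M_KP:
  assumes L: "L \<in> M_KP" and u: "u \<noteq> 0" shows "conj_by u L = L"
proof -
  obtain W where W: "W \<in> Gr_KP" "L = L_op W" using L by (auto simp: M_KP_def)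
  then show ?thesis using L_op_const[OF Gr_KP_Gr_H[OF W(1)] u] Gr_KP_const[OF W(1) u] by simp
qed

lemma conj_by_M_QKP_free:
  assumes L: "L \<in> M_QKP" and u: "cmod u = 1" "conj_by u L = L" shows "u\<^sup>2 = 1"
proof (rule ccontr)
  assume "u\<^sup>2 \<noteq> 1"
  moreover obtain W where W: "W \<in> Gr_QKP" "L = L_op W" using L by (auto simp: M_QKP_def)
  ultimately have "W \<in> Gr_KP" using stabilizer_imp_Gr_KP[of W u] u by (simp add: Gr_QKP_def)
  then show False using W by (simp add: Gr_QKP_def)
qed

lemma conj_by_square_eq:
  assumes "u\<^sup>2 = v\<^sup>2" shows "conj_by u L = conj_by v L"
  using assms conj_by_uminus[of v L] by (auto simp: power2_eq_iff)

text \<open>\<open>csqrt\<close> is not multiplicative, but a square root matters only up to sign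
  and -1 acts trivially, so this is still an action. It is free because on \<open>M_QKP\<close> only
  1 and -1 have fixed points.\<close>

lemma free_circle_action_M_QKP: "free_circle_action (\<lambda>v. conj_by (csqrt v)) M_QKP"
  unfolding free_circle_action_def
proof (intro conjI ballI impI)
  fix u v :: complex and L assume u: "u \<in> sphere 0 1" and L: "L \<in> M_QKP"
  have nz: "csqrt u \<noteq> 0" using u by auto
  show "conj_by (csqrt u) L \<in> M_QKP" by (rule conj_by_M_QKP[OF L nz])
  show "conj_by (csqrt (u * v)) L = conj_by (csqrt u) (conj_by (csqrt v) L)"
    unfolding conj_by_conj_by by (rule conj_by_square_eq) (simp add: power_mult_distrib mult.commute)
  assume "conj_by (csqrt u) L = L"
  then have "(csqrt u)\<^sup>2 = 1" by (rule conj_by_M_QKP_free[OF L, rotated]) (use u in \<open>simp add: norm_csqrt\<close>)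
  then show "u = 1" by simp
qed simp

lemma unit_circle_exp: "sphere 0 1 = range (\<lambda>t0::real. exp (\<i> * of_real t0))"
proof -
  have "x \<in> range (\<lambda>t0::real. exp (\<i> * of_real t0))" if x: "cmod x = 1" for x
  proof -
    have "x = exp (\<i> * of_real (Arg x))" using x by (simp only: complex_norm_eq_1_exp_eq)
    then show ?thesis by (rule range_eqI)
  qed
  then show ?thesis by auto
qed

lemma Gamma0_orbit_eq:
  assumes "L \<in> M_space" shows "Gamma0_orbit L = (\<lambda>u. conj_by u L) ` sphere 0 1"
  unfolding Gamma0_orbit_def Gamma0_def unit_circle_exp image_image
  by (rule image_cong[OF refl], rule M_act_const[OF assms]) simp

lemma orbit_csqrt: "(\<lambda>u. conj_by u L) ` sphere 0 1 = (\<lambda>u. conj_by (csqrt u) L) ` sphere 0 1"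
proof (rule antisym)
  show "(\<lambda>u. conj_by (csqrt u) L) ` sphere 0 1 \<subseteq> (\<lambda>u. conj_by u L) ` sphere 0 1"
  proof
    fix y assume "y \<in> (\<lambda>u. conj_by (csqrt u) L) ` sphere 0 1"
    then obtain u where "cmod u = 1" "y = conj_by (csqrt u) L" by auto
    then show "y \<in> (\<lambda>u. conj_by u L) ` sphere 0 1" by (intro image_eqI[of _ _ "csqrt u"]) (auto simp: norm_csqrt)
  qed
  show "(\<lambda>u. conj_by u L) ` sphere 0 1 \<subseteq> (\<lambda>u. conj_by (csqrt u) L) ` sphere 0 1"
  proof
    fix y assume "y \<in> (\<lambda>u. conj_by u L) ` sphere 0 1"
    then obtain u where "cmod u = 1" "y = conj_by u L" by auto
    moreover have "conj_by u L = conj_by (csqrt (u\<^sup>2)) L" by (rule conj_by_square_eq) simp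
    ultimately show "y \<in> (\<lambda>u. conj_by (csqrt u) L) ` sphere 0 1" by (intro image_eqI[of _ _ "u\<^sup>2"]) (auto simp: norm_power)
  qed
qed

lemma orbit_eq_iff:
  "(\<lambda>u. conj_by u L) ` sphere 0 1 = (\<lambda>u. conj_by u L') ` sphere 0 1 \<longleftrightarrow> (\<exists>u\<in>sphere 0 1. L = conj_by u L')"
proof
  assume "(\<lambda>u. conj_by u L) ` sphere 0 1 = (\<lambda>u. conj_by u L') ` sphere 0 1"
  moreover have "L \<in> (\<lambda>u. conj_by u L) ` sphere 0 1" by (rule image_eqI[of _ _ 1]) simp_all
  ultimately have "L \<in> (\<lambda>u. conj_by u L') ` sphere 0 1" by simp
  then show "\<exists>u\<in>sphere 0 1. L = conj_by u L'" by auto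
next
  assume "\<exists>u\<in>sphere 0 1. L = conj_by u L'"
  then obtain u where u: "cmod u = 1" "L = conj_by u L'" by auto
  then have "u \<noteq> 0" by auto
  then have L': "L' = conj_by (inverse u) L" unfolding u(2) conj_by_conj_by by simp
  have "(\<lambda>v. conj_by v (conj_by w M)) ` sphere 0 1 \<subseteq> (\<lambda>v. conj_by v M) ` sphere 0 1" if "cmod w = 1" for w M
  proof
    fix y assume "y \<in> (\<lambda>v. conj_by v (conj_by w M)) ` sphere 0 1"
    then obtain v where "cmod v = 1" "y = conj_by (w * v) M" by (auto simp: conj_by_conj_by)
    then show "y \<in> (\<lambda>v. conj_by v M) ` sphere 0 1" using that by (intro image_eqI[of _ _ "w * v"]) (auto simp: norm_mult)
  qed
  from this[OF u(1), of L'] this[of "inverse u" L] u(1) show "(\<lambda>u. conj_by u L) ` sphere 0 1 = (\<lambda>u. conj_by u L') ` sphere 0 1"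
    unfolding u(2)[symmetric] L'[symmetric] by (simp add: norm_inverse)
qed

section \<open>Lattices\<close>

lemma lattice_coordinates_unique:
  assumes ne: "\<omega>1 \<noteq> \<omega>2" and ind: "independent {\<omega>1, \<omega>2}"
    and eq: "of_int m * \<omega>1 + of_int n * \<omega>2 = of_int m' * \<omega>1 + of_int n' * (\<omega>2 :: complex)"
  shows "m = m' \<and> n = n'"
proof (rule ccontr)
  assume neq: "\<not> (m = m' \<and> n = n')"
  define u where "u = (\<lambda>v. if v = \<omega>1 then real_of_int (m - m') else real_of_int (n - n'))"
  have "(\<Sum>v\<in>{\<omega>1, \<omega>2}. u v *\<^sub>R v) = 0"
    using ne eq by (simp add: u_def scaleR_conv_of_real algebra_simps)
  moreover have "\<exists>v\<in>{\<omega>1, \<omega>2}. u v \<noteq> 0" using neq ne by (auto simp: u_def)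
  ultimately have "dependent {\<omega>1, \<omega>2}" by (auto simp: real_vector.dependent_finite)
  then show False using ind by contradiction
qed

text \<open>A relation and not a function of \<open>l\<close>, since \<open>u\<close> is determined
  only up to sign, and not at all for operators from \<open>Gr_KP\<close>.\<close>

definition shift_conj :: "psdo \<Rightarrow> complex \<Rightarrow> complex \<Rightarrow> bool" where
  "shift_conj L l u \<longleftrightarrow> cmod u = 1 \<and> (\<forall>n c. L n (translate l c) = conj_by u L n c)"

lemma shift_conj_0: "shift_conj L 0 1" by (simp add: shift_conj_def)

lemma shift_conj_add:
  assumes "shift_conj L l u" "shift_conj L l' u'" shows "shift_conj L (l + l') (u * u')" unfolding shift_conj_def
proof (intro conjI allI)
  show "cmod (u * u') = 1" using assms by (simp add: shift_conj_def norm_mult)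
  fix n c
  have "L n (translate l (translate l' c)) = conj_by u (conj_by u' L) n c"
    using assms unfolding shift_conj_def by (simp add: conj_by_def del: translate_trans)
  then show "L n (translate (l + l') c) = conj_by (u * u') L n c" by (simp add: conj_by_conj_by mult.commute)
qed

lemma shift_conj_minus:
  assumes "shift_conj L l u" shows "shift_conj L (- l) (inverse u)" unfolding shift_conj_def
proof (intro conjI allI)
  have u: "cmod u = 1" "u \<noteq> 0" using assms by (auto simp: shift_conj_def)
  then show "cmod (inverse u) = 1" by (simp add: norm_inverse)
  fix n c
  have "L n c = conj_by u L n (translate (- l) c)" using assms unfolding shift_conj_def by (metis add.right_inverse translate_0 translate_trans)
  then have "conj_by (inverse u) L n c = conj_by (inverse u) (conj_by u L) n (translate (- l) c)" by (simp add: conj_by_def)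
  then show "L n (translate (- l) c) = conj_by (inverse u) L n c" using u by (simp add: conj_by_conj_by)
qed

lemma shift_conj_int:
  assumes "shift_conj L l u" shows "shift_conj L (of_int m * l) (u powi m)"
proof -
  have u: "u \<noteq> 0" using assms by (auto simp: shift_conj_def)
  have nat: "shift_conj L (of_nat k * l) (u ^ k)" for k
  proof (induction k)
    case (Suc k)
    then show ?case using shift_conj_add[OF assms Suc] by (simp add: distrib_right)
  qed (simp add: shift_conj_0)
  show ?thesis
  proof (cases "m \<ge> 0")
    case True
    then show ?thesis using nat[of "nat m"] by (simp add: power_int_def)
  next
    case False
    then show ?thesis using shift_conj_minus[OF nat[of "nat (- m)"]] by (simp add: power_int_def power_inverse)
  qed
qed

text \<open>Multipliers picked separately for each lattice element need not be multiplicative.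
  Picking them for two generators and extending through the coordinates gives a character whose
  values are still multipliers.\<close>

lemma lattice_character:
  assumes L: "is_lattice \<Lambda>" and ex: "\<And>l. l \<in> \<Lambda> \<Longrightarrow> \<exists>u. shift_conj A l u"
  shows "\<exists>\<mu>\<in>circle_characters \<Lambda>. \<forall>l\<in>\<Lambda>. shift_conj A l (\<mu> l)"
proof -
  obtain \<omega>1 \<omega>2 where w: "\<omega>1 \<noteq> \<omega>2" "independent {\<omega>1, \<omega>2}" "\<Lambda> = {of_int m * \<omega>1 + of_int n * \<omega>2 | m n. True}"
    using L by (auto simp: is_lattice_def)
  let ?p = "\<lambda>m n. of_int m * \<omega>1 + of_int n * \<omega>2"
  have "?p 1 0 \<in> \<Lambda>" "?p 0 1 \<in> \<Lambda>" unfolding w(3) by blast+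
  then obtain u1 u2 where u: "shift_conj A \<omega>1 u1" "shift_conj A \<omega>2 u2" using ex by fastforce
  have u0: "u1 \<noteq> 0" "u2 \<noteq> 0" using u by (auto simp: shift_conj_def)
  \<comment> \<open>On the lattice the coordinates \<open>(m, n)\<close> are unique by linear
    independence; off the lattice the value is arbitrary.\<close>
  define \<mu> where "\<mu> = (\<lambda>l. case (SOME mn. l = ?p (fst mn) (snd mn)) of (m, n) \<Rightarrow> u1 powi m * u2 powi n)"
  have \<mu>: "\<mu> (?p m n) = u1 powi m * u2 powi n" for m n
  proof -
    have "(SOME mn. ?p m n = ?p (fst mn) (snd mn)) = (m, n)"
      by (rule some_equality) (use lattice_coordinates_unique[OF w(1,2)] in \<open>auto simp: prod_eq_iff\<close>)
    then show ?thesis by (simp add: \<mu>_def)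
  qed
  have P: "shift_conj A l (\<mu> l)" if l: "l \<in> \<Lambda>" for l
  proof -
    obtain m n where l: "l = ?p m n" using l unfolding w(3) by blast
    show ?thesis unfolding l \<mu> by (intro shift_conj_add shift_conj_int u)
  qed
  moreover have "\<mu> (l + l') = \<mu> l * \<mu> l'" if l: "l \<in> \<Lambda>" "l' \<in> \<Lambda>" for l l'
  proof -
    obtain m n m' n' where l: "l = ?p m n" "l' = ?p m' n'" using l unfolding w(3) by blast
    have "l + l' = ?p (m + m') (n + n')" by (simp add: l algebra_simps)
    then have "\<mu> (l + l') = u1 powi (m + m') * u2 powi (n + n')" by (simp only: \<mu>)
    then show ?thesis unfolding l \<mu> by (simp add: power_int_add u0)
  qed
  ultimately have "\<mu> \<in> circle_characters \<Lambda>" by (auto simp: circle_characters_def shift_conj_def)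
  then show ?thesis using P by blast
qed

lemma lattice_minus: "is_lattice \<Lambda> \<Longrightarrow> l \<in> \<Lambda> \<Longrightarrow> - l \<in> \<Lambda>"
proof -
  assume "is_lattice \<Lambda>" and l: "l \<in> \<Lambda>"
  then obtain \<omega>1 \<omega>2 where w: "\<Lambda> = {of_int m * \<omega>1 + of_int n * \<omega>2 | m n. True}" by (auto simp: is_lattice_def)
  obtain m n where "l = of_int m * \<omega>1 + of_int n * \<omega>2" using l unfolding w by blast
  then have "- l = of_int (- m) * \<omega>1 + of_int (- n) * \<omega>2" by simp
  then show "- l \<in> \<Lambda>" unfolding w by blast
qed

lemma W_z_Gr_H: "W \<in> Gr_H \<Longrightarrow> W_z W z \<in> Gr_H" by (simp add: W_z_eq V_shift_Gr_H)

lemma L_op_W_z: "W \<in> Gr_H \<Longrightarrow> L_op (W_z W z) = (\<lambda>n c. L_op W n (translate (- z) c))"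
  by (simp add: W_z_eq L_op_shift)

lemma periodicity:
  assumes W: "W \<in> Gr_H" and \<Lambda>: "is_lattice \<Lambda>"
  shows "(\<exists>\<mu>\<in>circle_characters \<Lambda>. \<forall>z. \<forall>l\<in>\<Lambda>. (\<lambda>n. L_z W n (z + l)) = (\<lambda>n. conj_by (\<mu> l) (L_z W) n z))
    \<longleftrightarrow> (\<forall>z. \<forall>l\<in>\<Lambda>. Gamma0_orbit (L_op (W_z W (z + l))) = Gamma0_orbit (L_op (W_z W z)))"
    (is "?L \<longleftrightarrow> ?R")
proof -
  have Lz: "L_z W n (z + l) = L_op W n (translate l (pt z))" "conj_by u (L_z W) n z = conj_by u (L_op W) n (pt z)" for n z l u
    by (simp_all add: L_z_def pt_def[symmetric] translate_pt conj_by_def)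
  have orb: "Gamma0_orbit (L_op (W_z W z)) = Gamma0_orbit (L_op (W_z W z')) \<longleftrightarrow>
      (\<exists>u\<in>sphere 0 1. L_op (W_z W z) = conj_by u (L_op (W_z W z')))" for z z'
    using Gamma0_orbit_eq[of "L_op (W_z W z)"] Gamma0_orbit_eq[of "L_op (W_z W z')"] W_z_Gr_H[OF W] orbit_eq_iff
    by (simp add: M_space_def)
  show ?thesis
  proof
    assume ?L
    then obtain \<mu> where \<mu>: "\<mu> \<in> circle_characters \<Lambda>"
      "\<And>z l n. l \<in> \<Lambda> \<Longrightarrow> L_op W n (translate l (pt z)) = conj_by (\<mu> l) (L_op W) n (pt z)"
      unfolding Lz fun_eq_iff by blast
    show ?R
    proof (intro allI ballI)
      fix z l assume l: "l \<in> \<Lambda>"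
      have u: "cmod (\<mu> l) = 1" "\<mu> l \<noteq> 0" using \<mu>(1) l by (auto simp: circle_characters_def)
      \<comment> \<open>The hypothesis speaks of the plane only; \<open>L_z_determines_L_op\<close>
        extends it to all parameters, as the comparison of orbits demands.\<close>
      have "L_z (V_shift W l) = L_z (gr_act (\<lambda>_. \<mu> l) W)"
        by (intro ext) (simp add: L_z_def pt_def[symmetric] L_op_shift[OF W] L_op_const[OF W u(2)] \<mu>(2)[OF l])
      then have e: "(\<lambda>n c. L_op W n (translate l c)) = conj_by (\<mu> l) (L_op W)"
        using L_z_determines_L_op[OF V_shift_Gr_H[OF W] gr_act_const_Gr_H[OF W u(2)]]
        by (simp add: L_op_shift[OF W] L_op_const[OF W u(2)])
      have "L_op (W_z W z) = conj_by (\<mu> l) (L_op (W_z W (z + l)))"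
      proof (intro ext)
        fix n c
        have "L_op W n (translate l (translate (- (z + l)) c)) = conj_by (\<mu> l) (L_op W) n (translate (- (z + l)) c)"
          using fun_cong[OF fun_cong[OF e]] .
        then show "L_op (W_z W z) n c = conj_by (\<mu> l) (L_op (W_z W (z + l))) n c"
          by (simp add: L_op_W_z[OF W] conj_by_def)
      qed
      then show "Gamma0_orbit (L_op (W_z W (z + l))) = Gamma0_orbit (L_op (W_z W z))"
        using orb[of z "z + l"] u(1) by auto
    qed
  next
    assume R: ?R
    have "\<exists>u. shift_conj (L_op W) l u" if "l \<in> \<Lambda>" for l
    proof -
      \<comment> \<open>Periodicity is used at \<open>z = 0\<close> with \<open>- l\<close>, because
        \<open>W_z W (- l)\<close> translates the argument of the operator by
        \<open>l\<close>.\<close>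
      have "Gamma0_orbit (L_op (W_z W (0 + - l))) = Gamma0_orbit (L_op (W_z W 0))"
        using R lattice_minus[OF \<Lambda> that] by blast
      then obtain u where u: "cmod u = 1" "L_op (W_z W (- l)) = conj_by u (L_op (W_z W 0))" unfolding orb by auto
      have "L_op W n (translate l c) = conj_by u (L_op W) n c" for n c
        using fun_cong[OF fun_cong[OF u(2)], of n c] by (simp add: L_op_W_z[OF W] conj_by_def)
      then show ?thesis using u(1) by (auto simp: shift_conj_def)
    qed
    then obtain \<mu> where "\<mu> \<in> circle_characters \<Lambda>" "\<And>l. l \<in> \<Lambda> \<Longrightarrow> shift_conj (L_op W) l (\<mu> l)"
      using lattice_character[OF \<Lambda>] by blast
    then show ?L unfolding Lz shift_conj_def by auto
  qed
qed

theorem theorem3p9: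
  shows
    "(\<forall>W\<in>Gr_H. \<forall>t0::real. L_op (W_t0 W t0) = conj_by (exp (\<i> * of_real t0)) (L_op W))
   \<and> ((\<forall>\<gamma>\<in>Gamma0. \<forall>L\<in>M_KP. M_act \<gamma> L = L)
      \<and> (\<exists>\<rho>. free_circle_action \<rho> M_QKP
            \<and> (\<forall>t0::real. \<forall>L\<in>M_QKP.
                  M_act (\<lambda>\<zeta>. exp (\<i> * of_real t0)) L = \<rho> ((exp (\<i> * of_real t0))\<^sup>2) L)
            \<and> Gamma0_orbit ` M_QKP = (\<lambda>L. (\<lambda>u. \<rho> u L) ` sphere 0 1) ` M_QKP))
   \<and> (\<forall>W\<in>Gr_H. \<forall>\<Lambda>. is_lattice \<Lambda> \<longrightarrow>
        ((\<exists>\<mu>\<in>circle_characters \<Lambda>. \<forall>z. \<forall>l\<in>\<Lambda>.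
            (\<lambda>n. L_z W n (z + l)) = (\<lambda>n. conj_by (\<mu> l) (L_z W) n z))
        \<longleftrightarrow> (\<forall>z. \<forall>l\<in>\<Lambda>. Gamma0_orbit (L_op (W_z W (z + l))) = Gamma0_orbit (L_op (W_z W z)))))"
proof (intro conjI)
  show "\<forall>W\<in>Gr_H. \<forall>t0::real. L_op (W_t0 W t0) = conj_by (exp (\<i> * of_real t0)) (L_op W)"
    by (simp add: W_t0_def L_op_const)
  show "\<forall>\<gamma>\<in>Gamma0. \<forall>L\<in>M_KP. M_act \<gamma> L = L"
    using M_KP_sub by (auto simp: Gamma0_def M_act_const conj_by_M_KP)
  show "\<exists>\<rho>. free_circle_action \<rho> M_QKP
      \<and> (\<forall>t0::real. \<forall>L\<in>M_QKP. M_act (\<lambda>\<zeta>. exp (\<i> * of_real t0)) L = \<rho> ((exp (\<i> * of_real t0))\<^sup>2) L)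
      \<and> Gamma0_orbit ` M_QKP = (\<lambda>L. (\<lambda>u. \<rho> u L) ` sphere 0 1) ` M_QKP"
  proof (intro exI[of _ "\<lambda>v. conj_by (csqrt v)"] conjI allI ballI)
    show "free_circle_action (\<lambda>v. conj_by (csqrt v)) M_QKP" by (rule free_circle_action_M_QKP)
    fix t0 :: real and L assume "L \<in> M_QKP"
    then have "M_act (\<lambda>\<zeta>. exp (\<i> * of_real t0)) L = conj_by (exp (\<i> * of_real t0)) L"
      using M_QKP_sub by (intro M_act_const) auto
    also have "\<dots> = conj_by (csqrt ((exp (\<i> * of_real t0))\<^sup>2)) L"
      by (rule conj_by_square_eq) (rule power2_csqrt[symmetric])
    finally show "M_act (\<lambda>\<zeta>. exp (\<i> * of_real t0)) L = conj_by (csqrt ((exp (\<i> * of_real t0))\<^sup>2)) L" .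
  next
    show "Gamma0_orbit ` M_QKP = (\<lambda>L. (\<lambda>u. conj_by (csqrt u) L) ` sphere 0 1) ` M_QKP"
    proof (rule image_cong[OF refl])
      fix L assume "L \<in> M_QKP"
      then have "L \<in> M_space" using M_QKP_sub by blast
      then show "Gamma0_orbit L = (\<lambda>u. conj_by (csqrt u) L) ` sphere 0 1"
        unfolding orbit_csqrt[symmetric] by (rule Gamma0_orbit_eq)
    qed
  qed
  show "\<forall>W\<in>Gr_H. \<forall>\<Lambda>. is_lattice \<Lambda> \<longrightarrow>
        ((\<exists>\<mu>\<in>circle_characters \<Lambda>. \<forall>z. \<forall>l\<in>\<Lambda>. (\<lambda>n. L_z W n (z + l)) = (\<lambda>n. conj_by (\<mu> l) (L_z W) n z))
        \<longleftrightarrow> (\<forall>z. \<forall>l\<in>\<Lambda>. Gamma0_orbit (L_op (W_z W (z + l))) = Gamma0_orbit (L_op (W_z W z))))"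
    using periodicity by blast
qed

end
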